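(* Let $f\in\ell^p(w)$, $1\le p<\infty$, with $w\in A_p$. Then: (i) The operators $Q^*f=\sup_{t\ge0}|Q_tf|$ and $\widetilde Q^*f=\sup_{t\ge0}|\widetilde Q_tf|$ are bounded from $\ell^p(w)$ into itself for $1<p<\infty$, and from $\ell^1(w)$ into weak-$\ell^1(w)$ (when $p=1$). (ii) The operators $Q_t$, $\widetilde Q_t$ and $P_t$ satisfy, for $t>0$, the Cauchy--Riemann type equations $$\begin{cases}\partial_t(Q_tf)=-D(P_tf),\\ \widetilde D(Q_tf)=\partial_t(P_tf);\end{cases}\qquad\begin{cases}\partial_t(\widetilde Q_tf)=-\widetilde D(P_tf),\\ D(\widetilde Q_tf)=\partial_t(P_tf).\end{cases}$$ Moreover, $\partial^2_{tt}Q_tf(n)+\Delta_{\mathrm d}Q_tf(n)=0$ and $\partial^2_{tt}\widetilde Q_tf(n)+\Delta_{\mathrm d}\widetilde Q_tf(n)=0$. (iii) For every $n\in\mathbb{Z}$, $$\lim_{t\to0}Q_tf(n)=\mathcal{R}f(n)\quad\text{and}\quad\lim_{t\to0}\widetilde Q_tf(n)=\widetilde{\mathcal{R}}f(n).$$ The limits also hold in the $\ell^p(w)$ sense for $1<p<\infty$.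
   Context: Difference operators on sequences: $\Delta_{\mathrm d}f(n)=f(n+1)-2f(n)+f(n-1)$, $Df(n)=f(n+1)-f(n)$, $\widetilde Df(n)=f(n)-f(n-1)$, so that $\Delta_{\mathrm d}=\widetilde DD$. For $k\in\mathbb{Z}$, $I_k(t)=\sum_{m=0}^\infty\frac{1}{m!\,\Gamma(m+k+1)}\left(\frac t2\right)^{2m+k}$ is the modified Bessel function of the first kind (with $1/\Gamma(j)=0$ for $j=0,-1,-2,\dots$). The discrete heat semigroup is $W_tf(n)=\sum_{m\in\mathbb{Z}}e^{-2t}I_{n-m}(2t)f(m)$, $t\ge0$, and the discrete Poisson semigroup is $P_tf(n)=\frac{1}{\sqrt\pi}\int_0^\infty\frac{e^{-u}}{\sqrt u}W_{t^2/(4u)}f(n)\,du$, $t\ge0$. The discrete Riesz transforms are $\mathcal{R}=\lim_{\alpha\to(1/2)^-}D(-\Delta_{\mathrm d})^{-\alpha}$ and $\widetilde{\mathcal{R}}=\lim_{\alpha\to(1/2)^-}\widetilde D(-\Delta_{\mathrm d})^{-\alpha}$. With the Fourier transform $\mathcal{F}_{\mathbb{Z}}(f)(\theta)=\sum_nf(n)e^{in\theta}$, they are the operators with multipliers $-ie^{-i\theta/2}$ and $-ie^{i\theta/2}$, $\theta\in[0,2\pi)$, respectively; equivalently, on $\ell^p(w)$ they are given by the absolutely convergent sums $$\mathcal{R}f(n)=-\frac1\pi\sum_{m\in\mathbb{Z}}\frac{f(m)}{n-m+1/2},\qquad\widetilde{\mathcal{R}}f(n)=-\frac1\pi\sum_{m\in\mathbb{Z}}\frac{f(m)}{n-m-1/2}.$$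 The conjugate harmonic functions are $Q_tf=\mathcal{R}P_tf$ and $\widetilde Q_tf=\widetilde{\mathcal{R}}P_tf$, $t\ge0$. A weight is a sequence $w=\{w(n)\}_{n\in\mathbb{Z}}$ of positive numbers. For $1<p<\infty$, $w\in A_p$ means that there is $C<\infty$ such that for all integers $M\le N$, $\big(\sum_{k=M}^Nw(k)\big)\big(\sum_{k=M}^Nw(k)^{-1/(p-1)}\big)^{p-1}\le C(N-M+1)^p$; $w\in A_1$ means that there is $C<\infty$ such that for all integers $M\le N$, $\big(\sum_{k=M}^Nw(k)\big)\sup_{k\in[M,N]}w(k)^{-1}\le C(N-M+1)$. The space $\ell^p(w)$ has norm $\big(\sum_n|f(n)|^pw(n)\big)^{1/p}$; $T$ is bounded from $\ell^1(w)$ into weak-$\ell^1(w)$ if there is $C$ with $\lambda\sum_{n:|Tf(n)|>\lambda}w(n)\le C\|f\|_{\ell^1(w)}$ for all $\lambda>0$ and $f\in\ell^1(w)$. *)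

theory Defs
  imports "HOL-Analysis.Analysis"
begin

definition diff_fwd :: "(int \<Rightarrow> complex) \<Rightarrow> int \<Rightarrow> complex" where
  "diff_fwd f n = f (n + 1) - f n"

definition diff_bwd :: "(int \<Rightarrow> complex) \<Rightarrow> int \<Rightarrow> complex" where
  "diff_bwd f n = f n - f (n - 1)"

definition discrete_laplacian :: "(int \<Rightarrow> complex) \<Rightarrow> int \<Rightarrow> complex" where
  "discrete_laplacian f n = f (n + 1) - 2 * f n + f (n - 1)"

text \<open>\<^const>\<open>rGamma\<close> is the entire function $1/\Gamma$, so it vanishes at the nonpositive
  integers. At \<open>t = 0\<close> every term in which the exponent is negative has a vanishing coefficient.\<close>

definition bessel_I :: "int \<Rightarrow> real \<Rightarrow> real" where
  "bessel_I k t =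
     (\<Sum>m. rGamma (of_int (int m + k + 1)) / fact m * (t / 2) powi (2 * int m + k))"

definition heat :: "real \<Rightarrow> (int \<Rightarrow> complex) \<Rightarrow> int \<Rightarrow> complex" where
  "heat t f n = (\<Sum>\<^sub>\<infinity>m. of_real (exp (- 2 * t) * bessel_I (n - m) (2 * t)) * f m)"

definition poisson :: "real \<Rightarrow> (int \<Rightarrow> complex) \<Rightarrow> int \<Rightarrow> complex" where
  "poisson t f n =
     of_real (1 / sqrt pi) *
     (LBINT u:{0<..}. of_real (exp (- u) / sqrt u) * heat (t\<^sup>2 / (4 * u)) f n)"

text \<open>On a weighted space the Riesz transforms are convolution operators. Their kernels are the
  Fourier coefficients of the multipliers $-ie^{-i\theta/2}$ and $-ie^{i\theta/2}$ of
  $D(-\Delta)^{-1/2}$ and $\widetilde D(-\Delta)^{-1/2}$ on $[0,2\pi)$; see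
  \<open>riesz_fwd_multiplier\<close> and \<open>riesz_bwd_multiplier\<close> below.\<close>

definition riesz_fwd :: "(int \<Rightarrow> complex) \<Rightarrow> int \<Rightarrow> complex" where
  "riesz_fwd f n = - (1 / of_real pi) * (\<Sum>\<^sub>\<infinity>m. f m / (of_int (n - m) + 1 / 2))"

definition riesz_bwd :: "(int \<Rightarrow> complex) \<Rightarrow> int \<Rightarrow> complex" where
  "riesz_bwd f n = - (1 / of_real pi) * (\<Sum>\<^sub>\<infinity>m. f m / (of_int (n - m) - 1 / 2))"

lemma half_integer_exp_integral:
  fixes n :: int and c :: complex
  assumes c: "c = 1 / 2 \<or> c = - 1 / 2"
  shows "((\<lambda>\<theta>. - \<i> * exp (- \<i> * c * of_real \<theta>) * exp (- \<i> * of_int n * of_real \<theta>))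
           has_integral 2 * of_real pi * (- (1 / of_real pi) * (1 / (of_int n + c)))) {0..2 * pi}"
proof -
  define a :: complex where "a = of_int n + c"
  obtain k :: int where k: "2 * a = of_int (2 * k + 1)"
  proof (cases "c = 1 / 2")
    case True
    then show ?thesis by (intro that[of n]) (simp add: a_def algebra_simps)
  next
    case False
    then show ?thesis using c by (intro that[of "n - 1"]) (simp add: a_def algebra_simps)
  qed
  have a0: "a \<noteq> 0"
  proof
    assume "a = 0"
    then have "(of_int (2 * k + 1) :: complex) = of_int 0" using k by simp
    then have "2 * k + 1 = 0" by (simp only: of_int_eq_iff)
    then show False by presburger
  qed
  have ex: "exp (- \<i> * a * of_real (2 * pi)) = - 1"
  proof -
    have "- \<i> * a * of_real (2 * pi) = - (2 * a) * of_real pi * \<i>" by simp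
    also have "\<dots> = (2 * of_int (- k - 1) * of_real pi) * \<i> + of_real pi * \<i>"
      by (simp only: k) (simp add: algebra_simps)
    also have "exp \<dots> = - 1"
      using exp_integer_2pi[of "of_int (- k - 1)"] by (simp only: exp_add exp_pi_i Ints_of_int) simp
    finally show ?thesis .
  qed
  have "((\<lambda>\<theta>. - \<i> * exp (- \<i> * a * of_real \<theta>))
          has_integral (exp (- \<i> * a * of_real (2 * pi)) / a - exp (- \<i> * a * of_real 0) / a))
          {0..2 * pi}"
  proof (rule fundamental_theorem_of_calculus)
    fix x :: real
    have "((\<lambda>z. exp (- \<i> * a * z) / a) has_field_derivative (- \<i> * exp (- \<i> * a * of_real x)))
            (at (of_real x))"
      using a0 by (auto intro!: derivative_eq_intros)
    then show "((\<lambda>\<theta>. exp (- \<i> * a * of_real \<theta>) / a) has_vector_derivative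
                 - \<i> * exp (- \<i> * a * of_real x)) (at x within {0..2 * pi})"
      using has_vector_derivative_real_field by (blast intro: has_vector_derivative_at_within)
  qed simp
  moreover have "- \<i> * exp (- \<i> * a * of_real \<theta>) =
      - \<i> * exp (- \<i> * c * of_real \<theta>) * exp (- \<i> * of_int n * of_real \<theta>)" for \<theta> :: real
    by (simp add: a_def algebra_simps mult_exp_exp)
  moreover have "exp (- \<i> * a * of_real (2 * pi)) / a - exp (- \<i> * a * of_real 0) / a =
      2 * of_real pi * (- (1 / of_real pi) * (1 / (of_int n + c)))"
    unfolding ex a_def[symmetric] using a0 by (simp add: field_simps)
  ultimately show ?thesis by (simp only:)
qed

lemma riesz_fwd_multiplier:
  "((\<lambda>\<theta>. - \<i> * exp (- \<i> * of_real \<theta> / 2) * exp (- \<i> * of_int n * of_real \<theta>))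
     has_integral 2 * of_real pi * (- (1 / of_real pi) * (1 / (of_int n + 1 / 2)))) {0..2 * pi}"
  using half_integer_exp_integral[of "1 / 2" n] by simp

lemma riesz_bwd_multiplier:
  "((\<lambda>\<theta>. - \<i> * exp (\<i> * of_real \<theta> / 2) * exp (- \<i> * of_int n * of_real \<theta>))
     has_integral 2 * of_real pi * (- (1 / of_real pi) * (1 / (of_int n - 1 / 2)))) {0..2 * pi}"
  using half_integer_exp_integral[of "- 1 / 2" n] by simp

definition conj_fwd :: "real \<Rightarrow> (int \<Rightarrow> complex) \<Rightarrow> int \<Rightarrow> complex" where
  "conj_fwd t f = riesz_fwd (poisson t f)"

definition conj_bwd :: "real \<Rightarrow> (int \<Rightarrow> complex) \<Rightarrow> int \<Rightarrow> complex" where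
  "conj_bwd t f = riesz_bwd (poisson t f)"

text \<open>The supremum is taken in \<^typ>\<open>real\<close>, so it is meaningful only if the orbit of
  \<open>f\<close> at \<open>n\<close> is bounded; this has to be asserted wherever the operator is used.\<close>

definition maximal_op ::
    "(real \<Rightarrow> (int \<Rightarrow> complex) \<Rightarrow> int \<Rightarrow> complex) \<Rightarrow> (int \<Rightarrow> complex) \<Rightarrow> int \<Rightarrow> real" where
  "maximal_op T f n = (SUP t\<in>{0..}. cmod (T t f n))"

definition muckenhoupt :: "real \<Rightarrow> (int \<Rightarrow> real) set" where
  "muckenhoupt p = {w. (\<forall>n. w n > 0) \<and>
     (if p = 1 then
        \<exists>C. \<forall>M N. M \<le> N \<longrightarrow>
          (\<Sum>k=M..N. w k) * (SUP k\<in>{M..N}. inverse (w k)) \<le> C * of_int (N - M + 1)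
      else
        \<exists>C. \<forall>M N. M \<le> N \<longrightarrow>
          (\<Sum>k=M..N. w k) * (\<Sum>k=M..N. w k powr (- 1 / (p - 1))) powr (p - 1)
            \<le> C * of_int (N - M + 1) powr p)}"

definition lp_space :: "real \<Rightarrow> (int \<Rightarrow> real) \<Rightarrow> (int \<Rightarrow> 'a::real_normed_vector) set" where
  "lp_space p w = {f. (\<lambda>n. norm (f n) powr p * w n) summable_on UNIV}"

definition lp_norm :: "real \<Rightarrow> (int \<Rightarrow> real) \<Rightarrow> (int \<Rightarrow> 'a::real_normed_vector) \<Rightarrow> real" where
  "lp_norm p w f = (\<Sum>\<^sub>\<infinity>n. norm (f n) powr p * w n) powr (1 / p)"

definition strong_type ::
    "real \<Rightarrow> (int \<Rightarrow> real) \<Rightarrow> ((int \<Rightarrow> complex) \<Rightarrow> int \<Rightarrow> real) \<Rightarrow> bool" where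
  "strong_type p w S \<longleftrightarrow>
     (\<exists>C. \<forall>f\<in>lp_space p w. S f \<in> lp_space p w \<and> lp_norm p w (S f) \<le> C * lp_norm p w f)"

definition weak_type_1 ::
    "(int \<Rightarrow> real) \<Rightarrow> ((int \<Rightarrow> complex) \<Rightarrow> int \<Rightarrow> real) \<Rightarrow> bool" where
  "weak_type_1 w S \<longleftrightarrow>
     (\<exists>C. \<forall>f\<in>lp_space 1 w. \<forall>l>0.
        w summable_on {n. \<bar>S f n\<bar> > l} \<and>
        l * (\<Sum>\<^sub>\<infinity>n\<in>{n. \<bar>S f n\<bar> > l}. w n) \<le> C * lp_norm 1 w f)"

text \<open>\<open>lp_norm\<close> is \<open>0\<close> on sequences outside \<open>lp_space\<close>, hence the membership clause.\<close>

definition lp_limit_at_0 ::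
    "real \<Rightarrow> (int \<Rightarrow> real) \<Rightarrow> (real \<Rightarrow> int \<Rightarrow> complex) \<Rightarrow> (int \<Rightarrow> complex) \<Rightarrow> bool" where
  "lp_limit_at_0 p w F g \<longleftrightarrow>
     (\<forall>t>0. (\<lambda>n. F t n - g n) \<in> lp_space p w) \<and>
     ((\<lambda>t. lp_norm p w (\<lambda>n. F t n - g n)) \<longlongrightarrow> 0) (at_right 0)"

end

theory Submission
  imports Defs "HOL-Probability.Distributions"
begin

text \<open>The two Riesz transforms differ by a translation: the backward transform at \<open>n\<close> is
  the forward one at \<open>n - 1\<close>. So it suffices to understand one conjugate kernel and
  its translate by one.

  \<^emph>\<open>Kernels.\<close> The generating function of the Bessel functions says that the
  heat kernel has the Fourier series \<open>exp (- s \<lambda>)\<close> with \<open>\<lambda> = 4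
  sin\<^sup>2 (\<theta>/2)\<close>. Subordination replaces \<open>exp (- s \<lambda>)\<close> by
  \<open>exp (- t sqrt \<lambda>)\<close>, so the Poisson kernel \<open>pk t\<close> and the
  conjugate kernel \<open>qk t\<close> (the Riesz transform of \<open>pk t\<close>) are
  trigonometric integrals of \<open>exp (- 2 t sin x)\<close> over \<open>[0, \<pi>]\<close>. For
  these integrals everything is elementary. Differentiation in \<open>t\<close> produces the
  factor \<open>2 sin x\<close>, which product formulas turn into differences in \<open>k\<close>:
  these are the Cauchy--Riemann equations (\<open>pk_deriv\<close>, \<open>qk_deriv\<close>).
  Integration by parts, with the observation that the total variation of \<open>exp (- c sin
  x)\<close> is bounded in \<open>c\<close>, shows that \<open>qk t\<close> is a Calderon--Zygmund
  kernel uniformly in \<open>t \<ge> 0\<close>: it is of size \<open>1 / \<bar>k\<bar>\<close>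
  with differences of size \<open>1 / k\<^sup>2\<close>.

  \<^emph>\<open>Assertions (ii) and (iii), pointwise.\<close> If \<open>\<Sum> \<bar>f m\<bar> /
  (1 + \<bar>m\<bar>)\<close> converges, then the semigroups are convolutions with these kernels
  (\<open>poisson_eq_conv\<close>, \<open>conj_fwd_eq_conv\<close>), and the kernel equations pass
  to \<open>f\<close> because all kernels and all their derivatives in \<open>t\<close> are
  bounded by multiples of \<open>1 / (1 + \<bar>k\<bar>)\<close>. The convergence holds for
  \<open>f\<close> in \<open>\<ell>\<^sup>p(w)\<close> with \<open>w\<close> in \<open>A_p\<close>
  (\<open>lp_space_tame\<close>).

  \<^emph>\<open>Assertion (i).\<close> The supremum over \<open>t\<close> is treated as one
  Calderon--Zygmund operator with values in bounded functions of \<open>t\<close>. Its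
  \<open>\<ell>\<^sup>2\<close> bound (\<open>conj_l2\<close>) holds because \<open>Q\<^sub>t
  f\<close> is the Poisson integral of the Riesz transform of \<open>f\<close>: the Poisson
  integrals are dominated by the Hardy--Littlewood maximal function, and the Riesz transform is an
  \<open>\<ell>\<^sup>2\<close> isometry because the columns of its matrix are orthogonal. The
  Calderon--Zygmund decomposition (\<open>weak_type_A1\<close>, with \<open>w = 1\<close>) then
  gives the weak type \<open>(1,1)\<close>.

  The passage to \<open>A_p\<close> weights is by sparse domination. On an interval
  \<open>Q\<close>, the operator is bounded by a multiple of the average of
  \<open>\<bar>f\<bar>\<close> over the triple of \<open>Q\<close>, except on a small set; that
  set is covered by disjoint intervals of at most half the total length, on which the same
  argument is repeated (\<open>sparse_step\<close>). Paired with a test sequence \<open>g\<close>,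
  this bounds the form \<open>\<Sum> T f g\<close> by a sum of products of averages of
  \<open>\<bar>f\<bar>\<close> and \<open>g\<close>. The \<open>A_p\<close> condition converts
  these into averages of \<open>\<bar>f\<bar> / \<sigma>\<close> with respect to the dual weight
  \<open>\<sigma>\<close> and of \<open>g / w\<close> with respect to \<open>w\<close>
  (\<open>Ap_bilinear_bound\<close>), and the two corresponding maximal functions are bounded on
  \<open>\<ell>\<^sup>p(\<sigma>)\<close> and on the dual space for arbitrary weights
  (\<open>interval_max_strong\<close>), because the one-sided maximal inequalities on the line
  hold for every measure with the same constant. The choice \<open>g = (T f)^(p-1) w\<close>
  yields the strong type bound (\<open>strong_type_Ap\<close>). For \<open>p = 1\<close>, an
  \<open>A_1\<close> weight is in \<open>A_2\<close>, which gives an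
  \<open>\<ell>\<^sup>2(w)\<close> bound; the Calderon--Zygmund decomposition, now with
  \<open>w\<close>, gives the weak type (\<open>conj_weak_A1\<close>).

  The same bilinear bound, applied to the intervals \<open>[-2^j, 2^j]\<close> with the unit mass
  at the origin as \<open>g\<close>, shows the summability \<open>\<Sum> \<bar>f m\<bar> / (1 +
  \<bar>m\<bar>) < \<infinity>\<close>. Finally, the limit in \<open>\<ell>\<^sup>p(w)\<close>
  follows from the pointwise one by dominated convergence, the maximal function being the
  dominating sequence.\<close>

section \<open>Maximal functions with respect to a weight\<close>

text \<open>The maximal ergodic inequality, in the form that admits a downward induction on the left
  endpoint: besides the positivity of the sum over \<open>E a\<close> one carries along that this
  sum dominates every initial sum. If \<open>a\<close> belongs to \<open>E a\<close>, the second
  clause for \<open>a + 1\<close> gives the second clause for \<open>a\<close>, and an initial sum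
  that is nonnegative then gives the first clause; if not, the set is unchanged and all initial sums
  are negative.\<close>

lemma maximal_ergodic_interval:
  fixes x :: "int \<Rightarrow> real" and a u :: int
  defines "E \<equiv> \<lambda>a. {n \<in> {a..u}. \<exists>b\<in>{n..u}. 0 \<le> (\<Sum>i=n..b. x i)}"
  shows "0 \<le> (\<Sum>i\<in>E a. x i) \<and> (\<forall>b\<in>{a..u}. (\<Sum>i=a..b. x i) \<le> (\<Sum>i\<in>E a. x i))"
proof (induction "nat (u - a + 1)" arbitrary: a)
  case 0
  then have "u < a" by auto
  then have "E a = {}" "{a..u} = {}" by (auto simp: E_def)
  then show ?case by simp
next
  case (Suc k)
  then have au: "a \<le> u" and k: "k = nat (u - (a + 1) + 1)" by auto
  have IH: "0 \<le> (\<Sum>i\<in>E (a+1). x i)"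
    "\<And>b. b \<in> {a+1..u} \<Longrightarrow> (\<Sum>i=a+1..b. x i) \<le> (\<Sum>i\<in>E (a+1). x i)"
    using Suc(1)[OF k] by auto
  have split: "(\<Sum>i=a..b. x i) = x a + (\<Sum>i=a+1..b. x i)" if "a \<le> b" for b
  proof -
    have "{a..b} = insert a {a+1..b}" using that by auto
    then show ?thesis by simp
  qed
  have fin: "finite (E (a+1))" by (rule finite_subset[of _ "{a+1..u}"]) (auto simp: E_def)
  show ?case
  proof (cases "\<exists>b\<in>{a..u}. 0 \<le> (\<Sum>i=a..b. x i)")
    case True
    have "E a = insert a (E (a+1))" using True au by (fastforce simp: E_def)
    moreover have "a \<notin> E (a+1)" by (simp add: E_def)
    ultimately have eq: "(\<Sum>i\<in>E a. x i) = x a + (\<Sum>i\<in>E (a+1). x i)" using fin by simp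
    have *: "(\<Sum>i=a..b. x i) \<le> (\<Sum>i\<in>E a. x i)" if "b \<in> {a..u}" for b
    proof (cases "b = a")
      case True then show ?thesis using eq IH(1) by simp
    next
      case False then show ?thesis using eq IH(2)[of b] that split[of b] by auto
    qed
    obtain b where "b \<in> {a..u}" "0 \<le> (\<Sum>i=a..b. x i)" using True by blast
    with *[of b] have "0 \<le> (\<Sum>i\<in>E a. x i)" by linarith
    with * show ?thesis by blast
  next
    case False
    have "n \<in> E a \<longleftrightarrow> n \<in> E (a+1)" for n
      using False by (cases "n = a") (auto simp: E_def)
    then have "E a = E (a+1)" by blast
    moreover have "(\<Sum>i=a..b. x i) \<le> (\<Sum>i\<in>E (a+1). x i)" if "b \<in> {a..u}" for b
    proof -
      have "(\<Sum>i=a..b. x i) < 0" using False that by (meson not_le)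
      then show ?thesis using IH(1) by linarith
    qed
    ultimately show ?thesis using IH(1) by auto
  qed
qed

text \<open>All three maximal functions only look at intervals inside a finite window
  \<open>{l..u}\<close>. They are then maxima of finitely many numbers, and no integrability is
  needed to make sense of them; the estimates below do not depend on the window, which can therefore
  be exhausted at the end.\<close>

definition right_max :: "(int \<Rightarrow> real) \<Rightarrow> (int \<Rightarrow> real) \<Rightarrow> int \<Rightarrow> int \<Rightarrow> real" where
  "right_max \<sigma> h u n = Max ((\<lambda>b. (\<Sum>i=n..b. h i * \<sigma> i) / (\<Sum>i=n..b. \<sigma> i)) ` {n..u})"

definition left_max :: "(int \<Rightarrow> real) \<Rightarrow> (int \<Rightarrow> real) \<Rightarrow> int \<Rightarrow> int \<Rightarrow> real" where
  "left_max \<sigma> h l n = Max ((\<lambda>a. (\<Sum>i=a..n. h i * \<sigma> i) / (\<Sum>i=a..n. \<sigma> i)) ` {l..n})"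

definition interval_max :: "(int \<Rightarrow> real) \<Rightarrow> (int \<Rightarrow> real) \<Rightarrow> int \<Rightarrow> int \<Rightarrow> int \<Rightarrow> real" where
  "interval_max \<sigma> h l u n = Max ((\<lambda>(a, b). (\<Sum>i=a..b. h i * \<sigma> i) / (\<Sum>i=a..b. \<sigma> i)) ` ({l..n} \<times> {n..u}))"

lemma sum_int_reflect: "(\<Sum>i=a..b. f (- i)) = (\<Sum>i=-b..-a. f (i::int))"
  by (rule sum.reindex_bij_witness[of _ uminus uminus]) auto

lemma left_max_reflect:
  "left_max \<sigma> h l n = right_max (\<lambda>i. \<sigma> (- i)) (\<lambda>i. h (- i)) (- l) (- n)"
proof -
  have "{l..n} = uminus ` {-n..-l}" by simp
  then show ?thesis unfolding left_max_def right_max_def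
    by (simp only: image_image sum_int_reflect[of "\<lambda>i. h i * \<sigma> i"] sum_int_reflect[of \<sigma>] minus_minus)
qed

text \<open>The average of \<open>h\<close> over \<open>{n..b}\<close> is at least \<open>c\<close>
  exactly if the sum of \<open>(h - c) \<sigma>\<close> over \<open>{n..b}\<close> is nonnegative.
  So this is the maximal ergodic inequality for \<open>(h - c) \<sigma>\<close>; it keeps the
  right-hand side restricted to the level set, which is what a strong type bound needs.\<close>

lemma right_max_level_sets:
  fixes \<sigma> h :: "int \<Rightarrow> real"
  assumes "\<And>i. \<sigma> i > 0"
  shows "c * (\<Sum>n\<in>{n\<in>{l..u}. c \<le> right_max \<sigma> h u n}. \<sigma> n)
          \<le> (\<Sum>n\<in>{n\<in>{l..u}. c \<le> right_max \<sigma> h u n}. h n * \<sigma> n)"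
proof -
  have "c \<le> right_max \<sigma> h u n \<longleftrightarrow> (\<exists>b\<in>{n..u}. 0 \<le> (\<Sum>i=n..b. (h i - c) * \<sigma> i))" if "n \<in> {l..u}" for n
  proof -
    have "c \<le> right_max \<sigma> h u n \<longleftrightarrow> (\<exists>b\<in>{n..u}. c \<le> (\<Sum>i=n..b. h i * \<sigma> i) / (\<Sum>i=n..b. \<sigma> i))"
      unfolding right_max_def using that by (subst Max_ge_iff) auto
    also have "\<dots> \<longleftrightarrow> (\<exists>b\<in>{n..u}. 0 \<le> (\<Sum>i=n..b. (h i - c) * \<sigma> i))"
    proof (rule bex_cong[OF refl])
      fix b assume "b \<in> {n..u}"
      then have "(\<Sum>i=n..b. \<sigma> i) > 0" using assms by (intro sum_pos) auto
      then show "c \<le> (\<Sum>i=n..b. h i * \<sigma> i) / (\<Sum>i=n..b. \<sigma> i) \<longleftrightarrow> 0 \<le> (\<Sum>i=n..b. (h i - c) * \<sigma> i)"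
        by (simp add: pos_le_divide_eq left_diff_distrib sum_subtractf sum_distrib_left)
    qed
    finally show ?thesis .
  qed
  then have eq: "{n\<in>{l..u}. c \<le> right_max \<sigma> h u n} = {n\<in>{l..u}. \<exists>b\<in>{n..u}. 0 \<le> (\<Sum>i=n..b. (h i - c) * \<sigma> i)}"
    by blast
  show ?thesis
    using maximal_ergodic_interval[where x = "\<lambda>i. (h i - c) * \<sigma> i" and a = l and u = u]
    unfolding eq by (simp add: left_diff_distrib sum_subtractf sum_distrib_left)
qed

lemma left_max_level_sets:
  fixes \<sigma> h :: "int \<Rightarrow> real"
  assumes "\<And>i. \<sigma> i > 0"
  shows "c * (\<Sum>n\<in>{n\<in>{l..u}. c \<le> left_max \<sigma> h l n}. \<sigma> n)
          \<le> (\<Sum>n\<in>{n\<in>{l..u}. c \<le> left_max \<sigma> h l n}. h n * \<sigma> n)"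
proof -
  have *: "(\<Sum>n\<in>{n\<in>{l..u}. c \<le> left_max \<sigma> h l n}. f n)
     = (\<Sum>n\<in>{n\<in>{-u..-l}. c \<le> right_max (\<lambda>i. \<sigma> (- i)) (\<lambda>i. h (- i)) (- l) n}. f (- n))"
    for f :: "int \<Rightarrow> real"
    unfolding left_max_reflect
    by (rule sum.reindex_bij_witness[of _ uminus uminus]) auto
  show ?thesis unfolding *
    using right_max_level_sets[of "\<lambda>i. \<sigma> (- i)" c "-u" "-l" "\<lambda>i. h (- i)"] assms by simp
qed

text \<open>Marcinkiewicz interpolation against the trivial bound at infinity, in the form of
  Doob's inequality. Integrating \<open>c powr (p - 2)\<close> times the hypothesis over
  \<open>c\<close> bounds \<open>\<Sum> m^p \<sigma>\<close> by \<open>p / (p - 1)\<close> times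
  \<open>\<Sum> h m^(p-1) \<sigma>\<close>; the factor \<open>m^(p-1)\<close> is then absorbed
  pointwise.\<close>

lemma strong_from_level_sets:
  fixes m h \<sigma> :: "'a \<Rightarrow> real"
  assumes fin: "finite W" and p: "1 < p"
    and nonneg: "\<And>n. n \<in> W \<Longrightarrow> 0 \<le> m n" "\<And>n. n \<in> W \<Longrightarrow> 0 \<le> h n" "\<And>n. n \<in> W \<Longrightarrow> 0 \<le> \<sigma> n"
    and lev: "\<And>c. 0 < c \<Longrightarrow> c * (\<Sum>n\<in>{n\<in>W. c \<le> m n}. \<sigma> n) \<le> (\<Sum>n\<in>{n\<in>W. c \<le> m n}. h n * \<sigma> n)"
  shows "(\<Sum>n\<in>W. m n powr p * \<sigma> n)
          \<le> 2 * (p / (p-1)) * (2 * (p / (p-1))) powr (p-1) * (\<Sum>n\<in>W. h n powr p * \<sigma> n)"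
proof -
  define q where "q = p / (p-1)"
  have q: "q > 1" using p by (simp add: q_def field_simps)
  define M where "M = Max (insert 0 (m ` W))"
  have mM: "m n \<le> M" if "n \<in> W" for n using that fin by (simp add: M_def)
  have M0: "0 \<le> M" using fin by (simp add: M_def)
  define F where "F = (\<lambda>n x. if x \<le> m n then x powr (p-2) * (h n - x) * \<sigma> n else 0)"
  have I: "(F n has_integral (h n * m n powr (p-1) / (p-1) - m n powr p / p) * \<sigma> n) {0..M}" if n: "n \<in> W" for n
  proof -
    have 1: "((\<lambda>x. x powr (p-2)) has_integral (m n powr (p-2+1) / (p-2+1))) {0..m n}"
      using p nonneg(1)[OF n] by (intro has_integral_powr_from_0) auto
    have 2: "((\<lambda>x. x powr (p-1)) has_integral (m n powr (p-1+1) / (p-1+1))) {0..m n}"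
      using p nonneg(1)[OF n] by (intro has_integral_powr_from_0) auto
    have "((\<lambda>x. (h n * x powr (p-2) - x powr (p-1)) * \<sigma> n) has_integral
         ((h n * (m n powr (p-2+1) / (p-2+1)) - m n powr (p-1+1) / (p-1+1)) * \<sigma> n)) {0..m n}"
      by (intro has_integral_mult_left has_integral_diff has_integral_mult_right 1 2)
    moreover have "(h n * x powr (p-2) - x powr (p-1)) * \<sigma> n = x powr (p-2) * (h n - x) * \<sigma> n"
      if "x \<in> {0..m n}" for x
    proof -
      have "x powr (p-1) = x powr (p-2) * x"
        using powr_add[of x "p-2" 1] that by (cases "x = 0") auto
      then show ?thesis by (simp add: algebra_simps)
    qed
    ultimately have "((\<lambda>x. x powr (p-2) * (h n - x) * \<sigma> n) has_integral
         ((h n * (m n powr (p-2+1) / (p-2+1)) - m n powr (p-1+1) / (p-1+1)) * \<sigma> n)) {0..m n}"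
      by (subst (asm) has_integral_cong) auto
    then have "((\<lambda>x. if x \<in> {0..m n} then x powr (p-2) * (h n - x) * \<sigma> n else 0) has_integral
         ((h n * (m n powr (p-2+1) / (p-2+1)) - m n powr (p-1+1) / (p-1+1)) * \<sigma> n)) {0..M}"
      using mM[OF n] by (subst has_integral_restrict) auto
    then have "(F n has_integral
         ((h n * (m n powr (p-2+1) / (p-2+1)) - m n powr (p-1+1) / (p-1+1)) * \<sigma> n)) {0..M}"
      by (subst (asm) has_integral_cong[where g = "F n"]) (auto simp: F_def)
    then show ?thesis by (simp add: algebra_simps)
  qed
  have "((\<lambda>x. \<Sum>n\<in>W. F n x) has_integral
      (\<Sum>n\<in>W. (h n * m n powr (p-1) / (p-1) - m n powr p / p) * \<sigma> n)) {0..M}"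
    by (intro has_integral_sum fin I)
  moreover have "0 \<le> (\<Sum>n\<in>W. F n x)" if "x \<in> {0..M}" for x
  proof -
    have "(\<Sum>n\<in>W. F n x) = (\<Sum>n\<in>{n\<in>W. x \<le> m n}. x powr (p-2) * (h n - x) * \<sigma> n)"
      unfolding F_def using fin by (subst sum.inter_filter) auto
    also have "\<dots> = x powr (p-2) * ((\<Sum>n\<in>{n\<in>W. x \<le> m n}. h n * \<sigma> n) - x * (\<Sum>n\<in>{n\<in>W. x \<le> m n}. \<sigma> n))"
      by (simp add: sum_distrib_left sum_subtractf[symmetric] algebra_simps)
    also have "\<dots> \<ge> 0" using lev[of x] that by (cases "x = 0") auto
    finally show ?thesis .
  qed
  ultimately have "0 \<le> (\<Sum>n\<in>W. (h n * m n powr (p-1) / (p-1) - m n powr p / p) * \<sigma> n)"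
    by (rule has_integral_nonneg)
  also have "\<dots> = (\<Sum>n\<in>W. h n * m n powr (p-1) * \<sigma> n) / (p-1) - (\<Sum>n\<in>W. m n powr p * \<sigma> n) / p"
    by (simp add: sum_subtractf sum_divide_distrib algebra_simps)
  finally have A: "(\<Sum>n\<in>W. m n powr p * \<sigma> n) \<le> q * (\<Sum>n\<in>W. h n * m n powr (p-1) * \<sigma> n)"
    using p by (simp add: q_def field_simps)
  \<comment> \<open>Either \<open>m\<close> is at most a multiple of \<open>h\<close>, or \<open>q
    h\<close> is at most \<open>m / 2\<close> and half of the left-hand side can be absorbed.\<close>
  have pt: "q * (h n * m n powr (p-1)) \<le> m n powr p / 2 + q * (2 * q) powr (p-1) * h n powr p" if n: "n \<in> W" for n
  proof (cases "m n \<le> 2 * q * h n")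
    case True
    have "m n powr (p-1) \<le> (2 * q * h n) powr (p-1)"
      using True nonneg(1)[OF n] p by (intro powr_mono2) auto
    also have "\<dots> = (2*q) powr (p-1) * h n powr (p-1)" using q nonneg(2)[OF n] by (subst powr_mult) auto
    finally have "q * (h n * m n powr (p-1)) \<le> q * (h n * ((2*q) powr (p-1) * h n powr (p-1)))"
      using q nonneg(2)[OF n] by (intro mult_left_mono) auto
    also have "\<dots> = q * (2*q) powr (p-1) * h n powr p"
      using powr_add[of "h n" "p-1" 1] nonneg(2)[OF n] by (cases "h n = 0") auto
    finally show ?thesis using powr_ge_zero[of "m n" p] by linarith
  next
    case False
    then have "q * h n \<le> m n / 2" by simp
    then have "q * h n * m n powr (p-1) \<le> m n / 2 * m n powr (p-1)" by (intro mult_right_mono) auto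
    also have "\<dots> = m n powr p / 2"
      using powr_add[of "m n" "p-1" 1] nonneg(1)[OF n] by (cases "m n = 0") auto
    finally show ?thesis using q by (simp add: mult.assoc add_increasing2)
  qed
  have "q * (\<Sum>n\<in>W. h n * m n powr (p-1) * \<sigma> n) = (\<Sum>n\<in>W. q * (h n * m n powr (p-1)) * \<sigma> n)"
    by (simp add: sum_distrib_left algebra_simps)
  also have "\<dots> \<le> (\<Sum>n\<in>W. (m n powr p / 2 + q * (2 * q) powr (p-1) * h n powr p) * \<sigma> n)"
    by (intro sum_mono mult_right_mono pt nonneg)
  also have "\<dots> = (\<Sum>n\<in>W. m n powr p * \<sigma> n) / 2 + q * (2 * q) powr (p-1) * (\<Sum>n\<in>W. h n powr p * \<sigma> n)"
    by (simp add: sum.distrib sum_distrib_left sum_divide_distrib algebra_simps)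
  finally show ?thesis using A unfolding q_def[symmetric] by (simp add: mult.assoc)
qed

lemma interval_max_ge:
  assumes "l \<le> a" "a \<le> n" "n \<le> b" "b \<le> u"
  shows "(\<Sum>i=a..b. h i * \<sigma> i) / (\<Sum>i=a..b. \<sigma> i) \<le> interval_max \<sigma> h l u n"
  unfolding interval_max_def
  by (rule Max_ge) (use assms in \<open>auto intro!: rev_image_eqI[of "(a,b)"]\<close>)

lemma interval_max_nonneg:
  assumes "\<And>i. \<sigma> i > 0" "\<And>i. 0 \<le> h i" "l \<le> n" "n \<le> u"
  shows "0 \<le> interval_max \<sigma> h l u n"
proof -
  have "0 \<le> (\<Sum>i=n..n. h i * \<sigma> i) / (\<Sum>i=n..n. \<sigma> i)"
    using assms by (intro divide_nonneg_nonneg sum_nonneg mult_nonneg_nonneg less_imp_le[of 0 "\<sigma> _"])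
  also have "\<dots> \<le> interval_max \<sigma> h l u n" using assms by (intro interval_max_ge) auto
  finally show ?thesis .
qed

text \<open>An interval around \<open>n\<close> is the union of its parts to the left and to the
  right of \<open>n\<close>, and both parts have smaller mass, whatever the weight; hence the constants below do not depend on \<open>\<sigma>\<close>.\<close>

lemma interval_max_le_one_sided:
  assumes pos: "\<And>i. \<sigma> i > 0" and h: "\<And>i. 0 \<le> h i" and n: "l \<le> n" "n \<le> u"
  shows "interval_max \<sigma> h l u n \<le> left_max \<sigma> h l n + right_max \<sigma> h u n"
    and "0 \<le> left_max \<sigma> h l n" and "0 \<le> right_max \<sigma> h u n"
proof -
  have L: "(\<Sum>i=a..n. h i * \<sigma> i) / (\<Sum>i=a..n. \<sigma> i) \<le> left_max \<sigma> h l n" if "a \<in> {l..n}" for a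
    unfolding left_max_def using that by (intro Max_ge) auto
  have R: "(\<Sum>i=n..b. h i * \<sigma> i) / (\<Sum>i=n..b. \<sigma> i) \<le> right_max \<sigma> h u n" if "b \<in> {n..u}" for b
    unfolding right_max_def using that by (intro Max_ge) auto
  have hn: "0 \<le> (\<Sum>i\<in>A. h i * \<sigma> i)" for A using h pos by (intro sum_nonneg) (simp add: less_imp_le)
  have s0: "0 \<le> (\<Sum>i\<in>A. \<sigma> i)" for A using pos by (intro sum_nonneg) (simp add: less_imp_le)
  show "0 \<le> left_max \<sigma> h l n" using L[of n] n divide_nonneg_nonneg[OF hn[of "{n..n}"] s0[of "{n..n}"]] by simp
  show "0 \<le> right_max \<sigma> h u n" using R[of n] n divide_nonneg_nonneg[OF hn[of "{n..n}"] s0[of "{n..n}"]] by simp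
  have "(\<Sum>i=a..b. h i * \<sigma> i) / (\<Sum>i=a..b. \<sigma> i) \<le> left_max \<sigma> h l n + right_max \<sigma> h u n"
    if "a \<in> {l..n}" "b \<in> {n..u}" for a b
  proof -
    have s3: "(\<Sum>i=a..b. h i * \<sigma> i) \<le> (\<Sum>i=a..n. h i * \<sigma> i) + (\<Sum>i=n..b. h i * \<sigma> i)"
    proof -
      have "{a..b} = {a..n} \<union> {n..b}" using that by auto
      then have "(\<Sum>i=a..b. h i * \<sigma> i) + (\<Sum>i\<in>{a..n} \<inter> {n..b}. h i * \<sigma> i) = (\<Sum>i=a..n. h i * \<sigma> i) + (\<Sum>i=n..b. h i * \<sigma> i)"
        by (simp only: sum.union_inter finite_atLeastAtMost_int)
      then show ?thesis using hn[of "{a..n} \<inter> {n..b}"] by linarith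
    qed
    moreover have p0: "(\<Sum>i=a..n. \<sigma> i) > 0" "(\<Sum>i=n..b. \<sigma> i) > 0" using that pos by (auto intro!: sum_pos)
    moreover have s1: "(\<Sum>i=a..n. \<sigma> i) \<le> (\<Sum>i=a..b. \<sigma> i)" and s2: "(\<Sum>i=n..b. \<sigma> i) \<le> (\<Sum>i=a..b. \<sigma> i)"
      using that by (intro sum_mono2; auto intro: less_imp_le pos)+
    ultimately have "(\<Sum>i=a..b. h i * \<sigma> i) / (\<Sum>i=a..b. \<sigma> i) \<le>
       (\<Sum>i=a..n. h i * \<sigma> i) / (\<Sum>i=a..n. \<sigma> i) + (\<Sum>i=n..b. h i * \<sigma> i) / (\<Sum>i=n..b. \<sigma> i)"
    proof -
      have "(\<Sum>i=a..b. h i * \<sigma> i) / (\<Sum>i=a..b. \<sigma> i) \<le> ((\<Sum>i=a..n. h i * \<sigma> i) + (\<Sum>i=n..b. h i * \<sigma> i)) / (\<Sum>i=a..b. \<sigma> i)"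
        using s3 s0 by (rule divide_right_mono)
      also have "\<dots> = (\<Sum>i=a..n. h i * \<sigma> i) / (\<Sum>i=a..b. \<sigma> i) + (\<Sum>i=n..b. h i * \<sigma> i) / (\<Sum>i=a..b. \<sigma> i)"
        by (rule add_divide_distrib)
      also have "\<dots> \<le> (\<Sum>i=a..n. h i * \<sigma> i) / (\<Sum>i=a..n. \<sigma> i) + (\<Sum>i=n..b. h i * \<sigma> i) / (\<Sum>i=n..b. \<sigma> i)"
        using p0 hn s1 s2 by (intro add_mono frac_le) auto
      finally show ?thesis .
    qed
    also have "\<dots> \<le> left_max \<sigma> h l n + right_max \<sigma> h u n" using L R that by (intro add_mono) auto
    finally show ?thesis .
  qed
  then show "interval_max \<sigma> h l u n \<le> left_max \<sigma> h l n + right_max \<sigma> h u n"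
    unfolding interval_max_def using n by (subst Max_le_iff) auto
qed

lemma powr_add_le:
  fixes a b p :: real
  assumes "0 \<le> a" "0 \<le> b" "0 \<le> p"
  shows "(a + b) powr p \<le> 2 powr p * (a powr p + b powr p)"
proof -
  have "(a + b) powr p \<le> (2 * max a b) powr p" using assms by (intro powr_mono2) auto
  also have "\<dots> = 2 powr p * (max a b) powr p" using assms by (subst powr_mult) auto
  also have "\<dots> \<le> 2 powr p * (a powr p + b powr p)"
    by (intro mult_left_mono) (auto simp: max_def)
  finally show ?thesis .
qed

text \<open>Since the constant is the same for all positive weights, this applies to an \<open>A_p\<close> weight and
  to its dual weight at the same time.\<close>

theorem interval_max_strong:
  assumes pos: "\<And>i. \<sigma> i > 0" and h: "\<And>i. 0 \<le> h i" and p: "1 < p"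
  shows "(\<Sum>n=l..u. interval_max \<sigma> h l u n powr p * \<sigma> n)
     \<le> 2 powr p * (4 * (p / (p-1)) * (2 * (p / (p-1))) powr (p-1)) * (\<Sum>n=l..u. h n powr p * \<sigma> n)"
proof -
  note os = interval_max_le_one_sided[of \<sigma> h, OF pos h]
  let ?C = "2 * (p / (p-1)) * (2 * (p / (p-1))) powr (p-1)"
  let ?S = "\<Sum>n=l..u. h n powr p * \<sigma> n"
  have "(\<Sum>n=l..u. interval_max \<sigma> h l u n powr p * \<sigma> n) \<le>
     (\<Sum>n=l..u. 2 powr p * (left_max \<sigma> h l n powr p + right_max \<sigma> h u n powr p) * \<sigma> n)"
  proof (intro sum_mono mult_right_mono)
    fix n assume n: "n \<in> {l..u}"
    have "interval_max \<sigma> h l u n powr p \<le> (left_max \<sigma> h l n + right_max \<sigma> h u n) powr p"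
      using os(1)[of l n u] interval_max_nonneg[of \<sigma> h l n u, OF pos h] n p by (intro powr_mono2) auto
    also have "\<dots> \<le> 2 powr p * (left_max \<sigma> h l n powr p + right_max \<sigma> h u n powr p)"
      using os(2,3)[of l n u] n p by (intro powr_add_le) auto
    finally show "interval_max \<sigma> h l u n powr p \<le> 2 powr p * (left_max \<sigma> h l n powr p + right_max \<sigma> h u n powr p)" .
  qed (simp add: pos less_imp_le)
  also have "\<dots> = 2 powr p * ((\<Sum>n=l..u. left_max \<sigma> h l n powr p * \<sigma> n) + (\<Sum>n=l..u. right_max \<sigma> h u n powr p * \<sigma> n))"
    by (simp add: sum_distrib_left sum.distrib[symmetric] algebra_simps)
  also have "\<dots> \<le> 2 powr p * (?C * ?S + ?C * ?S)"
  proof (intro mult_left_mono add_mono)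
    show "(\<Sum>n=l..u. left_max \<sigma> h l n powr p * \<sigma> n) \<le> ?C * ?S"
      using os(2)[of l _ u] h pos by (intro strong_from_level_sets p left_max_level_sets) (auto intro: less_imp_le)
    show "(\<Sum>n=l..u. right_max \<sigma> h u n powr p * \<sigma> n) \<le> ?C * ?S"
      using os(3)[of l _ u] h pos by (intro strong_from_level_sets p right_max_level_sets) (auto intro: less_imp_le)
  qed simp
  also have "\<dots> = 2 powr p * (4 * (p / (p-1)) * (2 * (p / (p-1))) powr (p-1)) * ?S"
    by (simp add: algebra_simps)
  finally show ?thesis .
qed

theorem interval_max_weak:
  assumes h: "\<And>i. 0 \<le> h i" and c: "0 < c"
  shows "c * card {n\<in>{l..u}. c < interval_max (\<lambda>_. 1) h l u n} \<le> 4 * (\<Sum>n=l..u. h n)"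
proof -
  let ?R = "{n\<in>{l..u}. c / 2 \<le> right_max (\<lambda>_. 1) h u n}"
  let ?L = "{n\<in>{l..u}. c / 2 \<le> left_max (\<lambda>_. 1) h l n}"
  have "{n\<in>{l..u}. c < interval_max (\<lambda>_. 1) h l u n} \<subseteq> ?R \<union> ?L"
    using interval_max_le_one_sided(1)[of "\<lambda>_. 1" h l _ u] h by force
  then have "card {n\<in>{l..u}. c < interval_max (\<lambda>_. 1) h l u n} \<le> card (?R \<union> ?L)"
    by (intro card_mono finite_UnI) (rule finite_subset[of _ "{l..u}"]; auto)+
  also have "card (?R \<union> ?L) \<le> card ?R + card ?L" by (rule card_Un_le)
  finally have "card {n\<in>{l..u}. c < interval_max (\<lambda>_. 1) h l u n} \<le> card ?R + card ?L" .
  moreover have cR: "c / 2 * real (card ?R) \<le> (\<Sum>n=l..u. h n)"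
  proof -
    have "c / 2 * real (card ?R) \<le> (\<Sum>n\<in>?R. h n)"
      using right_max_level_sets[of "\<lambda>_. 1" "c/2" l u h] by simp
    also have "\<dots> \<le> (\<Sum>n=l..u. h n)" using h by (intro sum_mono2) auto
    finally show ?thesis .
  qed
  moreover have cL: "c / 2 * real (card ?L) \<le> (\<Sum>n=l..u. h n)"
  proof -
    have "c / 2 * real (card ?L) \<le> (\<Sum>n\<in>?L. h n)"
      using left_max_level_sets[of "\<lambda>_. 1" "c/2" l u h] by simp
    also have "\<dots> \<le> (\<Sum>n=l..u. h n)" using h by (intro sum_mono2) auto
    finally show ?thesis .
  qed
  ultimately have "real (card {n\<in>{l..u}. c < interval_max (\<lambda>_. 1) h l u n}) \<le> real (card ?R) + real (card ?L)"
    by linarith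
  then have "c * card {n\<in>{l..u}. c < interval_max (\<lambda>_. 1) h l u n} \<le> c * (real (card ?R) + real (card ?L))"
    using c by (intro mult_left_mono) auto
  with cR cL show ?thesis by (simp add: algebra_simps)
qed

section \<open>Radially decreasing majorants\<close>

text \<open>Summation by parts: the sums \<open>s i\<close> over centred intervals grow at most
  linearly, so replacing \<open>s i\<close> by \<open>A (T + i)\<close> costs \<open>A \<Sum> (T +
  i) (1 / (T + i)^2 - 1 / (T + i + 1)^2)\<close>, which is comparable to \<open>A / T\<close>.\<close>

lemma radial_sum_bound:
  fixes g :: "int \<Rightarrow> real"
  assumes g: "\<And>i. 0 \<le> g i" and T: "1 \<le> T"
    and S: "\<And>i::nat. (\<Sum>k=-int i..int i. g (n + k)) \<le> A * (T + real i)"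
  shows "(\<Sum>k=-int L..int L. g (n + k) / (T + real_of_int \<bar>k\<bar>)\<^sup>2) \<le> 3 * A / T"
proof -
  define s where "s = (\<lambda>i::nat. \<Sum>k=-int i..int i. g (n + k))"
  have s0: "0 \<le> s i" for i unfolding s_def using g by (intro sum_nonneg) auto
  have A0: "0 \<le> A"
  proof -
    have "0 \<le> A * (T + real 0)" using S[of 0] s0[of 0] unfolding s_def by linarith
    then show ?thesis using T by (simp add: zero_le_mult_iff)
  qed
  have ext: "(\<Sum>k=-int (Suc i)..int (Suc i). h k) = (\<Sum>k=-int i..int i. h k) + h (- int (Suc i)) + h (int (Suc i))"
    for h :: "int \<Rightarrow> real" and i
  proof -
    have "{-int (Suc i)..int (Suc i)} = insert (- int (Suc i)) (insert (int (Suc i)) {-int i..int i})" by auto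
    then show ?thesis by simp
  qed
  \<comment> \<open>The induction carries the boundary term of the summation by parts, and a
    telescoping bound for the rest.\<close>
  have "(\<Sum>k=-int L..int L. g (n + k) / (T + real_of_int \<bar>k\<bar>)\<^sup>2)
      \<le> s L / (T + real L)\<^sup>2 + 2 * A * (1 / T - 1 / (T + real L))" for L
  proof (induction L)
    case 0
    then show ?case by (simp add: s_def)
  next
    case (Suc L)
    define y where "y = T + real L"
    have y: "y \<ge> 1" using T by (simp add: y_def)
    have e: "(\<Sum>k=-int (Suc L)..int (Suc L). g (n + k) / (T + real_of_int \<bar>k\<bar>)\<^sup>2)
       = (\<Sum>k=-int L..int L. g (n + k) / (T + real_of_int \<bar>k\<bar>)\<^sup>2) + (s (Suc L) - s L) / (y + 1)\<^sup>2"
      unfolding ext s_def y_def by (simp add: add_divide_distrib algebra_simps)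
    have "s L * (1 / y\<^sup>2 - 1 / (y+1)\<^sup>2) \<le> A * y * (1 / y\<^sup>2 - 1 / (y+1)\<^sup>2)"
      using S[of L] y unfolding s_def y_def by (intro mult_right_mono) (auto simp: frac_le)
    also have "\<dots> \<le> 2 * A * (1 / y - 1 / (y+1))"
    proof -
      \<comment> \<open>Both sides are multiples of \<open>1 / (y (y + 1))\<close>, with the factors
        \<open>(2 y + 1) / (y + 1)\<close> and \<open>2\<close>.\<close>
      have "y * (1 / y\<^sup>2 - 1 / (y+1)\<^sup>2) \<le> 2 * (1 / y - 1 / (y+1))"
        using y by (simp add: divide_simps power2_eq_square) (sos | (simp add: algebra_simps))
      then show ?thesis using A0 mult_left_mono[of _ _ A] by (fastforce simp: algebra_simps)
    qed
    finally have "s L / y\<^sup>2 + (s (Suc L) - s L) / (y + 1)\<^sup>2 \<le> s (Suc L) / (y+1)\<^sup>2 + 2 * A * (1 / y - 1 / (y+1))"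
      by (simp add: algebra_simps diff_divide_distrib)
    with Suc show ?case unfolding e y_def[symmetric]
      by (simp add: algebra_simps y_def)
  qed
  also have "s L / (T + real L)\<^sup>2 + 2 * A * (1 / T - 1 / (T + real L)) \<le> 3 * A / T"
  proof -
    have "s L / (T + real L)\<^sup>2 \<le> A * (T + real L) / (T + real L)\<^sup>2"
      using S[of L] unfolding s_def by (intro divide_right_mono) auto
    also have "\<dots> = A / (T + real L)" using T by (simp add: power2_eq_square)
    also have "\<dots> \<le> A / T" using T A0 by (intro divide_left_mono) auto
    finally have "s L / (T + real L)\<^sup>2 \<le> A / T" .
    moreover have "0 \<le> A / (T + real L)" using A0 T by simp
    moreover have "2 * A * (1 / T - 1 / (T + real L)) = 2 * (A / T) - 2 * (A / (T + real L))" by (simp add: algebra_simps)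
    moreover have "3 * A / T = 3 * (A / T)" by simp
    ultimately show ?thesis by linarith
  qed
  finally show ?thesis by simp
qed

lemma radial_le_interval_max:
  fixes g :: "int \<Rightarrow> real"
  assumes g: "\<And>i. 0 \<le> g i" and T: "1 \<le> T" and x: "l \<le> x" "x \<le> u"
  shows "(\<Sum>m=l..u. g m / (T + real_of_int \<bar>x - m\<bar>)\<^sup>2) \<le> 6 * interval_max (\<lambda>_. 1) g l u x / T"
proof -
  define M where "M = interval_max (\<lambda>_. 1) g l u x"
  define h where "h = (\<lambda>m. if m \<in> {l..u} then g m else 0)"
  have M0: "0 \<le> M" unfolding M_def using interval_max_nonneg[of "\<lambda>_. 1" g l x u] g x by simp
  define L where "L = nat (u - l)"
  have S: "(\<Sum>k=-int i..int i. h (x + k)) \<le> 2 * M * (T + real i)" for i :: nat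
  proof -
    define a b where "a = max l (x - int i)" and "b = min u (x + int i)"
    have ab: "l \<le> a" "a \<le> x" "x \<le> b" "b \<le> u" using x by (auto simp: a_def b_def)
    have "(\<Sum>k=-int i..int i. h (x + k)) = (\<Sum>m=x-int i..x+int i. h m)"
      by (rule sum.reindex_bij_witness[of _ "\<lambda>m. m - x" "\<lambda>k. x + k"]) auto
    also have "\<dots> = (\<Sum>m=a..b. g m)"
      by (rule sum.mono_neutral_cong_right) (auto simp: a_def b_def h_def)
    also have "\<dots> = (\<Sum>m=a..b. g m * 1) / (\<Sum>m=a..b. 1) * (b - a + 1)" using ab by simp
    also have "\<dots> \<le> M * (b - a + 1)" unfolding M_def using ab
      by (intro mult_right_mono interval_max_ge[of l a x b u g "\<lambda>_. 1"]) auto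
    also have "\<dots> \<le> M * (2 * (T + real i))"
      using T M0 by (intro mult_left_mono) (auto simp: a_def b_def)
    finally show ?thesis by (simp add: algebra_simps)
  qed
  have "(\<Sum>m=l..u. g m / (T + real_of_int \<bar>x - m\<bar>)\<^sup>2) = (\<Sum>m=l..u. h m / (T + real_of_int \<bar>x - m\<bar>)\<^sup>2)"
    by (simp add: h_def)
  also have "\<dots> = (\<Sum>m=x - int L..x + int L. h m / (T + real_of_int \<bar>x - m\<bar>)\<^sup>2)"
    using x by (intro sum.mono_neutral_left) (auto simp: h_def L_def)
  also have "\<dots> = (\<Sum>k=-int L..int L. h (x + k) / (T + real_of_int \<bar>k\<bar>)\<^sup>2)"
    by (rule sum.reindex_bij_witness[of _ "\<lambda>k. x + k" "\<lambda>m. m - x"]) (auto simp: abs_minus_commute)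
  also have "\<dots> \<le> 3 * (2 * M) / T"
    using g T S by (intro radial_sum_bound) (auto simp: h_def)
  finally show ?thesis by (simp add: M_def)
qed

section \<open>Stopping times on intervals\<close>

text \<open>A pair \<open>(a, k)\<close> encodes the interval of length \<open>2^k\<close> that
  starts at \<open>a\<close>. The starting points are not restricted to multiples of
  \<open>2^k\<close>: only the descendants of one given interval under repeated halving are ever
  compared.\<close>

definition ival :: "int \<times> nat \<Rightarrow> int set" where
  "ival P = {fst P..<fst P + 2 ^ snd P}"

definition triple :: "int \<times> nat \<Rightarrow> int set" where
  "triple P = {fst P - 2 ^ snd P..<fst P + 2 * 2 ^ snd P}"

lemma finite_ival [simp]: "finite (ival P)" "finite (triple P)"
  by (simp_all add: ival_def triple_def)

lemma ival_subset_triple: "ival P \<subseteq> triple P"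
proof -
  have "(0::int) < 2 ^ snd P" by simp
  then show ?thesis unfolding ival_def triple_def by (auto intro: order_trans)
qed

lemma card_ival [simp]: "card (ival P) = 2 ^ snd P" "card (triple P) = 3 * 2 ^ snd P"
  by (simp_all add: ival_def triple_def nat_add_distrib nat_mult_distrib nat_power_eq)

lemma triple_mono:
  assumes "ival P \<subseteq> ival Q" shows "triple P \<subseteq> triple Q"
proof -
  have 1: "(0::int) < 2 ^ snd P" by simp
  have "fst P \<in> ival P" by (auto simp: ival_def)
  then have "fst P \<in> ival Q" using assms by blast
  moreover have "fst P + 2 ^ snd P - 1 \<in> ival Q"
    by (rule subsetD[OF assms]) (use 1 in \<open>auto simp: ival_def simp del: zero_less_power\<close>)
  ultimately have a: "fst Q \<le> fst P" "fst P + 2 ^ snd P \<le> fst Q + 2 ^ snd Q" by (auto simp: ival_def)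
  show ?thesis
  proof
    fix x assume "x \<in> triple P"
    with a show "x \<in> triple Q" unfolding triple_def atLeastLessThan_iff by linarith
  qed
qed

text \<open>The outcome of the Calderon--Zygmund stopping time for \<open>f\<close> at height
  \<open>c\<close> inside \<open>R\<close>: disjoint intervals shorter than \<open>2^k\<close> on
  which the average of \<open>f\<close> lies in \<open>(c, 2 c]\<close>, with \<open>f \<le>
  c\<close> off them.\<close>

definition stopping_family :: "(int \<Rightarrow> real) \<Rightarrow> real \<Rightarrow> int set \<Rightarrow> nat \<Rightarrow> (int \<times> nat) set \<Rightarrow> bool" where
  "stopping_family f c R k F \<longleftrightarrow> finite F \<and> disjoint_family_on ival F \<and>
     (\<forall>P\<in>F. ival P \<subseteq> R \<and> snd P < k \<and>
        c * 2 ^ snd P < (\<Sum>n\<in>ival P. f n) \<and> (\<Sum>n\<in>ival P. f n) \<le> 2 * c * 2 ^ snd P) \<and>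
     (\<forall>n\<in>R. n \<notin> (\<Union>P\<in>F. ival P) \<longrightarrow> f n \<le> c)"

text \<open>Halve the interval. A half whose average exceeds \<open>c\<close> is selected; since the
  average over the whole interval was at most \<open>c\<close>, the average over the half is at most
  \<open>2 c\<close>. In the other half one goes on, and the process ends at single points.\<close>

lemma stopping_intervals:
  fixes f :: "int \<Rightarrow> real"
  assumes f: "\<And>n. 0 \<le> f n"
  shows "(\<Sum>n\<in>ival (a, k). f n) \<le> c * 2 ^ k \<Longrightarrow> \<exists>F. stopping_family f c (ival (a, k)) k F"
proof (induction k arbitrary: a)
  case 0
  then have "stopping_family f c (ival (a, 0)) 0 {}"
    by (auto simp: stopping_family_def ival_def disjoint_family_on_def atLeastLessThanPlusOne_atLeastAtMost_int)
  then show ?case by blast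
next
  case (Suc k)
  let ?H1 = "(a, k)" and ?H2 = "(a + 2 ^ k, k)"
  have un: "ival (a, Suc k) = ival ?H1 \<union> ival ?H2"
  proof -
    have "(0::int) < 2 ^ k" by simp
    then show ?thesis unfolding ival_def fst_conv snd_conv power_Suc
      by (auto simp del: zero_less_power)
  qed
  have dj: "ival ?H1 \<inter> ival ?H2 = {}" by (auto simp: ival_def)
  have half: "\<exists>F. stopping_family f c (ival H) (Suc k) F" if H: "H = ?H1 \<or> H = ?H2" for H
  proof (cases "(\<Sum>n\<in>ival H. f n) \<le> c * 2 ^ k")
    case True
    then obtain F where "stopping_family f c (ival H) k F" using Suc.IH H by blast
    then have "stopping_family f c (ival H) (Suc k) F" by (auto simp: stopping_family_def less_Suc_eq)
    then show ?thesis by blast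
  next
    case False
    have "(\<Sum>n\<in>ival H. f n) \<le> (\<Sum>n\<in>ival (a, Suc k). f n)"
      using H f by (intro sum_mono2) (auto simp: un)
    also have "\<dots> \<le> 2 * c * 2 ^ k" using Suc.prems by simp
    finally have "stopping_family f c (ival H) (Suc k) {H}"
      using False H by (auto simp: stopping_family_def disjoint_family_on_def)
    then show ?thesis by blast
  qed
  obtain F1 F2 where F: "stopping_family f c (ival ?H1) (Suc k) F1" "stopping_family f c (ival ?H2) (Suc k) F2"
    using half[of ?H1] half[of ?H2] by blast
  have "disjoint_family_on ival (F1 \<union> F2)"
    unfolding disjoint_family_on_def
  proof (intro ballI impI)
    fix P P' assume P: "P \<in> F1 \<union> F2" "P' \<in> F1 \<union> F2" "P \<noteq> P'"
    have s: "\<And>P. P \<in> F1 \<Longrightarrow> ival P \<subseteq> ival ?H1" "\<And>P. P \<in> F2 \<Longrightarrow> ival P \<subseteq> ival ?H2"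
      using F by (auto simp: stopping_family_def)
    have d: "disjoint_family_on ival F1" "disjoint_family_on ival F2"
      using F by (auto simp: stopping_family_def)
    consider "P \<in> F1" "P' \<in> F1" | "P \<in> F2" "P' \<in> F2" | "P \<in> F1" "P' \<in> F2" | "P \<in> F2" "P' \<in> F1"
      using P by blast
    then show "ival P \<inter> ival P' = {}"
    proof cases
      case 1 then show ?thesis using d(1) P(3) by (auto simp: disjoint_family_on_def)
    next
      case 2 then show ?thesis using d(2) P(3) by (auto simp: disjoint_family_on_def)
    next
      case 3 then show ?thesis using s(1)[of P] s(2)[of P'] dj by blast
    next
      case 4 then show ?thesis using s(2)[of P] s(1)[of P'] dj by blast
    qed
  qed
  moreover have "finite (F1 \<union> F2)" using F by (simp add: stopping_family_def)
  moreover have "\<forall>P\<in>F1 \<union> F2. ival P \<subseteq> ival ?H1 \<union> ival ?H2 \<and> snd P < Suc k \<and>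
        c * 2 ^ snd P < (\<Sum>n\<in>ival P. f n) \<and> (\<Sum>n\<in>ival P. f n) \<le> 2 * c * 2 ^ snd P"
    using F unfolding stopping_family_def by (meson Un_iff le_supI1 le_supI2)
  moreover have "\<forall>n\<in>ival ?H1 \<union> ival ?H2. n \<notin> (\<Union>P\<in>F1 \<union> F2. ival P) \<longrightarrow> f n \<le> c"
    using F unfolding stopping_family_def by blast
  ultimately have "stopping_family f c (ival (a, Suc k)) (Suc k) (F1 \<union> F2)"
    unfolding un stopping_family_def by blast
  then show ?case by blast
qed

lemma markov_sum:
  fixes X w :: "'a \<Rightarrow> real"
  assumes "finite A" "\<And>n. n \<in> A \<Longrightarrow> 0 \<le> X n" "\<And>n. n \<in> A \<Longrightarrow> 0 \<le> w n" "0 \<le> c"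
  shows "c * (\<Sum>n\<in>{n\<in>A. c < X n}. w n) \<le> (\<Sum>n\<in>A. X n * w n)"
proof -
  have "c * (\<Sum>n\<in>{n\<in>A. c < X n}. w n) = (\<Sum>n\<in>{n\<in>A. c < X n}. c * w n)" by (simp add: sum_distrib_left)
  also have "\<dots> \<le> (\<Sum>n\<in>{n\<in>A. c < X n}. X n * w n)" using assms by (intro sum_mono mult_right_mono) auto
  also have "\<dots> \<le> (\<Sum>n\<in>A. X n * w n)" using assms by (intro sum_mono2) auto
  finally show ?thesis .
qed

lemma sum_UN_le:
  fixes w :: "'b \<Rightarrow> real"
  assumes "finite F" "\<And>P. P \<in> F \<Longrightarrow> finite (G P)" "\<And>n. 0 \<le> w n"
  shows "(\<Sum>n\<in>(\<Union>P\<in>F. G P). w n) \<le> (\<Sum>P\<in>F. \<Sum>n\<in>G P. w n)"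
  using assms(1,2)
proof (induction F rule: finite_induct)
  case (insert P F)
  have "(\<Sum>n\<in>G P \<union> (\<Union>P\<in>F. G P). w n) + (\<Sum>n\<in>G P \<inter> (\<Union>P\<in>F. G P). w n)
      = (\<Sum>n\<in>G P. w n) + (\<Sum>n\<in>(\<Union>P\<in>F. G P). w n)"
    using insert by (intro sum.union_inter) auto
  moreover have "0 \<le> (\<Sum>n\<in>G P \<inter> (\<Union>P\<in>F. G P). w n)" using assms(3) by (intro sum_nonneg) auto
  ultimately have "(\<Sum>n\<in>G P \<union> (\<Union>P\<in>F. G P). w n) \<le> (\<Sum>n\<in>G P. w n) + (\<Sum>P\<in>F. \<Sum>n\<in>G P. w n)"
    using insert by fastforce
  then show ?case using insert by simp
qed simp

section \<open>Muckenhoupt weights\<close>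

text \<open>Hoelder's inequality for \<open>1 = w^(1/p) \<sigma>^(1/q)\<close>: the reverse of the
  \<open>A_p\<close> condition, valid on every finite set.\<close>

lemma Ap_holder:
  fixes w \<sigma> :: "'a \<Rightarrow> real"
  assumes p: "1 < p" and pos: "\<And>n. w n > 0" and \<sigma>: "\<And>n. \<sigma> n = w n powr (- 1 / (p - 1))"
    and E: "finite E" "E \<noteq> {}"
  shows "real (card E) powr p \<le> (\<Sum>n\<in>E. w n) * (\<Sum>n\<in>E. \<sigma> n) powr (p - 1)"
proof -
  define W S where "W = (\<Sum>n\<in>E. w n)" and "S = (\<Sum>n\<in>E. \<sigma> n)"
  have sp: "\<sigma> n > 0" for n using pos[of n] by (simp add: \<sigma>)
  have W: "W > 0" and S: "S > 0" unfolding W_def S_def using E pos sp by (auto intro!: sum_pos)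
  define q where "q = p / (p - 1)"
  have q: "q > 1" "1 / p + 1 / q = 1" using p by (auto simp: q_def field_simps)
  have one: "w n powr (1/p) * \<sigma> n powr (1/q) = 1" for n
    using pos[of n] p by (simp add: \<sigma> powr_powr q_def powr_add[symmetric] field_simps)
  \<comment> \<open>Young's inequality for the normalized sequences; summing it over
    \<open>E\<close> gives Hoelder's inequality.\<close>
  have pt: "1 / (W powr (1/p) * S powr (1/q)) \<le> (w n / W) / p + (\<sigma> n / S) / q" for n
  proof -
    have "(w n / W) powr (1/p) * (\<sigma> n / S) powr (1/q) \<le>
       ((w n / W) powr (1/p)) powr p / p + ((\<sigma> n / S) powr (1/q)) powr q / q"
      using p q by (intro Youngs_inequality) auto
    moreover have "(w n / W) powr (1/p) * (\<sigma> n / S) powr (1/q) = 1 / (W powr (1/p) * S powr (1/q))"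
      using one[of n] pos[of n] sp[of n] W S by (simp add: powr_divide)
    ultimately show ?thesis using p q pos[of n] sp[of n] W S by (simp add: powr_powr)
  qed
  have "real (card E) * (1 / (W powr (1/p) * S powr (1/q))) \<le> (\<Sum>n\<in>E. (w n / W) / p + (\<sigma> n / S) / q)"
    using sum_mono[of E "\<lambda>_. 1 / (W powr (1/p) * S powr (1/q))", OF pt] by simp
  also have "\<dots> = (W / W) / p + (S / S) / q"
    unfolding sum.distrib by (simp only: W_def S_def sum_divide_distrib)
  also have "\<dots> = 1" using W S q by simp
  finally have "real (card E) \<le> W powr (1/p) * S powr (1/q)" using W S by (simp add: field_simps)
  then have "real (card E) powr p \<le> (W powr (1/p) * S powr (1/q)) powr p" using p by (intro powr_mono2) auto
  also have "\<dots> = W * S powr (p - 1)"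
    using W S p by (simp add: powr_mult powr_powr q_def)
  finally show ?thesis by (simp add: W_def S_def)
qed

text \<open>Hoelder's inequality on \<open>E\<close> against the \<open>A_p\<close> condition on
  \<open>J\<close>: if \<open>E\<close> fills a fixed fraction of \<open>J\<close>, it carries a
  fixed fraction of the mass of \<open>J\<close>, both for \<open>w\<close> and for the dual weight
  \<open>\<sigma>\<close>.\<close>

lemma Ap_comparison:
  fixes w \<sigma> :: "'a \<Rightarrow> real"
  assumes p: "1 < p" and pos: "\<And>n. w n > 0" and \<sigma>: "\<And>n. \<sigma> n = w n powr (- 1 / (p - 1))"
    and J: "finite J" "E \<subseteq> J" "E \<noteq> {}" and \<kappa>: "real (card J) \<le> \<kappa> * real (card E)"
    and Ap: "(\<Sum>n\<in>J. w n) * (\<Sum>n\<in>J. \<sigma> n) powr (p - 1) \<le> D * real (card J) powr p"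
  shows "(\<Sum>n\<in>J. w n) \<le> D * \<kappa> powr p * (\<Sum>n\<in>E. w n)"
    and "(\<Sum>n\<in>J. \<sigma> n) \<le> (D * \<kappa> powr p) powr (1 / (p - 1)) * (\<Sum>n\<in>E. \<sigma> n)"
proof -
  have sp: "\<sigma> n > 0" for n using pos[of n] by (simp add: \<sigma>)
  have E: "finite E" using J finite_subset by auto
  define WJ SJ WE SE where "WJ = (\<Sum>n\<in>J. w n)" and "SJ = (\<Sum>n\<in>J. \<sigma> n)"
    and "WE = (\<Sum>n\<in>E. w n)" and "SE = (\<Sum>n\<in>E. \<sigma> n)"
  have le: "WE \<le> WJ" "SE \<le> SJ" unfolding WJ_def SJ_def WE_def SE_def
    using J pos sp by (auto intro!: sum_mono2 intro: less_imp_le)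
  have gt: "WE > 0" "SE > 0" unfolding WE_def SE_def using E J pos sp by (auto intro!: sum_pos)
  have cE: "card E > 0" using E J by (simp add: card_gt_0_iff)
  have cJ: "card J > 0" using J by (auto simp: card_gt_0_iff)
  have k0: "\<kappa> > 0" using \<kappa> cE cJ by (smt (verit) mult_nonpos_nonneg of_nat_0_less_iff)
  have D0: "D > 0"
  proof -
    have "0 < WJ * SJ powr (p - 1)" using gt le by simp
    then have "0 < D * real (card J) powr p" using Ap by (simp add: WJ_def SJ_def)
    then show ?thesis by (simp add: zero_less_mult_iff)
  qed
  have main: "WJ * SJ powr (p-1) \<le> D * \<kappa> powr p * (WE * SE powr (p-1))"
  proof -
    have "WJ * SJ powr (p-1) \<le> D * real (card J) powr p" using Ap by (simp add: WJ_def SJ_def)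
    also have "\<dots> \<le> D * (\<kappa> * real (card E)) powr p"
      using \<kappa> D0 p by (intro mult_left_mono powr_mono2) auto
    also have "\<dots> = D * \<kappa> powr p * real (card E) powr p" using k0 by (simp add: powr_mult)
    also have "\<dots> \<le> D * \<kappa> powr p * (WE * SE powr (p-1))"
      using Ap_holder[OF p pos \<sigma> E J(3)] D0 unfolding WE_def SE_def by (intro mult_left_mono) auto
    finally show ?thesis .
  qed
  show "WJ \<le> D * \<kappa> powr p * WE"
  proof -
    have "WJ * SE powr (p-1) \<le> WJ * SJ powr (p-1)"
      using le gt p by (intro mult_left_mono powr_mono2) auto
    then have "WJ * SE powr (p-1) \<le> (D * \<kappa> powr p * WE) * SE powr (p-1)" using main by (simp add: mult.assoc)
    then show ?thesis using gt by (simp add: mult_le_cancel_right)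
  qed
  show "SJ \<le> (D * \<kappa> powr p) powr (1 / (p-1)) * SE"
  proof -
    have "WE * SJ powr (p-1) \<le> WJ * SJ powr (p-1)" using le by (intro mult_right_mono) auto
    then have "WE * SJ powr (p-1) \<le> WE * (D * \<kappa> powr p * SE powr (p-1))" using main by (simp add: algebra_simps)
    then have "SJ powr (p-1) \<le> D * \<kappa> powr p * SE powr (p-1)" using gt by (simp add: mult_le_cancel_left)
    then have "(SJ powr (p-1)) powr (1/(p-1)) \<le> (D * \<kappa> powr p * SE powr (p-1)) powr (1/(p-1))"
      using p by (intro powr_mono2) auto
    then show ?thesis using p gt le D0 by (simp add: powr_powr powr_mult)
  qed
qed

text \<open>The bound on one term of a sparse form. By the \<open>A_p\<close> condition, the product
  of the plain averages of \<open>f\<close> and \<open>g\<close> over \<open>J\<close> is controlled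
  by the averages of \<open>f / \<sigma>\<close> with respect to \<open>\<sigma>\<close> and of
  \<open>g / w\<close> with respect to \<open>w\<close>. Young's inequality separates the two, and
  \<open>Ap_comparison\<close> moves the mass of \<open>J\<close> onto the part \<open>E\<close>. As
  the sets \<open>E\<close> of a sparse family are disjoint, the right-hand sides add up to the
  norms of two weighted maximal functions.\<close>

lemma Ap_bilinear_bound:
  fixes w \<sigma> :: "'a \<Rightarrow> real"
  assumes p: "1 < p" and pos: "\<And>n. w n > 0" and \<sigma>: "\<And>n. \<sigma> n = w n powr (- 1 / (p - 1))"
    and J: "finite J" "E \<subseteq> J" "E \<noteq> {}" and \<kappa>: "real (card J) \<le> \<kappa> * real (card E)"
    and Ap: "(\<Sum>n\<in>J. w n) * (\<Sum>n\<in>J. \<sigma> n) powr (p - 1) \<le> D * real (card J) powr p"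
    and f: "\<And>n. 0 \<le> f n" and g: "\<And>n. 0 \<le> g n"
    and M: "\<And>n. n \<in> E \<Longrightarrow> (\<Sum>i\<in>J. f i) / (\<Sum>i\<in>J. \<sigma> i) \<le> M n"
    and N: "\<And>n. n \<in> E \<Longrightarrow> (\<Sum>i\<in>J. g i) / (\<Sum>i\<in>J. w i) \<le> N n"
  shows "(\<Sum>i\<in>J. f i) * (\<Sum>i\<in>J. g i) / real (card J) \<le>
     D powr (1/p) * (D * \<kappa> powr p + (D * \<kappa> powr p) powr (1 / (p - 1))) *
       (\<Sum>n\<in>E. M n powr p * \<sigma> n + N n powr (p / (p-1)) * w n)"
proof -
  have sp: "\<sigma> n > 0" for n using pos[of n] by (simp add: \<sigma>)
  have E: "finite E" using J finite_subset by auto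
  define W S where "W = (\<Sum>n\<in>J. w n)" and "S = (\<Sum>n\<in>J. \<sigma> n)"
  have WS: "W > 0" "S > 0" unfolding W_def S_def using J pos sp by (auto intro!: sum_pos)
  define q where "q = p / (p - 1)"
  have q: "q > 1" "1 / p + 1 / q = 1" using p by (auto simp: q_def field_simps)
  define a b where "a = (\<Sum>i\<in>J. f i) / S" and "b = (\<Sum>i\<in>J. g i) / W"
  have ab: "a \<ge> 0" "b \<ge> 0" unfolding a_def b_def using WS f g by (auto intro!: divide_nonneg_nonneg sum_nonneg)
  have cJ: "card J > 0" using J by (auto simp: card_gt_0_iff)
  have D0: "D > 0"
  proof -
    have "0 < W * S powr (p - 1)" using WS by simp
    then have "0 < D * real (card J) powr p" using Ap by (simp add: W_def S_def)
    then show ?thesis by (simp add: zero_less_mult_iff)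
  qed
  have root: "W powr (1/p) * S powr (1/q) \<le> D powr (1/p) * real (card J)"
  proof -
    have "(W * S powr (p-1)) powr (1/p) \<le> (D * real (card J) powr p) powr (1/p)"
      using Ap p WS by (intro powr_mono2) (auto simp: W_def S_def)
    then show ?thesis using WS D0 p by (simp add: powr_mult powr_powr q_def)
  qed
  have WWq: "W powr (1/p) * W powr (1/q) = W" "S powr (1/p) * S powr (1/q) = S"
    using WS q by (simp_all add: powr_add[symmetric])
  have "(\<Sum>i\<in>J. f i) * (\<Sum>i\<in>J. g i) / real (card J) = a * b * (S * W) / real (card J)"
    using WS by (simp add: a_def b_def)
  also have "S * W = (W powr (1/p) * S powr (1/q)) * (S powr (1/p) * W powr (1/q))"
    using WWq by (metis mult.assoc mult.commute)
  also have "a * b * \<dots> / real (card J) \<le>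
      a * b * ((D powr (1/p) * real (card J)) * (S powr (1/p) * W powr (1/q))) / real (card J)"
    using ab by (intro divide_right_mono mult_left_mono mult_right_mono root) auto
  also have "\<dots> = D powr (1/p) * ((a * S powr (1/p)) * (b * W powr (1/q)))"
    using cJ by simp
  also have "\<dots> \<le> D powr (1/p) * (a powr p * S + b powr q * W)"
  proof (intro mult_left_mono)
    have "(a * S powr (1/p)) * (b * W powr (1/q)) \<le> (a * S powr (1/p)) powr p / p + (b * W powr (1/q)) powr q / q"
      using p q ab by (intro Youngs_inequality) auto
    also have "\<dots> = a powr p * S / p + b powr q * W / q"
      using p q ab WS by (simp add: powr_mult powr_powr)
    also have "\<dots> \<le> a powr p * S / 1 + b powr q * W / 1"
      using p q ab WS by (intro add_mono divide_left_mono) auto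
    finally show "(a * S powr (1/p)) * (b * W powr (1/q)) \<le> a powr p * S + b powr q * W" by simp
  qed simp
  also have "\<dots> \<le> D powr (1/p) * ((D * \<kappa> powr p + (D * \<kappa> powr p) powr (1 / (p - 1))) *
       (\<Sum>n\<in>E. M n powr p * \<sigma> n + N n powr q * w n))"
  proof (intro mult_left_mono)
    let ?c1 = "(D * \<kappa> powr p) powr (1 / (p - 1))" and ?c2 = "D * \<kappa> powr p"
    have cc: "?c1 \<ge> 0" "?c2 \<ge> 0" using D0 by auto
    have X: "a powr p * (\<Sum>n\<in>E. \<sigma> n) \<le> (\<Sum>n\<in>E. M n powr p * \<sigma> n)"
      unfolding sum_distrib_left using ab M p sp
      by (intro sum_mono mult_right_mono powr_mono2) (auto simp: a_def S_def intro: less_imp_le)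
    have Y: "b powr q * (\<Sum>n\<in>E. w n) \<le> (\<Sum>n\<in>E. N n powr q * w n)"
      unfolding sum_distrib_left using ab N q pos
      by (intro sum_mono mult_right_mono powr_mono2) (auto simp: b_def W_def intro: less_imp_le)
    have X0: "0 \<le> (\<Sum>n\<in>E. M n powr p * \<sigma> n)" and Y0: "0 \<le> (\<Sum>n\<in>E. N n powr q * w n)"
      by (intro sum_nonneg mult_nonneg_nonneg powr_ge_zero less_imp_le[OF sp] less_imp_le[OF pos])+
    note cmp = Ap_comparison[OF p pos \<sigma> J \<kappa> Ap, folded W_def S_def]
    have "a powr p * S \<le> a powr p * (?c1 * (\<Sum>n\<in>E. \<sigma> n))" by (intro mult_left_mono cmp(2)) auto
    also have "\<dots> = ?c1 * (a powr p * (\<Sum>n\<in>E. \<sigma> n))" by simp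
    also have "\<dots> \<le> ?c1 * (\<Sum>n\<in>E. M n powr p * \<sigma> n)" using cc X by (intro mult_left_mono) auto
    finally have 1: "a powr p * S \<le> ?c1 * (\<Sum>n\<in>E. M n powr p * \<sigma> n)" .
    have "b powr q * W \<le> b powr q * (?c2 * (\<Sum>n\<in>E. w n))" by (intro mult_left_mono cmp(1)) auto
    also have "\<dots> = ?c2 * (b powr q * (\<Sum>n\<in>E. w n))" by simp
    also have "\<dots> \<le> ?c2 * (\<Sum>n\<in>E. N n powr q * w n)" using cc Y by (intro mult_left_mono) auto
    finally have 2: "b powr q * W \<le> ?c2 * (\<Sum>n\<in>E. N n powr q * w n)" .
    have "?c1 * (\<Sum>n\<in>E. M n powr p * \<sigma> n) + ?c2 * (\<Sum>n\<in>E. N n powr q * w n) \<le>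
      (?c2 + ?c1) * ((\<Sum>n\<in>E. M n powr p * \<sigma> n) + (\<Sum>n\<in>E. N n powr q * w n))"
      using mult_nonneg_nonneg[OF cc(1) Y0] mult_nonneg_nonneg[OF cc(2) X0] by (simp add: algebra_simps)
    with 1 2 show "a powr p * S + b powr q * W \<le> (?c2 + ?c1) * (\<Sum>n\<in>E. M n powr p * \<sigma> n + N n powr q * w n)"
      by (simp add: sum.distrib)
  qed simp
  finally show ?thesis by (simp add: q_def mult.assoc)
qed

section \<open>Maximal operators of families of Calderon--Zygmund kernels\<close>

text \<open>A family of kernels with common size and smoothness constants. The supremum over the
  family is treated as one Calderon--Zygmund operator with values in bounded functions on
  \<open>I\<close>; linearity in \<open>f\<close> is used for each member separately, and all
  constants are those of the family. The size condition asks only for boundedness: cancellation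
  enters through the \<open>\<ell>\<^sup>2\<close> bound assumed below.\<close>

locale cz_family =
  fixes K :: "'i \<Rightarrow> int \<Rightarrow> real" and I :: "'i set" and C :: real
  assumes ne: "I \<noteq> {}"
    and bound: "i \<in> I \<Longrightarrow> \<bar>K i k\<bar> \<le> C"
    and smooth: "i \<in> I \<Longrightarrow> k \<noteq> 0 \<Longrightarrow> \<bar>K i k - K i (k - 1)\<bar> \<le> C / (real_of_int k)\<^sup>2"
begin

text \<open>Only finitely supported input is considered, so that all sums are finite. The supremum
  is finite because the kernels are uniformly bounded.\<close>

definition family_max :: "int set \<Rightarrow> (int \<Rightarrow> complex) \<Rightarrow> int \<Rightarrow> real" where
  "family_max S f n = (SUP i\<in>I. cmod (\<Sum>m\<in>S. of_real (K i (n - m)) * f m))"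

lemma C_nonneg: "0 \<le> C"
  using ne bound[of _ 0] abs_ge_zero order_trans by blast

lemma family_max_bdd: "bdd_above ((\<lambda>i. cmod (\<Sum>m\<in>S. of_real (K i (n - m)) * f m)) ` I)"
proof (rule bdd_aboveI2)
  fix i assume i: "i \<in> I"
  have "cmod (\<Sum>m\<in>S. of_real (K i (n - m)) * f m) \<le> (\<Sum>m\<in>S. cmod (of_real (K i (n - m)) * f m))"
    by (rule norm_sum)
  also have "\<dots> \<le> (\<Sum>m\<in>S. C * cmod (f m))"
    by (intro sum_mono) (auto simp: norm_mult intro!: mult_right_mono bound i)
  finally show "cmod (\<Sum>m\<in>S. of_real (K i (n - m)) * f m) \<le> (\<Sum>m\<in>S. C * cmod (f m))" .
qed

lemma family_max_upper: "i \<in> I \<Longrightarrow> cmod (\<Sum>m\<in>S. of_real (K i (n - m)) * f m) \<le> family_max S f n"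
  unfolding family_max_def by (rule cSUP_upper[OF _ family_max_bdd])

lemma family_max_least: "(\<And>i. i \<in> I \<Longrightarrow> cmod (\<Sum>m\<in>S. of_real (K i (n - m)) * f m) \<le> B) \<Longrightarrow> family_max S f n \<le> B"
  unfolding family_max_def by (rule cSUP_least[OF ne])

lemma family_max_nonneg: "0 \<le> family_max S f n"
  using ne family_max_upper norm_ge_zero order_trans by blast

lemma family_max_restrict:
  assumes "finite S'" "S \<subseteq> S'" "\<And>m. m \<in> S \<Longrightarrow> g m = f m" "\<And>m. m \<in> S' - S \<Longrightarrow> g m = 0"
  shows "family_max S' g n = family_max S f n"
proof -
  have "(\<Sum>m\<in>S'. of_real (K i (n - m)) * g m) = (\<Sum>m\<in>S. of_real (K i (n - m)) * f m)" for i
    using assms by (intro sum.mono_neutral_cong_right) auto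
  then show ?thesis by (simp add: family_max_def)
qed

lemma family_max_scale: "0 < c \<Longrightarrow> c * family_max S f n \<le> family_max S (\<lambda>m. of_real c * f m) n"
proof -
  assume c: "0 < c"
  have "family_max S f n \<le> family_max S (\<lambda>m. of_real c * f m) n / c"
  proof (rule family_max_least)
    fix i assume "i \<in> I"
    then have "cmod (\<Sum>m\<in>S. of_real (K i (n - m)) * (of_real c * f m)) \<le> family_max S (\<lambda>m. of_real c * f m) n"
      by (rule family_max_upper)
    also have "(\<Sum>m\<in>S. of_real (K i (n - m)) * (of_real c * f m)) = of_real c * (\<Sum>m\<in>S. of_real (K i (n - m)) * f m)"
      by (simp add: sum_distrib_left algebra_simps)
    finally show "cmod (\<Sum>m\<in>S. of_real (K i (n - m)) * f m) \<le> family_max S (\<lambda>m. of_real c * f m) n / c"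
      using c by (simp add: norm_mult field_simps)
  qed
  with c show ?thesis by (simp add: field_simps)
qed

lemma kernel_lipschitz:
  assumes i: "i \<in> I" and uv: "v \<le> u" and d: "0 < d"
    and far: "\<And>j. v < j \<Longrightarrow> j \<le> u \<Longrightarrow> d \<le> \<bar>real_of_int j\<bar>"
  shows "\<bar>K i u - K i v\<bar> \<le> C * (u - v) / d\<^sup>2"
  using uv far
proof (induction u rule: int_ge_induct)
  case base then show ?case by simp
next
  case (step u)
  have *: "d \<le> \<bar>real_of_int (u + 1)\<bar>" using step.prems[of "u+1"] step.hyps by simp
  then have nz: "u + 1 \<noteq> 0" using d by auto
  have "\<bar>K i (u + 1) - K i u\<bar> \<le> C / (real_of_int (u + 1))\<^sup>2" using smooth[OF i nz] by simp
  also have "\<dots> \<le> C / d\<^sup>2"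
  proof (rule divide_left_mono)
    show "d\<^sup>2 \<le> (real_of_int (u + 1))\<^sup>2" using * d by (simp add: abs_le_square_iff[symmetric])
    show "0 < (real_of_int (u + 1))\<^sup>2 * d\<^sup>2" using nz d by simp
  qed (rule C_nonneg)
  finally have "\<bar>K i (u + 1) - K i u\<bar> \<le> C / d\<^sup>2" .
  moreover have "\<bar>K i u - K i v\<bar> \<le> C * (u - v) / d\<^sup>2" using step.IH step.prems by simp
  moreover have "C * real_of_int (u + 1 - v) / d\<^sup>2 = C * real_of_int (u - v) / d\<^sup>2 + C / d\<^sup>2"
    by (simp add: add_divide_distrib[symmetric] algebra_simps)
  ultimately show ?case by linarith
qed

text \<open>If both arguments are on the same side of the origin and farther away than their
  distance, the whole segment between them stays at a distance comparable to \<open>l +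
  \<bar>v\<bar>\<close>.\<close>

lemma kernel_osc:
  assumes i: "i \<in> I" and l: "1 \<le> l" "\<bar>u - v\<bar> \<le> l" and far: "(l \<le> u \<and> l \<le> v) \<or> (u \<le> - l \<and> v \<le> - l)"
  shows "\<bar>K i u - K i v\<bar> \<le> 9 * C * l / (real_of_int l + \<bar>real_of_int v\<bar>)\<^sup>2"
proof -
  \<comment> \<open>Every integer between \<open>u\<close> and \<open>v\<close> has absolute value
    at least \<open>l\<close> and at least \<open>\<bar>v\<bar> - l\<close>, hence at least a third
    of \<open>l + \<bar>v\<bar>\<close>.\<close>
  define d where "d = (real_of_int l + \<bar>real_of_int v\<bar>) / 3"
  have d: "0 < d" using l by (simp add: d_def)
  have f: "d \<le> \<bar>real_of_int j\<bar>" if "min u v \<le> j" "j \<le> max u v" for j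
  proof -
    have "real_of_int l + \<bar>real_of_int v\<bar> \<le> 3 * \<bar>real_of_int j\<bar>"
      using that far l by (simp only: of_int_abs[symmetric] of_int_add[symmetric]) linarith
    then show ?thesis by (simp add: d_def)
  qed
  have "\<bar>K i u - K i v\<bar> \<le> C * \<bar>u - v\<bar> / d\<^sup>2"
  proof (cases "v \<le> u")
    case True
    then show ?thesis using kernel_lipschitz[OF i True d] f by simp
  next
    case False
    then have "u \<le> v" by simp
    from kernel_lipschitz[OF i this d] f show ?thesis using False by (simp add: abs_minus_commute)
  qed
  also have "\<dots> \<le> C * real_of_int l / d\<^sup>2"
    using l C_nonneg by (intro divide_right_mono mult_left_mono) auto
  also have "\<dots> = 9 * C * l / (real_of_int l + \<bar>real_of_int v\<bar>)\<^sup>2"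
    by (simp add: d_def power_divide)
  finally show ?thesis .
qed

text \<open>The part of the operator that sees only the values of \<open>f\<close> far from
  \<open>P\<close> varies little on \<open>P\<close>: the kernel difference is a radially decreasing
  majorant at scale \<open>\<bar>P\<bar>\<close>, so the maximal function at any point of
  \<open>P\<close> controls the variation.\<close>

lemma oscillation_le_max:
  assumes i: "i \<in> I" and x: "x \<in> ival P" "x' \<in> ival P" and sub: "triple P \<subseteq> {l..u}"
  shows "cmod ((\<Sum>m\<in>{l..u} - triple P. of_real (K i (x - m)) * f m) - (\<Sum>m\<in>{l..u} - triple P. of_real (K i (x' - m)) * f m))
     \<le> 54 * C * interval_max (\<lambda>_. 1) (\<lambda>m. cmod (f m)) l u x'"
proof -
  define L :: int where "L = 2 ^ snd P"
  have L: "1 \<le> L" by (simp add: L_def)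
  have x'lu: "l \<le> x'" "x' \<le> u" using sub x ival_subset_triple[of P] by auto
  have "cmod ((\<Sum>m\<in>{l..u} - triple P. of_real (K i (x - m)) * f m) - (\<Sum>m\<in>{l..u} - triple P. of_real (K i (x' - m)) * f m))
     = cmod (\<Sum>m\<in>{l..u} - triple P. of_real (K i (x - m) - K i (x' - m)) * f m)"
    by (simp add: sum_subtractf[symmetric] algebra_simps)
  also have "\<dots> \<le> (\<Sum>m\<in>{l..u} - triple P. \<bar>K i (x - m) - K i (x' - m)\<bar> * cmod (f m))"
    by (rule order_trans[OF norm_sum]) (simp add: norm_mult del: of_real_diff)
  also have "\<dots> \<le> (\<Sum>m\<in>{l..u} - triple P. 9 * C * L / (real_of_int L + \<bar>real_of_int (x' - m)\<bar>)\<^sup>2 * cmod (f m))"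
  proof (intro sum_mono mult_right_mono kernel_osc i L)
    fix m assume "m \<in> {l..u} - triple P"
    then show "\<bar>x - m - (x' - m)\<bar> \<le> L" "(L \<le> x - m \<and> L \<le> x' - m) \<or> (x - m \<le> - L \<and> x' - m \<le> - L)"
      using x by (auto simp: ival_def triple_def L_def)
  qed auto
  also have "\<dots> \<le> (\<Sum>m=l..u. 9 * C * L / (real_of_int L + \<bar>real_of_int (x' - m)\<bar>)\<^sup>2 * cmod (f m))"
    using C_nonneg L by (intro sum_mono2) auto
  also have "\<dots> = 9 * C * L * (\<Sum>m=l..u. cmod (f m) / (real_of_int L + real_of_int \<bar>x' - m\<bar>)\<^sup>2)"
    by (simp add: sum_distrib_left)
  also have "\<dots> \<le> 9 * C * L * (6 * interval_max (\<lambda>_. 1) (\<lambda>m. cmod (f m)) l u x' / real_of_int L)"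
    using C_nonneg L x'lu by (intro mult_left_mono radial_le_interval_max) auto
  also have "\<dots> = 54 * C * interval_max (\<lambda>_. 1) (\<lambda>m. cmod (f m)) l u x'" using L by simp
  finally show ?thesis .
qed

text \<open>The Calderon--Zygmund decomposition at height \<open>c\<close>, with respect to plain
  length, while the level sets are measured by \<open>w\<close>. The \<open>A_1\<close> condition
  bounds averages of \<open>w\<close> by each of its values; it is used to pass from
  \<open>w\<close> on an interval (the tripled stopping interval, the interval carrying an average
  of \<open>f\<close>, or a large centred interval in the tail estimate) to \<open>\<Sum>
  \<bar>f\<bar> w\<close> over the stopping interval. With \<open>w = 1\<close> this is the
  classical weak type bound.\<close>

theorem weak_type_A1:
  fixes w :: "int \<Rightarrow> real"
  assumes pos: "\<And>n. w n > 0"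
    and A1: "\<And>a b n. a \<le> n \<Longrightarrow> n \<le> b \<Longrightarrow> (\<Sum>i=a..b. w i) \<le> D * real_of_int (b - a + 1) * w n"
    and l2: "\<And>S A f. finite S \<Longrightarrow> finite A \<Longrightarrow> (\<Sum>n\<in>A. (family_max S f n)\<^sup>2 * w n) \<le> B * (\<Sum>m\<in>S. (cmod (f m))\<^sup>2 * w m)"
  shows "\<exists>B1\<ge>0. \<forall>S A f c. finite S \<longrightarrow> finite A \<longrightarrow> 0 < c \<longrightarrow>
     c * (\<Sum>n\<in>{n\<in>A. c < family_max S f n}. w n) \<le> B1 * (\<Sum>m\<in>S. cmod (f m) * w m)"
proof -
  have D1: "1 \<le> D" using A1[of 0 0 0] pos[of 0] by simp
  have B0: "0 \<le> B"
  proof -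
    have "0 \<le> (\<Sum>n\<in>{0}. (family_max {0} (\<lambda>_. 1) n)\<^sup>2 * w n)" using pos by (intro sum_nonneg) (simp add: less_imp_le)
    also have "\<dots> \<le> B * (\<Sum>m\<in>{0}. (cmod 1)\<^sup>2 * w m)" by (rule l2) auto
    finally show ?thesis using pos[of 0] by (simp add: zero_le_mult_iff)
  qed
  define B1 where "B1 = 3 * D + 8 * B * (1 + D) + 108 * C * D * (1 + D)"
  have "c * (\<Sum>n\<in>{n\<in>A. c < family_max S f n}. w n) \<le> B1 * (\<Sum>m\<in>S. cmod (f m) * w m)"
    if fin: "finite S" "finite A" and c: "0 < c" for S A f c
  proof -
    define f0 where "f0 = (\<lambda>n. if n \<in> S then f n else 0)"
    define N where "N = (\<Sum>m\<in>S. cmod (f m))"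
    define R where "R = Max (insert 0 (abs ` S))"
    have R: "\<bar>m\<bar> \<le> R" if "m \<in> S" for m using that fin by (simp add: R_def)
    have R0: "0 \<le> R" using fin by (simp add: R_def)
    \<comment> \<open>An interval so long that it contains the support and that the average of
      \<open>\<bar>f\<bar>\<close> over it is at most \<open>c\<close>; halving starts from there.\<close>
    define k where "k = nat \<lceil>max (2 * R + 1) (N / c)\<rceil>"
    have kk: "real k < 2 ^ k" by (rule of_nat_less_two_power)
    have k1: "2 * R + 1 \<le> 2 ^ k"
    proof -
      have "real_of_int (2 * R + 1) \<le> real k" using R0 unfolding k_def by (simp add: le_max_iff_disj) linarith
      also have "\<dots> \<le> 2 ^ k" using kk by linarith
      finally have "real_of_int (2 * R + 1) \<le> real_of_int (2 ^ k)" by simp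
      then show ?thesis by (simp only: of_int_le_iff)
    qed
    have k2: "N \<le> c * 2 ^ k"
    proof -
      have "N / c \<le> real k" unfolding k_def by linarith
      then have "N / c \<le> 2 ^ k" using kk by linarith
      then show ?thesis using c by (simp add: field_simps)
    qed
    define Q where "Q = ival (- R, k)"
    have SQ: "S \<subseteq> Q"
    proof
      fix m assume "m \<in> S"
      from R[OF this] k1 show "m \<in> Q" by (auto simp: Q_def ival_def)
    qed
    have fQ: "finite Q" by (simp add: Q_def)
    have sumf0: "(\<Sum>n\<in>Q. h n (f0 n)) = (\<Sum>n\<in>S. h n (f n))" if "\<And>n. h n 0 = 0" for h :: "int \<Rightarrow> complex \<Rightarrow> real"
      using SQ fQ that by (intro sum.mono_neutral_cong_right) (auto simp: f0_def)
    have "(\<Sum>n\<in>ival (- R, k). cmod (f0 n)) \<le> c * 2 ^ k"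
      using sumf0[of "\<lambda>n z. cmod z"] k2 by (simp add: Q_def[symmetric] N_def)
    then obtain F where F: "stopping_family (\<lambda>n. cmod (f0 n)) c Q k F"
      unfolding Q_def using stopping_intervals[of "\<lambda>n. cmod (f0 n)" "-R" k c] by auto
    have fF: "finite F" and dF: "disjoint_family_on ival F"
      and FQ: "\<And>P. P \<in> F \<Longrightarrow> ival P \<subseteq> Q"
      and Flo: "\<And>P. P \<in> F \<Longrightarrow> c * 2 ^ snd P < (\<Sum>n\<in>ival P. cmod (f0 n))"
      and Fhi: "\<And>P. P \<in> F \<Longrightarrow> (\<Sum>n\<in>ival P. cmod (f0 n)) \<le> 2 * c * 2 ^ snd P"
      and Foff: "\<And>n. n \<in> Q \<Longrightarrow> n \<notin> (\<Union>P\<in>F. ival P) \<Longrightarrow> cmod (f0 n) \<le> c"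
      using F by (auto simp: stopping_family_def)
    define X where "X = (\<Sum>m\<in>Q. cmod (f0 m) * w m)"
    have X: "X = (\<Sum>m\<in>S. cmod (f m) * w m)" unfolding X_def by (rule sumf0) simp
    have w0: "0 \<le> w n" for n using pos[of n] by simp
    define U where "U = (\<Union>P\<in>F. ival P)"
    define XP where "XP = (\<lambda>P. \<Sum>m\<in>ival P. cmod (f0 m) * w m)"
    have UQ: "U \<subseteq> Q" using FQ by (auto simp: U_def)
    have sumU: "(\<Sum>n\<in>U. h n) = (\<Sum>P\<in>F. \<Sum>n\<in>ival P. h n)" for h :: "int \<Rightarrow> real"
      unfolding U_def using dF fF by (intro sum.UNION_disjoint) (auto simp: disjoint_family_on_def)
    have XPX: "(\<Sum>P\<in>F. XP P) \<le> X"
      unfolding XP_def sumU[symmetric] X_def using UQ fQ w0 by (intro sum_mono2) auto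
    define av where "av = (\<lambda>P. (\<Sum>n\<in>ival P. f0 n) / 2 ^ snd P)"
    have avn: "cmod (av P) \<le> (\<Sum>n\<in>ival P. cmod (f0 n)) / 2 ^ snd P" for P
      unfolding av_def by (simp add: norm_divide norm_power divide_right_mono norm_sum)
    have wP: "(\<Sum>n\<in>ival P. w n) \<le> D * 2 ^ snd P * w m" if "m \<in> ival P" for P m
    proof -
      have "ival P = {fst P..fst P + 2 ^ snd P - 1}" by (auto simp: ival_def)
      with A1[of "fst P" m "fst P + 2 ^ snd P - 1"] that show ?thesis by simp
    qed
    have wP3: "(\<Sum>n\<in>triple P. w n) \<le> D * (3 * 2 ^ snd P) * w m" if "m \<in> ival P" for P m
    proof -
      have "triple P = {fst P - 2 ^ snd P..fst P + 2 * 2 ^ snd P - 1}" by (auto simp: triple_def)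
      moreover have "m \<in> triple P" using that ival_subset_triple by blast
      ultimately show ?thesis
        using A1[of "fst P - 2 ^ snd P" m "fst P + 2 * 2 ^ snd P - 1"] by simp
    qed
    have avw: "cmod (av P) * (\<Sum>n\<in>ival P. w n) \<le> D * XP P" for P
    proof -
      have "cmod (av P) * (\<Sum>n\<in>ival P. w n) \<le> (\<Sum>n\<in>ival P. cmod (f0 n)) / 2 ^ snd P * (\<Sum>n\<in>ival P. w n)"
        using w0 by (intro mult_right_mono avn sum_nonneg) auto
      also have "\<dots> = (\<Sum>m\<in>ival P. cmod (f0 m) / 2 ^ snd P * (\<Sum>n\<in>ival P. w n))"
        by (simp add: sum_divide_distrib sum_distrib_right)
      also have "\<dots> \<le> (\<Sum>m\<in>ival P. cmod (f0 m) / 2 ^ snd P * (D * 2 ^ snd P * w m))"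
        by (intro sum_mono mult_left_mono wP) auto
      also have "\<dots> = D * XP P" by (simp add: XP_def sum_distrib_left algebra_simps)
      finally show ?thesis .
    qed
    \<comment> \<open>The bad parts have mean zero on their stopping intervals; the good part
      \<open>g\<close>, which equals the averages \<open>av\<close> on the stopping intervals and
      \<open>f\<close> elsewhere, is bounded by \<open>2 c\<close>.\<close>
    define bad where "bad = (\<lambda>P n. if n \<in> ival P then f0 n - av P else 0)"
    have badsum: "(\<Sum>m\<in>ival P. cmod (bad P m) * w m) \<le> (1 + D) * XP P" for P
    proof -
      have "(\<Sum>m\<in>ival P. cmod (bad P m) * w m) \<le> (\<Sum>m\<in>ival P. (cmod (f0 m) + cmod (av P)) * w m)"
        by (intro sum_mono mult_right_mono w0) (auto simp: bad_def norm_triangle_ineq4)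
      also have "\<dots> = XP P + cmod (av P) * (\<Sum>n\<in>ival P. w n)"
        by (simp add: XP_def distrib_right sum.distrib sum_distrib_left)
      also have "\<dots> \<le> (1 + D) * XP P" using avw[of P] by (simp add: distrib_right)
      finally show ?thesis .
    qed
    define g where "g = (\<lambda>n. f0 n - (\<Sum>P\<in>F. bad P n))"
    have g_on: "g n = av P" if "P \<in> F" "n \<in> ival P" for P n
    proof -
      have "bad P' n = 0" if "P' \<in> F - {P}" for P'
        using dF that \<open>P \<in> F\<close> \<open>n \<in> ival P\<close> by (auto simp: disjoint_family_on_def bad_def)
      then have "(\<Sum>P\<in>F. bad P n) = bad P n" using fF \<open>P \<in> F\<close> by (simp add: sum.remove)
      then show ?thesis using that by (simp add: g_def bad_def)
    qed
    have g_off: "g n = f0 n" if "n \<notin> U" for n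
    proof -
      have "(\<Sum>P\<in>F. bad P n) = 0" using that by (intro sum.neutral) (auto simp: U_def bad_def)
      then show ?thesis by (simp add: g_def)
    qed
    have g_le: "cmod (g n) \<le> 2 * c" if "n \<in> Q" for n
    proof (cases "n \<in> U")
      case True
      then obtain P where P: "P \<in> F" "n \<in> ival P" by (auto simp: U_def)
      have "cmod (g n) \<le> (\<Sum>n\<in>ival P. cmod (f0 n)) / 2 ^ snd P" using g_on[OF P] avn by simp
      also have "\<dots> \<le> 2 * c" using Fhi[OF P(1)] by (simp add: divide_le_eq)
      finally show ?thesis .
    next
      case False
      then show ?thesis using Foff[OF that] g_off c by (auto simp: U_def)
    qed
    have g_w: "(\<Sum>n\<in>Q. cmod (g n) * w n) \<le> (1 + D) * X"
    proof -
      have "(\<Sum>n\<in>Q. cmod (g n) * w n) = (\<Sum>n\<in>Q - U. cmod (g n) * w n) + (\<Sum>n\<in>U. cmod (g n) * w n)"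
        using UQ fQ by (rule sum.subset_diff)
      also have "(\<Sum>n\<in>Q - U. cmod (g n) * w n) = (\<Sum>n\<in>Q - U. cmod (f0 n) * w n)"
        by (intro sum.cong) (auto simp: g_off)
      also have "\<dots> \<le> X" unfolding X_def using fQ w0 by (intro sum_mono2) auto
      also have "(\<Sum>n\<in>U. cmod (g n) * w n) = (\<Sum>P\<in>F. cmod (av P) * (\<Sum>n\<in>ival P. w n))"
        unfolding sumU by (intro sum.cong refl) (simp add: g_on sum_distrib_left)
      also have "\<dots> \<le> (\<Sum>P\<in>F. D * XP P)" by (intro sum_mono avw)
      also have "\<dots> \<le> D * X" using XPX D1 by (simp add: sum_distrib_left[symmetric])
      finally show ?thesis by (simp add: distrib_right)
    qed
    \<comment> \<open>A bound, uniform in the family, for the contribution of one bad part off the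
      tripled interval.\<close>
    define \<beta> where "\<beta> = (\<lambda>P x. \<Sum>m\<in>ival P. 9 * C * 2 ^ snd P / (2 ^ snd P + \<bar>real_of_int (x - fst P)\<bar>)\<^sup>2 * cmod (bad P m))"
    have \<beta>0: "0 \<le> \<beta> P x" for P x unfolding \<beta>_def using C_nonneg by (intro sum_nonneg) auto
    define U3 where "U3 = (\<Union>P\<in>F. triple P)"
    have fU3: "finite U3" using fF by (simp add: U3_def)
    \<comment> \<open>Off the tripled intervals, the mean value zero of \<open>bad P\<close> allows
      the kernel to be replaced by its difference with its value at the left endpoint of
      \<open>P\<close>.\<close>
    have TTf: "family_max S f x \<le> family_max Q g x + (\<Sum>P\<in>F. \<beta> P x)" if x: "x \<notin> U3" for x
    proof -
      have "family_max S f x = family_max Q f0 x"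
        by (rule family_max_restrict[symmetric]) (use fQ SQ in \<open>auto simp: f0_def\<close>)
      also have "family_max Q f0 x \<le> family_max Q g x + (\<Sum>P\<in>F. \<beta> P x)"
      proof (rule family_max_least)
        fix i assume i: "i \<in> I"
        have b: "cmod (\<Sum>m\<in>Q. of_real (K i (x - m)) * bad P m) \<le> \<beta> P x" if P: "P \<in> F" for P
        proof -
          have mean0: "(\<Sum>m\<in>ival P. bad P m) = 0"
            by (simp add: bad_def sum_subtractf av_def)
          have "(\<Sum>m\<in>Q. of_real (K i (x - m)) * bad P m) = (\<Sum>m\<in>ival P. of_real (K i (x - m)) * bad P m)"
            using FQ[OF P] fQ by (intro sum.mono_neutral_right) (auto simp: bad_def)
          also have "\<dots> = (\<Sum>m\<in>ival P. of_real (K i (x - m) - K i (x - fst P)) * bad P m)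
              + of_real (K i (x - fst P)) * (\<Sum>m\<in>ival P. bad P m)"
            unfolding sum_distrib_left sum.distrib[symmetric] by (rule sum.cong[OF refl]) (simp add: algebra_simps)
          also have "\<dots> = (\<Sum>m\<in>ival P. of_real (K i (x - m) - K i (x - fst P)) * bad P m)" using mean0 by simp
          also have "cmod \<dots> \<le> (\<Sum>m\<in>ival P. \<bar>K i (x - m) - K i (x - fst P)\<bar> * cmod (bad P m))"
            by (rule order_trans[OF norm_sum]) (simp add: norm_mult del: of_real_diff)
          also have "\<dots> \<le> \<beta> P x" unfolding \<beta>_def
          proof (intro sum_mono mult_right_mono)
            fix m assume m: "m \<in> ival P"
            have "x \<notin> triple P" using x P by (auto simp: U3_def)
            then have far: "(2 ^ snd P \<le> x - m \<and> 2 ^ snd P \<le> x - fst P) \<or> (x - m \<le> - (2 ^ snd P) \<and> x - fst P \<le> - (2 ^ snd P))"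
              using m by (auto simp: ival_def triple_def)
            have near: "\<bar>x - m - (x - fst P)\<bar> \<le> 2 ^ snd P" using m by (auto simp: ival_def)
            show "\<bar>K i (x - m) - K i (x - fst P)\<bar> \<le> 9 * C * 2 ^ snd P / (2 ^ snd P + \<bar>real_of_int (x - fst P)\<bar>)\<^sup>2"
              using kernel_osc[OF i _ near far] by simp
          qed auto
          finally show ?thesis .
        qed
        have "(\<Sum>m\<in>Q. of_real (K i (x - m)) * f0 m) = (\<Sum>m\<in>Q. of_real (K i (x - m)) * g m)
            + (\<Sum>m\<in>Q. \<Sum>P\<in>F. of_real (K i (x - m)) * bad P m)"
          unfolding sum.distrib[symmetric] by (rule sum.cong[OF refl]) (simp add: g_def right_diff_distrib sum_distrib_left)
        also have "(\<Sum>m\<in>Q. \<Sum>P\<in>F. of_real (K i (x - m)) * bad P m) = (\<Sum>P\<in>F. \<Sum>m\<in>Q. of_real (K i (x - m)) * bad P m)"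
          by (rule sum.swap)
        finally have "cmod (\<Sum>m\<in>Q. of_real (K i (x - m)) * f0 m) \<le> cmod (\<Sum>m\<in>Q. of_real (K i (x - m)) * g m)
            + cmod (\<Sum>P\<in>F. \<Sum>m\<in>Q. of_real (K i (x - m)) * bad P m)"
          by (simp add: norm_triangle_ineq)
        also have "cmod (\<Sum>P\<in>F. \<Sum>m\<in>Q. of_real (K i (x - m)) * bad P m) \<le> (\<Sum>P\<in>F. \<beta> P x)"
          by (rule order_trans[OF norm_sum]) (intro sum_mono b)
        also have "cmod (\<Sum>m\<in>Q. of_real (K i (x - m)) * g m) \<le> family_max Q g x" by (rule family_max_upper[OF i])
        finally show "cmod (\<Sum>m\<in>Q. of_real (K i (x - m)) * f0 m) \<le> family_max Q g x + (\<Sum>P\<in>F. \<beta> P x)" by simp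
      qed
      finally show ?thesis .
    qed
    \<comment> \<open>The tripled intervals: \<open>c\<close> is below the average of \<open>\<bar>f\<bar>\<close> over each stopping interval.\<close>
    have p1: "c * (\<Sum>n\<in>U3. w n) \<le> 3 * D * X"
    proof -
      have "(\<Sum>n\<in>U3. w n) \<le> (\<Sum>P\<in>F. \<Sum>n\<in>triple P. w n)"
        unfolding U3_def by (rule sum_UN_le) (use fF w0 in auto)
      then have "c * (\<Sum>n\<in>U3. w n) \<le> (\<Sum>P\<in>F. c * (\<Sum>n\<in>triple P. w n))"
        using c by (simp add: sum_distrib_left[symmetric])
      also have "\<dots> \<le> (\<Sum>P\<in>F. 3 * D * XP P)"
      proof (rule sum_mono)
        fix P assume P: "P \<in> F"
        have "c * (\<Sum>n\<in>triple P. w n) \<le> (\<Sum>n\<in>ival P. cmod (f0 n)) / 2 ^ snd P * (\<Sum>n\<in>triple P. w n)"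
          using Flo[OF P] w0 by (intro mult_right_mono sum_nonneg) (auto simp: field_simps)
        also have "\<dots> = (\<Sum>m\<in>ival P. cmod (f0 m) / 2 ^ snd P * (\<Sum>n\<in>triple P. w n))"
          by (simp add: sum_divide_distrib sum_distrib_right)
        also have "\<dots> \<le> (\<Sum>m\<in>ival P. cmod (f0 m) / 2 ^ snd P * (D * (3 * 2 ^ snd P) * w m))"
          by (intro sum_mono mult_left_mono wP3) auto
        also have "\<dots> = 3 * D * XP P" by (simp add: XP_def sum_distrib_left algebra_simps)
        finally show "c * (\<Sum>n\<in>triple P. w n) \<le> 3 * D * XP P" .
      qed
      also have "\<dots> \<le> 3 * D * X" using XPX D1 by (simp add: sum_distrib_left[symmetric])
      finally show ?thesis .
    qed
    \<comment> \<open>The good part: Chebyshev's inequality in \<open>\<ell>\<^sup>2(w)\<close> and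
      \<open>\<bar>g\<bar>\<^sup>2 \<le> 2 c \<bar>g\<bar>\<close>.\<close>
    have p2: "c * (\<Sum>n\<in>{n\<in>A. c / 2 < family_max Q g n}. w n) \<le> 8 * B * (1 + D) * X"
    proof -
      have "(c/2)\<^sup>2 * (\<Sum>n\<in>{n\<in>A. c / 2 < family_max Q g n}. w n) \<le> (c/2)\<^sup>2 * (\<Sum>n\<in>{n\<in>A. (c / 2)\<^sup>2 < (family_max Q g n)\<^sup>2}. w n)"
        using fin c w0 by (intro mult_left_mono sum_mono2) (auto intro!: power_strict_mono)
      also have "\<dots> \<le> (\<Sum>n\<in>A. (family_max Q g n)\<^sup>2 * w n)" by (rule markov_sum) (use fin w0 in auto)
      also have "\<dots> \<le> B * (\<Sum>m\<in>Q. (cmod (g m))\<^sup>2 * w m)" by (rule l2) (use fin fQ in auto)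
      also have "\<dots> \<le> B * (\<Sum>m\<in>Q. 2 * c * (cmod (g m) * w m))"
      proof (intro mult_left_mono sum_mono B0)
        fix m assume "m \<in> Q"
        then show "(cmod (g m))\<^sup>2 * w m \<le> 2 * c * (cmod (g m) * w m)"
          using mult_right_mono[OF g_le[of m], of "cmod (g m) * w m"] w0[of m] by (simp add: power2_eq_square mult.assoc)
      qed
      also have "\<dots> = 2 * c * (B * (\<Sum>m\<in>Q. cmod (g m) * w m))" by (simp add: sum_distrib_left algebra_simps)
      also have "\<dots> \<le> 2 * c * (B * ((1 + D) * X))" using c B0 by (intro mult_left_mono g_w) auto
      finally have "c * (c * (\<Sum>n\<in>{n\<in>A. c / 2 < family_max Q g n}. w n)) \<le> c * (8 * B * (1 + D) * X)"
        by (simp add: power2_eq_square algebra_simps)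
      then show ?thesis using c by (rule mult_left_le_imp_le)
    qed
    \<comment> \<open>The bad parts: Chebyshev's inequality in \<open>\<ell>\<^sup>1(w)\<close> and
      summation of the kernel majorant against \<open>w\<close>.\<close>
    have p3: "c * (\<Sum>n\<in>{n\<in>A. c / 2 < (\<Sum>P\<in>F. \<beta> P n)}. w n) \<le> 108 * C * D * (1 + D) * X"
    proof -
      have "c / 2 * (\<Sum>n\<in>{n\<in>A. c / 2 < (\<Sum>P\<in>F. \<beta> P n)}. w n) \<le> (\<Sum>n\<in>A. (\<Sum>P\<in>F. \<beta> P n) * w n)"
        by (rule markov_sum) (use fin c w0 \<beta>0 in \<open>auto intro: sum_nonneg\<close>)
      also have "\<dots> = (\<Sum>P\<in>F. \<Sum>n\<in>A. \<beta> P n * w n)" by (subst sum.swap) (simp add: sum_distrib_right)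
      also have "\<dots> \<le> (\<Sum>P\<in>F. 54 * C * D * ((1 + D) * XP P))"
      proof (rule sum_mono)
        fix P assume P: "P \<in> F"
        define L :: real where "L = 2 ^ snd P"
        have L: "1 \<le> L" by (simp add: L_def)
        have "(\<Sum>n\<in>A. \<beta> P n * w n) = (\<Sum>m\<in>ival P. 9 * C * L * cmod (bad P m) * (\<Sum>n\<in>A. w n / (L + real_of_int \<bar>n - fst P\<bar>)\<^sup>2))"
          unfolding \<beta>_def sum_distrib_right sum_distrib_left
          by (subst sum.swap) (simp add: L_def algebra_simps)
        also have "\<dots> \<le> (\<Sum>m\<in>ival P. 9 * C * L * cmod (bad P m) * (3 * (2 * D * w m) / L))"
        proof (intro sum_mono mult_left_mono)
          fix m assume m: "m \<in> ival P"
          define N where "N = nat (Max (insert 0 ((\<lambda>n. \<bar>n - fst P\<bar>) ` A)))"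
          have N: "\<bar>n - fst P\<bar> \<le> int N" if "n \<in> A" for n
            using that fin by (simp add: N_def le_nat_iff Max_ge_iff) 
          have "(\<Sum>n\<in>A. w n / (L + real_of_int \<bar>n - fst P\<bar>)\<^sup>2) \<le>
             (\<Sum>n=fst P - int N..fst P + int N. w n / (L + real_of_int \<bar>n - fst P\<bar>)\<^sup>2)"
            using w0 by (intro sum_mono2) (auto dest!: N)
          also have "\<dots> = (\<Sum>k=-int N..int N. w (fst P + k) / (L + real_of_int \<bar>k\<bar>)\<^sup>2)"
            by (rule sum.reindex_bij_witness[of _ "\<lambda>k. fst P + k" "\<lambda>n. n - fst P"]) auto
          also have "\<dots> \<le> 3 * (2 * D * w m) / L"
          proof (rule radial_sum_bound[OF w0 L])
            fix i :: nat
            have "(\<Sum>k=-int i..int i. w (fst P + k)) = (\<Sum>n=fst P - int i..fst P + int i. w n)"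
              by (rule sum.reindex_bij_witness[of _ "\<lambda>n. n - fst P" "\<lambda>k. fst P + k"]) auto
            also have "\<dots> \<le> (\<Sum>n=fst P - int i..fst P + 2 ^ snd P + int i. w n)"
              using w0 by (intro sum_mono2) auto
            also have "\<dots> \<le> D * real_of_int (fst P + 2 ^ snd P + int i - (fst P - int i) + 1) * w m"
              by (rule A1) (use m in \<open>auto simp: ival_def\<close>)
            also have "\<dots> \<le> D * (2 * (L + real i)) * w m"
              using D1 w0 L by (intro mult_right_mono mult_left_mono) (auto simp: L_def)
            finally show "(\<Sum>k=-int i..int i. w (fst P + k)) \<le> 2 * D * w m * (L + real i)" by (simp add: algebra_simps)
          qed
          finally show "(\<Sum>n\<in>A. w n / (L + real_of_int \<bar>n - fst P\<bar>)\<^sup>2) \<le> 3 * (2 * D * w m) / L" .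
        qed (use C_nonneg L in auto)
        also have "\<dots> = 54 * C * D * (\<Sum>m\<in>ival P. cmod (bad P m) * w m)"
          using L by (simp add: sum_distrib_left algebra_simps)
        also have "\<dots> \<le> 54 * C * D * ((1 + D) * XP P)" using C_nonneg D1 by (intro mult_left_mono badsum) auto
        finally show "(\<Sum>n\<in>A. \<beta> P n * w n) \<le> 54 * C * D * ((1 + D) * XP P)" .
      qed
      also have "\<dots> = 54 * C * D * (1 + D) * (\<Sum>P\<in>F. XP P)" by (simp add: sum_distrib_left mult.assoc)
      also have "\<dots> \<le> 54 * C * D * (1 + D) * X" using C_nonneg D1 by (intro mult_left_mono XPX) auto
      finally show ?thesis by simp
    qed
    have "{n\<in>A. c < family_max S f n} \<subseteq> U3 \<union> ({n\<in>A. c / 2 < family_max Q g n} \<union> {n\<in>A. c / 2 < (\<Sum>P\<in>F. \<beta> P n)})"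
      using TTf by force
    then have "(\<Sum>n\<in>{n\<in>A. c < family_max S f n}. w n) \<le> (\<Sum>n\<in>U3 \<union> ({n\<in>A. c / 2 < family_max Q g n} \<union> {n\<in>A. c / 2 < (\<Sum>P\<in>F. \<beta> P n)}). w n)"
      using fU3 fin w0 by (intro sum_mono2) auto
    also have "\<dots> \<le> (\<Sum>n\<in>U3. w n) + ((\<Sum>n\<in>{n\<in>A. c / 2 < family_max Q g n}. w n) + (\<Sum>n\<in>{n\<in>A. c / 2 < (\<Sum>P\<in>F. \<beta> P n)}. w n))"
    proof -
      have un: "(\<Sum>n\<in>G \<union> H. w n) \<le> (\<Sum>n\<in>G. w n) + (\<Sum>n\<in>H. w n)" if "finite G" "finite H" for G H
      proof -
        have "0 \<le> (\<Sum>n\<in>G \<inter> H. w n)" by (intro sum_nonneg w0)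
        then show ?thesis using sum.union_inter[OF that, of w] by linarith
      qed
      show ?thesis using fU3 fin by (intro order_trans[OF un] add_left_mono un) auto
    qed
    finally have "c * (\<Sum>n\<in>{n\<in>A. c < family_max S f n}. w n) \<le> c * (\<Sum>n\<in>U3. w n) + (c * (\<Sum>n\<in>{n\<in>A. c / 2 < family_max Q g n}. w n) + c * (\<Sum>n\<in>{n\<in>A. c / 2 < (\<Sum>P\<in>F. \<beta> P n)}. w n))"
      using c by (simp add: distrib_left[symmetric])
    also have "\<dots> \<le> 3 * D * X + (8 * B * (1 + D) * X + 108 * C * D * (1 + D) * X)" by (intro add_mono p1 p2 p3)
    also have "\<dots> = B1 * X" by (simp add: B1_def algebra_simps)
    finally show ?thesis by (simp add: X)
  qed
  moreover have "0 \<le> B1" using D1 B0 C_nonneg by (simp add: B1_def)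
  ultimately show ?thesis by blast
qed

end

section \<open>Domination by sparse forms and the strong type bound\<close>

lemma finite_subset_ival:
  fixes S :: "int set"
  assumes "finite S"
  obtains a k where "S \<subseteq> ival (a, k)"
proof -
  define R where "R = Max (insert 0 (abs ` S))"
  have R: "\<bar>m\<bar> \<le> R" if "m \<in> S" for m using that assms by (simp add: R_def)
  have R0: "0 \<le> R" using assms by (simp add: R_def)
  have "int (nat (2 * R + 1)) < 2 ^ nat (2 * R + 1)" using of_nat_less_two_power by blast
  then have k1: "2 * R + 1 < 2 ^ nat (2 * R + 1)" using R0 by simp
  have "S \<subseteq> ival (- R, nat (2 * R + 1))"
  proof
    fix m assume "m \<in> S"
    from R[OF this] k1 show "m \<in> ival (- R, nat (2 * R + 1))" by (auto simp: ival_def)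
  qed
  then show ?thesis by (rule that)
qed

text \<open>The weak type bound at the height \<open>N r\<close>. The point is the case \<open>N =
  0\<close>, in which the bound at every positive height forces \<open>X \<le> 0\<close>.\<close>

lemma weak_card:
  fixes X :: "int \<Rightarrow> real"
  assumes weak: "\<And>c. 0 < c \<Longrightarrow> c * real (card {n\<in>W. c < X n}) \<le> B * N"
    and fin: "finite W" and N: "0 \<le> N" and r: "0 < r" and B: "0 \<le> B"
  shows "real (card {n\<in>W. N * r < X n}) \<le> B / r"
proof (cases "N = 0")
  case True
  have "X n \<le> 0" if "n \<in> W" for n
  proof (rule ccontr)
    assume "\<not> X n \<le> 0"
    then have p: "0 < X n / 2" by simp
    have "n \<in> {n\<in>W. X n / 2 < X n}" using that p by simp
    then have "card {m\<in>W. X n / 2 < X m} > 0" using fin that p by (subst card_gt_0_iff) auto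
    then have "0 < X n / 2 * real (card {m\<in>W. X n / 2 < X m})" using p by simp
    with weak[OF p] True show False by simp
  qed
  then have "{n\<in>W. N * r < X n} = {}" using True by force
  then have "card {n\<in>W. N * r < X n} = 0" by (simp only: card.empty)
  moreover have "0 \<le> B / r" using B r by simp
  ultimately show ?thesis by (simp only: of_nat_0)
next
  case False
  then have "0 < N * r" using N r by simp
  from weak[OF this] have "N * (r * real (card {n\<in>W. N * r < X n})) \<le> N * B" by (simp add: algebra_simps)
  then have "r * real (card {n\<in>W. N * r < X n}) \<le> B" using False N by (simp add: mult_le_cancel_left)
  then show ?thesis using r by (simp add: field_simps)
qed

context cz_family
begin

text \<open>The sum over the tripled interval is divided by the length of the interval itself, so
  \<open>triple_density\<close> is three times an average.\<close>

definition triple_density :: "(int \<Rightarrow> complex) \<Rightarrow> int \<times> nat \<Rightarrow> real" where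
  "triple_density f P = (\<Sum>m\<in>triple P. cmod (f m)) / 2 ^ snd P"

lemma triple_density_nonneg: "0 \<le> triple_density f P" unfolding triple_density_def by (intro divide_nonneg_nonneg sum_nonneg) auto

definition triple_max :: "(int \<Rightarrow> complex) \<Rightarrow> int \<times> nat \<Rightarrow> int \<Rightarrow> real" where
  "triple_max f P = interval_max (\<lambda>_. 1) (\<lambda>m. cmod (f m)) (fst P - 2 ^ snd P) (fst P + 2 * 2 ^ snd P - 1)"

lemma triple_eq: "triple P = {fst P - 2 ^ snd P..fst P + 2 * 2 ^ snd P - 1}"
  by (auto simp: triple_def)

text \<open>Both functions are of weak type \<open>(1,1)\<close>, with constants \<open>B1\<close>
  and \<open>4\<close>; the factor \<open>8 (B1 + 4)\<close> makes the exceptional set fill at most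
  an eighth of \<open>P\<close>.\<close>

lemma exceptional_small:
  assumes B1: "0 \<le> B1" and weak: "\<And>S A f c. finite S \<Longrightarrow> finite A \<Longrightarrow> 0 < c \<Longrightarrow>
      c * real (card {n\<in>A. c < family_max S f n}) \<le> B1 * (\<Sum>m\<in>S. cmod (f m))"
  shows "8 * card {n\<in>ival P. 8 * (B1 + 4) * triple_density f P < family_max (triple P) f n \<or> 8 * (B1 + 4) * triple_density f P < triple_max f P n} \<le> 2 ^ snd P"
proof -
  let ?A = "8 * (B1 + 4)" and ?N = "\<Sum>m\<in>triple P. cmod (f m)"
  let ?r = "?A / 2 ^ snd P"
  have r: "0 < ?r" using B1 by simp
  have eq: "?A * triple_density f P = ?N * ?r" by (simp add: triple_density_def)
  have N0: "0 \<le> ?N" by (intro sum_nonneg) auto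
  have 1: "real (card {n\<in>ival P. ?N * ?r < family_max (triple P) f n}) \<le> B1 / ?r"
    by (rule weak_card) (use weak B1 N0 r in auto)
  have 2: "real (card {n\<in>ival P. ?N * ?r < triple_max f P n}) \<le> 4 / ?r"
  proof (rule weak_card)
    fix c :: real assume c: "0 < c"
    have "c * real (card {n\<in>ival P. c < triple_max f P n}) \<le> c * real (card {n\<in>triple P. c < triple_max f P n})"
      using ival_subset_triple[of P] c by (intro mult_left_mono of_nat_mono card_mono) auto
    also have "\<dots> \<le> 4 * ?N"
      unfolding triple_eq triple_max_def by (rule interval_max_weak) (use c in auto)
    finally show "c * real (card {n\<in>ival P. c < triple_max f P n}) \<le> 4 * ?N" .
  qed (use N0 r in auto)
  have "{n\<in>ival P. ?A * triple_density f P < family_max (triple P) f n \<or> ?A * triple_density f P < triple_max f P n}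
      = {n\<in>ival P. ?N * ?r < family_max (triple P) f n} \<union> {n\<in>ival P. ?N * ?r < triple_max f P n}"
    unfolding eq by blast
  then have "real (card {n\<in>ival P. ?A * triple_density f P < family_max (triple P) f n \<or> ?A * triple_density f P < triple_max f P n}) \<le> B1 / ?r + 4 / ?r"
    using card_Un_le[of "{n\<in>ival P. ?N * ?r < family_max (triple P) f n}" "{n\<in>ival P. ?N * ?r < triple_max f P n}"] 1 2 by simp
  also have "\<dots> = (B1 + 4) / ?r" by (simp only: add_divide_distrib)
  also have "\<dots> = 2 ^ snd P / 8"
  proof -
    have "x / (8 * x / T) = T / 8" if "0 < x" for x T :: real using that by simp
    then show ?thesis by this (use B1 in simp)
  qed
  finally have "real (8 * card {n\<in>ival P. ?A * triple_density f P < family_max (triple P) f n \<or> ?A * triple_density f P < triple_max f P n}) \<le> real (2 ^ snd P)"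
    by simp
  then show ?thesis by (simp only: of_nat_le_iff)
qed

text \<open>One step of the sparse domination. Off the exceptional set \<open>E\<close> of
  \<open>Q\<close> the operator and the maximal function are bounded by a multiple of \<open>triple_density f
  Q\<close>. The stopping time applied to the indicator function of \<open>E\<close> covers
  \<open>E\<close> by intervals that \<open>E\<close> fills between a quarter and a half. They have
  total length at most half of \<open>Q\<close>, and in each of them there is a point
  \<open>x'\<close> that is exceptional neither for \<open>Q\<close> nor for \<open>P\<close>.
  Comparing with \<open>x'\<close> by the oscillation bound, only the part of \<open>f\<close> on
  the triple of \<open>P\<close> remains to be estimated on \<open>P\<close>.\<close>

lemma sparse_step:
  assumes B1: "0 \<le> B1" and weak: "\<And>S A f c. finite S \<Longrightarrow> finite A \<Longrightarrow> 0 < c \<Longrightarrow>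
      c * real (card {n\<in>A. c < family_max S f n}) \<le> B1 * (\<Sum>m\<in>S. cmod (f m))"
  defines "B \<equiv> 8 * (B1 + 4) * (1 + 54 * C)"
  shows "\<exists>F. finite F \<and> disjoint_family_on ival F \<and> (\<forall>P\<in>F. ival P \<subseteq> ival Q \<and> snd P < snd Q)
     \<and> 2 ^ snd Q \<le> 2 * card (ival Q - (\<Union>P\<in>F. ival P))
     \<and> (\<forall>n\<in>ival Q - (\<Union>P\<in>F. ival P). family_max (triple Q) f n \<le> B * triple_density f Q)
     \<and> (\<forall>P\<in>F. \<forall>n\<in>ival P. family_max (triple Q) f n \<le> family_max (triple P) f n + B * triple_density f Q + B * triple_density f P)"
proof -
  let ?A = "8 * (B1 + 4)"
  have A0: "0 \<le> ?A" using B1 by simp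
  have AB: "?A \<le> B" using A0 C_nonneg unfolding B_def by (simp add: mult_le_cancel_left1)
  define E where "E = {n\<in>ival Q. ?A * triple_density f Q < family_max (triple Q) f n \<or> ?A * triple_density f Q < triple_max f Q n}"
  have fE: "finite E" by (simp add: E_def)
  have cE: "8 * card E \<le> 2 ^ snd Q" unfolding E_def by (rule exceptional_small[OF B1 weak])
  then have "real (8 * card E) \<le> real (2 ^ snd Q)" by (simp only: of_nat_le_iff)
  then have cE': "8 * real (card E) \<le> 2 ^ snd Q" by simp
  define e where "e = (\<lambda>n. if n \<in> E then 1 else (0::real))"
  have sume: "(\<Sum>n\<in>H. e n) = real (card (E \<inter> H))" if "finite H" for H
  proof -
    have "(\<Sum>n\<in>H. e n) = (\<Sum>n\<in>H \<inter> E. 1)" unfolding e_def using that by (rule sum.inter_restrict[symmetric])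
    then show ?thesis by (simp add: Int_commute)
  qed
  have "(\<Sum>n\<in>ival (fst Q, snd Q). e n) \<le> 1 / 4 * 2 ^ snd Q"
  proof -
    have "E \<inter> ival Q = E" by (auto simp: E_def)
    then show ?thesis using cE' by (simp add: sume)
  qed
  moreover have "\<And>n. 0 \<le> e n" by (simp add: e_def)
  ultimately obtain F where "stopping_family e (1/4) (ival Q) (snd Q) F"
    using stopping_intervals[of e "fst Q" "snd Q" "1/4"] by auto
  then have fF: "finite F" and dF: "disjoint_family_on ival F"
    and FQ: "\<And>P. P \<in> F \<Longrightarrow> ival P \<subseteq> ival Q \<and> snd P < snd Q"
    and Flo: "\<And>P. P \<in> F \<Longrightarrow> 1/4 * 2 ^ snd P < real (card (E \<inter> ival P))"
    and Fhi: "\<And>P. P \<in> F \<Longrightarrow> real (card (E \<inter> ival P)) \<le> 1/2 * 2 ^ snd P"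
    and Foff: "\<And>n. n \<in> ival Q \<Longrightarrow> n \<notin> (\<Union>P\<in>F. ival P) \<Longrightarrow> e n \<le> 1/4"
    by (auto simp: stopping_family_def sume)
  define U where "U = (\<Union>P\<in>F. ival P)"
  have UQ: "U \<subseteq> ival Q" using FQ by (auto simp: U_def)
  have fU: "finite U" using UQ finite_subset by (metis finite_ival(1))
  have cardU: "2 * card U \<le> 2 ^ snd Q"
  proof -
    have "real (card U) = (\<Sum>P\<in>F. 2 ^ snd P)"
      unfolding U_def using dF fF
      by (subst card_UN_disjoint) (auto simp: disjoint_family_on_def)
    also have "\<dots> \<le> (\<Sum>P\<in>F. 4 * real (card (E \<inter> ival P)))"
      using Flo by (intro sum_mono) (auto dest!: Flo)
    also have "\<dots> = 4 * real (\<Sum>P\<in>F. card (E \<inter> ival P))" by (simp add: sum_distrib_left)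
    also have "(\<Sum>P\<in>F. card (E \<inter> ival P)) = card (\<Union>P\<in>F. E \<inter> ival P)"
      using dF fF fE unfolding disjoint_family_on_def by (intro card_UN_disjoint[symmetric]) blast+
    also have "card (\<Union>P\<in>F. E \<inter> ival P) \<le> card E" using fE by (intro card_mono) auto
    finally have "2 * real (card U) \<le> 2 ^ snd Q" using cE' by simp
    then have "real (2 * card U) \<le> real (2 ^ snd Q)" by simp
    then show ?thesis by (simp only: of_nat_le_iff)
  qed
  have "card (ival Q - U) = 2 ^ snd Q - card U" using fU UQ by (simp add: card_Diff_subset)
  then have c1: "2 ^ snd Q \<le> 2 * card (ival Q - U)" using cardU by simp
  have c2: "family_max (triple Q) f n \<le> B * triple_density f Q" if "n \<in> ival Q - U" for n
  proof -
    have "n \<notin> E" using Foff[of n] that by (auto simp: U_def e_def split: if_splits)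
    then have "family_max (triple Q) f n \<le> ?A * triple_density f Q" using that by (auto simp: E_def)
    also have "\<dots> \<le> B * triple_density f Q" using AB triple_density_nonneg by (rule mult_right_mono)
    finally show ?thesis .
  qed
  have c3: "family_max (triple Q) f x \<le> family_max (triple P) f x + B * triple_density f Q + B * triple_density f P"
    if P: "P \<in> F" and x: "x \<in> ival P" for P x
  proof -
    define G where "G = {n\<in>ival P. ?A * triple_density f P < family_max (triple P) f n \<or> ?A * triple_density f P < triple_max f P n}"
    have cG: "8 * card G \<le> 2 ^ snd P" unfolding G_def by (rule exceptional_small[OF B1 weak])
    have "real (card (E \<inter> ival P)) \<le> real (2 ^ snd P) / 2" using Fhi[OF P] by simp
    then have "2 * card (E \<inter> ival P) \<le> 2 ^ snd P" by linarith
    with cG have "2 * card (E \<inter> ival P) + 2 * card G < 2 * 2 ^ snd P"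
      using zero_less_power[of "2::nat" "snd P"] by linarith
    then have "card (E \<inter> ival P \<union> G) < card (ival P)"
      using card_Un_le[of "E \<inter> ival P" G] by simp
    then have "\<not> ival P \<subseteq> E \<inter> ival P \<union> G"
      using card_mono[of "E \<inter> ival P \<union> G" "ival P"] fE by (auto simp: G_def not_le)
    then obtain x' where x': "x' \<in> ival P" "x' \<notin> E" "x' \<notin> G" by blast
    have x'Q: "x' \<in> ival Q" using x' FQ[OF P] by auto
    have b1: "family_max (triple Q) f x' \<le> ?A * triple_density f Q" "triple_max f Q x' \<le> ?A * triple_density f Q"
      using x' x'Q by (auto simp: E_def)
    have b2: "family_max (triple P) f x' \<le> ?A * triple_density f P" using x' by (auto simp: G_def)
    have sub: "triple P \<subseteq> triple Q" using FQ[OF P] by (intro triple_mono) auto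
    show ?thesis
    proof (rule family_max_least)
      fix i assume i: "i \<in> I"
      have split: "(\<Sum>m\<in>triple Q. of_real (K i (y - m)) * f m) =
         (\<Sum>m\<in>triple Q - triple P. of_real (K i (y - m)) * f m) + (\<Sum>m\<in>triple P. of_real (K i (y - m)) * f m)" for y
        using sub by (intro sum.subset_diff) auto
      define a where "a = (\<lambda>y. \<Sum>m\<in>triple Q - triple P. of_real (K i (y - m)) * f m)"
      define b where "b = (\<lambda>y. \<Sum>m\<in>triple P. of_real (K i (y - m)) * f m)"
      have "cmod (a x - a x') \<le> 54 * C * triple_max f Q x'"
        unfolding a_def triple_max_def triple_eq[of Q] using sub
        by (intro oscillation_le_max i x x'(1)) (simp add: triple_eq)
      also have "\<dots> \<le> 54 * C * (?A * triple_density f Q)" using b1 C_nonneg by (intro mult_left_mono) auto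
      finally have o: "cmod (a x - a x') \<le> 54 * C * (?A * triple_density f Q)" .
      have "cmod (a x' + b x') \<le> ?A * triple_density f Q"
        using family_max_upper[OF i, where S = "triple Q" and n = x' and f = f] b1 split[of x'] by (simp add: a_def b_def)
      moreover have "cmod (b x') \<le> ?A * triple_density f P"
        using family_max_upper[OF i, where S = "triple P" and n = x' and f = f] b2 by (simp add: b_def)
      moreover have "cmod (b x) \<le> family_max (triple P) f x" using family_max_upper[OF i] by (simp add: b_def)
      moreover have "cmod (a x + b x) \<le> cmod (a x - a x') + cmod (a x' + b x') + cmod (b x') + cmod (b x)"
      proof -
        have e: "a x + b x = ((a x - a x') + (a x' + b x')) + (b x - b x')" by simp
        show ?thesis
          unfolding e
          using norm_triangle_ineq[of "(a x - a x') + (a x' + b x')" "b x - b x'"]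
            norm_triangle_ineq[of "a x - a x'" "a x' + b x'"] norm_triangle_ineq4[of "b x" "b x'"]
          by linarith
      qed
      ultimately have "cmod (a x + b x) \<le> family_max (triple P) f x + (54 * C * (?A * triple_density f Q) + ?A * triple_density f Q) + ?A * triple_density f P"
        using o by linarith
      also have "54 * C * (?A * triple_density f Q) + ?A * triple_density f Q = B * triple_density f Q" by (simp add: B_def algebra_simps)
      also have "?A * triple_density f P \<le> B * triple_density f P" using AB triple_density_nonneg by (rule mult_right_mono)
      finally show "cmod (\<Sum>m\<in>triple Q. of_real (K i (x - m)) * f m) \<le> family_max (triple P) f x + B * triple_density f Q + B * triple_density f P"
        using split[of x] by (simp add: a_def b_def)
    qed
  qed
  show ?thesis
    using fF dF FQ c1 c2 c3 unfolding U_def by (intro exI[of _ F]) blast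
qed

text \<open>Iterating \<open>sparse_step\<close> by induction on the length of the interval. The
  induction hypothesis carries the extra term with \<open>triple_density\<close>, because this is what the
  step from \<open>Q\<close> to its children \<open>P\<close> produces. The term \<open>triple_density f Q
  \<Sum> g\<close> appears twice, and is paid for by the part \<open>E\<close> of \<open>Q\<close>
  outside the children, through \<open>Ap_bilinear_bound\<close>; since \<open>\<Psi>\<close> is summed over
  disjoint sets, no constant accumulates, and the sparse family itself never has to be named.\<close>

theorem sparse_form_bound:
  fixes w \<sigma> :: "int \<Rightarrow> real" and f :: "int \<Rightarrow> complex" and g :: "int \<Rightarrow> real" and l u :: int
  assumes B1: "0 \<le> B1" and weak: "\<And>S A f c. finite S \<Longrightarrow> finite A \<Longrightarrow> 0 < c \<Longrightarrow>
      c * real (card {n\<in>A. c < family_max S f n}) \<le> B1 * (\<Sum>m\<in>S. cmod (f m))"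
    and p: "1 < p" and pos: "\<And>n. w n > 0" and \<sigma>: "\<And>n. \<sigma> n = w n powr (- 1 / (p - 1))"
    and Ap: "\<And>a b. a \<le> b \<Longrightarrow> (\<Sum>n=a..b. w n) * (\<Sum>n=a..b. \<sigma> n) powr (p - 1) \<le> D * real_of_int (b - a + 1) powr p"
    and g: "\<And>n. 0 \<le> g n"
  defines "B \<equiv> 8 * (B1 + 4) * (1 + 54 * C)"
  defines "K0 \<equiv> 6 * B * (D powr (1/p) * (D * 6 powr p + (D * 6 powr p) powr (1 / (p - 1))))"
  defines "\<Psi> \<equiv> \<lambda>n. interval_max \<sigma> (\<lambda>m. cmod (f m) / \<sigma> m) l u n powr p * \<sigma> n
       + interval_max w (\<lambda>m. g m / w m) l u n powr (p / (p-1)) * w n"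
  shows "triple (a, k) \<subseteq> {l..u} \<Longrightarrow>
    (\<Sum>n\<in>ival (a, k). family_max (triple (a, k)) f n * g n) + B * triple_density f (a, k) * (\<Sum>n\<in>ival (a, k). g n)
      \<le> K0 * (\<Sum>n\<in>ival (a, k). \<Psi> n)"
proof (induction k arbitrary: a rule: less_induct)
  case (less k)
  define Q where "Q = (a, k)"
  have sQ [simp]: "snd Q = k" by (simp add: Q_def)
  have sp: "\<sigma> n > 0" for n using pos[of n] by (simp add: \<sigma>)
  have B0: "0 \<le> B" using B1 C_nonneg by (simp add: B_def)
  obtain F where fF: "finite F" and dF: "disjoint_family_on ival F"
    and FQ: "\<And>P. P \<in> F \<Longrightarrow> ival P \<subseteq> ival Q \<and> snd P < k"
    and cQ: "2 ^ k \<le> 2 * card (ival Q - (\<Union>P\<in>F. ival P))"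
    and off: "\<And>n. n \<in> ival Q - (\<Union>P\<in>F. ival P) \<Longrightarrow> family_max (triple Q) f n \<le> B * triple_density f Q"
    and on: "\<And>P n. P \<in> F \<Longrightarrow> n \<in> ival P \<Longrightarrow> family_max (triple Q) f n \<le> family_max (triple P) f n + B * triple_density f Q + B * triple_density f P"
    using sparse_step[OF B1 weak, of Q f] unfolding B_def sQ by blast
  define U where "U = (\<Union>P\<in>F. ival P)"
  \<comment> \<open>The part of \<open>Q\<close> outside its children; it fills at least half of
    \<open>Q\<close>, a sixth of the triple.\<close>
  define E where "E = ival Q - U"
  have UQ: "U \<subseteq> ival Q" using FQ by (auto simp: U_def)
  have sumU: "(\<Sum>n\<in>U. h n) = (\<Sum>P\<in>F. \<Sum>n\<in>ival P. h n)" for h :: "int \<Rightarrow> real"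
    unfolding U_def using dF fF by (intro sum.UNION_disjoint) (auto simp: disjoint_family_on_def)
  have sumQ: "(\<Sum>n\<in>ival Q. h n) = (\<Sum>n\<in>E. h n) + (\<Sum>P\<in>F. \<Sum>n\<in>ival P. h n)" for h :: "int \<Rightarrow> real"
    unfolding E_def sumU[symmetric] using UQ by (intro sum.subset_diff) auto
  have Psi: "0 \<le> \<Psi> n" for n unfolding \<Psi>_def using sp[of n] pos[of n] by (intro add_nonneg_nonneg mult_nonneg_nonneg) auto
  have lu: "triple Q \<subseteq> {l..u}" using less.prems by (simp add: Q_def)
  have key: "2 * B * triple_density f Q * (\<Sum>n\<in>ival Q. g n) \<le> K0 * (\<Sum>n\<in>E. \<Psi> n)"
  proof -
    let ?J = "triple Q"
    have EJ: "E \<subseteq> ?J" using ival_subset_triple[of Q] by (auto simp: E_def)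
    have cE: "2 ^ k \<le> 2 * card E" using cQ by (simp add: E_def U_def)
    then have "card E \<noteq> 0" by (intro notI) simp
    then have Ene: "E \<noteq> {}" by auto
    have rcE: "2 ^ k \<le> 2 * real (card E)" using of_nat_mono[OF cE, where 'a = real] by simp
    have iv: "l \<le> fst Q - 2 ^ snd Q" "fst Q + 2 * 2 ^ snd Q - 1 \<le> u"
    proof -
      have "(0::int) < 2 ^ snd Q" by simp
      then have "fst Q - 2 ^ snd Q \<in> triple Q" "fst Q + 2 * 2 ^ snd Q - 1 \<in> triple Q"
        unfolding triple_eq atLeastAtMost_iff by linarith+
      with lu show "l \<le> fst Q - 2 ^ snd Q" "fst Q + 2 * 2 ^ snd Q - 1 \<le> u" by auto
    qed
    have "(\<Sum>i\<in>?J. cmod (f i)) * (\<Sum>i\<in>?J. g i) / real (card ?J) \<le>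
       D powr (1/p) * (D * 6 powr p + (D * 6 powr p) powr (1 / (p - 1))) * (\<Sum>n\<in>E. \<Psi> n)"
      unfolding \<Psi>_def
    proof (rule Ap_bilinear_bound[OF p pos \<sigma> _ EJ Ene])
      show "real (card ?J) \<le> 6 * real (card E)" using rcE by simp
      show "(\<Sum>n\<in>?J. w n) * (\<Sum>n\<in>?J. \<sigma> n) powr (p - 1) \<le> D * real (card ?J) powr p"
      proof -
        have "(\<Sum>n\<in>?J. w n) * (\<Sum>n\<in>?J. \<sigma> n) powr (p - 1)
           \<le> D * real_of_int (fst Q + 2 * 2 ^ snd Q - 1 - (fst Q - 2 ^ snd Q) + 1) powr p"
          unfolding triple_eq by (rule Ap) simp
        also have "real_of_int (fst Q + 2 * 2 ^ snd Q - 1 - (fst Q - 2 ^ snd Q) + 1) = real (card ?J)" by simp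
        finally show ?thesis .
      qed
      fix n assume n: "n \<in> E"
      then have nJ: "fst Q - 2 ^ snd Q \<le> n" "n \<le> fst Q + 2 * 2 ^ snd Q - 1" using EJ by (auto simp: triple_eq)
      show "(\<Sum>i\<in>?J. cmod (f i)) / (\<Sum>i\<in>?J. \<sigma> i) \<le> interval_max \<sigma> (\<lambda>m. cmod (f m) / \<sigma> m) l u n"
        using interval_max_ge[OF iv(1) nJ iv(2), of "\<lambda>m. cmod (f m) / \<sigma> m" \<sigma>] sp by (simp add: triple_eq less_imp_neq[symmetric])
      show "(\<Sum>i\<in>?J. g i) / (\<Sum>i\<in>?J. w i) \<le> interval_max w (\<lambda>m. g m / w m) l u n"
        using interval_max_ge[OF iv(1) nJ iv(2), of "\<lambda>m. g m / w m" w] pos by (simp add: triple_eq less_imp_neq[symmetric])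
    qed (use g in auto)
    then have "6 * B * ((\<Sum>i\<in>?J. cmod (f i)) * (\<Sum>i\<in>?J. g i) / real (card ?J)) \<le>
       6 * B * (D powr (1/p) * (D * 6 powr p + (D * 6 powr p) powr (1 / (p - 1))) * (\<Sum>n\<in>E. \<Psi> n))"
      using B0 by (intro mult_left_mono) auto
    also have "6 * B * ((\<Sum>i\<in>?J. cmod (f i)) * (\<Sum>i\<in>?J. g i) / real (card ?J)) = 2 * B * triple_density f Q * (\<Sum>i\<in>?J. g i)"
      by (simp add: triple_density_def)
    finally have "2 * B * triple_density f Q * (\<Sum>i\<in>?J. g i) \<le> K0 * (\<Sum>n\<in>E. \<Psi> n)" by (simp add: K0_def mult.assoc)
    moreover have "2 * B * triple_density f Q * (\<Sum>n\<in>ival Q. g n) \<le> 2 * B * triple_density f Q * (\<Sum>i\<in>?J. g i)"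
      using B0 triple_density_nonneg g ival_subset_triple[of Q] by (intro mult_left_mono sum_mono2 mult_nonneg_nonneg) auto
    ultimately show ?thesis by linarith
  qed
  have IH: "(\<Sum>n\<in>ival P. family_max (triple P) f n * g n) + B * triple_density f P * (\<Sum>n\<in>ival P. g n) \<le> K0 * (\<Sum>n\<in>ival P. \<Psi> n)"
    if P: "P \<in> F" for P
  proof -
    have "triple P \<subseteq> {l..u}" using triple_mono[of P Q] FQ[OF P] lu by auto
    then show ?thesis using less.IH[of "snd P" "fst P"] FQ[OF P] by simp
  qed
  have "(\<Sum>n\<in>ival Q. family_max (triple Q) f n * g n)
     = (\<Sum>n\<in>E. family_max (triple Q) f n * g n) + (\<Sum>P\<in>F. \<Sum>n\<in>ival P. family_max (triple Q) f n * g n)" by (rule sumQ)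
  also have "\<dots> \<le> (\<Sum>n\<in>E. B * triple_density f Q * g n) +
       (\<Sum>P\<in>F. \<Sum>n\<in>ival P. (family_max (triple P) f n + B * triple_density f Q + B * triple_density f P) * g n)"
    using g by (intro add_mono sum_mono mult_right_mono off on) (auto simp: E_def U_def)
  also have "\<dots> = B * triple_density f Q * ((\<Sum>n\<in>E. g n) + (\<Sum>P\<in>F. \<Sum>n\<in>ival P. g n))
       + (\<Sum>P\<in>F. (\<Sum>n\<in>ival P. family_max (triple P) f n * g n) + B * triple_density f P * (\<Sum>n\<in>ival P. g n))"
    by (simp only: distrib_right distrib_left sum.distrib sum_distrib_left mult.assoc add_ac)
  also have "\<dots> \<le> B * triple_density f Q * (\<Sum>n\<in>ival Q. g n) + (\<Sum>P\<in>F. K0 * (\<Sum>n\<in>ival P. \<Psi> n))"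
    unfolding sumQ[of g] by (intro add_left_mono sum_mono IH)
  finally have "(\<Sum>n\<in>ival Q. family_max (triple Q) f n * g n) + B * triple_density f Q * (\<Sum>n\<in>ival Q. g n)
     \<le> K0 * (\<Sum>n\<in>E. \<Psi> n) + (\<Sum>P\<in>F. K0 * (\<Sum>n\<in>ival P. \<Psi> n))"
    using key by (simp add: algebra_simps)
  also have "\<dots> = K0 * (\<Sum>n\<in>ival Q. \<Psi> n)" unfolding sumQ[of \<Psi>] by (simp add: sum_distrib_left distrib_left)
  finally show ?case by (simp add: Q_def)
qed

end

text \<open>The two maximal theorems that end a sparse form estimate. The function \<open>f /
  \<sigma>\<close> has the same norm in \<open>\<ell>\<^sup>p(\<sigma>)\<close> as \<open>f\<close>
  in \<open>\<ell>\<^sup>p(w)\<close>, since \<open>\<sigma> powr (1 - p) = w\<close>.\<close>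

lemma weighted_maximal_sum_bound:
  fixes w \<sigma> :: "int \<Rightarrow> real" and f g :: "int \<Rightarrow> real"
  assumes p: "1 < p" and pos: "\<And>n. w n > 0" and \<sigma>: "\<And>n. \<sigma> n = w n powr (- 1 / (p - 1))"
    and f: "\<And>n. 0 \<le> f n" and g: "\<And>n. 0 \<le> g n"
  defines "cst \<equiv> \<lambda>p::real. 2 powr p * (4 * (p / (p-1)) * (2 * (p / (p-1))) powr (p-1))"
  shows "(\<Sum>n=l..u. interval_max \<sigma> (\<lambda>m. f m / \<sigma> m) l u n powr p * \<sigma> n
       + interval_max w (\<lambda>m. g m / w m) l u n powr (p / (p-1)) * w n)
     \<le> cst p * (\<Sum>n=l..u. f n powr p * w n) + cst (p / (p-1)) * (\<Sum>n=l..u. (g n / w n) powr (p / (p-1)) * w n)"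
proof -
  have sp: "\<sigma> n > 0" for n using pos[of n] by (simp add: \<sigma>)
  have q: "1 < p / (p-1)" using p by simp
  have "(\<Sum>n=l..u. interval_max \<sigma> (\<lambda>m. f m / \<sigma> m) l u n powr p * \<sigma> n) \<le> cst p * (\<Sum>n=l..u. (f n / \<sigma> n) powr p * \<sigma> n)"
    unfolding cst_def using f sp by (intro interval_max_strong p) (auto intro: divide_nonneg_pos)
  also have "(\<lambda>n. (f n / \<sigma> n) powr p * \<sigma> n) = (\<lambda>n. f n powr p * w n)"
  proof
    fix n
    have "(f n / \<sigma> n) powr p * \<sigma> n = f n powr p * (\<sigma> n powr (1 - p))"
      using sp[of n] f[of n] by (simp add: powr_divide powr_diff)
    also have "\<sigma> n powr (1 - p) = w n"
    proof -
      have "- 1 / (p - 1) * (1 - p) = 1" using p by (simp add: field_simps)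
      then show ?thesis using pos[of n] by (simp only: \<sigma> powr_powr) simp
    qed
    finally show "(f n / \<sigma> n) powr p * \<sigma> n = f n powr p * w n" .
  qed
  finally have 1: "(\<Sum>n=l..u. interval_max \<sigma> (\<lambda>m. f m / \<sigma> m) l u n powr p * \<sigma> n) \<le> cst p * (\<Sum>n=l..u. f n powr p * w n)" .
  have 2: "(\<Sum>n=l..u. interval_max w (\<lambda>m. g m / w m) l u n powr (p/(p-1)) * w n) \<le> cst (p/(p-1)) * (\<Sum>n=l..u. (g n / w n) powr (p/(p-1)) * w n)"
    unfolding cst_def using g pos by (intro interval_max_strong q) (auto intro: divide_nonneg_pos)
  show ?thesis unfolding sum.distrib using 1 2 by (rule add_mono)
qed

text \<open>Duality: test the sparse form bound with \<open>g = (T f)^(p-1) w\<close>, for which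
  both the left-hand side and the dual norm equal the quantity \<open>X\<close> to be bounded.
  Multiplying \<open>f\<close> by \<open>c\<close> multiplies the left-hand side by \<open>c\<close>
  but leaves the dual term alone, and \<open>c\<close> is chosen so large that the latter can be
  absorbed.\<close>

theorem (in cz_family) strong_type_Ap:
  fixes w \<sigma> :: "int \<Rightarrow> real"
  assumes B1: "0 \<le> B1" and weak: "\<And>S A f c. finite S \<Longrightarrow> finite A \<Longrightarrow> 0 < c \<Longrightarrow>
      c * real (card {n\<in>A. c < family_max S f n}) \<le> B1 * (\<Sum>m\<in>S. cmod (f m))"
    and p: "1 < p" and pos: "\<And>n. w n > 0" and \<sigma>: "\<And>n. \<sigma> n = w n powr (- 1 / (p - 1))"
    and Ap: "\<And>a b. a \<le> b \<Longrightarrow> (\<Sum>n=a..b. w n) * (\<Sum>n=a..b. \<sigma> n) powr (p - 1) \<le> D * real_of_int (b - a + 1) powr p"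
  shows "\<exists>B2\<ge>0. \<forall>S A f. finite S \<longrightarrow> finite A \<longrightarrow>
      (\<Sum>n\<in>A. family_max S f n powr p * w n) \<le> B2 * (\<Sum>m\<in>S. cmod (f m) powr p * w m)"
proof -
  define cst :: "real \<Rightarrow> real" where "cst = (\<lambda>p. 2 powr p * (4 * (p / (p-1)) * (2 * (p / (p-1))) powr (p-1)))"
  define K0 where "K0 = 6 * (8 * (B1 + 4) * (1 + 54 * C)) * (D powr (1/p) * (D * 6 powr p + (D * 6 powr p) powr (1 / (p - 1))))"
  have sp: "\<sigma> n > 0" for n using pos[of n] by (simp add: \<sigma>)
  have w0: "0 \<le> w n" for n using pos[of n] by simp
  have q: "1 < p / (p-1)" using p by simp
  have D0: "0 \<le> D"
  proof -
    have "0 \<le> w 0 * \<sigma> 0 powr (p-1)" using w0 by simp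
    also have "\<dots> \<le> D" using Ap[of 0 0] by simp
    finally show ?thesis .
  qed
  have cst0: "0 \<le> cst p'" if "1 < p'" for p' using that unfolding cst_def by simp
  have K00: "0 \<le> K0" using B1 C_nonneg D0 by (simp add: K0_def)
  define c where "c = K0 * cst (p/(p-1)) + 1"
  have c: "c > 0" using K00 cst0[OF q] unfolding c_def by (simp add: add_nonneg_pos)
  define B2 where "B2 = K0 * (cst p * c powr p)"
  have "(\<Sum>n\<in>A. family_max S f n powr p * w n) \<le> B2 * (\<Sum>m\<in>S. cmod (f m) powr p * w m)"
    if fin: "finite S" "finite A" for S A f
  proof -
    obtain a k where SA: "S \<union> A \<subseteq> ival (a, k)" using finite_subset_ival[of "S \<union> A"] fin by auto
    define Q where "Q = (a, k)"
    define l u where "l = a - 2 ^ k" and "u = a + 2 * 2 ^ k - 1"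
    have lu: "triple Q = {l..u}" by (simp add: triple_eq Q_def l_def u_def)
    have Qlu: "ival Q \<subseteq> {l..u}" using ival_subset_triple[of Q] lu by simp
    define f0 where "f0 = (\<lambda>m. if m \<in> S then f m else 0)"
    define X where "X = (\<Sum>n\<in>ival Q. family_max (triple Q) f0 n powr p * w n)"
    define g where "g = (\<lambda>n. if n \<in> ival Q then family_max (triple Q) f0 n powr (p-1) * w n else 0)"
    define h where "h = (\<lambda>m. of_real c * f0 m)"
    have S3: "S \<subseteq> triple Q" using SA ival_subset_triple[of Q] by (auto simp: Q_def)
    have eq: "family_max S f n = family_max (triple Q) f0 n" for n
      by (rule family_max_restrict[symmetric]) (use S3 in \<open>auto simp: f0_def\<close>)
    have g0: "0 \<le> g n" for n using w0 by (simp add: g_def)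
    have "c * X = (\<Sum>n\<in>ival Q. c * family_max (triple Q) f0 n * g n)"
    proof -
      have "family_max (triple Q) f0 n powr p = family_max (triple Q) f0 n * family_max (triple Q) f0 n powr (p-1)" for n
        using powr_add[of "family_max (triple Q) f0 n" 1 "p-1"] family_max_nonneg[of "triple Q" f0 n] by (cases "family_max (triple Q) f0 n = 0") auto
      then show ?thesis unfolding X_def g_def by (simp add: sum_distrib_left mult.assoc)
    qed
    also have "\<dots> \<le> (\<Sum>n\<in>ival Q. family_max (triple Q) h n * g n)"
      unfolding h_def by (intro sum_mono mult_right_mono family_max_scale c g0)
    also have "\<dots> \<le> (\<Sum>n\<in>ival Q. family_max (triple Q) h n * g n) + 8 * (B1 + 4) * (1 + 54 * C) * triple_density h Q * (\<Sum>n\<in>ival Q. g n)"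
      using B1 C_nonneg triple_density_nonneg g0 by (simp add: sum_nonneg)
    also have "\<dots> \<le> K0 * (\<Sum>n\<in>ival Q. interval_max \<sigma> (\<lambda>m. cmod (h m) / \<sigma> m) l u n powr p * \<sigma> n
       + interval_max w (\<lambda>m. g m / w m) l u n powr (p / (p-1)) * w n)"
      unfolding K0_def Q_def by (rule sparse_form_bound[OF B1 weak p pos \<sigma> Ap g0]) (use lu in \<open>auto simp: Q_def\<close>)
    also have "\<dots> \<le> K0 * (\<Sum>n=l..u. interval_max \<sigma> (\<lambda>m. cmod (h m) / \<sigma> m) l u n powr p * \<sigma> n
       + interval_max w (\<lambda>m. g m / w m) l u n powr (p / (p-1)) * w n)"
      using K00 Qlu sp w0 by (intro mult_left_mono sum_mono2) (auto intro!: add_nonneg_nonneg mult_nonneg_nonneg less_imp_le[OF sp])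
    also have "\<dots> \<le> K0 * (cst p * (\<Sum>n=l..u. cmod (h n) powr p * w n) + cst (p / (p-1)) * (\<Sum>n=l..u. (g n / w n) powr (p / (p-1)) * w n))"
      unfolding cst_def using K00 g0 by (intro mult_left_mono weighted_maximal_sum_bound p pos \<sigma>) auto
    also have "(\<Sum>n=l..u. (g n / w n) powr (p / (p-1)) * w n) = X"
    proof -
      have "(\<Sum>n=l..u. (g n / w n) powr (p / (p-1)) * w n) = (\<Sum>n\<in>ival Q. (family_max (triple Q) f0 n powr (p-1)) powr (p / (p-1)) * w n)"
        using Qlu pos by (intro sum.mono_neutral_cong_right) (auto simp: g_def less_imp_neq[symmetric])
      then show ?thesis using p by (simp add: X_def powr_powr)
    qed
    also have "(\<Sum>n=l..u. cmod (h n) powr p * w n) = c powr p * (\<Sum>m\<in>S. cmod (f m) powr p * w m)"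
    proof -
      have "(\<Sum>n=l..u. cmod (h n) powr p * w n) = (\<Sum>n\<in>S. c powr p * (cmod (f n) powr p * w n))"
        using S3 lu p c by (intro sum.mono_neutral_cong_right) (auto simp: h_def f0_def norm_mult powr_mult)
      then show ?thesis by (simp add: sum_distrib_left)
    qed
    finally have "X \<le> B2 * (\<Sum>m\<in>S. cmod (f m) powr p * w m)"
      by (simp add: c_def B2_def algebra_simps)
    moreover have "(\<Sum>n\<in>A. family_max S f n powr p * w n) \<le> X"
      unfolding X_def eq using SA w0 by (intro sum_mono2) (auto simp: Q_def)
    ultimately show ?thesis by linarith
  qed
  moreover have "0 \<le> B2" using K00 cst0[OF p] by (simp add: B2_def)
  ultimately show ?thesis by blast
qed

text \<open>For an \<open>A_p\<close> weight, sequences in \<open>\<ell>\<^sup>p(w)\<close> are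
  summable against \<open>1 / (1 + \<bar>m\<bar>)\<close>. This is the sparse form estimate for the
  nested intervals \<open>J j = {-2^j..2^j}\<close> with \<open>g\<close> the unit mass at the
  origin: the sets \<open>J (j + 1) - J j\<close> are disjoint and fill a third of \<open>J (j +
  1)\<close>, and the sum of the averages of \<open>f\<close> over the \<open>J j\<close> dominates
  the series in question.\<close>

theorem Ap_summable:
  fixes w \<sigma> :: "int \<Rightarrow> real" and f :: "int \<Rightarrow> real"
  assumes p: "1 < p" and pos: "\<And>n. w n > 0" and \<sigma>: "\<And>n. \<sigma> n = w n powr (- 1 / (p - 1))"
    and Ap: "\<And>a b. a \<le> b \<Longrightarrow> (\<Sum>n=a..b. w n) * (\<Sum>n=a..b. \<sigma> n) powr (p - 1) \<le> D * real_of_int (b - a + 1) powr p"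
    and f0: "\<And>n. 0 \<le> f n" and fs: "(\<lambda>n. f n powr p * w n) summable_on UNIV"
  shows "(\<lambda>m. f m / (1 + real_of_int \<bar>m\<bar>)) summable_on UNIV"
proof -
  define cst :: "real \<Rightarrow> real" where "cst = (\<lambda>p. 2 powr p * (4 * (p / (p-1)) * (2 * (p / (p-1))) powr (p-1)))"
  define Kk where "Kk = D powr (1/p) * (D * 3 powr p + (D * 3 powr p) powr (1 / (p - 1)))"
  have sp: "\<sigma> n > 0" for n using pos[of n] by (simp add: \<sigma>)
  have w0: "0 \<le> w n" for n using pos[of n] by simp
  have q: "1 < p / (p-1)" using p by simp
  have D0: "0 \<le> D"
  proof -
    have "0 \<le> w 0 * \<sigma> 0 powr (p-1)" using w0 by simp
    also have "\<dots> \<le> D" using Ap[of 0 0] by simp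
    finally show ?thesis .
  qed
  have Kk0: "0 \<le> Kk" using D0 by (simp add: Kk_def)
  have cst0: "0 \<le> cst p'" if "1 < p'" for p' using that unfolding cst_def by simp
  \<comment> \<open>The unit mass at the origin, so that \<open>\<Sum> g\<close> over each \<open>J
    j\<close> equals \<open>1\<close> and the product in \<open>Ap_bilinear_bound\<close> is the average of
    \<open>f\<close>.\<close>
  define g :: "int \<Rightarrow> real" where "g = (\<lambda>n. if n = 0 then 1 else 0)"
  define Bd where "Bd = Kk * (cst p * infsum (\<lambda>n. f n powr p * w n) UNIV + cst (p / (p-1)) * ((1 / w 0) powr (p / (p-1)) * w 0))"
  define J where "J = (\<lambda>j::nat. {- (2 ^ j)..2 ^ j} :: int set)"
  have cJ: "card (J j) = 2 * 2 ^ j + 1" for j by (simp add: J_def nat_add_distrib nat_mult_distrib nat_power_eq)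
  have main: "(\<Sum>m\<in>J L. f m / (1 + real_of_int \<bar>m\<bar>)) \<le> 5 * Bd" if L: "1 \<le> L" for L
  proof -
    define l u :: int where "l = - (2 ^ L)" and "u = 2 ^ L"
    have JL: "J L = {l..u}" by (simp add: J_def l_def u_def)
    define \<Psi> where "\<Psi> = (\<lambda>n. interval_max \<sigma> (\<lambda>m. f m / \<sigma> m) l u n powr p * \<sigma> n
       + interval_max w (\<lambda>m. g m / w m) l u n powr (p / (p-1)) * w n)"
    have Psi0: "0 \<le> \<Psi> n" for n unfolding \<Psi>_def using less_imp_le[OF sp] w0 by simp
    have mono: "J i \<subseteq> J j" if "i \<le> j" for i j
      using that power_increasing[of i j "2::int"] by (auto simp: J_def)
    have step: "(\<Sum>m\<in>J (Suc j). f m) / real (card (J (Suc j))) \<le> Kk * (\<Sum>n\<in>J (Suc j) - J j. \<Psi> n)" if j: "Suc j \<le> L" for j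
    proof -
      have sub: "J j \<subseteq> J (Suc j)" by (rule mono) simp
      have cd: "card (J (Suc j) - J j) = 2 * 2 ^ j"
        using sub by (subst card_Diff_subset) (simp_all add: cJ, simp add: J_def)
      have iv: "l \<le> - (2 ^ Suc j)" "2 ^ Suc j \<le> u" using power_increasing[of "Suc j" L "2::int"] j by (auto simp: l_def u_def)
      have "(\<Sum>i\<in>J (Suc j). f i) * (\<Sum>i\<in>J (Suc j). g i) / real (card (J (Suc j))) \<le>
         D powr (1/p) * (D * 3 powr p + (D * 3 powr p) powr (1 / (p - 1))) * (\<Sum>n\<in>J (Suc j) - J j. \<Psi> n)"
        unfolding \<Psi>_def
      proof (rule Ap_bilinear_bound[OF p pos \<sigma>])
        show "J (Suc j) - J j \<noteq> {}" using cd by (metis card.empty mult_eq_0_iff power_not_zero zero_neq_numeral)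
        show "real (card (J (Suc j))) \<le> 3 * real (card (J (Suc j) - J j))"
        proof -
          have "(1::real) \<le> 2 ^ j" by simp
          then show ?thesis unfolding cd cJ by (simp only: of_nat_add of_nat_mult of_nat_power of_nat_numeral power_Suc of_nat_1)
        qed
        show "(\<Sum>n\<in>J (Suc j). w n) * (\<Sum>n\<in>J (Suc j). \<sigma> n) powr (p - 1) \<le> D * real (card (J (Suc j))) powr p"
          unfolding cJ using Ap[of "- (2 ^ Suc j)" "2 ^ Suc j"] by (simp add: J_def algebra_simps)
        fix n assume n: "n \<in> J (Suc j) - J j"
        then have nJ: "- (2 ^ Suc j) \<le> n" "n \<le> 2 ^ Suc j" by (auto simp: J_def)
        show "(\<Sum>i\<in>J (Suc j). f i) / (\<Sum>i\<in>J (Suc j). \<sigma> i) \<le> interval_max \<sigma> (\<lambda>m. f m / \<sigma> m) l u n"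
          using interval_max_ge[OF iv(1) nJ iv(2), of "\<lambda>m. f m / \<sigma> m" \<sigma>] sp by (simp add: J_def less_imp_neq[symmetric])
        show "(\<Sum>i\<in>J (Suc j). g i) / (\<Sum>i\<in>J (Suc j). w i) \<le> interval_max w (\<lambda>m. g m / w m) l u n"
          using interval_max_ge[OF iv(1) nJ iv(2), of "\<lambda>m. g m / w m" w] pos by (simp add: J_def less_imp_neq[symmetric])
      qed (use f0 in \<open>auto simp: J_def g_def\<close>)
      moreover have "(\<Sum>i\<in>J (Suc j). g i) = 1" by (simp add: g_def J_def)
      ultimately show ?thesis by (simp add: Kk_def)
    qed
    have tel: "(\<Sum>j<M. \<Sum>n\<in>J (Suc j) - J j. \<Psi> n) \<le> (\<Sum>n\<in>J M. \<Psi> n)" for M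
    proof (induction M)
      case 0 then show ?case using Psi0 by (simp add: sum_nonneg)
    next
      case (Suc M)
      have "(\<Sum>n\<in>J (Suc M). \<Psi> n) = (\<Sum>n\<in>J (Suc M) - J M. \<Psi> n) + (\<Sum>n\<in>J M. \<Psi> n)"
        by (rule sum.subset_diff) (auto simp: J_def intro: mono[unfolded J_def, THEN subsetD])
      then show ?case using Suc by simp
    qed
    have "(\<Sum>j<L. (\<Sum>m\<in>J (Suc j). f m) / real (card (J (Suc j)))) \<le> (\<Sum>j<L. Kk * (\<Sum>n\<in>J (Suc j) - J j. \<Psi> n))"
      by (intro sum_mono step) auto
    also have "\<dots> \<le> Kk * (\<Sum>n\<in>J L. \<Psi> n)" using tel[of L] Kk0 by (simp add: sum_distrib_left[symmetric] mult_left_mono)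
    also have "\<dots> \<le> Kk * (cst p * (\<Sum>n=l..u. f n powr p * w n) + cst (p / (p-1)) * (\<Sum>n=l..u. (g n / w n) powr (p / (p-1)) * w n))"
      unfolding cst_def JL \<Psi>_def using Kk0 f0 by (intro mult_left_mono weighted_maximal_sum_bound p pos \<sigma>) (auto simp: g_def)
    also have "\<dots> \<le> Bd" unfolding Bd_def
    proof (intro mult_left_mono add_mono Kk0 cst0 p q)
      show "(\<Sum>n=l..u. f n powr p * w n) \<le> infsum (\<lambda>n. f n powr p * w n) UNIV"
        using fs w0 by (intro finite_sum_le_infsum) auto
      have "(\<Sum>n=l..u. (g n / w n) powr (p / (p-1)) * w n) = (\<Sum>n\<in>{0}. (g n / w n) powr (p / (p-1)) * w n)"
        by (rule sum.mono_neutral_right) (auto simp: g_def l_def u_def)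
      then show "(\<Sum>n=l..u. (g n / w n) powr (p / (p-1)) * w n) \<le> (1 / w 0) powr (p / (p-1)) * w 0" by (simp add: g_def)
    qed
    finally have A: "(\<Sum>j<L. (\<Sum>m\<in>J (Suc j). f m) / real (card (J (Suc j)))) \<le> Bd" .
    \<comment> \<open>The smallest interval \<open>J (j + 1)\<close> containing \<open>m\<close> has
      length at most \<open>5 (1 + \<bar>m\<bar>)\<close>.\<close>
    have pt: "1 / (1 + real_of_int \<bar>m\<bar>) \<le> 5 * (\<Sum>j<L. (if m \<in> J (Suc j) then 1 / real (card (J (Suc j))) else 0))" if m: "m \<in> J L" for m
    proof -
      define j where "j = (LEAST j. m \<in> J (Suc j))"
      have ex: "m \<in> J (Suc (L - 1))" using m L by simp
      have j1: "m \<in> J (Suc j)" unfolding j_def using ex by (rule LeastI)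
      have "j \<le> L - 1" unfolding j_def using ex by (rule Least_le)
      then have jL: "j < L" using L by simp
      have "2 ^ j \<le> 1 + \<bar>m\<bar>"
      proof (cases j)
        case (Suc i)
        then have "m \<notin> J (Suc i)" using not_less_Least[of i "\<lambda>j. m \<in> J (Suc j)"] by (simp add: j_def)
        then have "2 ^ Suc i < \<bar>m\<bar>" by (auto simp: J_def)
        then show ?thesis using Suc by simp
      qed simp
      then have "real_of_int (2 ^ j) \<le> real_of_int (1 + \<bar>m\<bar>)" by (simp only: of_int_le_iff)
      then have "real (card (J (Suc j))) \<le> 5 * (1 + real_of_int \<bar>m\<bar>)" unfolding cJ by simp
      then have "1 / (1 + real_of_int \<bar>m\<bar>) \<le> 5 * (1 / real (card (J (Suc j))))"
      proof -
        have "1 / x \<le> 5 * (1 / c)" if "0 < x" "0 < c" "c \<le> 5 * x" for x c :: real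
          using that by (simp add: field_simps)
        moreover have "0 < real (card (J (Suc j)))" by (simp only: cJ)
        moreover have "0 < 1 + real_of_int \<bar>m\<bar>" by simp
        ultimately show ?thesis using \<open>real (card (J (Suc j))) \<le> 5 * (1 + real_of_int \<bar>m\<bar>)\<close> by blast
      qed
      also have "1 / real (card (J (Suc j))) \<le> (\<Sum>j<L. (if m \<in> J (Suc j) then 1 / real (card (J (Suc j))) else 0))"
        using jL j1 by (intro order_trans[OF _ member_le_sum[of j]]) auto
      finally show ?thesis by simp
    qed
    have "(\<Sum>m\<in>J L. f m / (1 + real_of_int \<bar>m\<bar>)) = (\<Sum>m\<in>J L. f m * (1 / (1 + real_of_int \<bar>m\<bar>)))" by simp
    also have "\<dots> \<le> (\<Sum>m\<in>J L. f m * (5 * (\<Sum>j<L. (if m \<in> J (Suc j) then 1 / real (card (J (Suc j))) else 0))))"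
      using f0 by (intro sum_mono mult_left_mono pt) auto
    also have "\<dots> = 5 * (\<Sum>j<L. \<Sum>m\<in>J L. (if m \<in> J (Suc j) then f m / real (card (J (Suc j))) else 0))"
      by (subst sum.swap) (auto simp: sum_distrib_left intro!: sum.cong)
    also have "(\<Sum>j<L. \<Sum>m\<in>J L. (if m \<in> J (Suc j) then f m / real (card (J (Suc j))) else 0))
        = (\<Sum>j<L. (\<Sum>m\<in>J (Suc j). f m) / real (card (J (Suc j))))"
    proof (rule sum.cong[OF refl])
      fix j assume "j \<in> {..<L}"
      then have "J (Suc j) \<subseteq> J L" by (intro mono) auto
      moreover have "finite (J L)" by (simp add: J_def)
      ultimately show "(\<Sum>m\<in>J L. (if m \<in> J (Suc j) then f m / real (card (J (Suc j))) else 0)) = (\<Sum>m\<in>J (Suc j). f m) / real (card (J (Suc j)))"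
        by (simp add: sum.inter_restrict[symmetric] Int_absorb1 sum_divide_distrib)
    qed
    finally show ?thesis using A by simp
  qed
  show ?thesis
  proof (rule nonneg_bdd_above_summable_on)
    show "bdd_above (sum (\<lambda>m. f m / (1 + real_of_int \<bar>m\<bar>)) ` {F. F \<subseteq> UNIV \<and> finite F})"
    proof (rule bdd_aboveI2)
      fix F :: "int set" assume "F \<in> {F. F \<subseteq> UNIV \<and> finite F}"
      then have fin: "finite F" by simp
      define R where "R = Max (insert 0 (abs ` F))"
      have R: "\<bar>m\<bar> \<le> R" if "m \<in> F" for m using that fin by (simp add: R_def)
      have R0: "0 \<le> R" using fin by (simp add: R_def)
      have "int (nat R + 1) < 2 ^ (nat R + 1)" by (rule of_nat_less_two_power)
      then have "R \<le> 2 ^ (nat R + 1)" using R0 by simp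
      then have "F \<subseteq> J (nat R + 1)" using R by (force simp: J_def)
      then have "(\<Sum>m\<in>F. f m / (1 + real_of_int \<bar>m\<bar>)) \<le> (\<Sum>m\<in>J (nat R + 1). f m / (1 + real_of_int \<bar>m\<bar>))"
        using f0 by (intro sum_mono2) (auto simp: J_def)
      also have "\<dots> \<le> 5 * Bd" by (rule main) simp
      finally show "(\<Sum>m\<in>F. f m / (1 + real_of_int \<bar>m\<bar>)) \<le> 5 * Bd" .
    qed
  qed (use f0 in auto)
qed

section \<open>The Poisson kernel and its conjugate\<close>

text \<open>The Fourier coefficients of \<open>exp (-2 t \<bar>sin (\<theta>/2)\<bar>)\<close>,
  which is the multiplier of the Poisson semigroup because \<open>4 sin\<^sup>2 (\<theta>/2)\<close>
  is that of \<open>-\<Delta>\<^sub>d\<close>; the substitution \<open>\<theta> = 2 x\<close> makes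
  the absolute value disappear. This formula, and the next one for the conjugate kernel, are the
  ones with which everything is estimated; that \<open>pk\<close> is also the kernel defined by
  Bessel functions and subordination is shown later.\<close>

definition pk :: "real \<Rightarrow> int \<Rightarrow> real" where
  "pk t k = 1 / pi * integral {0..pi} (\<lambda>x. exp (- 2 * t * sin x) * cos (2 * real_of_int k * x))"

text \<open>The Fourier coefficients of the same multiplier times \<open>- \<i> exp (- \<i> \<theta>
  / 2)\<close>, the multiplier of \<open>\<R>\<close>.\<close>

definition qk :: "real \<Rightarrow> int \<Rightarrow> real" where
  "qk t k = - (1 / pi) * integral {0..pi} (\<lambda>x. exp (- 2 * t * sin x) * sin ((2 * real_of_int k + 1) * x))"

lemma integrable_cont: "continuous_on {0..pi} f \<Longrightarrow> (f :: real \<Rightarrow> real) integrable_on {0..pi}"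
  by (rule integrable_continuous_real)

lemma leibniz_0_pi:
  fixes c :: "real \<Rightarrow> real"
  assumes c: "continuous_on {0..pi} c"
  shows "((\<lambda>t. integral {0..pi} (\<lambda>x. exp (- 2 * t * sin x) * c x)) has_real_derivative
    integral {0..pi} (\<lambda>x. - 2 * sin x * (exp (- 2 * t * sin x) * c x))) (at t)"
proof -
  have c': "continuous_on (UNIV \<times> {0..pi}) (\<lambda>p::real \<times> real. c (snd p))"
    by (rule continuous_on_compose2[OF c]) (auto intro!: continuous_intros)
  have "((\<lambda>t. integral (cbox 0 pi) (\<lambda>x. exp (- 2 * t * sin x) * c x)) has_field_derivative
    integral (cbox 0 pi) (\<lambda>x. - 2 * sin x * (exp (- 2 * t * sin x) * c x))) (at t within UNIV)"
  proof (rule leibniz_rule_field_derivative)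
    show "((\<lambda>t. exp (- 2 * t * sin x) * c x) has_field_derivative - 2 * sin x * (exp (- 2 * t * sin x) * c x)) (at t within UNIV)" for t x
      by (auto intro!: derivative_eq_intros)
    show "(\<lambda>x. exp (- 2 * t * sin x) * c x) integrable_on cbox 0 pi" for t
      using c by (auto intro!: integrable_continuous_real continuous_intros)
    show "continuous_on (UNIV \<times> cbox 0 pi) (\<lambda>(t, x). - 2 * sin x * (exp (- 2 * t * sin x) * c x))"
      using c' by (auto simp: case_prod_beta intro!: continuous_intros)
  qed auto
  then show ?thesis by simp
qed

text \<open>Differentiation under the integral sign brings down \<open>- 2 sin x\<close>, and the
  product formulas for sine and cosine turn this into a difference in \<open>k\<close>. This lemma
  and the next one are the Cauchy--Riemann equations for the kernels.\<close>

lemma pk_deriv: "((\<lambda>t. pk t k) has_real_derivative (qk t k - qk t (k - 1))) (at t)"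
proof -
  let ?e = "\<lambda>x. exp (- 2 * t * sin x)"
  have "((\<lambda>t. pk t k) has_real_derivative 1 / pi * integral {0..pi} (\<lambda>x. - 2 * sin x * (?e x * cos (2 * real_of_int k * x)))) (at t)"
    unfolding pk_def by (intro DERIV_cmult leibniz_0_pi continuous_intros)
  also have "integral {0..pi} (\<lambda>x. - 2 * sin x * (?e x * cos (2 * real_of_int k * x)))
     = integral {0..pi} (\<lambda>x. ?e x * sin ((2 * real_of_int (k - 1) + 1) * x) - ?e x * sin ((2 * real_of_int k + 1) * x))"
  proof (rule integral_cong)
    fix x
    define y where "y = 2 * real_of_int k * x"
    have a: "(2 * real_of_int (k - 1) + 1) * x = y - x" "(2 * real_of_int k + 1) * x = y + x"
      by (simp_all add: y_def algebra_simps)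
    show "- 2 * sin x * (?e x * cos (2 * real_of_int k * x)) = ?e x * sin ((2 * real_of_int (k - 1) + 1) * x) - ?e x * sin ((2 * real_of_int k + 1) * x)"
      unfolding a y_def[symmetric] sin_diff sin_add by (simp add: algebra_simps)
  qed
  also have "\<dots> = integral {0..pi} (\<lambda>x. ?e x * sin ((2 * real_of_int (k - 1) + 1) * x)) - integral {0..pi} (\<lambda>x. ?e x * sin ((2 * real_of_int k + 1) * x))"
    by (intro integral_diff integrable_cont continuous_intros)
  also have "1 / pi * \<dots> = qk t k - qk t (k - 1)" by (simp add: qk_def algebra_simps)
  finally show ?thesis .
qed

lemma qk_deriv: "((\<lambda>t. qk t k) has_real_derivative (pk t k - pk t (k + 1))) (at t)"
proof -
  let ?e = "\<lambda>x. exp (- 2 * t * sin x)"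
  have "((\<lambda>t. qk t k) has_real_derivative - (1 / pi) * integral {0..pi} (\<lambda>x. - 2 * sin x * (?e x * sin ((2 * real_of_int k + 1) * x)))) (at t)"
    unfolding qk_def by (intro DERIV_cmult leibniz_0_pi continuous_intros)
  also have "integral {0..pi} (\<lambda>x. - 2 * sin x * (?e x * sin ((2 * real_of_int k + 1) * x)))
     = integral {0..pi} (\<lambda>x. ?e x * cos (2 * real_of_int (k + 1) * x) - ?e x * cos (2 * real_of_int k * x))"
  proof (rule integral_cong)
    fix x
    define y where "y = (2 * real_of_int k + 1) * x"
    have a: "2 * real_of_int (k + 1) * x = y + x" "2 * real_of_int k * x = y - x"
      by (simp_all add: y_def algebra_simps)
    show "- 2 * sin x * (?e x * sin ((2 * real_of_int k + 1) * x)) = ?e x * cos (2 * real_of_int (k + 1) * x) - ?e x * cos (2 * real_of_int k * x)"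
      unfolding a y_def[symmetric] cos_diff cos_add by (simp add: algebra_simps)
  qed
  also have "\<dots> = integral {0..pi} (\<lambda>x. ?e x * cos (2 * real_of_int (k + 1) * x)) - integral {0..pi} (\<lambda>x. ?e x * cos (2 * real_of_int k * x))"
    by (intro integral_diff integrable_cont continuous_intros)
  also have "- (1 / pi) * \<dots> = pk t k - pk t (k + 1)" by (simp add: pk_def algebra_simps)
  finally show ?thesis .
qed

lemma ibp_cos:
  fixes u u' :: "real \<Rightarrow> real"
  assumes u: "\<And>x. (u has_real_derivative u' x) (at x)" and u': "continuous_on {0..pi} u'"
    and a: "a \<noteq> 0" "sin (a * pi) = 0"
  shows "integral {0..pi} (\<lambda>x. u x * cos (a * x)) = - (1 / a) * integral {0..pi} (\<lambda>x. u' x * sin (a * x))"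
proof -
  have cu: "continuous_on {0..pi} u" by (rule DERIV_continuous_on) (rule has_field_derivative_at_within[OF u])
  have "((\<lambda>x. u x * cos (a * x) + 1 / a * (u' x * sin (a * x))) has_integral (u pi * sin (a * pi) / a - u 0 * sin (a * 0) / a)) {0..pi}"
  proof (rule fundamental_theorem_of_calculus)
    fix x :: real
    have "((\<lambda>x. u x * sin (a * x) / a) has_real_derivative (u x * cos (a * x) + 1 / a * (u' x * sin (a * x)))) (at x)"
      using a by (auto intro!: derivative_eq_intros u simp: field_simps)
    then show "((\<lambda>x. u x * sin (a * x) / a) has_vector_derivative (u x * cos (a * x) + 1 / a * (u' x * sin (a * x)))) (at x within {0..pi})"
      by (simp add: has_real_derivative_iff_has_vector_derivative has_vector_derivative_at_within)
  qed simp
  then have "0 = integral {0..pi} (\<lambda>x. u x * cos (a * x) + 1 / a * (u' x * sin (a * x)))"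
    using a by (simp add: integral_unique)
  also have "\<dots> = integral {0..pi} (\<lambda>x. u x * cos (a * x)) + 1 / a * integral {0..pi} (\<lambda>x. u' x * sin (a * x))"
    using cu u' a by (subst integral_add) (auto intro!: integrable_cont continuous_intros)
  finally show ?thesis by simp
qed

lemma ibp_sin:
  fixes u u' :: "real \<Rightarrow> real"
  assumes u: "\<And>x. (u has_real_derivative u' x) (at x)" and u': "continuous_on {0..pi} u'"
    and a: "a \<noteq> 0"
  shows "integral {0..pi} (\<lambda>x. u x * sin (a * x)) = (u 0 - u pi * cos (a * pi)) / a + 1 / a * integral {0..pi} (\<lambda>x. u' x * cos (a * x))"
proof -
  have cu: "continuous_on {0..pi} u" by (rule DERIV_continuous_on) (rule has_field_derivative_at_within[OF u])
  have "((\<lambda>x. u x * sin (a * x) - 1 / a * (u' x * cos (a * x))) has_integral (- u pi * cos (a * pi) / a - (- u 0 * cos (a * 0) / a))) {0..pi}"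
  proof (rule fundamental_theorem_of_calculus)
    fix x :: real
    have "((\<lambda>x. - u x * cos (a * x) / a) has_real_derivative (u x * sin (a * x) - 1 / a * (u' x * cos (a * x)))) (at x)"
      using a by (auto intro!: derivative_eq_intros u simp: field_simps)
    then show "((\<lambda>x. - u x * cos (a * x) / a) has_vector_derivative (u x * sin (a * x) - 1 / a * (u' x * cos (a * x)))) (at x within {0..pi})"
      by (simp add: has_real_derivative_iff_has_vector_derivative has_vector_derivative_at_within)
  qed simp
  then have "(u 0 - u pi * cos (a * pi)) / a = integral {0..pi} (\<lambda>x. u x * sin (a * x) - 1 / a * (u' x * cos (a * x)))"
    by (simp add: integral_unique diff_divide_distrib)
  also have "\<dots> = integral {0..pi} (\<lambda>x. u x * sin (a * x)) - 1 / a * integral {0..pi} (\<lambda>x. u' x * cos (a * x))"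
    using cu u' a by (subst integral_diff) (auto intro!: integrable_cont continuous_intros)
  finally show ?thesis by simp
qed

text \<open>The function \<open>exp (- c sin x)\<close> has total variation at most \<open>2\<close> on \<open>[0, \<pi>]\<close>, whatever
  \<open>c \<ge> 0\<close> is. This is why the bounds obtained below by integration by parts can be uniform in
  \<open>t\<close>.\<close>

lemma abs_cos_exp_integral:
  "((\<lambda>x. c * \<bar>cos x\<bar> * exp (- c * sin x)) has_integral 2 * (1 - exp (- c))) {0..pi}"
proof -
  have 1: "((\<lambda>x. c * \<bar>cos x\<bar> * exp (- c * sin x)) has_integral (- exp (- c * sin (pi/2)) - (- exp (- c * sin 0)))) {0..pi/2}"
  proof (rule fundamental_theorem_of_calculus)
    fix x assume x: "x \<in> {0..pi/2}"
    then have "0 \<le> cos x" by (intro cos_ge_zero) auto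
    then have "((\<lambda>x. - exp (- c * sin x)) has_real_derivative (c * \<bar>cos x\<bar> * exp (- c * sin x))) (at x)"
      by (auto intro!: derivative_eq_intros)
    then show "((\<lambda>x. - exp (- c * sin x)) has_vector_derivative (c * \<bar>cos x\<bar> * exp (- c * sin x))) (at x within {0..pi/2})"
      by (simp add: has_real_derivative_iff_has_vector_derivative has_vector_derivative_at_within)
  qed simp
  have 2: "((\<lambda>x. c * \<bar>cos x\<bar> * exp (- c * sin x)) has_integral (exp (- c * sin pi) - exp (- c * sin (pi/2)))) {pi/2..pi}"
  proof (rule fundamental_theorem_of_calculus)
    fix x assume x: "x \<in> {pi/2..pi}"
    have "0 \<le> cos (pi - x)" using x by (intro cos_ge_zero) auto
    then have "cos x \<le> 0" by (simp add: cos_diff)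
    then have "((\<lambda>x. exp (- c * sin x)) has_real_derivative (c * \<bar>cos x\<bar> * exp (- c * sin x))) (at x)"
      by (auto intro!: derivative_eq_intros)
    then show "((\<lambda>x. exp (- c * sin x)) has_vector_derivative (c * \<bar>cos x\<bar> * exp (- c * sin x))) (at x within {pi/2..pi})"
      by (simp add: has_real_derivative_iff_has_vector_derivative has_vector_derivative_at_within)
  qed simp
  have "((\<lambda>x. c * \<bar>cos x\<bar> * exp (- c * sin x)) has_integral ((- exp (- c * sin (pi/2)) - (- exp (- c * sin 0))) + (exp (- c * sin pi) - exp (- c * sin (pi/2))))) {0..pi}"
    by (rule has_integral_combine[OF _ _ 1 2]) auto
  then show ?thesis by (simp add: algebra_simps)
qed

lemma integral_abs_le:
  fixes f g :: "real \<Rightarrow> real"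
  assumes "continuous_on {0..pi} f" "(g has_integral B) {0..pi}" "\<And>x. x \<in> {0..pi} \<Longrightarrow> \<bar>f x\<bar> \<le> g x"
  shows "\<bar>integral {0..pi} f\<bar> \<le> B"
  using integral_norm_bound_integral[OF integrable_cont[OF assms(1)] has_integral_integrable[OF assms(2)]] assms
  by (simp add: integral_unique)

lemma sin_0_pi: "x \<in> {0..pi} \<Longrightarrow> 0 \<le> sin x" by (auto intro: sin_ge_zero)

lemma exp_le_1_0_pi: "0 \<le> t \<Longrightarrow> x \<in> {0..pi} \<Longrightarrow> exp (- 2 * t * sin x) \<le> 1"
  by (simp add: sin_0_pi)

lemma const_integral_pi: "((\<lambda>x. c) has_integral pi * c) {0..pi}"
  using has_integral_const_real[of c 0 pi] by simp

lemma pk_le_1: assumes "0 \<le> t" shows "\<bar>pk t k\<bar> \<le> 1"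
proof -
  have "\<bar>integral {0..pi} (\<lambda>x. exp (- 2 * t * sin x) * cos (2 * real_of_int k * x))\<bar> \<le> pi * 1"
  proof (rule integral_abs_le[OF _ const_integral_pi])
    fix x assume x: "x \<in> {0..pi}"
    show "\<bar>exp (- 2 * t * sin x) * cos (2 * real_of_int k * x)\<bar> \<le> 1"
      using exp_le_1_0_pi[OF assms x] abs_cos_le_one[of "2 * real_of_int k * x"] by (simp add: abs_mult mult_le_one)
  qed (intro continuous_intros)
  then show ?thesis by (simp add: pk_def abs_mult)
qed

lemma exp_deriv: "((\<lambda>x. exp (- 2 * t * sin x)) has_real_derivative (- (2 * t * cos x) * exp (- 2 * t * sin x))) (at x)"
  by (auto intro!: derivative_eq_intros)

lemma sin_2k_pi: "sin (2 * real_of_int k * pi) = 0"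
  using sin_zero_iff_int2 by (metis mult.assoc mult.commute of_int_mult of_int_numeral)

lemma cos_2k_pi: "cos (2 * real_of_int k * pi) = 1"
  using cos_int_2pin[of k] by (simp add: algebra_simps)

lemma cos_odd_pi: "cos ((2 * real_of_int k + 1) * pi) = - 1"
proof -
  have "(2 * real_of_int k + 1) * pi = 2 * real_of_int k * pi + pi" by (simp add: algebra_simps)
  then show ?thesis by (simp only: cos_add sin_2k_pi cos_2k_pi) simp
qed

lemma int_cos_exp_osc:
  assumes t: "0 \<le> t" and h: "continuous_on {0..pi} h" "\<And>x. \<bar>h x\<bar> \<le> 1"
  shows "\<bar>integral {0..pi} (\<lambda>x. - (2 * t * cos x) * exp (- 2 * t * sin x) * h x)\<bar> \<le> 2"
proof -
  have "\<bar>integral {0..pi} (\<lambda>x. - (2 * t * cos x) * exp (- 2 * t * sin x) * h x)\<bar> \<le> 2 * (1 - exp (- (2 * t)))"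
  proof (rule integral_abs_le[OF _ abs_cos_exp_integral])
    fix x
    have "\<bar>- (2 * t * cos x) * exp (- 2 * t * sin x) * h x\<bar> = 2 * t * \<bar>cos x\<bar> * exp (- (2 * t) * sin x) * \<bar>h x\<bar>"
      using t by (simp add: abs_mult)
    also have "\<dots> \<le> 2 * t * \<bar>cos x\<bar> * exp (- (2 * t) * sin x) * 1" using t h by (intro mult_left_mono) auto
    finally show "\<bar>- (2 * t * cos x) * exp (- 2 * t * sin x) * h x\<bar> \<le> 2 * t * \<bar>cos x\<bar> * exp (- (2 * t) * sin x)" by simp
  qed (intro continuous_intros h)
  also have "\<dots> \<le> 2" by simp
  finally show ?thesis .
qed

text \<open>One integration by parts; the boundary term survives because the frequency is odd, so
  there is no better decay in \<open>k\<close> at a fixed \<open>t\<close>.\<close>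

lemma qk_bound: assumes t: "0 \<le> t" shows "\<bar>qk t k\<bar> \<le> 2 / \<bar>2 * real_of_int k + 1\<bar>"
proof -
  define a where "a = 2 * real_of_int k + 1"
  have a: "a \<noteq> 0"
  proof
    assume "a = 0"
    then have "real_of_int (2 * k + 1) = real_of_int 0" by (simp add: a_def)
    then have "2 * k + 1 = 0" by (simp only: of_int_eq_iff)
    then show False by presburger
  qed
  have c: "continuous_on {0..pi} (\<lambda>x. - (2 * t * cos x) * exp (- 2 * t * sin x))" by (intro continuous_intros)
  define J where "J = integral {0..pi} (\<lambda>x. - (2 * t * cos x) * exp (- 2 * t * sin x) * cos (a * x))"
  have J: "\<bar>J\<bar> \<le> 2" unfolding J_def by (rule int_cos_exp_osc[OF t]) (auto intro!: continuous_intros)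
  have "integral {0..pi} (\<lambda>x. exp (- 2 * t * sin x) * sin (a * x)) = (1 - cos (a * pi)) / a + 1 / a * J"
    unfolding J_def using ibp_sin[OF exp_deriv c a] by simp
  also have "\<dots> = (2 + J) / a" by (simp add: a_def cos_odd_pi add_divide_distrib)
  finally have "\<bar>integral {0..pi} (\<lambda>x. exp (- 2 * t * sin x) * sin (a * x))\<bar> = \<bar>2 + J\<bar> / \<bar>a\<bar>" by simp
  also have "\<dots> \<le> 4 / \<bar>a\<bar>" using J by (intro divide_right_mono) auto
  finally have "\<bar>integral {0..pi} (\<lambda>x. exp (- 2 * t * sin x) * sin (a * x))\<bar> \<le> 4 / \<bar>a\<bar>" .
  then have "1 / pi * \<bar>integral {0..pi} (\<lambda>x. exp (- 2 * t * sin x) * sin (a * x))\<bar> \<le> 1 / 2 * (4 / \<bar>a\<bar>)"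
    using pi_ge_two by (intro mult_mono) (auto simp: field_simps)
  then show ?thesis by (simp add: qk_def abs_mult a_def)
qed

lemma pk_ibp:
  assumes k: "k \<noteq> 0"
  shows "integral {0..pi} (\<lambda>x. exp (- 2 * t * sin x) * cos (2 * real_of_int k * x)) =
     - (1 / (2 * real_of_int k)) * integral {0..pi} (\<lambda>x. - (2 * t * cos x) * exp (- 2 * t * sin x) * sin (2 * real_of_int k * x))"
proof (rule ibp_cos[OF exp_deriv])
  show "continuous_on {0..pi} (\<lambda>x. - (2 * t * cos x) * exp (- 2 * t * sin x))" by (intro continuous_intros)
qed (use k sin_2k_pi in auto)

text \<open>The bounds on \<open>pk t k\<close>: \<open>1 / \<bar>k\<bar>\<close> by one integration
  by parts, \<open>t / k\<^sup>2\<close> by two, in which the factor \<open>t\<close> comes out of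
  the first derivative, and \<open>2 / t\<close> from the decay of the exponential away from the
  endpoints. Together they give the Poisson kernel bound at scale \<open>max 1 t\<close>.\<close>

lemma pk_bound1: assumes t: "0 \<le> t" and k: "k \<noteq> 0" shows "\<bar>pk t k\<bar> \<le> 1 / \<bar>real_of_int k\<bar>"
proof -
  have "\<bar>integral {0..pi} (\<lambda>x. exp (- 2 * t * sin x) * cos (2 * real_of_int k * x))\<bar> \<le> 1 / (2 * \<bar>real_of_int k\<bar>) * 2"
    unfolding pk_ibp[OF k] abs_mult
    by (intro mult_mono int_cos_exp_osc t) (auto intro!: continuous_intros)
  then have "1 / pi * \<bar>integral {0..pi} (\<lambda>x. exp (- 2 * t * sin x) * cos (2 * real_of_int k * x))\<bar> \<le> 1 * (1 / (2 * \<bar>real_of_int k\<bar>) * 2)"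
    using pi_ge_two by (intro mult_mono) auto
  then show ?thesis by (simp add: pk_def abs_mult)
qed

lemma pk_bound2: assumes t: "0 \<le> t" and k: "k \<noteq> 0" shows "\<bar>pk t k\<bar> \<le> 3 * t / (real_of_int k)\<^sup>2"
proof -
  define a where "a = 2 * real_of_int k"
  have a: "a \<noteq> 0" using k by (simp add: a_def)
  let ?F = "\<lambda>x. exp (- 2 * t * sin x)"
  have d: "((\<lambda>x. cos x * ?F x) has_real_derivative (- sin x * ?F x + cos x * (- (2 * t * cos x) * ?F x))) (at x)" for x
    by (auto intro!: derivative_eq_intros)
  have "\<bar>integral {0..pi} (\<lambda>x. (- sin x * ?F x + cos x * (- (2 * t * cos x) * ?F x)) * cos (a * x))\<bar> \<le> pi * 1 + 2 * (1 - exp (- (2 * t)))"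
  proof (rule integral_abs_le[OF _ has_integral_add[OF const_integral_pi abs_cos_exp_integral]])
    fix x assume x: "x \<in> {0..pi}"
    have "\<bar>(- sin x * ?F x + cos x * (- (2 * t * cos x) * ?F x)) * cos (a * x)\<bar> \<le> \<bar>- sin x * ?F x + cos x * (- (2 * t * cos x) * ?F x)\<bar> * 1"
      unfolding abs_mult by (intro mult_left_mono abs_cos_le_one) auto
    also have "\<dots> \<le> \<bar>sin x\<bar> * ?F x + \<bar>cos x\<bar> * (2 * t * \<bar>cos x\<bar> * ?F x)"
      by (rule order_trans[OF eq_refl[OF mult_1_right] order_trans[OF abs_triangle_ineq]]) (use t in \<open>simp add: abs_mult\<close>)
    also have "\<dots> \<le> 1 * 1 + 1 * (2 * t * \<bar>cos x\<bar> * ?F x)"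
      using exp_le_1_0_pi[OF t x] t by (intro add_mono mult_mono) auto
    finally show "\<bar>(- sin x * ?F x + cos x * (- (2 * t * cos x) * ?F x)) * cos (a * x)\<bar> \<le> 1 + 2 * t * \<bar>cos x\<bar> * exp (- (2 * t) * sin x)"
      by simp
  qed (intro continuous_intros)
  also have "pi * 1 + 2 * (1 - exp (- (2 * t))) \<le> 6"
  proof -
    have "2 * (1 - exp (- (2 * t))) \<le> 2" by simp
    then show ?thesis using pi_less_4 by linarith
  qed
  finally have i1: "\<bar>integral {0..pi} (\<lambda>x. (- sin x * ?F x + cos x * (- (2 * t * cos x) * ?F x)) * cos (a * x))\<bar> \<le> 6" .
  define J where "J = integral {0..pi} (\<lambda>x. (- sin x * ?F x + cos x * (- (2 * t * cos x) * ?F x)) * cos (a * x))"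
  have c: "continuous_on {0..pi} (\<lambda>x. - sin x * ?F x + cos x * (- (2 * t * cos x) * ?F x))" by (intro continuous_intros)
  have "integral {0..pi} (\<lambda>x. cos x * ?F x * sin (a * x)) = (1 + cos (a * pi)) / a + 1 / a * J"
    unfolding J_def using ibp_sin[OF d c a] by simp
  also have "\<dots> = (2 + J) / a" by (simp add: a_def cos_2k_pi add_divide_distrib)
  finally have "\<bar>integral {0..pi} (\<lambda>x. cos x * ?F x * sin (a * x))\<bar> = \<bar>2 + J\<bar> / \<bar>a\<bar>" by simp
  also have "\<dots> \<le> 8 / \<bar>a\<bar>" using i1[folded J_def] by (intro divide_right_mono) auto
  finally have i2: "\<bar>integral {0..pi} (\<lambda>x. cos x * ?F x * sin (a * x))\<bar> \<le> 8 / \<bar>a\<bar>" .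
  have "integral {0..pi} (\<lambda>x. - (2 * t * cos x) * ?F x * sin (a * x)) = integral {0..pi} (\<lambda>x. (- 2 * t) * (cos x * ?F x * sin (a * x)))"
    by (simp add: algebra_simps)
  also have "\<dots> = (- 2 * t) * integral {0..pi} (\<lambda>x. cos x * ?F x * sin (a * x))" by (rule integral_mult_right)
  finally have "\<bar>pk t k\<bar> = 1 / pi * (1 / \<bar>a\<bar> * (2 * t * \<bar>integral {0..pi} (\<lambda>x. cos x * ?F x * sin (a * x))\<bar>))"
    unfolding pk_def pk_ibp[OF k] unfolding a_def[symmetric] using t by (simp only: abs_mult) (simp add: abs_mult)
  also have "\<dots> \<le> 1 / 2 * (1 / \<bar>a\<bar> * (2 * t * (8 / \<bar>a\<bar>)))"
    using i2 t pi_ge_two by (intro mult_mono) (auto simp: field_simps)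
  also have "\<dots> = 2 * t / (real_of_int k)\<^sup>2" by (simp add: a_def power2_eq_square field_simps)
  also have "\<dots> \<le> 3 * t / (real_of_int k)\<^sup>2" using t by (intro divide_right_mono) auto
  finally show ?thesis .
qed

text \<open>Where \<open>\<bar>cos x\<bar> \<ge> 1/2\<close>, the integrand is dominated by a
  derivative; elsewhere \<open>sin x \<ge> 1/2\<close> and it is at most \<open>exp (- t)\<close>.\<close>

lemma pk_bound3: assumes t: "0 < t" shows "\<bar>pk t k\<bar> \<le> 2 / t"
proof -
  let ?F = "\<lambda>x. exp (- 2 * t * sin x)"
  have "\<bar>integral {0..pi} (\<lambda>x. exp (- 2 * t * sin x) * cos (2 * real_of_int k * x))\<bar> \<le> 1 / t * (2 * (1 - exp (- (2 * t)))) + pi * exp (- t)"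
  proof (rule integral_abs_le[OF _ has_integral_add[OF has_integral_mult_right[OF abs_cos_exp_integral] const_integral_pi]])
    fix x assume x: "x \<in> {0..pi}"
    have "\<bar>?F x * cos (2 * real_of_int k * x)\<bar> \<le> ?F x * 1" unfolding abs_mult abs_exp_cancel by (intro mult_left_mono) auto
    also have "\<dots> \<le> 2 * \<bar>cos x\<bar> * ?F x + exp (- t)"
    proof (cases "1 / 2 \<le> \<bar>cos x\<bar>")
      case True
      then have "1 * ?F x \<le> 2 * \<bar>cos x\<bar> * ?F x" by (intro mult_right_mono) auto
      then show ?thesis using exp_ge_zero[of "- t"] by linarith
    next
      case False
      then have "\<bar>cos x\<bar>\<^sup>2 \<le> (1/2)\<^sup>2" by (intro power_mono) auto
      then have "(cos x)\<^sup>2 \<le> 1 / 4" by (simp add: power2_eq_square)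
      then have "(1/2)\<^sup>2 \<le> (sin x)\<^sup>2" using sin_cos_squared_add[of x] by (simp add: power2_eq_square)
      then have "1 / 2 \<le> sin x" using sin_0_pi[OF x] by (rule power2_le_imp_le)
      then have "?F x \<le> exp (- t)" using t by simp
      then show ?thesis by (simp add: add_increasing)
    qed
    also have "\<dots> = 1 / t * (2 * t * \<bar>cos x\<bar> * exp (- (2 * t) * sin x)) + exp (- t)" using t by simp
    finally show "\<bar>?F x * cos (2 * real_of_int k * x)\<bar> \<le> 1 / t * (2 * t * \<bar>cos x\<bar> * exp (- (2 * t) * sin x)) + exp (- t)" .
  qed (intro continuous_intros)
  also have "\<dots> \<le> 1 / t * 2 + pi * (1 / t)"
  proof (intro add_mono mult_left_mono)
    have "t \<le> exp t" using exp_ge_add_one_self[of t] by linarith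
    then show "exp (- t) \<le> 1 / t" using t by (simp add: exp_minus field_simps)
  qed (use t in auto)
  also have "\<dots> \<le> pi * (2 / t)" using t pi_ge_two by (simp add: field_simps)
  finally have "1 / pi * \<bar>integral {0..pi} (\<lambda>x. exp (- 2 * t * sin x) * cos (2 * real_of_int k * x))\<bar> \<le> 1 / pi * (pi * (2 / t))"
    by (intro mult_left_mono) auto
  then show ?thesis by (simp add: pk_def abs_mult)
qed

text \<open>The smoothness of the conjugate kernel, uniformly in \<open>t\<close>. By the
  Cauchy--Riemann equation the difference is a cosine integral of \<open>- 2 sin x exp (-2 t sin
  x)\<close>. This function vanishes at the endpoints, so that two integrations by parts are
  possible, and its second derivative is bounded in \<open>L\<^sup>1\<close>: polynomials in
  \<open>t sin x\<close> are absorbed by half of the exponential, which leaves \<open>t \<bar>cos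
  x\<bar> exp (- t sin x)\<close>.\<close>

lemma qk_diff_bound: assumes t: "0 \<le> t" and k: "k \<noteq> 0" shows "\<bar>qk t k - qk t (k - 1)\<bar> \<le> 6 / (real_of_int k)\<^sup>2"
proof -
  define a where "a = 2 * real_of_int k"
  have a: "a \<noteq> 0" using k by (simp add: a_def)
  let ?F = "\<lambda>x. exp (- 2 * t * sin x)"
  let ?g1 = "\<lambda>x. cos x * (1 - 2 * t * sin x) * ?F x"
  let ?g2 = "\<lambda>x. - sin x * (1 - 2 * t * sin x) * ?F x - 2 * t * (cos x)\<^sup>2 * (2 - 2 * t * sin x) * ?F x"
  have d1: "((\<lambda>x. sin x * ?F x) has_real_derivative ?g1 x) (at x)" for x
    by (auto intro!: derivative_eq_intros simp: algebra_simps)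
  have d2: "(?g1 has_real_derivative ?g2 x) (at x)" for x
    by (auto intro!: derivative_eq_intros simp: algebra_simps power2_eq_square)
  have "\<bar>integral {0..pi} (\<lambda>x. ?g2 x * cos (a * x))\<bar> \<le> pi * 1 + 6 * (2 * (1 - exp (- t)))"
  proof (rule integral_abs_le[OF _ has_integral_add[OF const_integral_pi has_integral_mult_right[OF abs_cos_exp_integral]]])
    fix x assume x: "x \<in> {0..pi}"
    define y where "y = 2 * t * sin x"
    have y: "0 \<le> y" using t sin_0_pi[OF x] by (simp add: y_def)
    have Fy: "?F x = exp (- y)" by (simp add: y_def)
    have e1: "\<bar>1 - y\<bar> * exp (- y) \<le> 1"
    proof -
      have "\<bar>1 - y\<bar> \<le> exp y" using exp_ge_add_one_self[of y] y by linarith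
      then have "\<bar>1 - y\<bar> * exp (- y) \<le> exp y * exp (- y)" by (intro mult_right_mono) auto
      then show ?thesis by (simp add: exp_minus)
    qed
    have e2: "\<bar>2 - y\<bar> * exp (- y) \<le> 3 * exp (- (y / 2))"
    proof -
      have "\<bar>2 - y\<bar> \<le> 3 * exp (y / 2)" using exp_ge_add_one_self[of "y/2"] y by linarith
      then have "\<bar>2 - y\<bar> * exp (- y) \<le> 3 * exp (y / 2) * exp (- y)" by (intro mult_right_mono) auto
      also have "\<dots> = 3 * exp (- (y / 2))" by (simp add: exp_add[symmetric] mult.assoc)
      finally show ?thesis .
    qed
    have "\<bar>?g2 x * cos (a * x)\<bar> \<le> \<bar>?g2 x\<bar> * 1" unfolding abs_mult by (intro mult_left_mono abs_cos_le_one) auto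
    also have "\<dots> \<le> \<bar>sin x\<bar> * (\<bar>1 - y\<bar> * exp (- y)) + 2 * t * (cos x)\<^sup>2 * (\<bar>2 - y\<bar> * exp (- y))"
      unfolding y_def[symmetric] Fy
      by (rule order_trans[OF eq_refl[OF mult_1_right] order_trans[OF abs_triangle_ineq4]]) (use t in \<open>simp add: abs_mult\<close>)
    also have "\<dots> \<le> 1 * 1 + 2 * t * \<bar>cos x\<bar> * (3 * exp (- (y / 2)))"
    proof (rule add_mono[OF mult_mono[OF _ e1] mult_mono[OF mult_left_mono e2]])
      have "\<bar>cos x\<bar> * \<bar>cos x\<bar> \<le> \<bar>cos x\<bar> * 1" by (intro mult_left_mono) auto
      then show "(cos x)\<^sup>2 \<le> \<bar>cos x\<bar>" by (simp add: power2_eq_square)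
    qed (use t in auto)
    finally show "\<bar>?g2 x * cos (a * x)\<bar> \<le> 1 + 6 * (t * \<bar>cos x\<bar> * exp (- t * sin x))" by (simp add: y_def)
  qed (intro continuous_intros)
  also have "pi * 1 + 6 * (2 * (1 - exp (- t))) \<le> 16"
  proof -
    have "6 * (2 * (1 - exp (- t))) \<le> 12" by simp
    then show ?thesis using pi_less_4 by linarith
  qed
  finally have i1: "\<bar>integral {0..pi} (\<lambda>x. ?g2 x * cos (a * x))\<bar> \<le> 16" .
  define J where "J = integral {0..pi} (\<lambda>x. ?g2 x * cos (a * x))"
  have c1: "continuous_on {0..pi} ?g1" and c2: "continuous_on {0..pi} ?g2" by (intro continuous_intros)+
  have "integral {0..pi} (\<lambda>x. ?g1 x * sin (a * x)) = (1 + cos (a * pi)) / a + 1 / a * J"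
    unfolding J_def using ibp_sin[OF d2 c2 a] by simp
  also have "\<dots> = (2 + J) / a" by (simp add: a_def cos_2k_pi add_divide_distrib)
  finally have "\<bar>integral {0..pi} (\<lambda>x. ?g1 x * sin (a * x))\<bar> = \<bar>2 + J\<bar> / \<bar>a\<bar>" by simp
  also have "\<dots> \<le> 18 / \<bar>a\<bar>" using i1[folded J_def] by (intro divide_right_mono) auto
  finally have i2: "\<bar>integral {0..pi} (\<lambda>x. ?g1 x * sin (a * x))\<bar> \<le> 18 / \<bar>a\<bar>" .
  have i3: "integral {0..pi} (\<lambda>x. sin x * ?F x * cos (a * x)) = - (1 / a) * integral {0..pi} (\<lambda>x. ?g1 x * sin (a * x))"
    by (rule ibp_cos[OF d1 c1 a]) (simp add: a_def sin_2k_pi)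
  have "qk t k - qk t (k - 1) = 1 / pi * integral {0..pi} (\<lambda>x. - 2 * sin x * (?F x * cos (2 * real_of_int k * x)))"
  proof -
    have "((\<lambda>t. pk t k) has_real_derivative 1 / pi * integral {0..pi} (\<lambda>x. - 2 * sin x * (?F x * cos (2 * real_of_int k * x)))) (at t)"
      unfolding pk_def by (intro DERIV_cmult leibniz_0_pi continuous_intros)
    with pk_deriv show ?thesis by (rule DERIV_unique)
  qed
  also have "integral {0..pi} (\<lambda>x. - 2 * sin x * (?F x * cos (2 * real_of_int k * x))) = integral {0..pi} (\<lambda>x. - 2 * (sin x * ?F x * cos (a * x)))"
    by (simp add: a_def mult.assoc)
  also have "\<dots> = - 2 * integral {0..pi} (\<lambda>x. sin x * ?F x * cos (a * x))" by (rule integral_mult_right)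
  finally have "\<bar>qk t k - qk t (k - 1)\<bar> = 1 / pi * (2 * (1 / \<bar>a\<bar> * \<bar>integral {0..pi} (\<lambda>x. ?g1 x * sin (a * x))\<bar>))"
    unfolding i3 by (simp add: abs_mult)
  also have "\<dots> \<le> 1 / 2 * (2 * (1 / \<bar>a\<bar> * (18 / \<bar>a\<bar>)))"
    using i2 pi_ge_two by (intro mult_mono) (auto simp: field_simps)
  also have "\<dots> = 9 / 2 / (real_of_int k)\<^sup>2" by (simp add: a_def power2_eq_square field_simps)
  also have "\<dots> \<le> 6 / (real_of_int k)\<^sup>2" by (intro divide_right_mono) auto
  finally show ?thesis .
qed

lemma qk_0: "qk 0 k = - (1 / pi) * (1 / (real_of_int k + 1 / 2))"
proof -
  define a where "a = 2 * real_of_int k + 1"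
  have a: "a \<noteq> 0"
  proof
    assume "a = 0"
    then have "real_of_int (2 * k + 1) = real_of_int 0" by (simp add: a_def)
    then have "2 * k + 1 = 0" by (simp only: of_int_eq_iff)
    then show False by presburger
  qed
  have "integral {0..pi} (\<lambda>x. 1 * sin (a * x)) = (1 - 1 * cos (a * pi)) / a + 1 / a * integral {0..pi} (\<lambda>x. 0 * cos (a * x))"
    by (rule ibp_sin) (use a in auto)
  also have "\<dots> = 2 / a" by (simp add: a_def cos_odd_pi)
  finally have "qk 0 k = - (1 / pi) * (2 / a)" by (simp add: qk_def a_def)
  also have "2 / a = 1 / (real_of_int k + 1 / 2)" using a by (simp add: a_def field_simps)
  finally show ?thesis .
qed

lemma half_int_abs: "1 + \<bar>real_of_int k\<bar> \<le> 3 * \<bar>2 * real_of_int k + 1\<bar>"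
proof -
  have "1 + \<bar>k\<bar> \<le> 3 * \<bar>2 * k + 1\<bar>" by presburger
  then have "real_of_int (1 + \<bar>k\<bar>) \<le> real_of_int (3 * \<bar>2 * k + 1\<bar>)" by (simp only: of_int_le_iff)
  then show ?thesis by simp
qed

lemma qk_decay: assumes t: "0 \<le> t" shows "\<bar>qk t k\<bar> \<le> 6 / (1 + \<bar>real_of_int k\<bar>)"
proof -
  have "2 / \<bar>2 * real_of_int k + 1\<bar> \<le> 6 / (1 + \<bar>real_of_int k\<bar>)"
  proof -
    have "0 < 3 * \<bar>2 * real_of_int k + 1\<bar>"
      by (rule less_le_trans[OF _ half_int_abs]) (simp add: add_pos_nonneg)
    then have "0 < \<bar>2 * real_of_int k + 1\<bar>" by simp
    then show ?thesis using half_int_abs[of k] by (simp add: field_simps)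
  qed
  with qk_bound[OF t, of k] show ?thesis by linarith
qed

lemma pk_decay: assumes t: "0 \<le> t" shows "\<bar>pk t k\<bar> \<le> 2 / (1 + \<bar>real_of_int k\<bar>)"
proof (cases "k = 0")
  case True then show ?thesis using pk_le_1[OF t, of k] by simp
next
  case False
  then have "1 \<le> \<bar>real_of_int k\<bar>" by linarith
  then have "1 / \<bar>real_of_int k\<bar> \<le> 2 / (1 + \<bar>real_of_int k\<bar>)" by (simp add: field_simps)
  with pk_bound1[OF t False] show ?thesis by linarith
qed

text \<open>The scale is \<open>max 1 t\<close>, not \<open>t\<close>, because at small times the
  kernel on the integers cannot concentrate below unit scale. Inside \<open>\<bar>k\<bar> \<le> max
  1 t\<close> the size bounds are used, outside the decay \<open>t / k\<^sup>2\<close>.\<close>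

lemma pk_poisson_bound: assumes t: "0 \<le> t"
  shows "\<bar>pk t k\<bar> \<le> 12 * max 1 t / (max 1 t + \<bar>real_of_int k\<bar>)\<^sup>2"
proof -
  define T where "T = max 1 t"
  have T: "1 \<le> T" "t \<le> T" by (auto simp: T_def)
  define y where "y = \<bar>real_of_int k\<bar>"
  show ?thesis unfolding T_def[symmetric] y_def[symmetric]
  proof (cases "y \<le> T")
    case True
    have "\<bar>pk t k\<bar> \<le> 2 / T"
    proof (cases "t \<le> 1")
      case True
      then have "T = 1" by (simp add: T_def)
      then show ?thesis using pk_le_1[OF t, of k] by simp
    next
      case False
      then have "T = t" by (simp add: T_def)
      then show ?thesis using pk_bound3[of t k] False by simp
    qed
    also have "2 / T = 8 * T / (2 * T)\<^sup>2" using T by (simp add: power2_eq_square)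
    also have "\<dots> \<le> 12 * T / (T + y)\<^sup>2"
    proof (rule frac_le)
      show "(T + y)\<^sup>2 \<le> (2 * T)\<^sup>2" using True T by (intro power_mono) (auto simp: y_def)
      show "0 < (T + y)\<^sup>2" using T by (simp add: y_def)
    qed (use T in auto)
    finally show "\<bar>pk t k\<bar> \<le> 12 * T / (T + y)\<^sup>2" .
  next
    case False
    then have y0: "0 < y" "T < y" using T by auto
    then have k: "k \<noteq> 0" by (auto simp: y_def)
    have "\<bar>pk t k\<bar> \<le> 3 * t / (real_of_int k)\<^sup>2" by (rule pk_bound2[OF t k])
    also have "\<dots> = 3 * t / y\<^sup>2" by (simp add: y_def)
    also have "\<dots> \<le> 3 * T / y\<^sup>2" using T by (intro divide_right_mono) auto
    also have "\<dots> = 12 * T / (2 * y)\<^sup>2" by (simp add: power2_eq_square)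
    also have "\<dots> \<le> 12 * T / (T + y)\<^sup>2"
    proof (rule frac_le)
      show "(T + y)\<^sup>2 \<le> (2 * y)\<^sup>2" using y0 T by (intro power_mono) auto
      show "0 < (T + y)\<^sup>2" using T y0 by simp
    qed (use T in auto)
    finally show "\<bar>pk t k\<bar> \<le> 12 * T / (T + y)\<^sup>2" .
  qed
qed

section \<open>Exchanging sum and integral, and subordination\<close>

text \<open>Fubini's theorem for an unordered sum over the integers. The series need only converge
  almost everywhere, so the exceptional null set is removed first, by setting the terms to zero
  there. The unordered sum has the value \<open>0\<close> on that set by convention, because for complex series
  convergence without order is absolute convergence; so the value of the sum does not change.\<close>

lemma integral_infsum_int:
  fixes h :: "int \<Rightarrow> 'a \<Rightarrow> complex"
  assumes int: "\<And>m. integrable M (h m)"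
    and sm: "(\<lambda>m. \<integral>x. cmod (h m x) \<partial>M) summable_on UNIV"
  shows "((\<lambda>m. \<integral>x. h m x \<partial>M) has_sum (\<integral>x. (\<Sum>\<^sub>\<infinity>m. h m x) \<partial>M)) UNIV"
proof -
  define g where "g = (\<lambda>n. h (int_decode n))"
  have gi [measurable]: "integrable M (g n)" for n by (simp add: g_def int)
  have gm [measurable]: "g n \<in> borel_measurable M" for n using gi by (rule borel_measurable_integrable)
  define N where "N = (\<lambda>x. \<Sum>n. ennreal (cmod (g n x)))"
  have Nm [measurable]: "N \<in> borel_measurable M" unfolding N_def by measurable
  have bij: "bij_betw int_decode UNIV UNIV" by (rule bij_int_decode)
  have sg: "summable (\<lambda>n. \<integral>x. cmod (g n x) \<partial>M)"
  proof -
    have "(\<lambda>n. \<integral>x. cmod (g n x) \<partial>M) summable_on UNIV"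
      unfolding g_def using summable_on_reindex_bij_betw[OF bij, of "\<lambda>m. \<integral>x. cmod (h m x) \<partial>M"] sm by simp
    then show ?thesis by (rule summable_on_imp_summable)
  qed
  have Nfin: "AE x in M. N x \<noteq> \<infinity>"
  proof (rule nn_integral_PInf_AE)
    have "(\<integral>\<^sup>+x. N x \<partial>M) = (\<Sum>n. \<integral>\<^sup>+x. ennreal (cmod (g n x)) \<partial>M)"
      unfolding N_def by (rule nn_integral_suminf) measurable
    also have "\<dots> = (\<Sum>n. ennreal (\<integral>x. cmod (g n x) \<partial>M))"
      by (intro arg_cong[where f = suminf] ext nn_integral_eq_integral integrable_norm gi) auto
    also have "\<dots> \<noteq> \<infinity>" unfolding infinity_ennreal_def by (rule ennreal_suminf_neq_top[OF sg]) simp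
    finally show "(\<integral>\<^sup>+x. N x \<partial>M) \<noteq> \<infinity>" .
  qed measurable
  have Nsum: "N x \<noteq> \<infinity> \<longleftrightarrow> summable (\<lambda>n. cmod (g n x))" for x
    unfolding N_def infinity_ennreal_def
    by (rule iffI; (rule summable_suminf_not_top ennreal_suminf_neq_top; simp))
  define k where "k = (\<lambda>n x. if N x = \<infinity> then 0 else g n x)"
  have km [measurable]: "k n \<in> borel_measurable M" for n unfolding k_def by measurable
  have kAE: "AE x in M. g n x = k n x" for n using Nfin by eventually_elim (simp add: k_def)
  have ki: "integrable M (k n)" for n using gi[of n] kAE[of n] by (subst integrable_cong_AE[symmetric]) auto
  have knorm: "(\<integral>x. cmod (k n x) \<partial>M) = (\<integral>x. cmod (g n x) \<partial>M)" for n
    by (rule integral_cong_AE) (use kAE[of n] in \<open>auto elim: eventually_mono\<close>)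
  have ksum: "summable (\<lambda>n. cmod (k n x))" for x using Nsum[of x] by (cases "N x = \<infinity>") (auto simp: k_def)
  have sums: "(\<lambda>n. integral\<^sup>L M (k n)) sums (\<integral>x. (\<Sum>n. k n x) \<partial>M)"
    by (rule sums_integral) (use ki ksum sg knorm in auto)
  have inf: "(\<Sum>n. k n x) = (\<Sum>\<^sub>\<infinity>m. h m x)" for x
  proof (cases "N x = \<infinity>")
    case True
    have "\<not> (\<lambda>m. h m x) summable_on UNIV"
    proof
      assume "(\<lambda>m. h m x) summable_on UNIV"
      then have "(\<lambda>m. cmod (h m x)) summable_on UNIV" by (simp add: summable_on_iff_abs_summable_on_complex)
      then have "(\<lambda>n. cmod (g n x)) summable_on UNIV"
        unfolding g_def using summable_on_reindex_bij_betw[OF bij, of "\<lambda>m. cmod (h m x)"] by simp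
      then have "summable (\<lambda>n. cmod (g n x))" by (rule summable_on_imp_summable)
      with True Nsum[of x] show False by simp
    qed
    then show ?thesis using True by (simp add: k_def infsum_not_exists)
  next
    case False
    then have sn: "summable (\<lambda>n. cmod (g n x))" using Nsum[of x] by simp
    then have "((\<lambda>n. g n x) has_sum (\<Sum>n. g n x)) UNIV"
      by (rule norm_summable_imp_has_sum) (rule summable_sums[OF summable_norm_cancel[OF sn]])
    then have "((\<lambda>m. h m x) has_sum (\<Sum>n. g n x)) UNIV"
      unfolding g_def using has_sum_reindex_bij_betw[OF bij, of "\<lambda>m. h m x"] by simp
    then show ?thesis using False by (simp add: k_def infsumI)
  qed
  have eqi: "integral\<^sup>L M (k n) = integral\<^sup>L M (g n)" for n
    by (rule integral_cong_AE) (use kAE[of n] in \<open>auto elim: eventually_mono\<close>)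
  have "summable (\<lambda>n. cmod (integral\<^sup>L M (g n)))"
    by (rule summable_comparison_test'[OF sg, of 0]) (auto intro: integral_norm_bound)
  then have "((\<lambda>n. integral\<^sup>L M (g n)) has_sum (\<integral>x. (\<Sum>\<^sub>\<infinity>m. h m x) \<partial>M)) UNIV"
    using sums[unfolded inf eqi] by (rule norm_summable_imp_has_sum)
  then show ?thesis
    unfolding g_def using has_sum_reindex_bij_betw[OF bij, of "\<lambda>m. integral\<^sup>L M (h m)"] by simp
qed

lemma gaussian_antiderivative:
  obtains G :: "real \<Rightarrow> real"
  where "\<And>y. (G has_real_derivative exp (- y\<^sup>2)) (at y)" "(G \<longlongrightarrow> sqrt pi / 2) at_top"
    "(G \<longlongrightarrow> - (sqrt pi / 2)) at_bot" "G 0 = 0"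
proof -
  define G where "G = (\<lambda>u::real. LBINT x=ereal 0..ereal u. exp (- x\<^sup>2) :: real)"
  have d: "(G has_real_derivative exp (- y\<^sup>2)) (at y)" for y
  proof -
    have "(G has_vector_derivative exp (- y\<^sup>2)) (at y within {- \<bar>y\<bar> - 1..\<bar>y\<bar> + 1})"
      unfolding G_def by (rule interval_integral_FTC2) (auto intro!: continuous_intros)
    moreover have "at y within {- \<bar>y\<bar> - 1..\<bar>y\<bar> + 1} = at y"
      by (rule at_within_Icc_at) auto
    ultimately show ?thesis by (simp add: has_real_derivative_iff_has_vector_derivative)
  qed
  have G0: "G 0 = 0" by (simp add: G_def)
  have int: "set_integrable lborel {0..} (\<lambda>x::real. exp (- x\<^sup>2))" "(LBINT x:{0..}. exp (- x\<^sup>2)) = sqrt pi / 2"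
    using gaussian_moment_0 by (auto simp: set_integrable_def set_lebesgue_integral_def has_bochner_integral_iff)
  have top: "(G \<longlongrightarrow> sqrt pi / 2) at_top"
  proof -
    have "((\<lambda>b. LBINT x:{0..b}. exp (- x\<^sup>2) :: real) \<longlongrightarrow> (LBINT x:{0..}. exp (- x\<^sup>2))) at_top"
      by (rule tendsto_set_lebesgue_integral_at_top) (use int in auto)
    moreover have "\<forall>\<^sub>F b in at_top. (LBINT x:{0..b}. exp (- x\<^sup>2)) = G b"
      using eventually_ge_at_top[of 0] by eventually_elim (simp add: G_def interval_integral_Icc)
    ultimately show ?thesis using int by (simp add: tendsto_cong)
  qed
  have odd: "G (- y) = - G y" for y
  proof -
    have "((\<lambda>y. G (- y) + G y) has_real_derivative 0) (at y)" for y
    proof -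
      have "((\<lambda>y. G (- y)) has_real_derivative - exp (- y\<^sup>2)) (at y)"
        using d[of "- y"] by (simp add: DERIV_mirror)
      from DERIV_add[OF this d[of y]] show ?thesis by simp
    qed
    then have "G (- y) + G y = G (- 0) + G 0" by (intro DERIV_isconst_all[of "\<lambda>y. G (- y) + G y"] allI)
    then show ?thesis using G0 by simp
  qed
  have bot: "(G \<longlongrightarrow> - (sqrt pi / 2)) at_bot"
  proof -
    have "((\<lambda>x. - G (- x)) \<longlongrightarrow> - (sqrt pi / 2)) at_bot"
      by (intro tendsto_minus filterlim_compose[OF top] filterlim_uminus_at_top_at_bot)
    then show ?thesis using odd by simp
  qed
  show ?thesis by (rule that[OF d top bot G0])
qed

text \<open>The integrand has an explicit antiderivative in terms of that of the Gaussian: the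
  derivatives of \<open>sqrt u \<plusminus> a / sqrt u\<close>, multiplied by the Gaussian at these
  points and by \<open>exp (\<plusminus> 2 a)\<close>, have the same exponential factor, and the
  terms with \<open>a\<close> cancel.\<close>

lemma subordination:
  assumes s: "0 \<le> s"
  shows "set_integrable lborel {0<..} (\<lambda>u. exp (- u) / sqrt u * exp (- (s\<^sup>2 / (4 * u))))"
    and "(LBINT u:{0<..}. exp (- u) / sqrt u * exp (- (s\<^sup>2 / (4 * u)))) = sqrt pi * exp (- s)"
proof -
  obtain G :: "real \<Rightarrow> real" where
    G: "\<And>y. (G has_real_derivative exp (- y\<^sup>2)) (at y)" and Gtop: "(G \<longlongrightarrow> sqrt pi / 2) at_top"
    and Gbot: "(G \<longlongrightarrow> - (sqrt pi / 2)) at_bot" and G0: "G 0 = 0"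
    using gaussian_antiderivative by blast
  define a where "a = s / 2"
  define F where "F = (\<lambda>u. exp (2 * a) * G (sqrt u + a / sqrt u) + exp (- (2 * a)) * G (sqrt u - a / sqrt u))"
  define f where "f = (\<lambda>u. exp (- u) / sqrt u * exp (- (s\<^sup>2 / (4 * u))))"
  have dF: "(F has_real_derivative f u) (at u)" if u: "0 < u" for u
  proof -
    define r where "r = sqrt u"
    have r: "0 < r" "r\<^sup>2 = u" using u by (auto simp: r_def)
    have 1: "((\<lambda>u. sqrt u + a / sqrt u) has_real_derivative (1 / (2 * r) - a / (2 * r ^ 3))) (at u)"
      using u r by (auto intro!: derivative_eq_intros simp: r_def[symmetric] field_simps power2_eq_square power3_eq_cube)
    have 2: "((\<lambda>u. sqrt u - a / sqrt u) has_real_derivative (1 / (2 * r) + a / (2 * r ^ 3))) (at u)"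
      using u r by (auto intro!: derivative_eq_intros simp: r_def[symmetric] field_simps power2_eq_square power3_eq_cube)
    have sq: "(a / r)\<^sup>2 = s\<^sup>2 / (4 * u)" by (simp add: a_def power_divide r(2))
    have sq1: "(r + a / r)\<^sup>2 = u + 2 * a + s\<^sup>2 / (4 * u)" and sq2: "(r - a / r)\<^sup>2 = u - 2 * a + s\<^sup>2 / (4 * u)"
      using r by (simp_all add: power2_sum power2_diff sq)
    have e1: "exp (2 * a) * exp (- (r + a / r)\<^sup>2) = exp (- u) * exp (- (s\<^sup>2 / (4 * u)))"
      unfolding exp_add[symmetric] sq1 by simp
    have e2: "exp (- (2 * a)) * exp (- (r - a / r)\<^sup>2) = exp (- u) * exp (- (s\<^sup>2 / (4 * u)))"
      unfolding exp_add[symmetric] sq2 by simp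
    have "(F has_real_derivative exp (2 * a) * (exp (- (r + a / r)\<^sup>2) * (1 / (2 * r) - a / (2 * r ^ 3)))
       + exp (- (2 * a)) * (exp (- (r - a / r)\<^sup>2) * (1 / (2 * r) + a / (2 * r ^ 3)))) (at u)"
      unfolding F_def
      by (intro DERIV_add DERIV_cmult) (use DERIV_chain2[OF G 1] DERIV_chain2[OF G 2] in \<open>auto simp: r_def\<close>)
    also have "exp (2 * a) * (exp (- (r + a / r)\<^sup>2) * (1 / (2 * r) - a / (2 * r ^ 3)))
       + exp (- (2 * a)) * (exp (- (r - a / r)\<^sup>2) * (1 / (2 * r) + a / (2 * r ^ 3)))
       = exp (- u) * exp (- (s\<^sup>2 / (4 * u))) * ((1 / (2 * r) - a / (2 * r ^ 3)) + (1 / (2 * r) + a / (2 * r ^ 3)))"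
      unfolding mult.assoc[symmetric] e1 e2 by (simp only: distrib_left)
    also have "\<dots> = f u" using r by (simp add: f_def r_def[symmetric] field_simps)
    finally show ?thesis .
  qed
  have sq0: "filterlim sqrt (at_right 0) (at_right (0::real))"
  proof -
    have "(sqrt \<longlongrightarrow> 0) (at_right (0::real))" using tendsto_real_sqrt[OF tendsto_ident_at, of 0 "{0<..}"] by simp
    moreover have "\<forall>\<^sub>F u in at_right (0::real). sqrt u \<in> {0<..} \<and> sqrt u \<noteq> 0"
      using eventually_at_right_less[of 0] by eventually_elim auto
    ultimately show ?thesis unfolding filterlim_at by simp
  qed
  \<comment> \<open>At the origin \<open>sqrt u - a / sqrt u\<close> tends to \<open>-
    \<infinity>\<close> if \<open>s > 0\<close>, but to \<open>0\<close> if \<open>s = 0\<close>;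
    hence the case distinction.\<close>
  have lim0: "(F \<longlongrightarrow> (if s = 0 then 0 else exp (2 * a) * (sqrt pi / 2) - exp (- (2 * a)) * (sqrt pi / 2))) (at_right 0)"
  proof (cases "s = 0")
    case True
    have "isCont G 0" using G by (rule DERIV_isCont)
    then have "((\<lambda>u. G (sqrt u)) \<longlongrightarrow> G 0) (at_right 0)"
      by (intro isCont_tendsto_compose[of 0 G]) (use sq0 in \<open>auto simp: filterlim_at\<close>)
    then have "((\<lambda>u. 2 * G (sqrt u)) \<longlongrightarrow> 2 * 0) (at_right 0)" using G0 by (intro tendsto_intros) auto
    then show ?thesis using True by (simp add: F_def a_def)
  next
    case False
    then have a: "0 < a" using s by (simp add: a_def)
    have inv: "filterlim (\<lambda>u. a / sqrt u) at_top (at_right 0)"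
      using filterlim_compose[OF filterlim_inverse_at_top_right sq0] a
      by (simp add: divide_inverse filterlim_tendsto_pos_mult_at_top[OF tendsto_const])
    have sq0': "(sqrt \<longlongrightarrow> 0) (at_right (0::real))" using sq0 by (simp add: filterlim_at)
    have "filterlim (\<lambda>u. sqrt u + a / sqrt u) at_top (at_right 0)"
      by (rule filterlim_tendsto_add_at_top[OF sq0' inv])
    then have 1: "((\<lambda>u. G (sqrt u + a / sqrt u)) \<longlongrightarrow> sqrt pi / 2) (at_right 0)" by (rule filterlim_compose[OF Gtop])
    have "filterlim (\<lambda>u. sqrt u - a / sqrt u) at_bot (at_right 0)"
    proof -
      have "filterlim (\<lambda>u. - sqrt u + a / sqrt u) at_top (at_right 0)"
        by (rule filterlim_tendsto_add_at_top[OF tendsto_minus[OF sq0'] inv])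
      then show ?thesis by (simp add: filterlim_uminus_at_bot)
    qed
    then have 2: "((\<lambda>u. G (sqrt u - a / sqrt u)) \<longlongrightarrow> - (sqrt pi / 2)) (at_right 0)" by (rule filterlim_compose[OF Gbot])
    have "(F \<longlongrightarrow> exp (2 * a) * (sqrt pi / 2) + exp (- (2 * a)) * (- (sqrt pi / 2))) (at_right 0)"
      unfolding F_def by (intro tendsto_intros 1 2)
    then show ?thesis using False by simp
  qed
  have limtop: "(F \<longlongrightarrow> exp (2 * a) * (sqrt pi / 2) + exp (- (2 * a)) * (sqrt pi / 2)) at_top"
  proof -
    have inv: "((\<lambda>u::real. a / sqrt u) \<longlongrightarrow> 0) at_top"
      by (rule tendsto_divide_0[OF tendsto_const]) (simp add: filterlim_at_top_imp_at_infinity sqrt_at_top)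
    have "filterlim (\<lambda>u. a / sqrt u + sqrt u) at_top at_top" "filterlim (\<lambda>u. - (a / sqrt u) + sqrt u) at_top at_top"
      by (rule filterlim_tendsto_add_at_top[OF inv sqrt_at_top] filterlim_tendsto_add_at_top[OF tendsto_minus[OF inv] sqrt_at_top])+
    from this[THEN filterlim_compose[OF Gtop]] show ?thesis
      unfolding F_def by (intro tendsto_intros) (simp_all add: add.commute)
  qed
  let ?A = "if s = 0 then 0 else exp (2 * a) * (sqrt pi / 2) - exp (- (2 * a)) * (sqrt pi / 2)"
  let ?B = "exp (2 * a) * (sqrt pi / 2) + exp (- (2 * a)) * (sqrt pi / 2)"
  have A: "((F \<circ> real_of_ereal) \<longlongrightarrow> ?A) (at_right (ereal 0))"
    unfolding ereal_tendsto_simps1 by (rule lim0)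
  have B: "((F \<circ> real_of_ereal) \<longlongrightarrow> ?B) (at_left \<infinity>)"
    unfolding ereal_tendsto_simps1 by (rule limtop)
  have cf: "isCont f u" if "0 < u" for u unfolding f_def using that by (intro continuous_intros) auto
  have f0: "0 \<le> f u" if "0 < u" for u using that by (simp add: f_def)
  have ei: "einterval (ereal 0) \<infinity> = {0<..}" by (auto simp: einterval_def)
  note ftc = interval_integral_FTC_nonneg[of "ereal 0" \<infinity> F f, OF _ _ _ _ A B]
  have "set_integrable lborel (einterval (ereal 0) \<infinity>) f"
    by (rule ftc(1)) (use dF cf f0 in auto)
  then show "set_integrable lborel {0<..} (\<lambda>u. exp (- u) / sqrt u * exp (- (s\<^sup>2 / (4 * u))))"
    unfolding ei f_def .
  have "(LBINT x=ereal 0..\<infinity>. f x) = ?B - ?A"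
    by (rule ftc(2)) (use dF cf f0 in auto)
  then have "(LBINT x:{0<..}. f x) = ?B - ?A"
    by (simp add: interval_lebesgue_integral_def ei)
  also have "\<dots> = sqrt pi * exp (- s)" by (auto simp: a_def)
  finally show "(LBINT u:{0<..}. exp (- u) / sqrt u * exp (- (s\<^sup>2 / (4 * u)))) = sqrt pi * exp (- s)"
    unfolding f_def .
qed

section \<open>The generating function of the Bessel functions\<close>

lemma has_sum_exp_series:
  fixes x :: complex
  shows "((\<lambda>n. x ^ n / fact n) has_sum exp x) UNIV"
proof (rule norm_summable_imp_has_sum)
  show "summable (\<lambda>n. cmod (x ^ n / fact n))"
    using summable_norm_exp[of x] by (simp add: divide_inverse scaleR_conv_of_real norm_mult mult.commute)
  show "(\<lambda>n. x ^ n / fact n) sums exp x"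
    using exp_converges[of x] by (simp add: divide_inverse scaleR_conv_of_real mult.commute)
qed

lemma has_sum_product_UNIV:
  fixes f :: "'a \<Rightarrow> complex" and g :: "'b \<Rightarrow> complex"
  assumes f: "(f has_sum a) UNIV" and g: "(g has_sum b) UNIV"
  shows "((\<lambda>(x, y). f x * g y) has_sum (a * b)) UNIV"
    and "(\<lambda>z. norm (case z of (x, y) \<Rightarrow> f x * g y)) summable_on UNIV"
proof -
  have fa: "(\<lambda>x. norm (f x)) summable_on UNIV" and ga: "(\<lambda>x. norm (g x)) summable_on UNIV"
    using f g by (auto simp: summable_on_iff_abs_summable_on_complex[symmetric] summable_on_def)
  have "(\<lambda>z. norm (case z of (x, y) \<Rightarrow> f x * g y)) summable_on (SIGMA x:UNIV. UNIV)"
    unfolding Infinite_Sum.abs_summable_on_Sigma_iff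
  proof (intro conjI ballI)
    show "(\<lambda>y. norm (case (x, y) of (x, y) \<Rightarrow> f x * g y)) summable_on UNIV" for x
      using summable_on_cmult_right[OF ga, of "cmod (f x)"] by (simp add: norm_mult)
    have "(\<Sum>\<^sub>\<infinity>y. cmod (case (x, y) of (x, y) \<Rightarrow> f x * g y)) = cmod (f x) * (\<Sum>\<^sub>\<infinity>y. cmod (g y))" for x
      by (simp add: norm_mult infsum_cmult_right[OF ga])
    then show "(\<lambda>x. norm (\<Sum>\<^sub>\<infinity>y. cmod (case (x, y) of (x, y) \<Rightarrow> f x * g y))) summable_on UNIV"
      using summable_on_cmult_left[OF fa, of "\<Sum>\<^sub>\<infinity>y. cmod (g y)"] by (simp add: abs_mult infsum_nonneg)
  qed
  then show abs: "(\<lambda>z. norm (case z of (x, y) \<Rightarrow> f x * g y)) summable_on UNIV" by simp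
  have s: "(\<lambda>(x, y). f x * g y) summable_on (UNIV \<times> UNIV)"
    using abs_summable_summable[OF abs] by simp
  have "((\<lambda>x. f x * b) has_sum infsum (\<lambda>(x, y). f x * g y) (UNIV \<times> UNIV)) UNIV"
    by (rule has_sum_SigmaD[OF has_sum_infsum[OF s]]) (use has_sum_cmult_right[OF g] in simp)
  moreover have "((\<lambda>x. f x * b) has_sum (a * b)) UNIV" by (rule has_sum_cmult_left[OF f])
  ultimately have "infsum (\<lambda>(x, y). f x * g y) (UNIV \<times> UNIV) = a * b" by (rule has_sum_unique)
  then show "((\<lambda>(x, y). f x * g y) has_sum (a * b)) UNIV" using has_sum_infsum[OF s] by simp
qed

text \<open>The \<open>m\<close>-th term of the series of \<open>bessel_I k z\<close>. If
  \<open>k\<close> is negative, the terms with \<open>m + k < 0\<close> vanish, so that the pairs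
  \<open>(k, m)\<close> of interest correspond to pairs of natural numbers \<open>(m + k,
  m)\<close>.\<close>

definition bessel_term :: "int \<Rightarrow> real \<Rightarrow> nat \<Rightarrow> real" where
  "bessel_term k z m = rGamma (of_int (int m + k + 1)) / fact m * (z / 2) powi (2 * int m + k)"

lemma bessel_term_neg: "int m + k < 0 \<Longrightarrow> bessel_term k z m = 0"
proof -
  assume "int m + k < 0"
  then have "(of_int (int m + k + 1) :: real) \<in> \<int>\<^sub>\<le>\<^sub>0" by (intro nonpos_Ints_of_int) simp
  then have "rGamma (of_int (int m + k + 1) :: real) = 0" by (simp only: rGamma_eq_zero_iff)
  then show ?thesis by (simp add: bessel_term_def)
qed

lemma bessel_term_nonneg_index:
  "bessel_term (int a - int b) z b = (z / 2) ^ a / fact a * ((z / 2) ^ b / fact b)"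
proof -
  have "(of_int (int b + (int a - int b) + 1) :: real) = 1 + of_nat a" by simp
  moreover have "rGamma (1 + of_nat a :: real) = 1 / fact a"
    by (simp add: rGamma_inverse_Gamma Gamma_fact divide_inverse)
  moreover have "(z / 2) powi (2 * int b + (int a - int b)) = (z / 2) ^ (a + b)"
  proof -
    have "2 * int b + (int a - int b) = int (a + b)" by simp
    then show ?thesis by (simp only: power_int_of_nat)
  qed
  ultimately show ?thesis unfolding bessel_term_def by (simp only:) (simp add: power_add)
qed

lemma bessel_term_ge_0: "0 \<le> z \<Longrightarrow> 0 \<le> bessel_term k z m"
proof (cases "int m + k < 0")
  case True then show ?thesis by (simp add: bessel_term_neg)
next
  case False
  assume "0 \<le> z"
  moreover obtain a where "int a = int m + k" using False by (metis nonneg_int_cases not_less)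
  then have "k = int a - int m" by simp
  ultimately show ?thesis by (simp add: bessel_term_nonneg_index)
qed

text \<open>The product of the exponential series of \<open>(z/2) cis \<theta>\<close> and
  \<open>(z/2) cis (-\<theta>)\<close>, summed over the differences \<open>k = a - b\<close> of the
  exponents. Absolute convergence of the double series also yields that of the Bessel series.\<close>

lemma bessel_generating_function:
  "(bessel_term k z has_sum bessel_I k z) UNIV"
  "((\<lambda>k. of_real (bessel_I k z) * cis (of_int k * \<theta>)) has_sum of_real (exp (z * cos \<theta>))) UNIV"
proof -
  have E: "exp (of_real (z/2) * cis \<theta>) * exp (of_real (z/2) * cis (- \<theta>)) = of_real (exp (z * cos \<theta>))" for \<theta>
  proof -
    have "of_real (z/2) * cis \<theta> + of_real (z/2) * cis (- \<theta>) = of_real (z * cos \<theta>)"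
      by (simp add: complex_eq_iff)
    then show ?thesis by (simp only: exp_add[symmetric] exp_of_real)
  qed
  have P: "((\<lambda>(x, y). (of_real (z/2) * cis \<theta>) ^ x / fact x * ((of_real (z/2) * cis (- \<theta>)) ^ y / fact y)) has_sum of_real (exp (z * cos \<theta>))) UNIV" for \<theta>
    using has_sum_product_UNIV(1)[OF has_sum_exp_series[of "of_real (z/2) * cis \<theta>"] has_sum_exp_series[of "of_real (z/2) * cis (- \<theta>)"]]
    unfolding E .
  let ?S = "SIGMA k:UNIV. {m::nat. 0 \<le> int m + k}"
  have R: "((\<lambda>(k, m). of_real (bessel_term k z m) * cis (of_int k * \<theta>)) has_sum of_real (exp (z * cos \<theta>))) ?S" for \<theta>
  proof (subst has_sum_reindex_bij_witness[where i = "\<lambda>(k, m). (nat (int m + k), m)" and j = "\<lambda>(a, b). (int a - int b, b)" and S = UNIV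
        and h = "\<lambda>(k, m). of_real (bessel_term k z m) * cis (of_int k * \<theta>)", symmetric])
    show "((\<lambda>(x, y). (of_real (z/2) * cis \<theta>) ^ x / fact x * ((of_real (z/2) * cis (- \<theta>)) ^ y / fact y)) has_sum of_real (exp (z * cos \<theta>))) UNIV"
      by (rule P)
    fix ab :: "nat \<times> nat" assume "ab \<in> UNIV"
    obtain a b where ab: "ab = (a, b)" by (cases ab)
    have "cis (of_int (int a - int b) * \<theta>) = cis \<theta> ^ a * cis (- \<theta>) ^ b"
    proof -
      have "cis \<theta> ^ a * cis (- \<theta>) ^ b = cis (real a * \<theta> + real b * (- \<theta>))" by (simp only: Complex.DeMoivre cis_mult)
      also have "real a * \<theta> + real b * (- \<theta>) = of_int (int a - int b) * \<theta>" by (simp add: algebra_simps)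
      finally show ?thesis by simp
    qed
    then show "(case case ab of (a, b) \<Rightarrow> (int a - int b, b) of (k, m) \<Rightarrow> of_real (bessel_term k z m) * cis (of_int k * \<theta>)) =
       (case ab of (x, y) \<Rightarrow> (of_real (z/2) * cis \<theta>) ^ x / fact x * ((of_real (z/2) * cis (- \<theta>)) ^ y / fact y))"
      by (simp add: ab bessel_term_nonneg_index power_mult_distrib power_divide)
  qed auto
  have inner: "(bessel_term k z has_sum bessel_I k z) UNIV" for k
  proof -
    have "(\<lambda>q. norm (case q of (k, m) \<Rightarrow> of_real (bessel_term k z m) * cis (of_int k * 0))) summable_on ?S"
      using has_sum_imp_summable[OF R[of 0]] unfolding summable_on_iff_abs_summable_on_complex .
    then have "(\<lambda>m. cmod (of_real (bessel_term k z m))) summable_on {m. 0 \<le> int m + k}"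
      unfolding Infinite_Sum.abs_summable_on_Sigma_iff by simp
    then have "(\<lambda>m. bessel_term k z m) summable_on {m. 0 \<le> int m + k}"
      using abs_summable_summable[of "bessel_term k z"] by simp
    then have "(\<lambda>m. bessel_term k z m) summable_on UNIV"
      by (subst summable_on_cong_neutral[where S = "{m. 0 \<le> int m + k}" and g = "bessel_term k z", symmetric]) (auto simp: bessel_term_neg)
    then obtain s where s: "(bessel_term k z has_sum s) UNIV" by (auto simp: summable_on_def)
    then have "bessel_term k z sums s" by (rule has_sum_imp_sums)
    then have "bessel_I k z = s" unfolding bessel_I_def bessel_term_def[symmetric] by (rule sums_unique[symmetric])
    with s show ?thesis by simp
  qed
  then show "(bessel_term k z has_sum bessel_I k z) UNIV" .
  show "((\<lambda>k. of_real (bessel_I k z) * cis (of_int k * \<theta>)) has_sum of_real (exp (z * cos \<theta>))) UNIV"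
  proof (rule has_sum_SigmaD[OF R])
    fix k :: int
    have "(bessel_term k z has_sum bessel_I k z) {m. 0 \<le> int m + k}"
      by (subst has_sum_cong_neutral[where T = UNIV and g = "bessel_term k z"]) (auto simp: bessel_term_neg inner)
    then have "((\<lambda>m. of_real (bessel_term k z m)) has_sum (of_real (bessel_I k z) :: complex)) {m. 0 \<le> int m + k}"
      by (rule has_sum_of_real)
    then show "((\<lambda>m. case (k, m) of (k, m) \<Rightarrow> of_real (bessel_term k z m) * cis (of_int k * \<theta>)) has_sum
        of_real (bessel_I k z) * cis (of_int k * \<theta>)) {m. 0 \<le> int m + k}"
      using has_sum_cmult_left by fastforce
  qed
qed

lemma bessel_I_nonneg: "0 \<le> z \<Longrightarrow> 0 \<le> bessel_I k z"
  using bessel_generating_function(1)[of k z] by (rule has_sum_nonneg) (simp add: bessel_term_ge_0)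

lemma bessel_I_measurable [measurable]: "bessel_I k \<in> borel_measurable borel"
proof -
  have "(\<lambda>z::real. (z / 2) powi e) \<in> borel_measurable borel" for e :: int
    by (cases "0 \<le> e") (simp_all add: power_int_def)
  then show ?thesis unfolding bessel_I_def[abs_def]
    by (intro borel_measurable_suminf borel_measurable_times borel_measurable_const)
qed

definition heat_kernel :: "real \<Rightarrow> int \<Rightarrow> real" where
  "heat_kernel s k = exp (- 2 * s) * bessel_I k (2 * s)"

lemma heat_kernel_nonneg: "0 \<le> s \<Longrightarrow> 0 \<le> heat_kernel s k"
  by (simp add: heat_kernel_def bessel_I_nonneg)

lemma heat_kernel_measurable [measurable]: "(\<lambda>s. heat_kernel s k) \<in> borel_measurable borel"
  unfolding heat_kernel_def by measurable

text \<open>The symbol \<open>exp (- s \<lambda>)\<close> of the heat semigroup at \<open>\<lambda>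
  = 4 sin\<^sup>2 \<phi>\<close>, with \<open>\<theta> = 2 \<phi>\<close>.\<close>

lemma heat_kernel_fourier:
  "((\<lambda>k. of_real (heat_kernel s k) * cis (2 * of_int k * \<phi>)) has_sum of_real (exp (- 4 * s * (sin \<phi>)\<^sup>2))) UNIV"
proof -
  have "((\<lambda>k. of_real (exp (- 2 * s)) * (of_real (bessel_I k (2 * s)) * cis (of_int k * (2 * \<phi>)))) has_sum
       of_real (exp (- 2 * s)) * of_real (exp (2 * s * cos (2 * \<phi>)))) UNIV"
    by (intro has_sum_cmult_right bessel_generating_function)
  moreover have "exp (- 2 * s) * exp (2 * s * cos (2 * \<phi>)) = exp (- 4 * s * (sin \<phi>)\<^sup>2)"
    unfolding exp_add[symmetric] cos_double_sin by (simp add: algebra_simps)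
  moreover have "of_int k * (2 * \<phi>) = 2 * of_int k * \<phi>" for k :: int by simp
  ultimately show ?thesis
    by (simp only: heat_kernel_def of_real_mult[symmetric] mult.assoc[symmetric])
qed

lemma heat_kernel_sum: "(heat_kernel s has_sum 1) UNIV"
proof -
  have "((\<lambda>k. complex_of_real (heat_kernel s k)) has_sum of_real 1) UNIV"
    using heat_kernel_fourier[of s 0] by simp
  then show ?thesis by (simp only: has_sum_of_real_iff)
qed

lemma heat_kernel_le_1: "0 \<le> s \<Longrightarrow> heat_kernel s k \<le> 1"
  using finite_sum_le_has_sum[OF heat_kernel_sum[of s], of "{k}"] by (simp add: heat_kernel_nonneg)

lemma heat_eq: "heat s f n = (\<Sum>\<^sub>\<infinity>m. of_real (heat_kernel s (n - m)) * f m)"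
  by (simp add: heat_def heat_kernel_def)

section \<open>The Poisson kernel as a mixture of heat kernels\<close>

text \<open>The density of the Gamma distribution with parameter \<open>1/2\<close>, up to its total
  mass \<open>sqrt \<pi>\<close>.\<close>

definition gamma_density :: "real \<Rightarrow> real" where
  "gamma_density u = exp (- u) / sqrt u"

lemma gamma_density_nonneg: "0 < u \<Longrightarrow> 0 \<le> gamma_density u" by (simp add: gamma_density_def)

lemma gamma_density_measurable [measurable]: "gamma_density \<in> borel_measurable borel"
  unfolding gamma_density_def by measurable

lemma gamma_density_integral:
  "set_integrable lborel {0<..} gamma_density" "(LBINT u:{0<..}. gamma_density u) = sqrt pi"
  using subordination[of 0] by (simp_all add: gamma_density_def[abs_def])

definition poisson_weight :: "real \<Rightarrow> real \<Rightarrow> int \<Rightarrow> real" where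
  "poisson_weight t u k = gamma_density u * heat_kernel (t\<^sup>2 / (4 * u)) k"

lemma poisson_weight_measurable [measurable]: "(\<lambda>u. poisson_weight t u k) \<in> borel_measurable borel"
  unfolding poisson_weight_def by measurable

lemma poisson_weight_bounds:
  assumes "0 < u" shows "0 \<le> poisson_weight t u k" "poisson_weight t u k \<le> gamma_density u"
proof -
  have s: "0 \<le> t\<^sup>2 / (4 * u)" using assms by simp
  show "0 \<le> poisson_weight t u k" unfolding poisson_weight_def
    using heat_kernel_nonneg[OF s] gamma_density_nonneg[OF assms] by simp
  show "poisson_weight t u k \<le> gamma_density u" unfolding poisson_weight_def
    using heat_kernel_le_1[OF s] gamma_density_nonneg[OF assms] by (simp add: mult_left_le)
qed

lemma poisson_weight_integrable: "set_integrable lborel {0<..} (\<lambda>u. poisson_weight t u k)"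
proof (rule set_integrable_bound[OF gamma_density_integral(1)])
  show "set_borel_measurable lborel {0<..} (\<lambda>u. poisson_weight t u k)"
    unfolding set_borel_measurable_def by measurable
  show "AE u in lborel. u \<in> {0<..} \<longrightarrow> norm (poisson_weight t u k) \<le> norm (gamma_density u)"
    using poisson_weight_bounds gamma_density_nonneg by (intro AE_I2) fastforce
qed

text \<open>The convolution kernel of the Poisson semigroup as it is defined, by subordination of
  heat kernels.\<close>

definition subordinated_kernel :: "real \<Rightarrow> int \<Rightarrow> real" where
  "subordinated_kernel t k = (LBINT u:{0<..}. poisson_weight t u k) / sqrt pi"

lemma subordinated_kernel_nonneg: "0 \<le> subordinated_kernel t k"
  unfolding subordinated_kernel_def set_lebesgue_integral_def
  by (intro divide_nonneg_nonneg integral_nonneg) (auto simp: indicator_def poisson_weight_bounds)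

lemma subordinated_kernel_summable: "subordinated_kernel t summable_on UNIV"
proof (rule nonneg_bdd_above_summable_on)
  show "bdd_above (sum (subordinated_kernel t) ` {F. F \<subseteq> UNIV \<and> finite F})"
  proof (rule bdd_aboveI2)
    fix F :: "int set" assume "F \<in> {F. F \<subseteq> UNIV \<and> finite F}"
    then have F: "finite F" by simp
    have "(\<Sum>k\<in>F. LBINT u:{0<..}. poisson_weight t u k) = (LBINT u:{0<..}. \<Sum>k\<in>F. poisson_weight t u k)"
      unfolding set_lebesgue_integral_def scaleR_sum_right
      by (rule Bochner_Integration.integral_sum[symmetric]) (rule poisson_weight_integrable[unfolded set_integrable_def])
    also have "\<dots> \<le> (LBINT u:{0<..}. gamma_density u)"
    proof (rule set_integral_mono)
      show "set_integrable lborel {0<..} (\<lambda>u. \<Sum>k\<in>F. poisson_weight t u k)"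
        unfolding set_integrable_def scaleR_sum_right
        by (intro Bochner_Integration.integrable_sum poisson_weight_integrable[unfolded set_integrable_def])
      fix u :: real assume "u \<in> {0<..}"
      then have u: "0 < u" by simp
      then have s: "0 \<le> t\<^sup>2 / (4 * u)" by simp
      have "(\<Sum>k\<in>F. heat_kernel (t\<^sup>2 / (4 * u)) k) \<le> 1"
        by (rule finite_sum_le_has_sum[OF heat_kernel_sum]) (use F heat_kernel_nonneg[OF s] in auto)
      then show "(\<Sum>k\<in>F. poisson_weight t u k) \<le> gamma_density u"
        unfolding poisson_weight_def sum_distrib_left[symmetric]
        using gamma_density_nonneg[OF u] by (simp add: mult_left_le)
    qed (rule gamma_density_integral)
    finally have "(\<Sum>k\<in>F. LBINT u:{0<..}. poisson_weight t u k) \<le> sqrt pi" by (simp add: gamma_density_integral)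
    then have "(\<Sum>k\<in>F. LBINT u:{0<..}. poisson_weight t u k) / sqrt pi \<le> 1" by simp
    then show "sum (subordinated_kernel t) F \<le> 1" unfolding subordinated_kernel_def by (simp add: sum_divide_distrib)
  qed
qed (simp add: subordinated_kernel_nonneg)

text \<open>The exchange of the sum over the integers with the integral over \<open>u\<close>, for
  general coefficients \<open>c\<close>: applied to exponentials it gives the Fourier series of the
  kernel, and applied to a sequence \<open>f\<close> it shows that the Poisson semigroup is a
  convolution. The index map \<open>\<sigma>\<close> is there for the reflection in the latter.\<close>

lemma subordinated_kernel_mixture:
  fixes c :: "int \<Rightarrow> complex"
  assumes sm: "(\<lambda>m. subordinated_kernel t (\<sigma> m) * cmod (c m)) summable_on UNIV"
  shows "((\<lambda>m. of_real (subordinated_kernel t (\<sigma> m)) * c m) has_sum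
     of_real (1 / sqrt pi) * (LBINT u:{0<..}. of_real (gamma_density u) * (\<Sum>\<^sub>\<infinity>m. of_real (heat_kernel (t\<^sup>2 / (4 * u)) (\<sigma> m)) * c m))) UNIV"
proof -
  define h where "h = (\<lambda>m u. indicator {0<..} u *\<^sub>R (of_real (poisson_weight t u (\<sigma> m)) * c m) :: complex)"
  have i0: "integrable lborel (\<lambda>u. indicator {0<..} u *\<^sub>R poisson_weight t u k)" for k
    using poisson_weight_integrable by (simp add: set_integrable_def)
  have hr: "h m u = of_real (indicator {0<..} u *\<^sub>R poisson_weight t u (\<sigma> m)) * c m" for m u
    by (simp add: h_def indicator_def)
  have hi: "integrable lborel (h m)" for m
    unfolding hr[abs_def] by (intro integrable_mult_left integrable_of_real i0)
  have hI: "(\<integral>u. h m u \<partial>lborel) = of_real (sqrt pi * subordinated_kernel t (\<sigma> m)) * c m" for m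
    unfolding hr by (subst integral_mult_left_zero, subst integral_complex_of_real) (simp add: subordinated_kernel_def set_lebesgue_integral_def)
  have hn: "(\<integral>u. cmod (h m u) \<partial>lborel) = sqrt pi * (subordinated_kernel t (\<sigma> m) * cmod (c m))" for m
  proof -
    have "cmod (h m u) = (indicator {0<..} u *\<^sub>R poisson_weight t u (\<sigma> m)) * cmod (c m)" for u
      using poisson_weight_bounds(1)[of u] by (auto simp: h_def indicator_def norm_mult)
    then show ?thesis by (simp add: subordinated_kernel_def set_lebesgue_integral_def)
  qed
  have "((\<lambda>m. \<integral>u. h m u \<partial>lborel) has_sum (\<integral>u. (\<Sum>\<^sub>\<infinity>m. h m u) \<partial>lborel)) UNIV"
    by (rule integral_infsum_int[OF hi]) (simp add: hn summable_on_cmult_right sm)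
  moreover have "(\<Sum>\<^sub>\<infinity>m. h m u) = indicator {0<..} u *\<^sub>R (of_real (gamma_density u) * (\<Sum>\<^sub>\<infinity>m. of_real (heat_kernel (t\<^sup>2 / (4 * u)) (\<sigma> m)) * c m))" for u
  proof -
    have "(\<Sum>\<^sub>\<infinity>m. h m u) = (\<Sum>\<^sub>\<infinity>m. (of_real (indicator {0<..} u * gamma_density u)) * (of_real (heat_kernel (t\<^sup>2 / (4 * u)) (\<sigma> m)) * c m))"
      by (simp add: hr poisson_weight_def mult.assoc)
    then show ?thesis by (simp add: infsum_cmult_right' indicator_def)
  qed
  ultimately have "((\<lambda>m. of_real (sqrt pi * subordinated_kernel t (\<sigma> m)) * c m) has_sum
     (LBINT u:{0<..}. of_real (gamma_density u) * (\<Sum>\<^sub>\<infinity>m. of_real (heat_kernel (t\<^sup>2 / (4 * u)) (\<sigma> m)) * c m))) UNIV"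
    by (simp add: hI set_lebesgue_integral_def)
  from has_sum_cmult_right[OF this, of "of_real (1 / sqrt pi)"] show ?thesis by (simp add: mult.assoc[symmetric])
qed

lemma subordinated_kernel_fourier:
  assumes t: "0 \<le> t"
  shows "((\<lambda>k. of_real (subordinated_kernel t k) * cis (2 * of_int k * x)) has_sum of_real (exp (- 2 * t * \<bar>sin x\<bar>))) UNIV"
proof -
  have "((\<lambda>k. of_real (subordinated_kernel t k) * cis (2 * of_int k * x)) has_sum
     of_real (1 / sqrt pi) * (LBINT u:{0<..}. of_real (gamma_density u) * (\<Sum>\<^sub>\<infinity>m. of_real (heat_kernel (t\<^sup>2 / (4 * u)) m) * cis (2 * of_int m * x)))) UNIV"
    using subordinated_kernel_summable by (intro subordinated_kernel_mixture[where \<sigma> = "\<lambda>m. m"]) simp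
  also have "(LBINT u:{0<..}. of_real (gamma_density u) * (\<Sum>\<^sub>\<infinity>m. of_real (heat_kernel (t\<^sup>2 / (4 * u)) m) * cis (2 * of_int m * x)))
     = (LBINT u:{0<..}. complex_of_real (exp (- u) / sqrt u * exp (- ((2 * t * \<bar>sin x\<bar>)\<^sup>2 / (4 * u)))))"
  proof (rule set_lebesgue_integral_cong)
    show "\<forall>u. u \<in> {0<..} \<longrightarrow> of_real (gamma_density u) * (\<Sum>\<^sub>\<infinity>m. of_real (heat_kernel (t\<^sup>2 / (4 * u)) m) * cis (2 * of_int m * x))
       = complex_of_real (exp (- u) / sqrt u * exp (- ((2 * t * \<bar>sin x\<bar>)\<^sup>2 / (4 * u))))"
    proof (intro allI impI)
      fix u :: real assume "u \<in> {0<..}"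
      have "- 4 * (t\<^sup>2 / (4 * u)) * (sin x)\<^sup>2 = - ((2 * t * \<bar>sin x\<bar>)\<^sup>2 / (4 * u))" by (simp add: power_mult_distrib)
      then have "(\<Sum>\<^sub>\<infinity>m. of_real (heat_kernel (t\<^sup>2 / (4 * u)) m) * cis (2 * of_int m * x)) = complex_of_real (exp (- ((2 * t * \<bar>sin x\<bar>)\<^sup>2 / (4 * u))))"
        using infsumI[OF heat_kernel_fourier[of "t\<^sup>2 / (4 * u)" x]] by simp
      then show "of_real (gamma_density u) * (\<Sum>\<^sub>\<infinity>m. of_real (heat_kernel (t\<^sup>2 / (4 * u)) m) * cis (2 * of_int m * x))
       = complex_of_real (exp (- u) / sqrt u * exp (- ((2 * t * \<bar>sin x\<bar>)\<^sup>2 / (4 * u))))"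
        by (simp only: gamma_density_def of_real_mult)
    qed
  qed simp
  also have "\<dots> = complex_of_real (LBINT u:{0<..}. exp (- u) / sqrt u * exp (- ((2 * t * \<bar>sin x\<bar>)\<^sup>2 / (4 * u))))"
    unfolding set_lebesgue_integral_def by (simp add: scaleR_conv_of_real flip: of_real_mult integral_complex_of_real)
  also have "(LBINT u:{0<..}. exp (- u) / sqrt u * exp (- ((2 * t * \<bar>sin x\<bar>)\<^sup>2 / (4 * u)))) = sqrt pi * exp (- (2 * t * \<bar>sin x\<bar>))"
    using t by (intro subordination) simp
  also have "of_real (1 / sqrt pi) * complex_of_real (sqrt pi * exp (- (2 * t * \<bar>sin x\<bar>))) = of_real (exp (- 2 * t * \<bar>sin x\<bar>))"
    unfolding of_real_mult[symmetric] by simp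
  finally show ?thesis .
qed

lemma poisson_has_sum:
  assumes sm: "(\<lambda>m. subordinated_kernel t (n - m) * cmod (f m)) summable_on UNIV"
  shows "((\<lambda>m. of_real (subordinated_kernel t (n - m)) * f m) has_sum poisson t f n) UNIV"
  using subordinated_kernel_mixture[OF sm] by (simp add: poisson_def heat_eq gamma_density_def)

text \<open>The integral of \<open>cis (i x)\<close> over \<open>[0, \<pi>]\<close>, half a period:
  besides the orthogonality for even \<open>i\<close> this gives, for odd \<open>i\<close>, the
  kernel of the Riesz transform.\<close>

definition cis_mean :: "int \<Rightarrow> complex" where
  "cis_mean i = (if i = 0 then of_real pi else (cis (of_int i * pi) - 1) / (\<i> * of_int i))"

lemma cis_mean_integral:
  "((\<lambda>x. cis (of_int i * x)) has_integral cis_mean i) {0..pi}"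
proof (cases "i = 0")
  case True
  then show ?thesis using has_integral_const_real[of "1::complex" 0 pi] by (simp add: cis_mean_def scaleR_conv_of_real)
next
  case False
  have "((\<lambda>x. cis (of_int i * x)) has_integral (cis (of_int i * pi) / (\<i> * of_int i) - cis (of_int i * 0) / (\<i> * of_int i))) {0..pi}"
  proof (rule fundamental_theorem_of_calculus)
    fix x :: real
    have "((\<lambda>z. exp (\<i> * of_int i * z) / (\<i> * of_int i)) has_field_derivative exp (\<i> * of_int i * of_real x)) (at (of_real x))"
      using False by (auto intro!: derivative_eq_intros)
    then have "((\<lambda>x. exp (\<i> * of_int i * of_real x) / (\<i> * of_int i)) has_vector_derivative exp (\<i> * of_int i * of_real x)) (at x within {0..pi})"
      using has_vector_derivative_real_field by (blast intro: has_vector_derivative_at_within)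
    moreover have "exp (\<i> * of_int i * of_real y) = cis (of_int i * y)" for y
      by (simp add: cis_conv_exp mult.assoc)
    ultimately show "((\<lambda>x. cis (of_int i * x) / (\<i> * of_int i)) has_vector_derivative cis (of_int i * x)) (at x within {0..pi})" by simp
  qed simp
  then show ?thesis using False by (simp add: cis_mean_def diff_divide_distrib)
qed

lemma set_integral_interval:
  fixes f :: "real \<Rightarrow> complex"
  assumes "continuous_on {0..pi} f"
  shows "set_integrable lborel {0..pi} f" "(LBINT x:{0..pi}. f x) = integral {0..pi} f"
  using borel_integrable_atLeastAtMost'[OF assms] set_borel_integral_eq_integral by auto

lemma continuous_on_cis' [continuous_intros]: "continuous_on A g \<Longrightarrow> continuous_on A (\<lambda>x. cis (g x))"
  by (rule continuous_on_compose2[OF continuous_on_cis[OF continuous_on_id]]) auto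

text \<open>The Fourier series of the kernel integrated term by term against \<open>cis (- j
  x)\<close>. For even \<open>j\<close> a single term remains, which is \<open>subordinated_kernel_eq_pk\<close>;
  for odd \<open>j\<close> the terms are Riesz kernels, which is \<open>qk_has_sum\<close>.\<close>

lemma subordinated_kernel_cis_mean:
  assumes t: "0 \<le> t"
  shows "((\<lambda>m. of_real (subordinated_kernel t m) * cis_mean (2 * m - j)) has_sum
     integral {0..pi} (\<lambda>x. cis (- (of_int j * x)) * of_real (exp (- 2 * t * sin x)))) UNIV"
proof -
  define h where "h = (\<lambda>m x. indicator {0..pi} x *\<^sub>R (of_real (subordinated_kernel t m) * cis (of_int (2 * m - j) * x)) :: complex)"
  have c: "continuous_on {0..pi} (\<lambda>x. of_real (subordinated_kernel t m) * cis (of_int (2 * m - j) * x))" for m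
    by (intro continuous_intros)
  have hi: "integrable lborel (h m)" for m
    using set_integral_interval(1)[OF c] by (simp add: h_def set_integrable_def)
  have hI: "(\<integral>x. h m x \<partial>lborel) = of_real (subordinated_kernel t m) * cis_mean (2 * m - j)" for m
  proof -
    have "(\<integral>x. h m x \<partial>lborel) = integral {0..pi} (\<lambda>x. of_real (subordinated_kernel t m) * cis (of_int (2 * m - j) * x))"
      unfolding h_def using set_integral_interval(2)[OF c[of m]] unfolding set_lebesgue_integral_def .
    also have "\<dots> = of_real (subordinated_kernel t m) * integral {0..pi} (\<lambda>x. cis (of_int (2 * m - j) * x))" by (rule integral_mult_right)
    also have "integral {0..pi} (\<lambda>x. cis (of_int (2 * m - j) * x)) = cis_mean (2 * m - j)"
      by (rule integral_unique[OF cis_mean_integral])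
    finally show ?thesis .
  qed
  have hn: "(\<integral>x. cmod (h m x) \<partial>lborel) = pi * subordinated_kernel t m" for m
  proof -
    have "(\<integral>x. cmod (h m x) \<partial>lborel) = (\<integral>x. indicator {0..pi} x *\<^sub>R subordinated_kernel t m \<partial>lborel)"
      using subordinated_kernel_nonneg[of t m] by (intro Bochner_Integration.integral_cong) (auto simp: h_def norm_mult)
    then show ?thesis by simp
  qed
  have "((\<lambda>m. \<integral>x. h m x \<partial>lborel) has_sum (\<integral>x. (\<Sum>\<^sub>\<infinity>m. h m x) \<partial>lborel)) UNIV"
    by (rule integral_infsum_int[OF hi]) (simp add: hn summable_on_cmult_right subordinated_kernel_summable)
  moreover have "(\<Sum>\<^sub>\<infinity>m. h m x) = indicator {0..pi} x *\<^sub>R (cis (- (of_int j * x)) * of_real (exp (- 2 * t * sin x)))" for x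
  proof (cases "x \<in> {0..pi}")
    case True
    have "((\<lambda>m. cis (- (of_int j * x)) * (of_real (subordinated_kernel t m) * cis (2 * of_int m * x))) has_sum cis (- (of_int j * x)) * of_real (exp (- 2 * t * \<bar>sin x\<bar>))) UNIV"
      by (intro has_sum_cmult_right subordinated_kernel_fourier t)
    moreover have "cis (- (of_int j * x)) * (of_real (subordinated_kernel t m) * cis (2 * of_int m * x)) = h m x" for m
    proof -
      have "cis (of_int (2 * m - j) * x) = cis (- (of_int j * x)) * cis (2 * of_int m * x)" by (simp add: cis_mult algebra_simps)
      then show ?thesis using True by (simp add: h_def)
    qed
    moreover have "\<bar>sin x\<bar> = sin x" using sin_0_pi[OF True] by simp
    ultimately show ?thesis using True by (simp add: infsumI)
  next
    case False
    then show ?thesis by (simp add: h_def)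
  qed
  moreover have "(LBINT x:{0..pi}. cis (- (of_int j * x)) * of_real (exp (- 2 * t * sin x))) =
     integral {0..pi} (\<lambda>x. cis (- (of_int j * x)) * of_real (exp (- 2 * t * sin x)))"
    by (intro set_integral_interval continuous_intros)
  ultimately show ?thesis by (simp add: hI set_lebesgue_integral_def)
qed

lemma integral_Re_Im:
  fixes f :: "real \<Rightarrow> complex"
  assumes "continuous_on {0..pi} f"
  shows "Re (integral {0..pi} f) = integral {0..pi} (\<lambda>x. Re (f x))" "Im (integral {0..pi} f) = integral {0..pi} (\<lambda>x. Im (f x))"
proof -
  have i: "f integrable_on {0..pi}" using assms by (rule integrable_continuous_real)
  show "Re (integral {0..pi} f) = integral {0..pi} (\<lambda>x. Re (f x))"
    using integral_linear[OF i bounded_linear_Re] by (simp add: o_def)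
  show "Im (integral {0..pi} f) = integral {0..pi} (\<lambda>x. Im (f x))"
    using integral_linear[OF i bounded_linear_Im] by (simp add: o_def)
qed

lemma cis_mean_even: "cis_mean (2 * i) = (if i = 0 then of_real pi else 0)"
proof -
  have "cis (2 * real_of_int i * pi) = 1" by (simp add: complex_eq_iff cos_2k_pi sin_2k_pi)
  then show ?thesis by (simp add: cis_mean_def)
qed

lemma cis_mean_odd: "cis_mean (2 * i + 1) = \<i> * of_real (1 / (of_int i + 1 / 2))"
proof -
  have nz: "(2 * of_int i + 1 :: real) \<noteq> 0" using half_int_abs[of i] by (metis abs_zero add_nonneg_pos mult_zero_right not_less abs_ge_zero zero_less_one add.commute)
  have "2 * i + 1 \<noteq> 0" by presburger
  moreover have "cis (of_int (2 * i + 1) * pi) = - 1"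
  proof -
    have "sin ((2 * real_of_int i + 1) * pi) = 0" by (simp only: distrib_right sin_add sin_2k_pi) simp
    then show ?thesis using cos_odd_pi[of i] by (simp add: complex_eq_iff)
  qed
  ultimately have "cis_mean (2 * i + 1) = - 2 / (\<i> * of_int (2 * i + 1))" by (simp add: cis_mean_def)
  also have "\<dots> = \<i> * of_real (2 / (2 * of_int i + 1))"
  proof -
    have "- 2 / (\<i> * x) = \<i> * (2 / x)" for x :: complex
    proof -
      have m2: "(- 2 :: complex) = \<i> * (\<i> * 2)" by (simp flip: mult.assoc)
      show ?thesis
        by (simp only: m2 mult_divide_mult_cancel_left complex_i_not_zero not_False_eq_True times_divide_eq_right)
    qed
    from this[of "of_int (2 * i + 1)"] show ?thesis by simp
  qed
  also have "2 / (2 * real_of_int i + 1) = 1 / (of_int i + 1 / 2)" using nz by (simp add: field_simps)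
  finally show ?thesis .
qed

lemma subordinated_kernel_eq_pk: assumes t: "0 \<le> t" shows "subordinated_kernel t k = pk t k"
proof -
  let ?f = "\<lambda>x. cis (- (of_int (2 * k) * x)) * of_real (exp (- 2 * t * sin x))"
  have "((\<lambda>m. of_real (subordinated_kernel t m) * cis_mean (2 * (m - k))) has_sum integral {0..pi} ?f) UNIV"
    using subordinated_kernel_cis_mean[OF t, of "2 * k"] by (simp add: right_diff_distrib)
  moreover have "((\<lambda>m. of_real (subordinated_kernel t m) * cis_mean (2 * (m - k))) has_sum (of_real (subordinated_kernel t k) * of_real pi)) UNIV"
  proof -
    have "cis_mean (2 * (m - k)) = (if m = k then of_real pi else 0)" for m by (subst cis_mean_even) auto
    then show ?thesis by (intro has_sum_finite_neutralI[of "{k}"]) (auto simp only: finite.intros mult_zero_right sum.insert sum.empty insert_iff empty_iff if_True if_False split: if_splits, auto)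
  qed
  ultimately have "integral {0..pi} ?f = of_real (subordinated_kernel t k) * of_real pi" by (rule has_sum_unique)
  then have "Re (integral {0..pi} ?f) = subordinated_kernel t k * pi" by simp
  moreover have "Re (integral {0..pi} ?f) = integral {0..pi} (\<lambda>x. exp (- 2 * t * sin x) * cos (2 * real_of_int k * x))"
    by (subst integral_Re_Im) (auto intro!: continuous_intros simp: mult.commute)
  ultimately have "subordinated_kernel t k * pi = pk t k * pi" by (simp add: pk_def)
  then show ?thesis by simp
qed

text \<open>The conjugate Poisson kernel is the Riesz kernel convolved with the Poisson kernel. Both are
  read off from a single integral, so that no product of Fourier series has to be justified.\<close>

lemma qk_has_sum: assumes t: "0 \<le> t" shows "((\<lambda>m. pk t m * qk 0 (k - m)) has_sum qk t k) UNIV"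
proof -
  let ?f = "\<lambda>x. cis (- (of_int (2 * k + 1) * x)) * of_real (exp (- 2 * t * sin x))"
  have "((\<lambda>m. of_real (subordinated_kernel t m) * cis_mean (2 * m - (2 * k + 1))) has_sum integral {0..pi} ?f) UNIV"
    by (rule subordinated_kernel_cis_mean[OF t])
  from has_sum_Im[OF this] have "((\<lambda>m. Im (of_real (subordinated_kernel t m) * cis_mean (2 * m - (2 * k + 1)))) has_sum Im (integral {0..pi} ?f)) UNIV" .
  moreover have "Im (integral {0..pi} ?f) = - integral {0..pi} (\<lambda>x. exp (- 2 * t * sin x) * sin ((2 * real_of_int k + 1) * x))"
    by (subst integral_Re_Im) (auto intro!: continuous_intros simp: mult.commute)
  moreover have "Im (of_real (subordinated_kernel t m) * cis_mean (2 * m - (2 * k + 1))) = pk t m * (pi * qk 0 (k - m))" for m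
  proof -
    have "2 * m - (2 * k + 1) = 2 * (m - k - 1) + 1" by simp
    then have "cis_mean (2 * m - (2 * k + 1)) = \<i> * of_real (1 / (of_int (m - k - 1) + 1 / 2))" by (simp only: cis_mean_odd)
    moreover have "1 / (of_int (m - k - 1) + 1 / 2) = pi * qk 0 (k - m)"
    proof -
      have "of_int (m - k - 1) + 1 / 2 = - (real_of_int (k - m) + 1 / 2)" by simp
      moreover have "1 / (- x) = pi * (- (1 / pi) * (1 / x))" for x :: real by simp
      ultimately show ?thesis by (simp only: qk_0)
    qed
    ultimately have "cis_mean (2 * m - (2 * k + 1)) = \<i> * of_real (pi * qk 0 (k - m))" by (simp only:)
    moreover have "Im (of_real a * (\<i> * of_real b)) = a * b" for a b by simp
    ultimately show ?thesis by (simp only: subordinated_kernel_eq_pk[OF t])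
  qed
  ultimately have "((\<lambda>m. pk t m * (pi * qk 0 (k - m))) has_sum - integral {0..pi} (\<lambda>x. exp (- 2 * t * sin x) * sin ((2 * real_of_int k + 1) * x))) UNIV"
    by simp
  from has_sum_cmult_right[OF this, of "1 / pi"] show ?thesis by (simp add: qk_def mult.commute)
qed

lemma pk_nonneg: "0 \<le> t \<Longrightarrow> 0 \<le> pk t k"
  using subordinated_kernel_nonneg[of t k] subordinated_kernel_eq_pk by simp

lemma pk_sum: assumes t: "0 \<le> t" shows "(pk t has_sum 1) UNIV"
proof -
  have "((\<lambda>k. complex_of_real (pk t k)) has_sum of_real 1) UNIV"
    using subordinated_kernel_fourier[OF t, of 0] subordinated_kernel_eq_pk[OF t] by simp
  then show ?thesis by (simp only: has_sum_of_real_iff)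
qed

section \<open>The Riesz transform and the conjugate maximal function in \<open>\<ell>\<^sup>2\<close>\<close>

lemma inverse_shift_tendsto: "(\<lambda>N. 1 / (real N + c)) \<longlonglongrightarrow> 0"
proof (rule tendsto_divide_0[OF tendsto_const])
  have "filterlim (\<lambda>N. c + real N) at_top sequentially"
    by (rule filterlim_tendsto_add_at_top[OF tendsto_const filterlim_real_sequentially])
  then show "filterlim (\<lambda>N. real N + c) at_infinity sequentially"
    by (intro filterlim_at_top_imp_at_infinity) (simp add: add.commute)
qed

text \<open>The kernel of \<open>\<R>\<close> up to the factor \<open>- 1 / \<pi>\<close>.\<close>

definition hilbert_kernel :: "int \<Rightarrow> real" where "hilbert_kernel j = 1 / (real_of_int j + 1 / 2)"

lemma half_int_nonzero: "real_of_int j + 1 / 2 \<noteq> 0"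
proof
  assume "real_of_int j + 1 / 2 = 0"
  then have "real_of_int (2 * j + 1) = real_of_int 0" by simp
  then have "2 * j + 1 = 0" by (simp only: of_int_eq_iff)
  then show False by presburger
qed

lemma int_window_Suc:
  "(\<Sum>n=-int (Suc N)..int (Suc N). h n) = (\<Sum>n=-int N..int N. h n) + h (- int (Suc N)) + (h (int (Suc N)) :: real)"
proof -
  have "{-int (Suc N)..int (Suc N)} = insert (- int (Suc N)) (insert (int (Suc N)) {-int N..int N})" by auto
  then show ?thesis by simp
qed

text \<open>For \<open>m = 0\<close> the terms with \<open>n\<close> and \<open>- n - 1\<close>
  cancel, and one term is left in each window. A change of \<open>m\<close> by one adds and removes
  one term at the ends of the window.\<close>

lemma hilbert_kernel_window_tendsto: "(\<lambda>N. \<Sum>n=-int N..int N. hilbert_kernel (n - m)) \<longlonglongrightarrow> 0"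
proof (induction m rule: int_induct[where k = 0])
  case base
  have "(\<Sum>n=-int N..int N. hilbert_kernel (n - 0)) = 1 / (real N + 1/2)" for N
  proof (induction N)
    case 0 then show ?case by (simp add: hilbert_kernel_def)
  next
    case (Suc N)
    have "hilbert_kernel (- int (Suc N) - 0) = - (1 / (real N + 1/2))"
    proof -
      have "real_of_int (- int (Suc N) - 0) + 1/2 = - (real N + 1/2)" by simp
      then show ?thesis unfolding hilbert_kernel_def by (simp only: divide_minus_right)
    qed
    then show ?case unfolding int_window_Suc Suc by (simp add: hilbert_kernel_def)
  qed
  then show ?case using inverse_shift_tendsto[of "1/2"] by simp
next
  have tel: "(\<Sum>n=-int N..int N. hilbert_kernel (n - (m + 1))) = (\<Sum>n=-int N..int N. hilbert_kernel (n - m)) + hilbert_kernel (- int N - m - 1) - hilbert_kernel (int N - m)" for m N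
  proof (induction N)
    case 0 then show ?case by simp
  next
    case (Suc N)
    have e1: "hilbert_kernel (- int (Suc N) - m) = hilbert_kernel (- int N - m - 1)" by (rule arg_cong[where f = hilbert_kernel]) simp
    have e2: "hilbert_kernel (int (Suc N) - (m + 1)) = hilbert_kernel (int N - m)" by (rule arg_cong[where f = hilbert_kernel]) simp
    have e3: "hilbert_kernel (- int (Suc N) - (m + 1)) = hilbert_kernel (- int (Suc N) - m - 1)" by (rule arg_cong[where f = hilbert_kernel]) simp
    show ?case unfolding int_window_Suc Suc e1 e2 e3 by linarith
  qed
  have l1: "(\<lambda>N. hilbert_kernel (int N - m)) \<longlonglongrightarrow> 0" for m
    using inverse_shift_tendsto[of "1/2 - real_of_int m"] by (simp add: hilbert_kernel_def algebra_simps)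
  have l2: "(\<lambda>N. hilbert_kernel (- int N - m - 1)) \<longlonglongrightarrow> 0" for m
  proof -
    have "hilbert_kernel (- int N - m - 1) = - (1 / (real N + (real_of_int m + 1/2)))" for N
    proof -
      have "real_of_int (- int N - m - 1) + 1/2 = - (real N + (real_of_int m + 1/2))" by simp
      then show ?thesis unfolding hilbert_kernel_def by (simp only: divide_minus_right)
    qed
    then show ?thesis using tendsto_minus[OF inverse_shift_tendsto[of "real_of_int m + 1/2"]] by simp
  qed
  {
    case (step1 m)
    show ?case unfolding tel using tendsto_diff[OF tendsto_add[OF step1(2) l2[of m]] l1[of m]] by simp
  next
    case (step2 m)
    have "(\<Sum>n=-int N..int N. hilbert_kernel (n - (m - 1))) = (\<Sum>n=-int N..int N. hilbert_kernel (n - m)) - hilbert_kernel (- int N - (m - 1) - 1) + hilbert_kernel (int N - (m - 1))" for N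
      using tel[of "m - 1" N] by simp
    then show ?case using tendsto_add[OF tendsto_diff[OF step2(2) l2[of "m - 1"]] l1[of "m - 1"]] by simp
  }
qed

text \<open>Different columns of the matrix \<open>1 / (n - m + 1/2)\<close> are orthogonal, by
  partial fractions: their product is a multiple of the difference of the two columns, whose window
  sums tend to \<open>0\<close>. Up to the constant, the Riesz transform is thus an isometry, with
  no use of Fourier analysis.\<close>

lemma hilbert_kernel_orthogonal:
  assumes "m \<noteq> m'"
  shows "(\<lambda>N. \<Sum>n=-int N..int N. hilbert_kernel (n - m) * hilbert_kernel (n - m')) \<longlonglongrightarrow> 0"
proof -
  have "hilbert_kernel (n - m) * hilbert_kernel (n - m') = (hilbert_kernel (n - m') - hilbert_kernel (n - m)) / real_of_int (m' - m)" for n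
  proof -
    define x y where "x = real_of_int (n - m) + 1/2" and "y = real_of_int (n - m') + 1/2"
    have nz: "x \<noteq> 0" "y \<noteq> 0" unfolding x_def y_def by (rule half_int_nonzero)+
    have d: "real_of_int (m' - m) = x - y" by (simp add: x_def y_def)
    have "x - y \<noteq> 0" using assms unfolding d[symmetric] by simp
    then have "1 / x * (1 / y) = (1 / y - 1 / x) / (x - y)" using nz by (simp add: field_simps)
    then show ?thesis unfolding hilbert_kernel_def d x_def[symmetric] y_def[symmetric] .
  qed
  then have "(\<Sum>n=-int N..int N. hilbert_kernel (n - m) * hilbert_kernel (n - m')) =
      ((\<Sum>n=-int N..int N. hilbert_kernel (n - m')) - (\<Sum>n=-int N..int N. hilbert_kernel (n - m))) / real_of_int (m' - m)" for N
    by (simp add: sum_subtractf flip: sum_divide_distrib)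
  moreover have "(\<lambda>N. ((\<Sum>n=-int N..int N. hilbert_kernel (n - m')) - (\<Sum>n=-int N..int N. hilbert_kernel (n - m))) / real_of_int (m' - m)) \<longlonglongrightarrow> (0 - 0) / real_of_int (m' - m)"
    using assms by (intro tendsto_intros hilbert_kernel_window_tendsto) auto
  ultimately show ?thesis by simp
qed

lemma hilbert_kernel_le: "(hilbert_kernel j)\<^sup>2 \<le> 36 / (1 + real_of_int \<bar>j\<bar>)\<^sup>2"
proof -
  have "1 + real_of_int \<bar>j\<bar> \<le> 6 * \<bar>real_of_int j + 1/2\<bar>" 
  proof -
    have "2 * real_of_int j + 1 = 2 * (real_of_int j + 1/2)" by simp
    then have "\<bar>2 * real_of_int j + 1\<bar> = 2 * \<bar>real_of_int j + 1/2\<bar>" by (simp only: abs_mult abs_numeral)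
    then show ?thesis using half_int_abs[of j] by simp
  qed
  then have "(1 + real_of_int \<bar>j\<bar>)\<^sup>2 \<le> (6 * \<bar>real_of_int j + 1/2\<bar>)\<^sup>2" by (intro power_mono) auto
  then have "(1 + real_of_int \<bar>j\<bar>)\<^sup>2 \<le> 36 * (real_of_int j + 1/2)\<^sup>2" by (simp add: power_mult_distrib)
  moreover have "0 < (real_of_int j + 1/2)\<^sup>2" using half_int_nonzero[of j] by simp
  ultimately have "1 / (real_of_int j + 1/2)\<^sup>2 \<le> 36 / (1 + real_of_int \<bar>j\<bar>)\<^sup>2"
    by (subst frac_le_eq) (auto simp: divide_le_0_iff add_nonneg_eq_0_iff)
  then show ?thesis by (simp add: hilbert_kernel_def power_divide)
qed

lemma inverse_square_sum_le:
  assumes "finite A"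
  shows "(\<Sum>j\<in>A. 1 / (1 + real_of_int \<bar>j - m\<bar>)\<^sup>2) \<le> 6"
proof -
  define N where "N = nat (Max (insert 0 ((\<lambda>j. \<bar>j - m\<bar>) ` A)))"
  have N: "\<bar>j - m\<bar> \<le> int N" if "j \<in> A" for j using that assms by (simp add: N_def le_nat_iff Max_ge_iff)
  have "(\<Sum>j\<in>A. 1 / (1 + real_of_int \<bar>j - m\<bar>)\<^sup>2) \<le> (\<Sum>j=m - int N..m + int N. 1 / (1 + real_of_int \<bar>j - m\<bar>)\<^sup>2)"
    by (intro sum_mono2) (auto dest!: N)
  also have "\<dots> = (\<Sum>k=-int N..int N. 1 / (1 + real_of_int \<bar>k\<bar>)\<^sup>2)"
    by (rule sum.reindex_bij_witness[of _ "\<lambda>k. m + k" "\<lambda>n. n - m"]) auto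
  also have "\<dots> \<le> 3 * 2 / 1"
    using radial_sum_bound[of "\<lambda>_. 1" 1 0 2 N] by simp
  finally show ?thesis by simp
qed

text \<open>The quadratic form is expanded over a large window; the off-diagonal terms vanish in the
  limit and the diagonal ones are the bounded norms of the columns.\<close>

lemma hilbert_kernel_l2_real:
  fixes f :: "int \<Rightarrow> real"
  assumes S: "finite S" and A: "finite A"
  shows "(\<Sum>n\<in>A. (\<Sum>m\<in>S. hilbert_kernel (n - m) * f m)\<^sup>2) \<le> 216 * (\<Sum>m\<in>S. (f m)\<^sup>2)"
proof -
  define G where "G = (\<lambda>N m m'. \<Sum>n=-int N..int N. hilbert_kernel (n - m) * hilbert_kernel (n - m'))"
  have eq: "(\<Sum>n=-int N..int N. (\<Sum>m\<in>S. hilbert_kernel (n - m) * f m)\<^sup>2) = (\<Sum>m\<in>S. \<Sum>m'\<in>S. f m * f m' * G N m m')" for N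
  proof -
    have "(\<Sum>n=-int N..int N. (\<Sum>m\<in>S. hilbert_kernel (n - m) * f m)\<^sup>2)
       = (\<Sum>n=-int N..int N. \<Sum>m\<in>S. \<Sum>m'\<in>S. f m * f m' * (hilbert_kernel (n - m) * hilbert_kernel (n - m')))"
      unfolding power2_eq_square sum_product by (intro sum.cong refl) simp
    also have "\<dots> = (\<Sum>m\<in>S. \<Sum>m'\<in>S. \<Sum>n=-int N..int N. f m * f m' * (hilbert_kernel (n - m) * hilbert_kernel (n - m')))"
      by (rule trans[OF sum.swap]) (rule sum.cong[OF refl], rule sum.swap)
    finally show ?thesis by (simp add: G_def sum_distrib_left)
  qed
  have diag: "G N m m \<le> 216" for N m
  proof -
    have "G N m m = (\<Sum>n=-int N..int N. (hilbert_kernel (n - m))\<^sup>2)" by (simp add: G_def power2_eq_square)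
    also have "\<dots> \<le> (\<Sum>n=-int N..int N. 36 * (1 / (1 + real_of_int \<bar>n - m\<bar>)\<^sup>2))"
    proof (rule sum_mono)
      show "(hilbert_kernel (n - m))\<^sup>2 \<le> 36 * (1 / (1 + real_of_int \<bar>n - m\<bar>)\<^sup>2)" for n using hilbert_kernel_le[of "n - m"] by simp
    qed
    also have "\<dots> \<le> 36 * 6" unfolding sum_distrib_left[symmetric] by (intro mult_left_mono inverse_square_sum_le) auto
    finally show ?thesis by simp
  qed
  define off where "off = (\<lambda>N. \<Sum>m\<in>S. \<Sum>m'\<in>S - {m}. f m * f m' * G N m m')"
  have off0: "off \<longlonglongrightarrow> 0"
  proof -
    have "(\<lambda>N. \<Sum>m\<in>S. \<Sum>m'\<in>S - {m}. f m * f m' * G N m m') \<longlonglongrightarrow> (\<Sum>m\<in>S. \<Sum>m'\<in>S - {m}. f m * f m' * 0)"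
      unfolding G_def by (intro tendsto_sum tendsto_mult tendsto_const hilbert_kernel_orthogonal) auto
    then show ?thesis by (simp add: off_def)
  qed
  have le: "(\<Sum>n=-int N..int N. (\<Sum>m\<in>S. hilbert_kernel (n - m) * f m)\<^sup>2) \<le> 216 * (\<Sum>m\<in>S. (f m)\<^sup>2) + off N" for N
  proof -
    have "(\<Sum>n=-int N..int N. (\<Sum>m\<in>S. hilbert_kernel (n - m) * f m)\<^sup>2) = (\<Sum>m\<in>S. f m * f m * G N m m + (\<Sum>m'\<in>S - {m}. f m * f m' * G N m m'))"
      unfolding eq using S by (intro sum.cong refl sum.remove) auto
    also have "\<dots> = (\<Sum>m\<in>S. (f m)\<^sup>2 * G N m m) + off N" by (simp add: sum.distrib off_def power2_eq_square)
    also have "\<dots> \<le> (\<Sum>m\<in>S. (f m)\<^sup>2 * 216) + off N" using diag by (intro add_right_mono sum_mono mult_left_mono) auto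
    also have "(\<Sum>m\<in>S. (f m)\<^sup>2 * 216) = 216 * (\<Sum>m\<in>S. (f m)\<^sup>2)" by (simp add: sum_distrib_right[symmetric])
    finally show ?thesis .
  qed
  define R where "R = nat (Max (insert 0 (abs ` A)))"
  have R: "\<bar>n\<bar> \<le> int R" if "n \<in> A" for n using that A by (simp add: R_def le_nat_iff Max_ge_iff)
  have lower: "(\<Sum>n\<in>A. (\<Sum>m\<in>S. hilbert_kernel (n - m) * f m)\<^sup>2) \<le> 216 * (\<Sum>m\<in>S. (f m)\<^sup>2) + off N" if "R \<le> N" for N
  proof -
    have "A \<subseteq> {-int N..int N}"
    proof
      fix n assume "n \<in> A"
      from R[OF this] that show "n \<in> {-int N..int N}" by auto
    qed
    then have "(\<Sum>n\<in>A. (\<Sum>m\<in>S. hilbert_kernel (n - m) * f m)\<^sup>2) \<le> (\<Sum>n=-int N..int N. (\<Sum>m\<in>S. hilbert_kernel (n - m) * f m)\<^sup>2)"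
      by (intro sum_mono2) auto
    with le[of N] show ?thesis by linarith
  qed
  have "(\<Sum>n\<in>A. (\<Sum>m\<in>S. hilbert_kernel (n - m) * f m)\<^sup>2) \<le> 216 * (\<Sum>m\<in>S. (f m)\<^sup>2) + 0"
    by (rule tendsto_lowerbound[OF tendsto_add[OF tendsto_const off0]])
       (use lower in \<open>auto simp: eventually_sequentially\<close>)
  then show ?thesis by simp
qed

lemma qk_0_hilbert_kernel: "qk 0 j = - (1 / pi) * hilbert_kernel j"
  by (simp add: qk_0 hilbert_kernel_def)

definition riesz_sum :: "int set \<Rightarrow> (int \<Rightarrow> complex) \<Rightarrow> int \<Rightarrow> complex" where
  "riesz_sum S f j = (\<Sum>m\<in>S. of_real (qk 0 (j - m)) * f m)"

lemma riesz_l2: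
  assumes S: "finite S" and A: "finite A"
  shows "(\<Sum>n\<in>A. (cmod (riesz_sum S f n))\<^sup>2) \<le> 216 * (\<Sum>m\<in>S. (cmod (f m))\<^sup>2)"
proof -
  have pt: "(cmod (riesz_sum S f n))\<^sup>2 \<le> (\<Sum>m\<in>S. hilbert_kernel (n - m) * Re (f m))\<^sup>2 + (\<Sum>m\<in>S. hilbert_kernel (n - m) * Im (f m))\<^sup>2" for n
  proof -
    have "Re (riesz_sum S f n) = - (1 / pi) * (\<Sum>m\<in>S. hilbert_kernel (n - m) * Re (f m))"
      "Im (riesz_sum S f n) = - (1 / pi) * (\<Sum>m\<in>S. hilbert_kernel (n - m) * Im (f m))"
      by (simp_all add: riesz_sum_def qk_0_hilbert_kernel sum_distrib_left sum_divide_distrib sum_negf)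
    then have "(cmod (riesz_sum S f n))\<^sup>2 = (1 / pi)\<^sup>2 * ((\<Sum>m\<in>S. hilbert_kernel (n - m) * Re (f m))\<^sup>2 + (\<Sum>m\<in>S. hilbert_kernel (n - m) * Im (f m))\<^sup>2)"
      by (simp add: cmod_power2 power_mult_distrib power_divide add_divide_distrib)
    also have "\<dots> \<le> 1 * ((\<Sum>m\<in>S. hilbert_kernel (n - m) * Re (f m))\<^sup>2 + (\<Sum>m\<in>S. hilbert_kernel (n - m) * Im (f m))\<^sup>2)"
      using pi_ge_two by (intro mult_right_mono) (auto simp: power_le_one_iff)
    finally show ?thesis by simp
  qed
  have "(\<Sum>n\<in>A. (cmod (riesz_sum S f n))\<^sup>2) \<le> (\<Sum>n\<in>A. (\<Sum>m\<in>S. hilbert_kernel (n - m) * Re (f m))\<^sup>2) + (\<Sum>n\<in>A. (\<Sum>m\<in>S. hilbert_kernel (n - m) * Im (f m))\<^sup>2)"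
    unfolding sum.distrib[symmetric] by (intro sum_mono pt)
  also have "\<dots> \<le> 216 * (\<Sum>m\<in>S. (Re (f m))\<^sup>2) + 216 * (\<Sum>m\<in>S. (Im (f m))\<^sup>2)"
    by (intro add_mono hilbert_kernel_l2_real S A)
  also have "\<dots> = 216 * (\<Sum>m\<in>S. (cmod (f m))\<^sup>2)" by (simp add: cmod_power2 sum.distrib)
  finally show ?thesis .
qed

lemma has_sum_finite_sum:
  fixes h :: "'a \<Rightarrow> 'b \<Rightarrow> complex"
  assumes "finite S" "\<And>m. (h m has_sum s m) A"
  shows "((\<lambda>x. \<Sum>m\<in>S. h m x) has_sum (\<Sum>m\<in>S. s m)) A"
  using assms(1) by (induction S rule: finite_induct) (auto intro: has_sum_add assms(2))

text \<open>The conjugate Poisson integral of a finitely supported sequence is the Poisson integral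
  of its Riesz transform.\<close>

lemma qk_sum_eq:
  assumes t: "0 \<le> t" and S: "finite S"
  shows "((\<lambda>j. of_real (pk t (n - j)) * riesz_sum S f j) has_sum (\<Sum>m\<in>S. of_real (qk t (n - m)) * f m)) UNIV"
proof -
  have "((\<lambda>j. of_real (pk t (n - j) * qk 0 (j - m)) * f m) has_sum of_real (qk t (n - m)) * f m) UNIV" for m
  proof (intro has_sum_cmult_left has_sum_of_real)
    have "((\<lambda>j. pk t (n - j) * qk 0 (j - m)) has_sum qk t (n - m)) UNIV \<longleftrightarrow>
        ((\<lambda>i. pk t i * qk 0 (n - m - i)) has_sum qk t (n - m)) UNIV"
      by (rule has_sum_reindex_bij_witness[of _ "\<lambda>i. n - i" "\<lambda>j. n - j"]) auto
    then show "((\<lambda>j. pk t (n - j) * qk 0 (j - m)) has_sum qk t (n - m)) UNIV" using qk_has_sum[OF t] by simp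
  qed
  then have "((\<lambda>j. \<Sum>m\<in>S. of_real (pk t (n - j) * qk 0 (j - m)) * f m) has_sum (\<Sum>m\<in>S. of_real (qk t (n - m)) * f m)) UNIV"
    by (rule has_sum_finite_sum[OF S])
  then show ?thesis by (simp add: riesz_sum_def sum_distrib_left mult.assoc)
qed

text \<open>The kernel of \<open>Q\<^sub>t\<close> for \<open>c = 0\<close>, that of the backward
  operator for \<open>c = 1\<close>: the two Riesz transforms differ by a translation only, but
  Calderon--Zygmund kernels are centred, so both are kept.\<close>

definition conj_kernel :: "int \<Rightarrow> real \<Rightarrow> int \<Rightarrow> real" where
  "conj_kernel c t k = qk t (k - c)"

text \<open>The translation by \<open>c\<close> costs a factor \<open>4\<close>, since
  \<open>\<bar>k\<bar> \<le> 2 \<bar>k - c\<bar>\<close> unless \<open>k = c\<close>; there the size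
  bound is used.\<close>

lemma conj_kernel_cz:
  assumes c: "c \<in> {0, 1}"
  shows "cz_family (conj_kernel c) {0..} 24"
proof
  show "{0..} \<noteq> ({} :: real set)" by auto
next
  fix t :: real and k :: int assume t: "t \<in> {0..}"
  then have t: "0 \<le> t" by simp
  have "\<bar>qk t (k - c)\<bar> \<le> 6 / (1 + \<bar>real_of_int (k - c)\<bar>)" by (rule qk_decay[OF t])
  also have "\<dots> \<le> 6 / 1" by (intro divide_left_mono) auto
  finally show "\<bar>conj_kernel c t k\<bar> \<le> 24" by (simp add: conj_kernel_def)
next
  fix t :: real and k :: int assume t: "t \<in> {0..}" and k: "k \<noteq> 0"
  then have t: "0 \<le> t" by simp
  have b: "\<bar>qk t j\<bar> \<le> 6" for j
  proof -
    have "\<bar>qk t j\<bar> \<le> 6 / (1 + \<bar>real_of_int j\<bar>)" by (rule qk_decay[OF t])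
    also have "\<dots> \<le> 6 / 1" by (intro divide_left_mono) auto
    finally show ?thesis by simp
  qed
  show "\<bar>conj_kernel c t k - conj_kernel c t (k - 1)\<bar> \<le> 24 / (real_of_int k)\<^sup>2"
  proof (cases "k = c")
    case True
    then have "k = 1" using c k by auto
    then show ?thesis using b[of "1 - c"] b[of "0 - c"] by (simp add: conj_kernel_def)
  next
    case False
    then have kc: "k - c \<noteq> 0" by simp
    have "\<bar>k\<bar> \<le> 2 * \<bar>k - c\<bar>"
    proof (cases "c = 0")
      case True then show ?thesis by simp
    next
      case False
      with c have 1: "c = 1" by simp
      with kc k have "2 \<le> k \<or> k \<le> - 1" by arith
      then show ?thesis unfolding 1 by arith
    qed
    then have "real_of_int \<bar>k\<bar> \<le> real_of_int (2 * \<bar>k - c\<bar>)" by (simp only: of_int_le_iff)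
    then have "\<bar>real_of_int k\<bar> \<le> 2 * \<bar>real_of_int (k - c)\<bar>" by simp
    then have "\<bar>real_of_int k\<bar>\<^sup>2 \<le> (2 * \<bar>real_of_int (k - c)\<bar>)\<^sup>2" by (intro power_mono) auto
    then have sq: "(real_of_int k)\<^sup>2 \<le> 4 * (real_of_int (k - c))\<^sup>2" by (simp add: power_mult_distrib)
    have "\<bar>conj_kernel c t k - conj_kernel c t (k - 1)\<bar> = \<bar>qk t (k - c) - qk t (k - c - 1)\<bar>"
      by (simp add: conj_kernel_def algebra_simps)
    also have "\<dots> \<le> 6 / (real_of_int (k - c))\<^sup>2" by (rule qk_diff_bound[OF t kc])
    also have "\<dots> = 24 / (4 * (real_of_int (k - c))\<^sup>2)" by simp
    also have "\<dots> \<le> 24 / (real_of_int k)\<^sup>2"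
    proof (rule divide_left_mono[OF sq])
      have "0 < (real_of_int (k - c))\<^sup>2" using kc by (simp only: zero_less_power2 of_int_eq_0_iff) simp
      moreover have "0 < (real_of_int k)\<^sup>2" using k by simp
      ultimately show "0 < 4 * (real_of_int (k - c))\<^sup>2 * (real_of_int k)\<^sup>2" by (intro mult_pos_pos) auto
    qed simp
    finally show ?thesis .
  qed
qed

lemma riesz_sum_decay:
  assumes S: "finite S" and e: "0 < e"
  shows "\<exists>N. \<forall>j. N < \<bar>j\<bar> \<longrightarrow> cmod (riesz_sum S f j) \<le> e"
proof -
  define R where "R = Max (insert 0 (abs ` S))"
  have R: "\<bar>m\<bar> \<le> R" if "m \<in> S" for m using that S by (simp add: R_def)
  define F where "F = (\<Sum>m\<in>S. cmod (f m))"
  have F0: "0 \<le> F" unfolding F_def by (intro sum_nonneg) auto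
  define N where "N = R + \<lceil>6 * F / e\<rceil>"
  have "cmod (riesz_sum S f j) \<le> e" if j: "N < \<bar>j\<bar>" for j
  proof -
    have "cmod (riesz_sum S f j) \<le> (\<Sum>m\<in>S. \<bar>qk 0 (j - m)\<bar> * cmod (f m))"
      unfolding riesz_sum_def by (rule order_trans[OF norm_sum]) (simp add: norm_mult)
    also have "\<dots> \<le> (\<Sum>m\<in>S. 6 / (1 + 6 * F / e) * cmod (f m))"
    proof (intro sum_mono mult_right_mono)
      fix m assume m: "m \<in> S"
      have "\<lceil>6 * F / e\<rceil> \<le> \<bar>j - m\<bar>" using R[OF m] j by (simp add: N_def)
      then have "6 * F / e \<le> \<bar>real_of_int (j - m)\<bar>" by (simp add: ceiling_le_iff)
      then have "6 / (1 + \<bar>real_of_int (j - m)\<bar>) \<le> 6 / (1 + 6 * F / e)"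
        using F0 e by (intro divide_left_mono mult_pos_pos) (auto intro: add_pos_nonneg)
      with qk_decay[of 0 "j - m"] show "\<bar>qk 0 (j - m)\<bar> \<le> 6 / (1 + 6 * F / e)" by simp
    qed auto
    also have "\<dots> = 6 / (1 + 6 * F / e) * F" by (simp add: F_def sum_distrib_left)
    also have "\<dots> \<le> e"
    proof -
      have "0 < 1 + 6 * F / e" using F0 e by (intro add_pos_nonneg) auto
      moreover have "6 * F \<le> e * (1 + 6 * F / e)" using e by (simp add: distrib_left)
      ultimately show ?thesis by (simp add: divide_le_eq)
    qed
    finally show ?thesis .
  qed
  then show ?thesis by blast
qed

text \<open>The conjugate Poisson integral is the Poisson integral of the Riesz transform, and the
  Poisson kernel has a radially decreasing majorant of bounded mass; so the maximal function is at
  most \<open>72\<close> times the Hardy--Littlewood maximal function of the Riesz transform. The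
  latter is not finitely supported: outside a large window it is smaller than \<open>e\<close>, and
  contributes at most \<open>e\<close> because the Poisson kernel has sum \<open>1\<close>. The
  factor \<open>3 * 10^8\<close> is \<open>2 * 72^2\<close> times \<open>128\<close> (the maximal
  theorem) times \<open>216\<close> (the Riesz transform), rounded up.\<close>

theorem conj_l2:
  assumes c: "c \<in> {0, 1}" and S: "finite S" and A: "finite A"
  shows "(\<Sum>n\<in>A. (cz_family.family_max (conj_kernel c) {0..} S f n)\<^sup>2) \<le> 300000000 * (\<Sum>m\<in>S. (cmod (f m))\<^sup>2)"
proof -
  interpret cz_family "conj_kernel c" "{0..}" 24 by (rule conj_kernel_cz[OF c])
  show ?thesis
  proof (rule field_le_epsilon)
    fix \<delta> :: real assume \<delta>: "0 < \<delta>"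
    define e where "e = min 1 (\<delta> / (2 * real (card A) + 1))"
    have e: "0 < e" "e \<le> 1" using \<delta> by (auto simp: e_def)
    obtain N0 where N0: "\<And>j. N0 < \<bar>j\<bar> \<Longrightarrow> cmod (riesz_sum S f j) \<le> e" using riesz_sum_decay[OF S e(1)] by blast
    define N where "N = Max (insert N0 (insert 0 (abs ` ((\<lambda>n. n - c) ` A))))"
    have NN: "N0 \<le> N" "\<And>n. n \<in> A \<Longrightarrow> \<bar>n - c\<bar> \<le> N" unfolding N_def using A by (intro Max_ge; auto)+
    define M where "M = interval_max (\<lambda>_. 1) (\<lambda>j. cmod (riesz_sum S f j)) (- N) N"
    have M0: "0 \<le> M n" if "\<bar>n\<bar> \<le> N" for n unfolding M_def using that by (intro interval_max_nonneg) auto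
    have pt: "family_max S f n \<le> 72 * M (n - c) + e" if n: "n \<in> A" for n
    proof (rule family_max_least)
      fix t :: real assume "t \<in> {0..}"
      then have t: "0 \<le> t" by simp
      define T where "T = max 1 t"
      have T: "1 \<le> T" by (simp add: T_def)
      have nc: "- N \<le> n - c" "n - c \<le> N" using NN(2)[OF n] by auto
      let ?W = "{-N..N}"
      let ?h = "\<lambda>j. of_real (pk t (n - c - j)) * riesz_sum S f j"
      have hs: "(?h has_sum (\<Sum>m\<in>S. of_real (conj_kernel c t (n - m)) * f m)) UNIV"
        using qk_sum_eq[OF t S, of "n - c" f] by (simp add: conj_kernel_def algebra_simps)
      have ps: "((\<lambda>j. pk t (n - c - j)) has_sum 1) UNIV"
      proof -
        have "((\<lambda>j. pk t (n - c - j)) has_sum 1) UNIV \<longleftrightarrow> (pk t has_sum 1) UNIV"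
          by (rule has_sum_reindex_bij_witness[of _ "\<lambda>i. n - c - i" "\<lambda>j. n - c - j"]) auto
        then show ?thesis using pk_sum[OF t] by simp
      qed
      have hs2: "(?h has_sum ((\<Sum>m\<in>S. of_real (conj_kernel c t (n - m)) * f m) - sum ?h ?W)) (UNIV - ?W)"
        by (rule has_sum_Diff[OF hs]) (auto intro: has_sum_finite)
      have ps2: "((\<lambda>j. e * pk t (n - c - j)) has_sum e * (1 - (\<Sum>j\<in>?W. pk t (n - c - j)))) (UNIV - ?W)"
        by (intro has_sum_cmult_right has_sum_Diff[OF ps]) (auto intro: has_sum_finite)
      have "cmod ((\<Sum>m\<in>S. of_real (conj_kernel c t (n - m)) * f m) - sum ?h ?W) \<le> e * (1 - (\<Sum>j\<in>?W. pk t (n - c - j)))"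
      proof (rule norm_infsum_le[OF hs2 ps2])
        fix j assume "j \<in> UNIV - ?W"
        then have "N0 < \<bar>j\<bar>" using NN(1) by auto
        then have "pk t (n - c - j) * cmod (riesz_sum S f j) \<le> pk t (n - c - j) * e"
          by (intro mult_left_mono N0 pk_nonneg t)
        then show "cmod (?h j) \<le> e * pk t (n - c - j)" using pk_nonneg[OF t] by (simp add: norm_mult mult.commute)
      qed
      also have "\<dots> \<le> e * 1" using e pk_nonneg[OF t] by (intro mult_left_mono) (auto intro!: sum_nonneg)
      finally have tail: "cmod ((\<Sum>m\<in>S. of_real (conj_kernel c t (n - m)) * f m) - sum ?h ?W) \<le> e" by simp
      have "cmod (sum ?h ?W) \<le> (\<Sum>j\<in>?W. \<bar>pk t (n - c - j)\<bar> * cmod (riesz_sum S f j))"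
        by (rule order_trans[OF norm_sum]) (simp add: norm_mult)
      also have "\<dots> \<le> (\<Sum>j\<in>?W. 12 * T / (T + \<bar>real_of_int (n - c - j)\<bar>)\<^sup>2 * cmod (riesz_sum S f j))"
        unfolding T_def by (intro sum_mono mult_right_mono pk_poisson_bound t) auto
      also have "\<dots> = 12 * T * (\<Sum>j=-N..N. cmod (riesz_sum S f j) / (T + real_of_int \<bar>n - c - j\<bar>)\<^sup>2)"
        by (simp add: sum_distrib_left)
      also have "\<dots> \<le> 12 * T * (6 * M (n - c) / T)"
        unfolding M_def using T nc by (intro mult_left_mono radial_le_interval_max) auto
      also have "\<dots> = 72 * M (n - c)" using T by simp
      finally have main: "cmod (sum ?h ?W) \<le> 72 * M (n - c)" .
      have "cmod (\<Sum>m\<in>S. of_real (conj_kernel c t (n - m)) * f m) \<le> cmod (sum ?h ?W) + cmod ((\<Sum>m\<in>S. of_real (conj_kernel c t (n - m)) * f m) - sum ?h ?W)"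
        using norm_triangle_ineq[of "sum ?h ?W" "(\<Sum>m\<in>S. of_real (conj_kernel c t (n - m)) * f m) - sum ?h ?W"] by simp
      with main tail show "cmod (\<Sum>m\<in>S. of_real (conj_kernel c t (n - m)) * f m) \<le> 72 * M (n - c) + e" by linarith
    qed
    have "(\<Sum>n\<in>A. (family_max S f n)\<^sup>2) \<le> (\<Sum>n\<in>A. 10368 * (M (n - c))\<^sup>2 + 2 * e)"
    proof (rule sum_mono)
      fix n assume n: "n \<in> A"
      have "(family_max S f n)\<^sup>2 \<le> (72 * M (n - c) + e)\<^sup>2" using pt[OF n] family_max_nonneg by (intro power_mono) auto
      also have "\<dots> \<le> 2 * (72 * M (n - c))\<^sup>2 + 2 * e\<^sup>2"
        using sum_squares_bound[of "72 * M (n - c)" e] by (simp add: power2_sum)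
      also have "e\<^sup>2 \<le> e" using e by (simp add: power2_eq_square mult_left_le)
      finally show "(family_max S f n)\<^sup>2 \<le> 10368 * (M (n - c))\<^sup>2 + 2 * e" by (simp add: power_mult_distrib)
    qed
    also have "\<dots> = 10368 * (\<Sum>n\<in>A. (M (n - c))\<^sup>2) + 2 * real (card A) * e"
      by (simp add: sum.distrib sum_distrib_left)
    also have "(\<Sum>n\<in>A. (M (n - c))\<^sup>2) = (\<Sum>n\<in>(\<lambda>n. n - c) ` A. (M n)\<^sup>2)"
      by (subst sum.reindex) (auto simp: inj_on_def)
    also have "(\<Sum>n\<in>(\<lambda>n. n - c) ` A. (M n)\<^sup>2) \<le> (\<Sum>n=-N..N. (M n)\<^sup>2)"
    proof (rule sum_mono2)
      show "(\<lambda>n. n - c) ` A \<subseteq> {-N..N}"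
      proof
        fix x assume "x \<in> (\<lambda>n. n - c) ` A"
        then obtain n where "n \<in> A" "x = n - c" by auto
        with NN(2)[of n] show "x \<in> {-N..N}" by auto
      qed
    qed auto
    also have "\<dots> = (\<Sum>n=-N..N. M n powr 2 * 1)"
    proof (rule sum.cong[OF refl])
      fix n assume "n \<in> {-N..N}"
      then have "0 \<le> M n" by (intro M0) auto
      then show "(M n)\<^sup>2 = M n powr 2 * 1" by simp
    qed
    also have "\<dots> \<le> 2 powr 2 * (4 * (2 / (2-1)) * (2 * (2 / (2-1))) powr (2-1)) * (\<Sum>n=-N..N. cmod (riesz_sum S f n) powr 2 * 1)"
      unfolding M_def by (rule interval_max_strong) auto
    also have "\<dots> = 128 * (\<Sum>n=-N..N. (cmod (riesz_sum S f n))\<^sup>2)" by (simp add: powr_numeral)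
    also have "\<dots> \<le> 128 * (216 * (\<Sum>m\<in>S. (cmod (f m))\<^sup>2))" by (intro mult_left_mono riesz_l2 S) auto
    finally have "(\<Sum>n\<in>A. (family_max S f n)\<^sup>2) \<le> 10368 * (128 * (216 * (\<Sum>m\<in>S. (cmod (f m))\<^sup>2))) + 2 * real (card A) * e" by simp
    also have "2 * real (card A) * e \<le> \<delta>"
    proof -
      have "2 * real (card A) * e \<le> (2 * real (card A) + 1) * (\<delta> / (2 * real (card A) + 1))"
        using \<delta> e by (intro mult_mono) (auto simp: e_def)
      also have "\<dots> = \<delta>"
      proof -
        have "2 * real (card A) + 1 \<noteq> 0" by (smt (verit) of_nat_0_le_iff)
        then show ?thesis by simp
      qed
      finally show ?thesis .
    qed
    also have "10368 * (128 * (216 * (\<Sum>m\<in>S. (cmod (f m))\<^sup>2))) \<le> 300000000 * (\<Sum>m\<in>S. (cmod (f m))\<^sup>2)"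
      by (simp add: sum_nonneg)
    finally show "(\<Sum>n\<in>A. (family_max S f n)\<^sup>2) \<le> 300000000 * (\<Sum>m\<in>S. (cmod (f m))\<^sup>2) + \<delta>" by simp
  qed
qed

theorem conj_weak_unweighted:
  assumes c: "c \<in> {0, 1}"
  shows "\<exists>B1\<ge>0. \<forall>S A f l. finite S \<longrightarrow> finite A \<longrightarrow> 0 < l \<longrightarrow>
      l * real (card {n\<in>A. l < cz_family.family_max (conj_kernel c) {0..} S f n}) \<le> B1 * (\<Sum>m\<in>S. cmod (f m))"
proof -
  interpret cz_family "conj_kernel c" "{0..}" 24 by (rule conj_kernel_cz[OF c])
  have "\<exists>B1\<ge>0. \<forall>S A f l. finite S \<longrightarrow> finite A \<longrightarrow> 0 < l \<longrightarrow>
     l * (\<Sum>n\<in>{n\<in>A. l < family_max S f n}. 1) \<le> B1 * (\<Sum>m\<in>S. cmod (f m) * 1)"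
  proof (rule weak_type_A1[where D = 1])
    show "(\<Sum>n\<in>A. (family_max S f n)\<^sup>2 * 1) \<le> 300000000 * (\<Sum>m\<in>S. (cmod (f m))\<^sup>2 * 1)"
      if "finite S" "finite A" for S A f using conj_l2[OF c that] by simp
  qed auto
  then show ?thesis by simp
qed

theorem conj_strong:
  fixes w :: "int \<Rightarrow> real"
  assumes c: "c \<in> {0, 1}" and p: "1 < p" and pos: "\<And>n. w n > 0"
    and Ap: "\<And>a b. a \<le> b \<Longrightarrow> (\<Sum>n=a..b. w n) * (\<Sum>n=a..b. w n powr (- 1 / (p - 1))) powr (p - 1) \<le> D * real_of_int (b - a + 1) powr p"
  shows "\<exists>B2\<ge>0. \<forall>S A f. finite S \<longrightarrow> finite A \<longrightarrow>
      (\<Sum>n\<in>A. cz_family.family_max (conj_kernel c) {0..} S f n powr p * w n) \<le> B2 * (\<Sum>m\<in>S. cmod (f m) powr p * w m)"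
proof -
  interpret cz_family "conj_kernel c" "{0..}" 24 by (rule conj_kernel_cz[OF c])
  obtain B1 where B1: "0 \<le> B1" and weak: "\<And>S A f l. finite S \<Longrightarrow> finite A \<Longrightarrow> 0 < l \<Longrightarrow>
      l * real (card {n\<in>A. l < family_max S f n}) \<le> B1 * (\<Sum>m\<in>S. cmod (f m))"
    using conj_weak_unweighted[OF c] by blast
  show ?thesis by (rule strong_type_Ap[OF B1 weak p pos refl Ap])
qed

text \<open>An \<open>A_1\<close> weight is an \<open>A_2\<close> weight, so the strong type bound
  with \<open>p = 2\<close> supplies the \<open>\<ell>\<^sup>2(w)\<close> bound on which the
  Calderon--Zygmund decomposition with respect to \<open>w\<close> rests.\<close>

theorem conj_weak_A1:
  fixes w :: "int \<Rightarrow> real"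
  assumes c: "c \<in> {0, 1}" and pos: "\<And>n. w n > 0"
    and A1: "\<And>a b n. a \<le> n \<Longrightarrow> n \<le> b \<Longrightarrow> (\<Sum>i=a..b. w i) \<le> D * real_of_int (b - a + 1) * w n"
  shows "\<exists>B1\<ge>0. \<forall>S A f l. finite S \<longrightarrow> finite A \<longrightarrow> 0 < l \<longrightarrow>
     l * (\<Sum>n\<in>{n\<in>A. l < cz_family.family_max (conj_kernel c) {0..} S f n}. w n) \<le> B1 * (\<Sum>m\<in>S. cmod (f m) * w m)"
proof -
  interpret cz_family "conj_kernel c" "{0..}" 24 by (rule conj_kernel_cz[OF c])
  have "\<exists>B2\<ge>0. \<forall>S A f. finite S \<longrightarrow> finite A \<longrightarrow>
      (\<Sum>n\<in>A. family_max S f n powr 2 * w n) \<le> B2 * (\<Sum>m\<in>S. cmod (f m) powr 2 * w m)"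
  proof (rule conj_strong[OF c _ pos])
    fix a b :: int assume ab: "a \<le> b"
    let ?W = "\<Sum>n=a..b. w n" and ?L = "real_of_int (b - a + 1)"
    have W: "0 < ?W" using ab pos by (intro sum_pos) auto
    have "(\<Sum>n=a..b. w n powr (- 1 / (2 - 1))) \<le> (\<Sum>n=a..b. D * ?L / ?W)"
    proof (rule sum_mono)
      fix n assume n: "n \<in> {a..b}"
      have "w n powr (- 1 / (2 - 1)) = 1 / w n" using pos[of n] by (simp add: powr_minus divide_inverse)
      also have "\<dots> \<le> D * ?L / ?W" using A1[of a n b] n W pos[of n] by (simp add: field_simps)
      finally show "w n powr (- 1 / (2 - 1)) \<le> D * ?L / ?W" .
    qed
    also have "\<dots> = ?L * (D * ?L / ?W)" using ab by simp
    finally have "?W * (\<Sum>n=a..b. w n powr (- 1 / (2 - 1))) \<le> ?W * (?L * (D * ?L / ?W))" using W by (intro mult_left_mono) auto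
    also have "\<dots> = D * ?L\<^sup>2" using W by (simp add: power2_eq_square)
    finally have "?W * (\<Sum>n=a..b. w n powr (- 1 / (2 - 1))) \<le> D * ?L\<^sup>2" .
    moreover have "0 \<le> (\<Sum>n=a..b. w n powr (- 1 / (2 - 1)))" by (intro sum_nonneg) auto
    ultimately show "?W * (\<Sum>n=a..b. w n powr (- 1 / (2 - 1))) powr (2 - 1) \<le> D * ?L powr 2"
      using ab by (simp add: powr_numeral)
  qed simp
  then obtain B2 where "\<And>S A f. finite S \<Longrightarrow> finite A \<Longrightarrow>
      (\<Sum>n\<in>A. family_max S f n powr 2 * w n) \<le> B2 * (\<Sum>m\<in>S. cmod (f m) powr 2 * w m)" by blast
  then have l2: "\<And>S A f. finite S \<Longrightarrow> finite A \<Longrightarrow> (\<Sum>n\<in>A. (family_max S f n)\<^sup>2 * w n) \<le> B2 * (\<Sum>m\<in>S. (cmod (f m))\<^sup>2 * w m)"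
    using family_max_nonneg by (simp add: powr_numeral)
  show ?thesis by (rule weak_type_A1[OF pos A1 l2])
qed

section \<open>Convolution with kernels of order \<open>1 / \<bar>k\<bar>\<close>\<close>

text \<open>The largest space on which the Riesz transforms are given by absolutely convergent sums.
  All qualitative assertions hold there; the weight matters only for the membership of
  \<open>\<ell>\<^sup>p(w)\<close> in it.\<close>

definition tame :: "(int \<Rightarrow> complex) \<Rightarrow> bool" where
  "tame f \<longleftrightarrow> (\<lambda>m. cmod (f m) / (1 + real_of_int \<bar>m\<bar>)) summable_on UNIV"

definition conv :: "(int \<Rightarrow> real) \<Rightarrow> (int \<Rightarrow> complex) \<Rightarrow> int \<Rightarrow> complex" where
  "conv K f n = (\<Sum>\<^sub>\<infinity>m. of_real (K (n - m)) * f m)"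

definition decays :: "real \<Rightarrow> (int \<Rightarrow> real) \<Rightarrow> bool" where
  "decays C K \<longleftrightarrow> (\<forall>k. \<bar>K k\<bar> \<le> C / (1 + \<bar>real_of_int k\<bar>))"

text \<open>The best bound at \<open>n\<close> for convolutions of \<open>f\<close> with kernels
  bounded by \<open>1 / (1 + \<bar>k\<bar>)\<close>.\<close>

definition potential :: "(int \<Rightarrow> complex) \<Rightarrow> int \<Rightarrow> real" where
  "potential f n = (\<Sum>\<^sub>\<infinity>m. cmod (f m) / (1 + \<bar>real_of_int (n - m)\<bar>))"

lemma tame_summable:
  assumes f: "tame f"
  shows "(\<lambda>m. cmod (f m) / (1 + \<bar>real_of_int (n - m)\<bar>)) summable_on UNIV"
proof (rule summable_on_comparison_test)
  show "(\<lambda>m. (1 + \<bar>real_of_int n\<bar>) * (cmod (f m) / (1 + real_of_int \<bar>m\<bar>))) summable_on UNIV"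
    using f unfolding tame_def by (rule summable_on_cmult_right)
  fix m
  have "\<bar>real_of_int m\<bar> \<le> \<bar>real_of_int n\<bar> + \<bar>real_of_int (n - m)\<bar>" by simp
  moreover have "0 \<le> \<bar>real_of_int n\<bar> * \<bar>real_of_int (n - m)\<bar>" by simp
  ultimately have "1 + \<bar>real_of_int m\<bar> \<le> (1 + \<bar>real_of_int n\<bar>) * (1 + \<bar>real_of_int (n - m)\<bar>)"
    by (simp only: distrib_left distrib_right)
  then have "1 / (1 + \<bar>real_of_int (n - m)\<bar>) \<le> (1 + \<bar>real_of_int n\<bar>) / (1 + \<bar>real_of_int m\<bar>)"
    by (simp add: divide_simps add_pos_nonneg)
  then have "cmod (f m) * (1 / (1 + \<bar>real_of_int (n - m)\<bar>)) \<le> cmod (f m) * ((1 + \<bar>real_of_int n\<bar>) / (1 + \<bar>real_of_int m\<bar>))"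
    by (intro mult_left_mono) auto
  then show "cmod (f m) / (1 + \<bar>real_of_int (n - m)\<bar>) \<le> (1 + \<bar>real_of_int n\<bar>) * (cmod (f m) / (1 + real_of_int \<bar>m\<bar>))"
    by (simp add: mult.commute)
qed auto

lemma decays_nonneg: "decays C K \<Longrightarrow> 0 \<le> C"
  unfolding decays_def using abs_ge_zero[of "K 0"] by (metis abs_zero add.right_neutral div_by_1 of_int_0 order_trans)

lemma decays_term:
  assumes "decays C K"
  shows "cmod (of_real (K (n - m)) * f m) \<le> C * (cmod (f m) / (1 + \<bar>real_of_int (n - m)\<bar>))"
proof -
  have "\<bar>K (n - m)\<bar> * cmod (f m) \<le> C / (1 + \<bar>real_of_int (n - m)\<bar>) * cmod (f m)"
    using assms unfolding decays_def by (intro mult_right_mono) (rule spec, auto)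
  then show ?thesis by (simp add: norm_mult)
qed

lemma conv_abs_summable:
  assumes "tame f" "decays C K"
  shows "(\<lambda>m. cmod (of_real (K (n - m)) * f m)) summable_on UNIV"
  by (rule summable_on_comparison_test[OF summable_on_cmult_right[OF tame_summable[OF assms(1), of n], of C]])
     (use decays_term[OF assms(2)] in auto)

lemma conv_has_sum:
  assumes "tame f" "decays C K"
  shows "((\<lambda>m. of_real (K (n - m)) * f m) has_sum conv K f n) UNIV"
  unfolding conv_def by (rule has_sum_infsum[OF abs_summable_summable[OF conv_abs_summable[OF assms]]])

lemma conv_bound:
  assumes "tame f" "decays C K"
  shows "cmod (conv K f n) \<le> C * potential f n"
proof (rule norm_infsum_le[OF conv_has_sum[OF assms]])
  show "((\<lambda>m. C * (cmod (f m) / (1 + \<bar>real_of_int (n - m)\<bar>))) has_sum C * potential f n) UNIV"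
    unfolding potential_def by (intro has_sum_cmult_right has_sum_infsum tame_summable assms)
qed (rule decays_term[OF assms(2)])

lemma conv_diff:
  assumes "tame f" "decays C K" "decays D L"
  shows "conv (\<lambda>k. K k - L k) f n = conv K f n - conv L f n"
proof -
  have "((\<lambda>m. of_real (K (n - m)) * f m + - (of_real (L (n - m)) * f m)) has_sum (conv K f n + - conv L f n)) UNIV"
    using assms by (intro has_sum_add has_sum_uminusI conv_has_sum)
  then have "((\<lambda>m. of_real (K (n - m) - L (n - m)) * f m) has_sum (conv K f n - conv L f n)) UNIV"
    by (simp add: left_diff_distrib)
  then show ?thesis unfolding conv_def[of "\<lambda>k. K k - L k"] by (rule infsumI)
qed

lemma conv_scale: "conv (\<lambda>k. c * K k) f n = of_real c * conv K f n"
  by (simp add: conv_def mult.assoc infsum_cmult_right')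

lemma conv_shift: "conv (\<lambda>k. K (k + j)) f n = conv K f (n + j)"
proof -
  have "n - m + j = n + j - m" for m by simp
  then show ?thesis by (simp only: conv_def)
qed

lemma decays_diff: "decays C K \<Longrightarrow> decays D L \<Longrightarrow> decays (C + D) (\<lambda>k. K k - L k)"
  unfolding decays_def
proof
  fix k
  assume "\<forall>k. \<bar>K k\<bar> \<le> C / (1 + \<bar>real_of_int k\<bar>)" "\<forall>k. \<bar>L k\<bar> \<le> D / (1 + \<bar>real_of_int k\<bar>)"
  then have "\<bar>K k\<bar> + \<bar>L k\<bar> \<le> C / (1 + \<bar>real_of_int k\<bar>) + D / (1 + \<bar>real_of_int k\<bar>)" by (intro add_mono) blast+
  then show "\<bar>K k - L k\<bar> \<le> (C + D) / (1 + \<bar>real_of_int k\<bar>)"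
    unfolding add_divide_distrib by (rule order_trans[OF abs_triangle_ineq4])
qed

lemma decays_shift:
  assumes K: "decays C K" and j: "\<bar>j\<bar> \<le> 1"
  shows "decays (2 * C) (\<lambda>k. K (k + j))"
  unfolding decays_def
proof
  fix k
  have "1 + \<bar>k\<bar> \<le> 2 * (1 + \<bar>k + j\<bar>)" using j by arith
  then have "real_of_int (1 + \<bar>k\<bar>) \<le> real_of_int (2 * (1 + \<bar>k + j\<bar>))" by (simp only: of_int_le_iff)
  then have "1 + \<bar>real_of_int k\<bar> \<le> 2 * (1 + \<bar>real_of_int (k + j)\<bar>)" by simp
  then have "2 * C / (2 * (1 + \<bar>real_of_int (k + j)\<bar>)) \<le> 2 * C / (1 + \<bar>real_of_int k\<bar>)"
    using decays_nonneg[OF K] by (intro divide_left_mono mult_pos_pos) (auto simp: add_pos_nonneg)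
  moreover have "2 * C / (2 * (1 + \<bar>real_of_int (k + j)\<bar>)) = C / (1 + \<bar>real_of_int (k + j)\<bar>)"
    by (rule mult_divide_mult_cancel_left) simp
  ultimately show "\<bar>K (k + j)\<bar> \<le> 2 * C / (1 + \<bar>real_of_int k\<bar>)"
    using K unfolding decays_def by (metis order_trans)
qed

lemma decays_mono: "decays C K \<Longrightarrow> C \<le> D \<Longrightarrow> decays D K"
  unfolding decays_def by (meson abs_ge_zero add_nonneg_nonneg divide_right_mono order_trans zero_le_one)

lemma decays_pk: "0 \<le> t \<Longrightarrow> decays 2 (pk t)"
  unfolding decays_def using pk_decay by blast

lemma decays_qk: "0 \<le> t \<Longrightarrow> decays 6 (qk t)"
  unfolding decays_def using qk_decay by blast

section \<open>Poisson and conjugate Poisson semigroups as convolutions\<close>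

lemma poisson_eq_conv:
  assumes f: "tame f" and t: "0 \<le> t"
  shows "poisson t f n = conv (pk t) f n"
proof -
  have "(\<lambda>m. subordinated_kernel t (n - m) * cmod (f m)) summable_on UNIV"
    using conv_abs_summable[OF f decays_pk[OF t], of n] subordinated_kernel_eq_pk[OF t] pk_nonneg[OF t] by (simp add: norm_mult)
  from poisson_has_sum[OF this] have "((\<lambda>m. of_real (pk t (n - m)) * f m) has_sum poisson t f n) UNIV"
    by (simp add: subordinated_kernel_eq_pk[OF t])
  then show ?thesis unfolding conv_def by (rule infsumI[symmetric])
qed

lemma riesz_fwd_eq_conv: "riesz_fwd f n = conv (qk 0) f n"
proof -
  have "of_real (qk 0 (n - m)) * f m = - (1 / of_real pi) * (f m / (of_int (n - m) + 1 / 2))" for m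
    by (simp add: qk_0)
  then show ?thesis unfolding riesz_fwd_def conv_def by (simp only: infsum_cmult_right')
qed

lemma riesz_bwd_eq: "riesz_bwd f n = riesz_fwd f (n - 1)"
proof -
  have "of_int (n - m) - 1 / 2 = (of_int (n - 1 - m) + 1 / 2 :: complex)" for m by simp
  then show ?thesis unfolding riesz_fwd_def riesz_bwd_def by (simp only:)
qed

lemma conj_bwd_eq: "conj_bwd t f n = conj_fwd t f (n - 1)"
  by (simp add: conj_bwd_def conj_fwd_def riesz_bwd_eq)

text \<open>The convolution of the absolute values of the Riesz and Poisson kernels decays like
  \<open>1 / \<bar>n - m\<bar>\<close> without a logarithm, because the Poisson kernel decays
  quadratically. With \<open>a\<close> and \<open>b\<close> the distances of \<open>j\<close> from
  \<open>n\<close> and \<open>m\<close>, the product is of order \<open>1 / (a b\<^sup>2)\<close>,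
  and \<open>\<bar>n - m\<bar> / (a b\<^sup>2) \<le> (a + b) / (a b\<^sup>2)\<close> is bounded by
  the squares of \<open>1 / a\<close> and \<open>1 / b\<close>.\<close>

lemma riesz_poisson_sum_bound:
  assumes t: "0 \<le> t" and A: "finite A"
  shows "(\<Sum>j\<in>A. \<bar>qk 0 (n - j)\<bar> * pk t (j - m)) \<le> 1728 * max 1 t / (1 + \<bar>real_of_int (n - m)\<bar>)"
proof -
  define T where "T = max 1 t"
  have T: "1 \<le> T" by (simp add: T_def)
  define N where "N = 1 + \<bar>real_of_int (n - m)\<bar>"
  have N: "0 < N" by (simp add: N_def add_pos_nonneg)
  have pt: "\<bar>qk 0 (n - j)\<bar> * pk t (j - m) \<le> 144 * T / N * (1 / (1 + real_of_int \<bar>j - n\<bar>)\<^sup>2 + 1 / (1 + real_of_int \<bar>j - m\<bar>)\<^sup>2)" for j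
  proof -
    define a b where "a = 1 + real_of_int \<bar>j - n\<bar>" and "b = 1 + real_of_int \<bar>j - m\<bar>"
    have ab: "0 < a" "0 < b" by (simp_all add: a_def b_def add_pos_nonneg)
    have q: "\<bar>qk 0 (n - j)\<bar> \<le> 6 / a"
      using qk_decay[of 0 "n - j"] by (simp add: a_def abs_minus_commute)
    have "pk t (j - m) \<le> 12 * T / (T + \<bar>real_of_int (j - m)\<bar>)\<^sup>2"
      using pk_poisson_bound[OF t, of "j - m"] unfolding T_def by linarith
    also have "\<dots> \<le> 12 * T / b\<^sup>2"
    proof (intro divide_left_mono)
      show "b\<^sup>2 \<le> (T + \<bar>real_of_int (j - m)\<bar>)\<^sup>2" using T by (intro power_mono) (auto simp: b_def)
    qed (use T ab in \<open>auto intro!: mult_pos_pos add_pos_nonneg simp: zero_less_power2\<close>)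
    finally have p: "pk t (j - m) \<le> 12 * T / b\<^sup>2" .
    have Nab: "N \<le> a + b" unfolding N_def a_def b_def by simp
    have "\<bar>qk 0 (n - j)\<bar> * pk t (j - m) \<le> 6 / a * (12 * T / b\<^sup>2)"
      using ab by (intro mult_mono q p pk_nonneg t) auto
    also have "\<dots> = 72 * T / N * (N / (a * b\<^sup>2))" using N by simp
    also have "\<dots> \<le> 72 * T / N * (2 * (1 / a\<^sup>2 + 1 / b\<^sup>2))"
    proof (intro mult_left_mono)
      have "N / (a * b\<^sup>2) \<le> (a + b) / (a * b\<^sup>2)" using Nab ab by (intro divide_right_mono) auto
      also have "\<dots> = (1 / b)\<^sup>2 + (1 / a) * (1 / b)" using ab by (simp add: field_simps power2_eq_square)
      also have "\<dots> \<le> 2 * ((1 / a)\<^sup>2 + (1 / b)\<^sup>2)"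
      proof -
        have "y\<^sup>2 + x * y \<le> 2 * (x\<^sup>2 + y\<^sup>2)" for x y :: real
        proof -
          have "b + c \<le> 2 * a + 2 * b" if "2 * c \<le> a + b" "0 \<le> a" "0 \<le> b" for a b c :: real using that by linarith
          from this[of "x * y" "x\<^sup>2" "y\<^sup>2"] have "y\<^sup>2 + x * y \<le> 2 * x\<^sup>2 + 2 * y\<^sup>2" using sum_squares_bound[of x y] by (simp add: mult.assoc)
          then show ?thesis by (simp only: distrib_left)
        qed
        then show ?thesis .
      qed
      finally show "N / (a * b\<^sup>2) \<le> 2 * (1 / a\<^sup>2 + 1 / b\<^sup>2)" by (simp add: power_divide)
    qed (use T N in auto)
    also have "\<dots> = 144 * T / N * (1 / a\<^sup>2 + 1 / b\<^sup>2)" by simp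
    finally show ?thesis unfolding a_def b_def .
  qed
  have "(\<Sum>j\<in>A. \<bar>qk 0 (n - j)\<bar> * pk t (j - m)) \<le> (\<Sum>j\<in>A. 144 * T / N * (1 / (1 + real_of_int \<bar>j - n\<bar>)\<^sup>2 + 1 / (1 + real_of_int \<bar>j - m\<bar>)\<^sup>2))"
    by (intro sum_mono pt)
  also have "\<dots> = 144 * T / N * ((\<Sum>j\<in>A. 1 / (1 + real_of_int \<bar>j - n\<bar>)\<^sup>2) + (\<Sum>j\<in>A. 1 / (1 + real_of_int \<bar>j - m\<bar>)\<^sup>2))"
    by (simp only: sum_distrib_left[symmetric] sum.distrib)
  also have "\<dots> \<le> 144 * T / N * (6 + 6)"
    using T N by (intro mult_left_mono add_mono inverse_square_sum_le A) auto
  finally show ?thesis by (simp add: T_def N_def)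
qed

text \<open>Associativity of the convolution of the Riesz kernel, the Poisson kernel and
  \<open>f\<close>. The preceding bound gives absolute summability of the double series for every
  tame \<open>f\<close>.\<close>

lemma conj_fwd_eq_conv:
  assumes f: "tame f" and t: "0 \<le> t"
  shows "conj_fwd t f n = conv (qk t) f n"
proof -
  let ?G = "\<lambda>m j. of_real (qk 0 (n - j)) * (of_real (pk t (j - m)) * f m)"
  let ?C = "1728 * max 1 t"
  have inner: "(\<lambda>j. \<bar>qk 0 (n - j)\<bar> * pk t (j - m)) summable_on UNIV" for m
    by (rule nonneg_bdd_above_summable_on)
       (use riesz_poisson_sum_bound[OF t] pk_nonneg[OF t] in \<open>auto intro!: bdd_aboveI2\<close>)
  have inner_le: "(\<Sum>\<^sub>\<infinity>j. \<bar>qk 0 (n - j)\<bar> * pk t (j - m)) \<le> ?C / (1 + \<bar>real_of_int (n - m)\<bar>)" for m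
    by (rule infsum_le_finite_sums[OF inner]) (rule riesz_poisson_sum_bound[OF t])
  have nG: "cmod (?G m j) = \<bar>qk 0 (n - j)\<bar> * pk t (j - m) * cmod (f m)" for m j
    using pk_nonneg[OF t] by (simp add: norm_mult)
  have "(\<lambda>(m, j). cmod (?G m j)) summable_on (UNIV \<times> UNIV)"
  proof (rule summable_on_SigmaI)
    show "((\<lambda>j. case (m, j) of (m, j) \<Rightarrow> cmod (?G m j)) has_sum (\<Sum>\<^sub>\<infinity>j. \<bar>qk 0 (n - j)\<bar> * pk t (j - m)) * cmod (f m)) UNIV" for m
      unfolding prod.case nG by (intro has_sum_cmult_left has_sum_infsum inner)
    show "(\<lambda>m. (\<Sum>\<^sub>\<infinity>j. \<bar>qk 0 (n - j)\<bar> * pk t (j - m)) * cmod (f m)) summable_on UNIV"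
    proof (rule summable_on_comparison_test[OF summable_on_cmult_right[OF tame_summable[OF f, of n], of ?C]])
      fix m
      show "(\<Sum>\<^sub>\<infinity>j. \<bar>qk 0 (n - j)\<bar> * pk t (j - m)) * cmod (f m) \<le> ?C * (cmod (f m) / (1 + \<bar>real_of_int (n - m)\<bar>))"
        using mult_right_mono[OF inner_le[of m], of "cmod (f m)"] by simp
      show "0 \<le> (\<Sum>\<^sub>\<infinity>j. \<bar>qk 0 (n - j)\<bar> * pk t (j - m)) * cmod (f m)"
        using pk_nonneg[OF t] by (intro mult_nonneg_nonneg infsum_nonneg) auto
    qed
  qed auto
  then have "(\<lambda>(m, j). ?G m j) summable_on (UNIV \<times> UNIV)"
    by (intro abs_summable_summable[of "\<lambda>(m, j). ?G m j"]) (simp add: case_prod_unfold)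
  from infsum_swap_banach[OF this]
  have swap: "(\<Sum>\<^sub>\<infinity>m. \<Sum>\<^sub>\<infinity>j. ?G m j) = (\<Sum>\<^sub>\<infinity>j. \<Sum>\<^sub>\<infinity>m. ?G m j)" .
  have "(\<Sum>\<^sub>\<infinity>j. ?G m j) = of_real (qk t (n - m)) * f m" for m
  proof -
    have "((\<lambda>j. pk t (j - m) * qk 0 (n - j)) has_sum qk t (n - m)) UNIV \<longleftrightarrow>
        ((\<lambda>i. pk t i * qk 0 (n - m - i)) has_sum qk t (n - m)) UNIV"
      by (rule has_sum_reindex_bij_witness[of _ "\<lambda>i. i + m" "\<lambda>j. j - m"]) auto
    then have "((\<lambda>j. pk t (j - m) * qk 0 (n - j)) has_sum qk t (n - m)) UNIV" using qk_has_sum[OF t] by simp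
    from has_sum_cmult_left[OF has_sum_of_real[OF this], of "f m"]
    have "((\<lambda>j. ?G m j) has_sum of_real (qk t (n - m)) * f m) UNIV" by (simp add: algebra_simps)
    then show ?thesis by (rule infsumI)
  qed
  moreover have "(\<Sum>\<^sub>\<infinity>m. ?G m j) = of_real (qk 0 (n - j)) * conv (pk t) f j" for j
    by (simp add: conv_def infsum_cmult_right')
  ultimately have "conv (qk t) f n = conv (qk 0) (conv (pk t) f) n"
    using swap by (simp add: conv_def)
  moreover have "poisson t f = conv (pk t) f" using poisson_eq_conv[OF f t] by blast
  ultimately show ?thesis by (simp add: conj_fwd_def riesz_fwd_eq_conv)
qed

section \<open>Cauchy--Riemann equations and boundary values\<close>

lemma quadratic_remainder:
  fixes \<phi> \<phi>' \<phi>'' :: "real \<Rightarrow> real"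
  assumes d1: "\<And>z. 0 < z \<Longrightarrow> (\<phi> has_real_derivative \<phi>' z) (at z)"
    and d2: "\<And>z. 0 < z \<Longrightarrow> (\<phi>' has_real_derivative \<phi>'' z) (at z)"
    and B: "\<And>z. 0 < z \<Longrightarrow> \<bar>\<phi>'' z\<bar> \<le> B" and st: "0 < s" "0 < t"
  shows "\<bar>\<phi> s - \<phi> t - (s - t) * \<phi>' t\<bar> \<le> B * (s - t)\<^sup>2"
proof -
  have B0: "0 \<le> B" using B[of 1] by linarith
  have lip: "\<bar>\<phi>' y - \<phi>' x\<bar> \<le> B * \<bar>y - x\<bar>" if "0 < x" "0 < y" for x y
  proof -
    have "norm (\<phi>' y - \<phi>' x) \<le> B * norm (y - x)"
    proof (rule field_differentiable_bound[of "{0<..}" \<phi>' \<phi>''])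
      show "(\<phi>' has_field_derivative \<phi>'' z) (at z within {0<..})" if "z \<in> {0<..}" for z
        using d2[of z] that by (auto dest: has_field_derivative_at_within)
      show "norm (\<phi>'' z) \<le> B" if "z \<in> {0<..}" for z using B[of z] that by simp
    qed (use that in auto)
    then show ?thesis by simp
  qed
  define \<psi> where "\<psi> = (\<lambda>z. \<phi> z - z * \<phi>' t)"
  let ?U = "{min s t..max s t}"
  have "norm (\<psi> s - \<psi> t) \<le> B * \<bar>s - t\<bar> * norm (s - t)"
  proof (rule field_differentiable_bound[of ?U \<psi> "\<lambda>z. \<phi>' z - \<phi>' t"])
    fix z assume z: "z \<in> ?U"
    then have z0: "0 < z" using st by auto
    show "(\<psi> has_field_derivative \<phi>' z - \<phi>' t) (at z within ?U)"
      unfolding \<psi>_def by (rule has_field_derivative_at_within) (auto intro!: derivative_eq_intros d1[OF z0])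
    have "\<bar>\<phi>' z - \<phi>' t\<bar> \<le> B * \<bar>z - t\<bar>" by (rule lip[OF st(2) z0])
    also have "\<dots> \<le> B * \<bar>s - t\<bar>" using z B0 by (intro mult_left_mono) auto
    finally show "norm (\<phi>' z - \<phi>' t) \<le> B * \<bar>s - t\<bar>" by simp
  qed auto
  then have "\<bar>\<psi> s - \<psi> t\<bar> \<le> B * (\<bar>s - t\<bar> * \<bar>s - t\<bar>)" by (simp add: mult.assoc)
  also have "\<bar>s - t\<bar> * \<bar>s - t\<bar> = (s - t)\<^sup>2" by (simp add: power2_eq_square abs_mult_self_eq)
  finally show ?thesis by (simp add: \<psi>_def algebra_simps)
qed

lemma has_vector_derivative_quadratic:
  fixes g :: "real \<Rightarrow> complex"
  assumes t: "0 < t" and q: "\<And>s. 0 < s \<Longrightarrow> cmod (g s - g t - of_real (s - t) * d) \<le> M * (s - t)\<^sup>2"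
  shows "(g has_vector_derivative d) (at t)"
  unfolding has_vector_derivative_def has_derivative_at
proof
  show "bounded_linear (\<lambda>x. x *\<^sub>R d)" by (rule bounded_linear_scaleR_left)
  have "((\<lambda>h. M * \<bar>h\<bar>) \<longlongrightarrow> 0) (at 0)"
    by (rule tendsto_eq_intros refl | simp)+
  moreover have "\<forall>\<^sub>F h in at 0. norm (norm (g (t + h) - g t - h *\<^sub>R d) / norm h) \<le> M * \<bar>h\<bar>"
  proof -
    have "\<forall>\<^sub>F h in at 0. - t < (h::real)" using t by (intro order_tendstoD(1)[OF tendsto_ident_at]) simp
    moreover have "\<forall>\<^sub>F h in at 0. h \<noteq> (0::real)" by (simp add: eventually_at_filter)
    ultimately show ?thesis
    proof eventually_elim
      case (elim h)
      have "cmod (g (t + h) - g t - of_real (t + h - t) * d) \<le> M * (t + h - t)\<^sup>2" using elim by (intro q) simp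
      then have "cmod (g (t + h) - g t - h *\<^sub>R d) \<le> M * \<bar>h\<bar> * \<bar>h\<bar>"
        by (simp add: scaleR_conv_of_real power2_eq_square abs_mult_self_eq mult.assoc)
      then show ?case using elim by (simp add: divide_le_eq)
    qed
  qed
  ultimately show "(\<lambda>h. norm (g (t + h) - g t - h *\<^sub>R d) / norm h) \<midarrow>0\<rightarrow> 0"
    by (rule Lim_null_comparison[rotated])
qed

text \<open>Differentiation under the sum with a quantitative remainder: a bound on the second
  derivatives of the kernel by \<open>C / (1 + \<bar>k\<bar>)\<close> makes the remainder of first
  order a kernel with the same decay and the factor \<open>(s - t)\<^sup>2\<close>, so no limit has
  to be exchanged with the sum.\<close>

lemma conv_has_vector_derivative:
  fixes U V X :: "real \<Rightarrow> int \<Rightarrow> real"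
  assumes f: "tame f" and t: "0 < t"
    and d1: "\<And>z k. 0 < z \<Longrightarrow> ((\<lambda>z. U z k) has_real_derivative V z k) (at z)"
    and d2: "\<And>z k. 0 < z \<Longrightarrow> ((\<lambda>z. V z k) has_real_derivative X z k) (at z)"
    and U: "\<And>z. 0 < z \<Longrightarrow> decays C (U z)" and V: "\<And>z. 0 < z \<Longrightarrow> decays C (V z)" and X: "\<And>z. 0 < z \<Longrightarrow> decays C (X z)"
  shows "((\<lambda>s. conv (U s) f n) has_vector_derivative conv (V t) f n) (at t)"
proof (rule has_vector_derivative_quadratic[OF t, where M = "C * potential f n" and d = "conv (V t) f n" and g = "\<lambda>s. conv (U s) f n"])
  fix s :: real assume s: "0 < s"
  let ?R = "\<lambda>k. U s k - U t k - (s - t) * V t k"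
  have "\<bar>?R k\<bar> \<le> C / (1 + \<bar>real_of_int k\<bar>) * (s - t)\<^sup>2" for k
    by (rule quadratic_remainder[where \<phi> = "\<lambda>z. U z k" and \<phi>' = "\<lambda>z. V z k" and \<phi>'' = "\<lambda>z. X z k"])
       (use d1 d2 s t X in \<open>auto simp: decays_def\<close>)
  then have dR: "decays (C * (s - t)\<^sup>2) ?R" by (simp add: decays_def)
  have dV: "decays (C * \<bar>s - t\<bar>) (\<lambda>k. (s - t) * V t k)"
    unfolding decays_def
  proof
    fix k
    have "\<bar>s - t\<bar> * \<bar>V t k\<bar> \<le> \<bar>s - t\<bar> * (C / (1 + \<bar>real_of_int k\<bar>))"
      using V[OF t] by (intro mult_left_mono) (auto simp: decays_def)
    then show "\<bar>(s - t) * V t k\<bar> \<le> C * \<bar>s - t\<bar> / (1 + \<bar>real_of_int k\<bar>)" by (simp add: abs_mult mult.commute)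
  qed
  have "conv ?R f n = conv (\<lambda>k. U s k - U t k) f n - conv (\<lambda>k. (s - t) * V t k) f n"
    by (rule conv_diff[OF f decays_diff[OF U[OF s] U[OF t]] dV])
  also have "conv (\<lambda>k. U s k - U t k) f n = conv (U s) f n - conv (U t) f n"
    by (rule conv_diff[OF f U[OF s] U[OF t]])
  also have "conv (\<lambda>k. (s - t) * V t k) f n = of_real (s - t) * conv (V t) f n" by (rule conv_scale)
  finally have e: "conv ?R f n = conv (U s) f n - conv (U t) f n - of_real (s - t) * conv (V t) f n" .
  have r1: "cmod (conv (U s) f n - conv (U t) f n - of_real (s - t) * conv (V t) f n) = cmod (conv ?R f n)"
    by (rule arg_cong[OF e[symmetric]])
  have r2: "cmod (conv ?R f n) \<le> C * (s - t)\<^sup>2 * potential f n" by (rule conv_bound[OF f dR])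
  have r3: "C * (s - t)\<^sup>2 * potential f n = (C * potential f n) * (s - t)\<^sup>2" 
  proof -
    have "x * y * z = x * z * y" for x y z :: real by simp
    then show ?thesis by this
  qed
  show "cmod (conv (U s) f n - conv (U t) f n - of_real (s - t) * conv (V t) f n) \<le> (C * potential f n) * (s - t)\<^sup>2"
    by (rule order_trans[OF eq_refl[OF r1] order_trans[OF r2 eq_refl[OF r3]]])
qed

lemma decays_pk_diff: "0 \<le> t \<Longrightarrow> decays 6 (\<lambda>k. pk t k - pk t (k + 1))"
  using decays_diff[OF decays_pk decays_shift[OF decays_pk, of t 1], of t] by simp

lemma decays_qk_diff: "0 \<le> t \<Longrightarrow> decays 18 (\<lambda>k. qk t k - qk t (k - 1))"
  using decays_diff[OF decays_qk decays_shift[OF decays_qk, of t "-1"], of t] by simp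

lemma conv_pk_deriv:
  assumes f: "tame f" and t: "0 < t"
  shows "((\<lambda>s. conv (pk s) f n) has_vector_derivative (conv (qk t) f n - conv (qk t) f (n - 1))) (at t)"
proof -
  have D: "((\<lambda>s. conv (pk s) f n) has_vector_derivative conv (\<lambda>k. qk t k - qk t (k - 1)) f n) (at t)"
  proof (rule conv_has_vector_derivative[OF f t, where C = 18 and X = "\<lambda>z k. (pk z k - pk z (k + 1)) - (pk z (k - 1) - pk z k)"])
    show "((\<lambda>z. qk z k - qk z (k - 1)) has_real_derivative (pk z k - pk z (k + 1)) - (pk z (k - 1) - pk z k)) (at z)" for z k
      using DERIV_diff[OF qk_deriv[of k z] qk_deriv[of "k - 1" z]] by simp
    fix z :: real assume z: "0 < z"
    show "decays 18 (pk z)" using decays_mono[OF decays_pk[of z], of 18] z by simp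
    show "decays 18 (\<lambda>k. qk z k - qk z (k - 1))" using decays_qk_diff[of z] z by simp
    have "decays (6 + 2 * 6) (\<lambda>k. (pk z k - pk z (k + 1)) - (pk z (k + - 1) - pk z (k + - 1 + 1)))"
      using z by (intro decays_diff[OF decays_pk_diff decays_shift[OF decays_pk_diff]]) auto
    then show "decays 18 (\<lambda>k. (pk z k - pk z (k + 1)) - (pk z (k - 1) - pk z k))" by simp
  qed (rule pk_deriv)
  have e1: "conv (\<lambda>k. qk t k - qk t (k - 1)) f n = conv (qk t) f n - conv (\<lambda>k. qk t (k + - 1)) f n"
    using conv_diff[OF f decays_qk[of t] decays_shift[OF decays_qk[of t], of "-1"], of n] t by simp
  have e2: "conv (\<lambda>k. qk t (k + - 1)) f n = conv (qk t) f (n - 1)" using conv_shift[of "qk t" "-1" f n] by simp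
  show ?thesis using D unfolding e1 e2 .
qed

lemma conv_qk_deriv:
  assumes f: "tame f" and t: "0 < t"
  shows "((\<lambda>s. conv (qk s) f n) has_vector_derivative (conv (pk t) f n - conv (pk t) f (n + 1))) (at t)"
proof -
  have D: "((\<lambda>s. conv (qk s) f n) has_vector_derivative conv (\<lambda>k. pk t k - pk t (k + 1)) f n) (at t)"
  proof (rule conv_has_vector_derivative[OF f t, where C = 54 and X = "\<lambda>z k. (qk z k - qk z (k - 1)) - (qk z (k + 1) - qk z k)"])
    show "((\<lambda>z. pk z k - pk z (k + 1)) has_real_derivative (qk z k - qk z (k - 1)) - (qk z (k + 1) - qk z k)) (at z)" for z k
      using DERIV_diff[OF pk_deriv[of k z] pk_deriv[of "k + 1" z]] by simp
    fix z :: real assume z: "0 < z"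
    show "decays 54 (qk z)" using decays_mono[OF decays_qk[of z], of 54] z by simp
    show "decays 54 (\<lambda>k. pk z k - pk z (k + 1))" using decays_mono[OF decays_pk_diff[of z], of 54] z by simp
    have "decays (18 + 2 * 18) (\<lambda>k. (qk z k - qk z (k - 1)) - (qk z (k + 1) - qk z (k + 1 - 1)))"
      using z by (intro decays_diff[OF decays_qk_diff decays_shift[OF decays_qk_diff]]) auto
    then show "decays 54 (\<lambda>k. (qk z k - qk z (k - 1)) - (qk z (k + 1) - qk z k))" by simp
  qed (rule qk_deriv)
  have e1: "conv (\<lambda>k. pk t k - pk t (k + 1)) f n = conv (pk t) f n - conv (\<lambda>k. pk t (k + 1)) f n"
    using conv_diff[OF f decays_pk[of t] decays_shift[OF decays_pk[of t], of 1], of n] t by simp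
  have e2: "conv (\<lambda>k. pk t (k + 1)) f n = conv (pk t) f (n + 1)" by (rule conv_shift[of "pk t" 1 f n])
  show ?thesis using D unfolding e1 e2 .
qed

lemma eventually_positive_transfer:
  fixes g h :: "real \<Rightarrow> complex"
  assumes "(g has_vector_derivative d) (at t)" "0 < t" "\<And>s. 0 < s \<Longrightarrow> g s = h s"
  shows "(h has_vector_derivative d) (at t)"
  using has_vector_derivative_transform_within_open[OF assms(1), of "{0<..}" h] assms by auto

text \<open>The equations for the kernels, convolved with \<open>f\<close>. The backward pair
  follows from the forward one by translation, since the backward conjugate function at
  \<open>n\<close> is the forward one at \<open>n - 1\<close>.\<close>

theorem cauchy_riemann:
  assumes f: "tame f" and t: "0 < t"
  shows conj_fwd_deriv: "((\<lambda>s. conj_fwd s f n) has_vector_derivative - diff_fwd (poisson t f) n) (at t)"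
    and poisson_deriv: "((\<lambda>s. poisson s f n) has_vector_derivative diff_bwd (conj_fwd t f) n) (at t)"
    and conj_bwd_deriv: "((\<lambda>s. conj_bwd s f n) has_vector_derivative - diff_bwd (poisson t f) n) (at t)"
    and poisson_deriv': "((\<lambda>s. poisson s f n) has_vector_derivative diff_fwd (conj_bwd t f) n) (at t)"
proof -
  have c: "conj_fwd s f k = conv (qk s) f k" "poisson s f k = conv (pk s) f k" if "0 < s" for s k
    using conj_fwd_eq_conv[OF f, of s] poisson_eq_conv[OF f, of s] that by auto
  have D: "((\<lambda>s. conj_fwd s f n) has_vector_derivative - diff_fwd (poisson t f) n) (at t)" for n
    by (rule eventually_positive_transfer[where g = "\<lambda>s. conv (qk s) f n"])
       (use conv_qk_deriv[OF f t, of n] t in \<open>auto simp: c diff_fwd_def\<close>)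
  show "((\<lambda>s. conj_fwd s f n) has_vector_derivative - diff_fwd (poisson t f) n) (at t)" by (rule D)
  show P: "((\<lambda>s. poisson s f n) has_vector_derivative diff_bwd (conj_fwd t f) n) (at t)"
    by (rule eventually_positive_transfer[where g = "\<lambda>s. conv (pk s) f n"])
       (use conv_pk_deriv[OF f t, of n] t in \<open>auto simp: c diff_bwd_def\<close>)
  show "((\<lambda>s. conj_bwd s f n) has_vector_derivative - diff_bwd (poisson t f) n) (at t)"
    using D[of "n - 1"] by (simp add: conj_bwd_eq diff_fwd_def diff_bwd_def)
  show "((\<lambda>s. poisson s f n) has_vector_derivative diff_fwd (conj_bwd t f) n) (at t)"
    using P by (simp add: conj_bwd_eq diff_fwd_def diff_bwd_def)
qed

lemma conj_fwd_second_deriv: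
  assumes f: "tame f" and t: "0 < t"
  shows "((\<lambda>s. vector_derivative (\<lambda>r. conj_fwd r f n) (at s)) has_vector_derivative - discrete_laplacian (conj_fwd t f) n) (at t)"
proof (rule eventually_positive_transfer[where g = "\<lambda>s. - diff_fwd (poisson s f) n"])
  show "- diff_fwd (poisson s f) n = vector_derivative (\<lambda>r. conj_fwd r f n) (at s)" if "0 < s" for s
    by (rule vector_derivative_at[OF conj_fwd_deriv[OF f that], symmetric])
  have "((\<lambda>s. - (poisson s f (n + 1) - poisson s f n)) has_vector_derivative - (diff_bwd (conj_fwd t f) (n + 1) - diff_bwd (conj_fwd t f) n)) (at t)"
    by (intro has_vector_derivative_minus has_vector_derivative_diff poisson_deriv f t)
  moreover have "- (diff_bwd (conj_fwd t f) (n + 1) - diff_bwd (conj_fwd t f) n) = - discrete_laplacian (conj_fwd t f) n"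
    by (simp add: diff_bwd_def discrete_laplacian_def)
  ultimately show "((\<lambda>s. - diff_fwd (poisson s f) n) has_vector_derivative - discrete_laplacian (conj_fwd t f) n) (at t)"
    unfolding diff_fwd_def by simp
qed (rule t)

lemma conj_bwd_second_deriv:
  assumes f: "tame f" and t: "0 < t"
  shows "((\<lambda>s. vector_derivative (\<lambda>r. conj_bwd r f n) (at s)) has_vector_derivative - discrete_laplacian (conj_bwd t f) n) (at t)"
  using conj_fwd_second_deriv[OF f t, of "n - 1"] by (simp add: conj_bwd_eq[abs_def] discrete_laplacian_def)

text \<open>By the Cauchy--Riemann equation, the derivative of \<open>qk\<close> in \<open>t\<close>
  decays like \<open>1 / (1 + \<bar>k\<bar>)\<close> uniformly in \<open>t\<close>, so the
  difference to the Riesz kernel does so with the factor \<open>t\<close>.\<close>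

lemma conj_fwd_limit_bound:
  assumes f: "tame f" and t: "0 \<le> t"
  shows "cmod (conj_fwd t f n - riesz_fwd f n) \<le> 6 * t * potential f n"
proof -
  have "decays (6 * t) (\<lambda>k. qk t k - qk 0 k)"
    unfolding decays_def
  proof
    fix k
    have "norm (qk t k - qk 0 k) \<le> 6 / (1 + \<bar>real_of_int k\<bar>) * norm (t - 0)"
    proof (rule field_differentiable_bound[of "{0..}" "\<lambda>z. qk z k" "\<lambda>z. pk z k - pk z (k + 1)"])
      show "((\<lambda>z. qk z k) has_field_derivative pk z k - pk z (k + 1)) (at z within {0..})" for z
        by (rule has_field_derivative_at_within[OF qk_deriv])
      show "norm (pk z k - pk z (k + 1)) \<le> 6 / (1 + \<bar>real_of_int k\<bar>)" if "z \<in> {0..}" for z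
        using decays_pk_diff[of z] that by (simp add: decays_def)
    qed (use t in auto)
    then show "\<bar>qk t k - qk 0 k\<bar> \<le> 6 * t / (1 + \<bar>real_of_int k\<bar>)" using t by simp
  qed
  from conv_bound[OF f this, of n] show ?thesis
    using conv_diff[OF f decays_qk[OF t] decays_qk[of 0], of n] by (simp add: conj_fwd_eq_conv[OF f t] riesz_fwd_eq_conv)
qed

lemma conj_fwd_tendsto:
  assumes f: "tame f"
  shows "((\<lambda>t. conj_fwd t f n) \<longlongrightarrow> riesz_fwd f n) (at_right 0)"
proof (rule LIM_zero_cancel, rule Lim_null_comparison)
  show "\<forall>\<^sub>F t in at_right 0. norm (conj_fwd t f n - riesz_fwd f n) \<le> 6 * t * potential f n"
    using eventually_at_right_less[of 0] by eventually_elim (simp add: conj_fwd_limit_bound[OF f])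
  show "((\<lambda>t. 6 * t * potential f n) \<longlongrightarrow> 0) (at_right 0)"
    by (rule tendsto_eq_intros refl | simp)+
qed

section \<open>From finitely supported sequences to weighted spaces\<close>

lemma small_tail:
  fixes g :: "int \<Rightarrow> real"
  assumes g: "\<And>m. 0 \<le> g m" and s: "g summable_on UNIV" and e: "0 < e"
  shows "\<exists>F. finite F \<and> (\<forall>S. finite S \<longrightarrow> F \<subseteq> S \<longrightarrow> infsum g (UNIV - S) \<le> e)"
proof -
  have diff: "infsum g (UNIV - S) = infsum g UNIV - sum g S" if "finite S" for S
    using has_sum_Diff[OF has_sum_infsum[OF s] has_sum_finite[OF that]] by (intro infsumI) auto
  have "\<exists>F. finite F \<and> infsum g UNIV - e < sum g F"
  proof (rule ccontr)
    assume "\<not> ?thesis"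
    then have "infsum g UNIV \<le> infsum g UNIV - e" by (intro infsum_le_finite_sums[OF s]) (auto simp: not_less)
    with e show False by simp
  qed
  then obtain F where F: "finite F" "infsum g UNIV - e < sum g F" by blast
  have "infsum g (UNIV - S) \<le> e" if "finite S" "F \<subseteq> S" for S
  proof -
    have "sum g F \<le> sum g S" using that g by (intro sum_mono2) auto
    with F diff[OF that(1)] show ?thesis by linarith
  qed
  with F show ?thesis by blast
qed

text \<open>The maximal function of the conjugate Poisson integral, written with the kernel and for
  both shifts at once. The value at \<open>t = 0\<close>, the Riesz transform itself, is included.\<close>

definition conj_max :: "int \<Rightarrow> (int \<Rightarrow> complex) \<Rightarrow> int \<Rightarrow> real" where
  "conj_max c f n = (SUP t\<in>{0..}. cmod (conv (conj_kernel c t) f n))"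

lemma conv_conj_kernel: "conv (conj_kernel c t) f n = conv (qk t) f (n - c)"
  using conv_shift[of "qk t" "- c" f n] by (simp add: conj_kernel_def[abs_def])

lemma decays_conj_kernel: "c \<in> {0, 1} \<Longrightarrow> 0 \<le> t \<Longrightarrow> decays 12 (conj_kernel c t)"
  using decays_shift[OF decays_qk[of t], of "- c"] by (auto simp: conj_kernel_def[abs_def])

lemma conj_max_bdd:
  assumes "c \<in> {0, 1}" "tame f"
  shows "bdd_above ((\<lambda>t. cmod (conv (conj_kernel c t) f n)) ` {0..})"
  by (rule bdd_aboveI2[of _ _ "12 * potential f n"]) (use conv_bound[OF assms(2) decays_conj_kernel[OF assms(1)]] in auto)

lemma conj_max_upper:
  assumes "c \<in> {0, 1}" "tame f" "0 \<le> t"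
  shows "cmod (conv (conj_kernel c t) f n) \<le> conj_max c f n"
  unfolding conj_max_def by (rule cSUP_upper[OF _ conj_max_bdd[OF assms(1,2)]]) (use assms in auto)

lemma conj_max_nonneg: "c \<in> {0, 1} \<Longrightarrow> tame f \<Longrightarrow> 0 \<le> conj_max c f n"
  using conj_max_upper[of c f 0 n] norm_ge_zero order_trans by blast

text \<open>At finitely many points, and uniformly in \<open>t\<close>, a tame sequence may be
  replaced by its restriction to a finite set: the kernels have the common majorant \<open>12 / (1 +
  \<bar>k\<bar>)\<close>.\<close>

lemma conj_max_truncation:
  assumes c: "c \<in> {0, 1}" and f: "tame f" and A: "finite A" and e: "0 < e"
  shows "\<exists>S. finite S \<and> (\<forall>n\<in>A. conj_max c f n \<le> cz_family.family_max (conj_kernel c) {0..} S f n + e)"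
proof -
  interpret cz_family "conj_kernel c" "{0..}" 24 by (rule conj_kernel_cz[OF c])
  let ?g = "\<lambda>n m. 12 * (cmod (f m) / (1 + \<bar>real_of_int (n - m)\<bar>))"
  have gs: "?g n summable_on UNIV" for n by (rule summable_on_cmult_right[OF tame_summable[OF f]])
  have "\<exists>F. finite F \<and> (\<forall>S. finite S \<longrightarrow> F \<subseteq> S \<longrightarrow> infsum (?g n) (UNIV - S) \<le> e)" for n
    by (rule small_tail[OF _ gs e]) auto
  then obtain F where F: "\<And>n. finite (F n)" "\<And>n S. finite S \<Longrightarrow> F n \<subseteq> S \<Longrightarrow> infsum (?g n) (UNIV - S) \<le> e"
    by metis
  define S where "S = (\<Union>n\<in>A. F n)"
  have S: "finite S" using A F by (simp add: S_def)
  have "conj_max c f n \<le> family_max S f n + e" if n: "n \<in> A" for n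
    unfolding conj_max_def
  proof (rule cSUP_least)
    fix t :: real assume t: "t \<in> {0..}"
    then have t0: "0 \<le> t" by simp
    let ?h = "\<lambda>m. of_real (conj_kernel c t (n - m)) * f m"
    have "(?h has_sum (conv (conj_kernel c t) f n - sum ?h S)) (UNIV - S)"
      by (rule has_sum_Diff[OF conv_has_sum[OF f decays_conj_kernel[OF c t0]] has_sum_finite[OF S]]) auto
    moreover have "(?g n has_sum infsum (?g n) (UNIV - S)) (UNIV - S)"
      by (rule has_sum_infsum) (rule summable_on_subset_banach[OF gs], auto)
    ultimately have "cmod (conv (conj_kernel c t) f n - sum ?h S) \<le> infsum (?g n) (UNIV - S)"
      by (rule norm_infsum_le) (rule decays_term[OF decays_conj_kernel[OF c t0]])
    also have "\<dots> \<le> e" by (rule F(2)[OF S]) (use n in \<open>auto simp: S_def\<close>)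
    finally have "cmod (conv (conj_kernel c t) f n - sum ?h S) \<le> e" .
    moreover have "cmod (sum ?h S) \<le> family_max S f n" by (rule family_max_upper[OF t])
    ultimately show "cmod (conv (conj_kernel c t) f n) \<le> family_max S f n + e"
      using norm_triangle_sub[of "conv (conj_kernel c t) f n" "sum ?h S"] by linarith
  qed auto
  with S show ?thesis by blast
qed

lemma finite_sums_summable:
  fixes g :: "int \<Rightarrow> real"
  assumes "\<And>n. 0 \<le> g n" "\<And>A. finite A \<Longrightarrow> sum g A \<le> B"
  shows "g summable_on UNIV" "infsum g UNIV \<le> B"
proof -
  show s: "g summable_on UNIV"
    by (rule nonneg_bdd_above_summable_on) (use assms in \<open>auto intro!: bdd_aboveI2\<close>)
  show "infsum g UNIV \<le> B" by (rule infsum_le_finite_sums[OF s]) (use assms in auto)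
qed

text \<open>The error \<open>e\<close> of the truncation is chosen as at most half of the smallest
  positive value of the maximal function on \<open>A\<close>, so that it is absorbed into a factor
  \<open>2\<close>.\<close>

lemma conj_max_strong:
  fixes w :: "int \<Rightarrow> real"
  assumes c: "c \<in> {0, 1}" and p: "1 < p" and pos: "\<And>n. w n > 0"
    and Ap: "\<And>a b. a \<le> b \<Longrightarrow> (\<Sum>n=a..b. w n) * (\<Sum>n=a..b. w n powr (- 1 / (p - 1))) powr (p - 1) \<le> D * real_of_int (b - a + 1) powr p"
  shows "\<exists>B\<ge>0. \<forall>f. tame f \<longrightarrow> f \<in> lp_space p w \<longrightarrow> (\<forall>A. finite A \<longrightarrow>
     (\<Sum>n\<in>A. conj_max c f n powr p * w n) \<le> B * (\<Sum>\<^sub>\<infinity>n. cmod (f n) powr p * w n))"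
proof -
  interpret cz_family "conj_kernel c" "{0..}" 24 by (rule conj_kernel_cz[OF c])
  obtain B2 where B20: "0 \<le> B2" and B2: "\<And>S A f. finite S \<Longrightarrow> finite A \<Longrightarrow>
      (\<Sum>n\<in>A. family_max S f n powr p * w n) \<le> B2 * (\<Sum>m\<in>S. cmod (f m) powr p * w m)"
    using conj_strong[OF c p pos Ap] by blast
  have w0: "0 \<le> w n" for n using pos[of n] by simp
  have "(\<Sum>n\<in>A. conj_max c f n powr p * w n) \<le> 2 powr p * B2 * (\<Sum>\<^sub>\<infinity>n. cmod (f n) powr p * w n)"
    if f: "tame f" "f \<in> lp_space p w" and A: "finite A" for f A
  proof -
    define A' where "A' = {n\<in>A. 0 < conj_max c f n}"
    have A': "finite A'" using A by (simp add: A'_def)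
    define e where "e = Min (insert 1 (conj_max c f ` A')) / 2"
    have e: "0 < e" using A' by (simp add: e_def A'_def)
    have e2: "2 * e \<le> conj_max c f n" if "n \<in> A'" for n using A' that by (simp add: e_def)
    obtain S where S: "finite S" "\<And>n. n \<in> A' \<Longrightarrow> conj_max c f n \<le> family_max S f n + e"
      using conj_max_truncation[OF c f(1) A' e] by blast
    have half: "conj_max c f n \<le> 2 * family_max S f n" if "n \<in> A'" for n using S(2)[OF that] e2[OF that] by linarith
    have "(\<Sum>n\<in>A. conj_max c f n powr p * w n) = (\<Sum>n\<in>A'. conj_max c f n powr p * w n)"
      using A conj_max_nonneg[OF c f(1)] by (intro sum.mono_neutral_right) (auto simp: A'_def less_le)
    also have "\<dots> \<le> (\<Sum>n\<in>A'. 2 powr p * (family_max S f n powr p * w n))"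
    proof (rule sum_mono)
      fix n assume n: "n \<in> A'"
      have "conj_max c f n powr p \<le> (2 * family_max S f n) powr p"
        using half[OF n] conj_max_nonneg[OF c f(1)] p by (intro powr_mono2) auto
      also have "\<dots> = 2 powr p * family_max S f n powr p" using family_max_nonneg by (simp add: powr_mult)
      finally have "conj_max c f n powr p * w n \<le> 2 powr p * family_max S f n powr p * w n" using w0 by (rule mult_right_mono)
      then show "conj_max c f n powr p * w n \<le> 2 powr p * (family_max S f n powr p * w n)" by (simp add: mult.assoc)
    qed
    also have "\<dots> = 2 powr p * (\<Sum>n\<in>A'. family_max S f n powr p * w n)" by (simp add: sum_distrib_left)
    also have "\<dots> \<le> 2 powr p * (B2 * (\<Sum>m\<in>S. cmod (f m) powr p * w m))" by (intro mult_left_mono B2 S A') auto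
    also have "\<dots> \<le> 2 powr p * (B2 * (\<Sum>\<^sub>\<infinity>n. cmod (f n) powr p * w n))"
      using f(2) B20 S w0 unfolding lp_space_def by (intro mult_left_mono finite_sum_le_infsum) auto
    finally show ?thesis by (simp add: mult.assoc)
  qed
  moreover have "0 \<le> 2 powr p * B2" using B20 by simp
  ultimately show ?thesis by blast
qed

lemma conj_max_weak:
  fixes w :: "int \<Rightarrow> real"
  assumes c: "c \<in> {0, 1}" and pos: "\<And>n. w n > 0"
    and A1: "\<And>a b n. a \<le> n \<Longrightarrow> n \<le> b \<Longrightarrow> (\<Sum>i=a..b. w i) \<le> D * real_of_int (b - a + 1) * w n"
  shows "\<exists>B\<ge>0. \<forall>f. tame f \<longrightarrow> f \<in> lp_space 1 w \<longrightarrow> (\<forall>A l. finite A \<longrightarrow> 0 < l \<longrightarrow>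
     l * (\<Sum>n\<in>{n\<in>A. l < conj_max c f n}. w n) \<le> B * (\<Sum>\<^sub>\<infinity>n. cmod (f n) powr 1 * w n))"
proof -
  interpret cz_family "conj_kernel c" "{0..}" 24 by (rule conj_kernel_cz[OF c])
  obtain B1 where B10: "0 \<le> B1" and B1: "\<And>S A f l. finite S \<Longrightarrow> finite A \<Longrightarrow> 0 < l \<Longrightarrow>
     l * (\<Sum>n\<in>{n\<in>A. l < family_max S f n}. w n) \<le> B1 * (\<Sum>m\<in>S. cmod (f m) * w m)"
    using conj_weak_A1[OF c pos A1] by blast
  have w0: "0 \<le> w n" for n using pos[of n] by simp
  have "l * (\<Sum>n\<in>{n\<in>A. l < conj_max c f n}. w n) \<le> 2 * B1 * (\<Sum>\<^sub>\<infinity>n. cmod (f n) powr 1 * w n)"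
    if f: "tame f" "f \<in> lp_space 1 w" and A: "finite A" and l: "0 < l" for f A l
  proof -
    obtain S where S: "finite S" "\<And>n. n \<in> A \<Longrightarrow> conj_max c f n \<le> family_max S f n + l / 2"
      using conj_max_truncation[OF c f(1) A, of "l / 2"] l by auto
    have "(\<Sum>n\<in>{n\<in>A. l < conj_max c f n}. w n) \<le> (\<Sum>n\<in>{n\<in>A. l / 2 < family_max S f n}. w n)"
    proof (rule sum_mono2)
      show "{n\<in>A. l < conj_max c f n} \<subseteq> {n\<in>A. l / 2 < family_max S f n}" using S(2) by fastforce
    qed (use A w0 in auto)
    then have "l * (\<Sum>n\<in>{n\<in>A. l < conj_max c f n}. w n) \<le> 2 * (l / 2 * (\<Sum>n\<in>{n\<in>A. l / 2 < family_max S f n}. w n))"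
      using l by simp
    also have "\<dots> \<le> 2 * (B1 * (\<Sum>m\<in>S. cmod (f m) * w m))" using l by (intro mult_left_mono B1 S A) auto
    also have "(\<Sum>m\<in>S. cmod (f m) * w m) = (\<Sum>m\<in>S. cmod (f m) powr 1 * w m)" by simp
    also have "2 * (B1 * (\<Sum>m\<in>S. cmod (f m) powr 1 * w m)) \<le> 2 * (B1 * (\<Sum>\<^sub>\<infinity>n. cmod (f n) powr 1 * w n))"
      using f(2) B10 S w0 unfolding lp_space_def by (intro mult_left_mono finite_sum_le_infsum) auto
    finally show ?thesis by (simp add: mult.assoc)
  qed
  moreover have "0 \<le> 2 * B1" using B10 by simp
  ultimately show ?thesis by blast
qed

lemma maximal_op_eq:
  assumes "tame f"
  shows "maximal_op conj_fwd f n = conj_max 0 f n" "maximal_op conj_bwd f n = conj_max 1 f n"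
  using assms unfolding maximal_op_def conj_max_def
  by (auto simp: conv_conj_kernel conj_bwd_eq conj_fwd_eq_conv intro!: SUP_cong)

lemma strong_typeI:
  assumes p: "1 < p" and w: "\<And>n. 0 < w n" and B: "0 \<le> B"
    and nonneg: "\<And>f n. f \<in> lp_space p w \<Longrightarrow> 0 \<le> Q f n"
    and bound: "\<And>f A. f \<in> lp_space p w \<Longrightarrow> finite A \<Longrightarrow> (\<Sum>n\<in>A. Q f n powr p * w n) \<le> B * (\<Sum>\<^sub>\<infinity>n. cmod (f n) powr p * w n)"
  shows "strong_type p w Q"
  unfolding strong_type_def
proof (intro exI ballI conjI)
  fix f :: "int \<Rightarrow> complex" assume f: "f \<in> lp_space p w"
  have w0: "0 \<le> w n" for n using w[of n] by simp
  have eq: "norm (Q f n) powr p * w n = Q f n powr p * w n" for n using nonneg[OF f] by simp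
  note fs = finite_sums_summable[of "\<lambda>n. Q f n powr p * w n", OF _ bound[OF f]]
  have s: "(\<lambda>n. Q f n powr p * w n) summable_on UNIV" using w0 by (intro fs(1)) auto
  have i: "(\<Sum>\<^sub>\<infinity>n. Q f n powr p * w n) \<le> B * (\<Sum>\<^sub>\<infinity>n. cmod (f n) powr p * w n)" using w0 by (intro fs(2)) auto
  show "Q f \<in> lp_space p w" unfolding lp_space_def using s by (simp only: mem_Collect_eq eq)
  have "lp_norm p w (Q f) \<le> (B * (\<Sum>\<^sub>\<infinity>n. cmod (f n) powr p * w n)) powr (1 / p)"
    unfolding lp_norm_def eq using p w0 i by (intro powr_mono2 infsum_nonneg) auto
  also have "\<dots> = B powr (1 / p) * lp_norm p w f"
    unfolding lp_norm_def by (rule powr_mult)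
  finally show "lp_norm p w (Q f) \<le> B powr (1 / p) * lp_norm p w f" .
qed

lemma weak_type_1I:
  assumes w: "\<And>n. 0 < w n"
    and nonneg: "\<And>f n. f \<in> lp_space 1 w \<Longrightarrow> 0 \<le> Q f n"
    and bound: "\<And>f A l. f \<in> lp_space 1 w \<Longrightarrow> finite A \<Longrightarrow> 0 < l \<Longrightarrow>
      l * (\<Sum>n\<in>{n\<in>A. l < Q f n}. w n) \<le> B * (\<Sum>\<^sub>\<infinity>n. cmod (f n) powr 1 * w n)"
  shows "weak_type_1 w Q"
  unfolding weak_type_1_def
proof (intro exI ballI allI impI)
  fix f :: "int \<Rightarrow> complex" and l :: real assume f: "f \<in> lp_space 1 w" and l: "0 < l"
  have w0: "0 \<le> w n" for n using w[of n] by simp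
  let ?E = "{n. \<bar>Q f n\<bar> > l}"
  let ?N = "\<Sum>\<^sub>\<infinity>n. cmod (f n) powr 1 * w n"
  have fin: "sum w A \<le> B * ?N / l" if A: "finite A" "A \<subseteq> ?E" for A
  proof -
    have "{n\<in>A. l < Q f n} = A" using A nonneg[OF f] by auto
    then have "l * sum w A \<le> B * ?N" using bound[OF f A(1) l] by simp
    then show ?thesis using l by (simp add: field_simps)
  qed
  have s: "w summable_on ?E"
    by (rule nonneg_bdd_above_summable_on) (use w0 fin in \<open>auto intro!: bdd_aboveI2\<close>)
  have "infsum w ?E \<le> B * ?N / l" by (rule infsum_le_finite_sums[OF s]) (use fin in auto)
  then have "l * infsum w ?E \<le> B * ?N" using l by (simp add: field_simps)
  moreover have "lp_norm 1 w f = ?N"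
  proof -
    have "0 \<le> ?N" using w0 by (intro infsum_nonneg) auto
    then show ?thesis by (simp add: lp_norm_def)
  qed
  ultimately show "w summable_on ?E \<and> l * infsum w ?E \<le> B * lp_norm 1 w f" using s by simp
qed

text \<open>Dominated convergence: outside a finite set the norm is controlled by the tail of
  \<open>G\<close>, on that set the convergence is pointwise.\<close>

lemma lp_limit_dominated:
  fixes F :: "real \<Rightarrow> int \<Rightarrow> complex" and G :: "int \<Rightarrow> real"
  assumes p: "1 < p" and w: "\<And>n. 0 < w n"
    and dom: "\<And>t n. 0 < t \<Longrightarrow> cmod (F t n) \<le> G n" and G: "(\<lambda>n. G n powr p * w n) summable_on UNIV"
    and lim: "\<And>n. ((\<lambda>t. F t n) \<longlongrightarrow> 0) (at_right 0)"
  shows "\<forall>t>0. F t \<in> lp_space p w" "((\<lambda>t. lp_norm p w (F t)) \<longlongrightarrow> 0) (at_right 0)"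
proof -
  have w0: "0 \<le> w n" for n using w[of n] by simp
  have le: "cmod (F t n) powr p * w n \<le> G n powr p * w n" if "0 < t" for t n
    using dom[OF that, of n] p w0 by (intro mult_right_mono powr_mono2) auto
  have sF: "(\<lambda>n. cmod (F t n) powr p * w n) summable_on UNIV" if "0 < t" for t
    by (rule summable_on_comparison_test[OF G]) (use le[OF that] w0 in auto)
  then show "\<forall>t>0. F t \<in> lp_space p w" by (simp add: lp_space_def)
  define H where "H = (\<lambda>t. \<Sum>\<^sub>\<infinity>n. cmod (F t n) powr p * w n)"
  have H0: "0 \<le> H t" for t unfolding H_def using w0 by (intro infsum_nonneg) auto
  have H_lim: "(H \<longlongrightarrow> 0) (at_right 0)"
  proof (rule tendstoI)
    fix e :: real assume e: "0 < e"
    obtain A where A: "finite A" "infsum (\<lambda>n. G n powr p * w n) (UNIV - A) \<le> e / 2"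
      using small_tail[OF _ G, of "e / 2"] e w0 by (auto simp: mult_nonneg_nonneg)
    have "((\<lambda>t. \<Sum>n\<in>A. cmod (F t n) powr p * w n) \<longlongrightarrow> (\<Sum>n\<in>A. 0 * w n)) (at_right 0)"
    proof (intro tendsto_sum tendsto_mult tendsto_const)
      fix n
      show "((\<lambda>t. cmod (F t n) powr p) \<longlongrightarrow> 0) (at_right 0)"
        by (rule tendsto_zero_powrI[OF tendsto_norm_zero[OF lim] tendsto_const]) (use p in auto)
    qed
    then have "((\<lambda>t. \<Sum>n\<in>A. cmod (F t n) powr p * w n) \<longlongrightarrow> 0) (at_right 0)" by simp
    then have "\<forall>\<^sub>F t in at_right 0. (\<Sum>n\<in>A. cmod (F t n) powr p * w n) < e / 2"
      using e by (intro order_tendstoD(2)) auto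
    moreover have "\<forall>\<^sub>F t in at_right 0. 0 < (t::real)" by (rule eventually_at_right_less)
    ultimately show "\<forall>\<^sub>F t in at_right 0. dist (H t) 0 < e"
    proof eventually_elim
      case (elim t)
      let ?f = "\<lambda>n. cmod (F t n) powr p * w n"
      have "infsum ?f (UNIV - A) = H t - sum ?f A"
        unfolding H_def using has_sum_Diff[OF has_sum_infsum[OF sF[OF elim(2)]] has_sum_finite[OF A(1)]]
        by (intro infsumI) auto
      moreover have "infsum ?f (UNIV - A) \<le> infsum (\<lambda>n. G n powr p * w n) (UNIV - A)"
        by (rule infsum_mono[OF summable_on_subset_banach[OF sF[OF elim(2)]] summable_on_subset_banach[OF G]])
           (use le[OF elim(2)] in auto)
      ultimately show ?case using elim A H0[of t] by simp
    qed
  qed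
  have norm_eq: "lp_norm p w (F t) = H t powr (1 / p)" for t by (simp add: lp_norm_def H_def)
  show "((\<lambda>t. lp_norm p w (F t)) \<longlongrightarrow> 0) (at_right 0)"
    unfolding norm_eq by (rule tendsto_zero_powrI[OF H_lim tendsto_const]) (use p H0 in auto)
qed

lemma muckenhoupt_gt_1D:
  assumes "w \<in> muckenhoupt p" "1 < p"
  obtains D where "\<And>n. 0 < w n" "\<And>a b. a \<le> b \<Longrightarrow>
     (\<Sum>n=a..b. w n) * (\<Sum>n=a..b. w n powr (- 1 / (p - 1))) powr (p - 1) \<le> D * real_of_int (b - a + 1) powr p"
  using assms unfolding muckenhoupt_def by auto

lemma muckenhoupt_1D:
  assumes "w \<in> muckenhoupt 1"
  obtains D where "\<And>n. 0 < w n" "\<And>a b n. a \<le> n \<Longrightarrow> n \<le> b \<Longrightarrow>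
     (\<Sum>i=a..b. w i) \<le> D * real_of_int (b - a + 1) * w n"
proof -
  from assms obtain D where w: "\<And>n. 0 < w n"
    and D: "\<And>M N. M \<le> N \<Longrightarrow> (\<Sum>k=M..N. w k) * (SUP k\<in>{M..N}. inverse (w k)) \<le> D * of_int (N - M + 1)"
    unfolding muckenhoupt_def by auto
  have "(\<Sum>i=a..b. w i) \<le> D * real_of_int (b - a + 1) * w n" if n: "a \<le> n" "n \<le> b" for a b n
  proof -
    have "inverse (w n) \<le> (SUP k\<in>{a..b}. inverse (w k))"
      using n by (intro cSUP_upper) auto
    then have "(\<Sum>i=a..b. w i) * inverse (w n) \<le> (\<Sum>i=a..b. w i) * (SUP k\<in>{a..b}. inverse (w k))"
      using w by (intro mult_left_mono sum_nonneg) (auto intro: less_imp_le)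
    also have "\<dots> \<le> D * of_int (b - a + 1)" using n by (intro D) simp
    finally show ?thesis using w[of n] by (simp add: field_simps)
  qed
  with w show ?thesis by (rule that)
qed

text \<open>For \<open>p > 1\<close> this is \<open>Ap_summable\<close>. For \<open>p = 1\<close>
  the \<open>A_1\<close> condition on the interval between \<open>0\<close> and \<open>m\<close>
  bounds \<open>1 / (1 + \<bar>m\<bar>)\<close> by a multiple of \<open>w m\<close>.\<close>

lemma lp_space_tame:
  assumes p: "1 \<le> p" and w: "w \<in> muckenhoupt p" and f: "f \<in> lp_space p w"
  shows "tame f"
proof (cases "p = 1")
  case True
  then obtain D where w: "\<And>n. 0 < w n" and A1: "\<And>a b n. a \<le> n \<Longrightarrow> n \<le> b \<Longrightarrow>
     (\<Sum>i=a..b. w i) \<le> D * real_of_int (b - a + 1) * w n" using w muckenhoupt_1D by blast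
  show ?thesis unfolding tame_def
  proof (rule summable_on_comparison_test)
    show "(\<lambda>m. D / w 0 * (cmod (f m) powr p * w m)) summable_on UNIV"
      using f unfolding lp_space_def by (intro summable_on_cmult_right) simp
    fix m :: int
    have "w 0 \<le> (\<Sum>i=min 0 m..max 0 m. w i)"
      using w by (intro member_le_sum) (auto intro: less_imp_le)
    also have "\<dots> \<le> D * real_of_int (max 0 m - min 0 m + 1) * w m" by (intro A1) auto
    also have "max 0 m - min 0 m + 1 = 1 + \<bar>m\<bar>" by auto
    finally have "w 0 \<le> D * (1 + real_of_int \<bar>m\<bar>) * w m" by simp
    then have "1 / (1 + real_of_int \<bar>m\<bar>) \<le> D / w 0 * w m"
      using w[of 0] by (simp add: field_simps add_pos_nonneg)
    then have "cmod (f m) * (1 / (1 + real_of_int \<bar>m\<bar>)) \<le> cmod (f m) * (D / w 0 * w m)" by (intro mult_left_mono) auto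
    then show "cmod (f m) / (1 + real_of_int \<bar>m\<bar>) \<le> D / w 0 * (cmod (f m) powr p * w m)"
      using True by (simp add: algebra_simps)
  qed auto
next
  case False
  with p have p1: "1 < p" by simp
  obtain D where pos: "\<And>n. 0 < w n" and Ap: "\<And>a b. a \<le> b \<Longrightarrow>
     (\<Sum>n=a..b. w n) * (\<Sum>n=a..b. w n powr (- 1 / (p - 1))) powr (p - 1) \<le> D * real_of_int (b - a + 1) powr p"
    using muckenhoupt_gt_1D[OF w p1] by blast
  show ?thesis unfolding tame_def
    by (rule Ap_summable[OF p1 pos refl Ap]) (use f in \<open>auto simp: lp_space_def\<close>)
qed

theorem conj_max_strong_type:
  assumes c: "c \<in> {0, 1}" and p: "1 < p" and w: "w \<in> muckenhoupt p"
    and Q: "\<And>f n. f \<in> lp_space p w \<Longrightarrow> Q f n = conj_max c f n"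
  shows "strong_type p w Q"
    and "\<And>f. f \<in> lp_space p w \<Longrightarrow> (\<lambda>n. conj_max c f n powr p * w n) summable_on UNIV"
proof -
  obtain D where pos: "\<And>n. 0 < w n" and Ap: "\<And>a b. a \<le> b \<Longrightarrow>
     (\<Sum>n=a..b. w n) * (\<Sum>n=a..b. w n powr (- 1 / (p - 1))) powr (p - 1) \<le> D * real_of_int (b - a + 1) powr p"
    using muckenhoupt_gt_1D[OF w p] by blast
  have tame: "tame f" if "f \<in> lp_space p w" for f :: "int \<Rightarrow> complex" using lp_space_tame[OF _ w that] p by simp
  obtain B where B: "0 \<le> B" and bd: "\<And>f A. f \<in> lp_space p w \<Longrightarrow> finite A \<Longrightarrow>
     (\<Sum>n\<in>A. conj_max c f n powr p * w n) \<le> B * (\<Sum>\<^sub>\<infinity>n. cmod (f n) powr p * w n)"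
    using conj_max_strong[OF c p pos Ap] tame by blast
  show "strong_type p w Q"
    by (rule strong_typeI[OF p pos B]) (use Q bd conj_max_nonneg[OF c tame] in auto)
  show "(\<lambda>n. conj_max c f n powr p * w n) summable_on UNIV" if f: "f \<in> lp_space p w" for f
    by (rule finite_sums_summable(1)[OF _ bd[OF f]]) (auto intro!: mult_nonneg_nonneg less_imp_le[OF pos])
qed

theorem conj_max_weak_type:
  assumes c: "c \<in> {0, 1}" and w: "w \<in> muckenhoupt 1"
    and Q: "\<And>f n. f \<in> lp_space 1 w \<Longrightarrow> Q f n = conj_max c f n"
  shows "weak_type_1 w Q"
proof -
  obtain D where pos: "\<And>n. 0 < w n" and A1: "\<And>a b n. a \<le> n \<Longrightarrow> n \<le> b \<Longrightarrow>
     (\<Sum>i=a..b. w i) \<le> D * real_of_int (b - a + 1) * w n" using w muckenhoupt_1D by blast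
  have tame: "tame f" if "f \<in> lp_space 1 w" for f :: "int \<Rightarrow> complex" using lp_space_tame[OF _ w that] by simp
  obtain B where bd: "\<And>f A l. f \<in> lp_space 1 w \<Longrightarrow> finite A \<Longrightarrow> 0 < l \<Longrightarrow>
     l * (\<Sum>n\<in>{n\<in>A. l < conj_max c f n}. w n) \<le> B * (\<Sum>\<^sub>\<infinity>n. cmod (f n) powr 1 * w n)"
    using conj_max_weak[OF c pos A1] tame by blast
  show ?thesis
    by (rule weak_type_1I[OF pos, where B = B]) (use Q bd conj_max_nonneg[OF c tame] in auto)
qed

text \<open>Pointwise convergence together with the bound by twice the maximal function, which lies
  in \<open>\<ell>\<^sup>p(w)\<close>.\<close>

lemma conj_lp_limit:
  assumes c: "c \<in> {0, 1}" and p: "1 < p" and w: "w \<in> muckenhoupt p" and f: "f \<in> lp_space p w"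
  shows "lp_limit_at_0 p w (\<lambda>t n. conj_fwd t f (n - c)) (\<lambda>n. riesz_fwd f (n - c))"
proof -
  have pos: "0 < w n" for n using w by (simp add: muckenhoupt_def)
  have tame: "tame f" using lp_space_tame[OF _ w f] p by simp
  have le: "cmod (conj_fwd t f (n - c)) \<le> conj_max c f n" if "0 \<le> t" for t n
    using conj_max_upper[OF c tame that, of n] by (simp add: conv_conj_kernel conj_fwd_eq_conv[OF tame that])
  have le0: "cmod (riesz_fwd f (n - c)) \<le> conj_max c f n" for n
    using conj_max_upper[OF c tame, of 0 n] by (simp add: conv_conj_kernel riesz_fwd_eq_conv)
  have dom: "cmod (conj_fwd t f (n - c) - riesz_fwd f (n - c)) \<le> 2 * conj_max c f n" if "0 < t" for t n
    using norm_triangle_ineq4[of "conj_fwd t f (n - c)" "riesz_fwd f (n - c)"] le[of t n] le0[of n] that by simp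
  have "(\<lambda>n. 2 powr p * (conj_max c f n powr p * w n)) summable_on UNIV"
    by (intro summable_on_cmult_right conj_max_strong_type(2)[OF c p w _ f, where Q = "conj_max c"]) auto
  then have G: "(\<lambda>n. (2 * conj_max c f n) powr p * w n) summable_on UNIV"
    using conj_max_nonneg[OF c tame] by (simp add: powr_mult mult.assoc)
  have lim: "((\<lambda>t. conj_fwd t f (n - c) - riesz_fwd f (n - c)) \<longlongrightarrow> 0) (at_right 0)" for n
    by (rule LIM_zero[OF conj_fwd_tendsto[OF tame]])
  show ?thesis unfolding lp_limit_at_0_def
    using lp_limit_dominated[OF p pos dom G lim] by blast
qed

section \<open>Maximal bounds, Cauchy--Riemann equations and limits\<close>

theorem theorem3:
  fixes p :: real and w :: "int \<Rightarrow> real"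
  assumes "1 \<le> p" and "w \<in> muckenhoupt p"
  shows
    "((\<forall>f\<in>lp_space p w. \<forall>n.
          bdd_above ((\<lambda>t. cmod (conj_fwd t f n)) ` {0..}) \<and>
          bdd_above ((\<lambda>t. cmod (conj_bwd t f n)) ` {0..})) \<and>
      (1 < p \<longrightarrow> strong_type p w (maximal_op conj_fwd) \<and> strong_type p w (maximal_op conj_bwd)) \<and>
      (p = 1 \<longrightarrow> weak_type_1 w (maximal_op conj_fwd) \<and> weak_type_1 w (maximal_op conj_bwd)))
   \<and> (\<forall>f\<in>lp_space p w. \<forall>t>0. \<forall>n.
        ((\<lambda>s. conj_fwd s f n) has_vector_derivative - diff_fwd (poisson t f) n) (at t) \<and>
        ((\<lambda>s. poisson s f n) has_vector_derivative diff_bwd (conj_fwd t f) n) (at t) \<and>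
        ((\<lambda>s. conj_bwd s f n) has_vector_derivative - diff_bwd (poisson t f) n) (at t) \<and>
        ((\<lambda>s. poisson s f n) has_vector_derivative diff_fwd (conj_bwd t f) n) (at t) \<and>
        (\<lambda>s. vector_derivative (\<lambda>r. conj_fwd r f n) (at s)) differentiable (at t) \<and>
        vector_derivative (\<lambda>s. vector_derivative (\<lambda>r. conj_fwd r f n) (at s)) (at t)
          + discrete_laplacian (conj_fwd t f) n = 0 \<and>
        (\<lambda>s. vector_derivative (\<lambda>r. conj_bwd r f n) (at s)) differentiable (at t) \<and>
        vector_derivative (\<lambda>s. vector_derivative (\<lambda>r. conj_bwd r f n) (at s)) (at t)
          + discrete_laplacian (conj_bwd t f) n = 0)
   \<and> (\<forall>f\<in>lp_space p w.
        (\<forall>n. ((\<lambda>t. conj_fwd t f n) \<longlongrightarrow> riesz_fwd f n) (at_right 0) \<and>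
             ((\<lambda>t. conj_bwd t f n) \<longlongrightarrow> riesz_bwd f n) (at_right 0)) \<and>
        (1 < p \<longrightarrow> lp_limit_at_0 p w (\<lambda>t. conj_fwd t f) (riesz_fwd f) \<and>
                   lp_limit_at_0 p w (\<lambda>t. conj_bwd t f) (riesz_bwd f)))"
proof (intro conjI)
  have tame: "tame f" if "f \<in> lp_space p w" for f :: "int \<Rightarrow> complex" using lp_space_tame[OF assms that] .
  show "\<forall>f\<in>lp_space p w. \<forall>n.
          bdd_above ((\<lambda>t. cmod (conj_fwd t f n)) ` {0..}) \<and> bdd_above ((\<lambda>t. cmod (conj_bwd t f n)) ` {0..})"
  proof (intro ballI allI)
    fix f :: "int \<Rightarrow> complex" and n assume "f \<in> lp_space p w"
    then have f: "tame f" by (rule tame)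
    have b: "bdd_above ((\<lambda>t. cmod (conj_fwd t f n)) ` {0..})" for n
      by (rule bdd_aboveI2[of _ _ "6 * potential f n"])
         (use conv_bound[OF f decays_qk] conj_fwd_eq_conv[OF f] in auto)
    show "bdd_above ((\<lambda>t. cmod (conj_fwd t f n)) ` {0..}) \<and> bdd_above ((\<lambda>t. cmod (conj_bwd t f n)) ` {0..})"
      using b[of n] b[of "n - 1"] by (simp add: conj_bwd_eq)
  qed
  show "1 < p \<longrightarrow> strong_type p w (maximal_op conj_fwd) \<and> strong_type p w (maximal_op conj_bwd)"
    using conj_max_strong_type(1)[OF _ _ assms(2)] maximal_op_eq[OF tame] by auto
  show "p = 1 \<longrightarrow> weak_type_1 w (maximal_op conj_fwd) \<and> weak_type_1 w (maximal_op conj_bwd)"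
    using conj_max_weak_type[of _ w] assms(2) maximal_op_eq[OF tame] by auto
  show "\<forall>f\<in>lp_space p w. \<forall>t>0. \<forall>n.
        ((\<lambda>s. conj_fwd s f n) has_vector_derivative - diff_fwd (poisson t f) n) (at t) \<and>
        ((\<lambda>s. poisson s f n) has_vector_derivative diff_bwd (conj_fwd t f) n) (at t) \<and>
        ((\<lambda>s. conj_bwd s f n) has_vector_derivative - diff_bwd (poisson t f) n) (at t) \<and>
        ((\<lambda>s. poisson s f n) has_vector_derivative diff_fwd (conj_bwd t f) n) (at t) \<and>
        (\<lambda>s. vector_derivative (\<lambda>r. conj_fwd r f n) (at s)) differentiable (at t) \<and>
        vector_derivative (\<lambda>s. vector_derivative (\<lambda>r. conj_fwd r f n) (at s)) (at t)
          + discrete_laplacian (conj_fwd t f) n = 0 \<and>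
        (\<lambda>s. vector_derivative (\<lambda>r. conj_bwd r f n) (at s)) differentiable (at t) \<and>
        vector_derivative (\<lambda>s. vector_derivative (\<lambda>r. conj_bwd r f n) (at s)) (at t)
          + discrete_laplacian (conj_bwd t f) n = 0"
  proof (intro ballI allI impI)
    fix f :: "int \<Rightarrow> complex" and t :: real and n assume "f \<in> lp_space p w" and t: "0 < t"
    then have f: "tame f" by (intro tame)
    note d2 = conj_fwd_second_deriv[OF f t, of n] conj_bwd_second_deriv[OF f t, of n]
    show "((\<lambda>s. conj_fwd s f n) has_vector_derivative - diff_fwd (poisson t f) n) (at t) \<and>
        ((\<lambda>s. poisson s f n) has_vector_derivative diff_bwd (conj_fwd t f) n) (at t) \<and>
        ((\<lambda>s. conj_bwd s f n) has_vector_derivative - diff_bwd (poisson t f) n) (at t) \<and>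
        ((\<lambda>s. poisson s f n) has_vector_derivative diff_fwd (conj_bwd t f) n) (at t) \<and>
        (\<lambda>s. vector_derivative (\<lambda>r. conj_fwd r f n) (at s)) differentiable (at t) \<and>
        vector_derivative (\<lambda>s. vector_derivative (\<lambda>r. conj_fwd r f n) (at s)) (at t)
          + discrete_laplacian (conj_fwd t f) n = 0 \<and>
        (\<lambda>s. vector_derivative (\<lambda>r. conj_bwd r f n) (at s)) differentiable (at t) \<and>
        vector_derivative (\<lambda>s. vector_derivative (\<lambda>r. conj_bwd r f n) (at s)) (at t)
          + discrete_laplacian (conj_bwd t f) n = 0"
      using cauchy_riemann[OF f t, of n] d2 d2[THEN differentiableI_vector] d2[THEN vector_derivative_at] by simp
  qed
  show "\<forall>f\<in>lp_space p w.
        (\<forall>n. ((\<lambda>t. conj_fwd t f n) \<longlongrightarrow> riesz_fwd f n) (at_right 0) \<and>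
             ((\<lambda>t. conj_bwd t f n) \<longlongrightarrow> riesz_bwd f n) (at_right 0)) \<and>
        (1 < p \<longrightarrow> lp_limit_at_0 p w (\<lambda>t. conj_fwd t f) (riesz_fwd f) \<and>
                   lp_limit_at_0 p w (\<lambda>t. conj_bwd t f) (riesz_bwd f))"
  proof (intro ballI conjI allI impI)
    fix f :: "int \<Rightarrow> complex" and n assume f: "f \<in> lp_space p w"
    show "((\<lambda>t. conj_fwd t f n) \<longlongrightarrow> riesz_fwd f n) (at_right 0)" by (rule conj_fwd_tendsto[OF tame[OF f]])
    show "((\<lambda>t. conj_bwd t f n) \<longlongrightarrow> riesz_bwd f n) (at_right 0)"
      unfolding conj_bwd_eq riesz_bwd_eq by (rule conj_fwd_tendsto[OF tame[OF f]])
    assume p: "1 < p"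
    show "lp_limit_at_0 p w (\<lambda>t. conj_fwd t f) (riesz_fwd f)"
      using conj_lp_limit[OF _ p assms(2) f, of 0] by simp
    show "lp_limit_at_0 p w (\<lambda>t. conj_bwd t f) (riesz_bwd f)"
      using conj_lp_limit[OF _ p assms(2) f, of 1] by (simp add: conj_bwd_eq[abs_def] riesz_bwd_eq[abs_def])
  qed
qed

end
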